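(* Let $d\ge2$, let $P$ be a law on environments under which the conductances are iid and uniformly elliptic, and let $\ell\in\mathbb R^d$ with $|\ell|=1$. For any $t\ge1$ and any $f\in\mathcal H_{-1}$, $$\lim_{\lambda\to0}\frac{\frac{\lambda^2}{t}\,\mathbb E_{Q,\lambda}\Big[\sum_{k=0}^{\lfloor t/\lambda^2\rfloor}f(\bar\omega_k)\Big]-Q_0f}{\lambda}=\Lambda f .$$
   Context: $\mathcal B(\mathbb Z^d)$ is the set of non-oriented nearest-neighbor bonds of $\mathbb Z^d$ and $\Omega:=(0,\infty)^{\mathcal B(\mathbb Z^d)}$; $\omega\in\Omega$ is an environment and $\omega(x,y)=\omega(y,x)$ is the conductance of the bond $(x,y)$. The walk $(X_n)_{n\ge0}$ in $\omega$ started at $x$ is the Markov chain with law $P^x_\omega$ given by $P^x_\omega(X_0=x)=1$ and $P^x_\omega(X_{n+1}=y+e\mid X_n=y)=\omega(y,y+e)/\sum_{|e'|=1}\omega(y,y+e')$ for $|e|=1$; $E_\omega^x$ is its expectation, and the superscript is dropped for $x=0$. $P$ is a probability measure on $\Omega$ such that (i) there is $\kappa>1$ with $\kappa^{-1}\le\omega(x,y)\le\kappa$ for all bonds, and (ii) $(\omega(e))_{e\in\mathcal B(\mathbb Z^d)}$ are iid under $P$. For $\lambda\in(0,1)$, $\omega^\lambda(x,y)=\omega(x,y)e^{\lambda\ell\cdot(x+y)}$, $P_{\omega,\lambda}:=P^0_{\omega^\lambda}$, and $\mathbb P_0:=P\times P_\omega$. Shifts: $(\theta_z\omega)(x,y)=\omega(z+x,z+y)$,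 and $\bar\omega_n:=\theta_{X_n}\omega$. $Q_0$ is the probability measure $\frac{dQ_0}{dP}(\omega)=Z^{-1}\sum_{|y|=1}\omega(0,y)$ ($Z$ a normalization constant). $Q_0f=\int f\,dQ_0$, and $\mathbb E_{Q,\lambda}$ is the expectation with respect to $Q_0\times P_{\omega,\lambda}$. $\mathcal H_{-1}$ is the set of functions $f:\Omega\to\mathbb R$ in $L^2(Q_0)$ such that the limit $\sigma^2(f):=\lim_{n\to\infty}\frac1nQ_0E_\omega\big[\big(\sum_{k=0}^nf(\bar\omega_k)\big)^2\big]$ exists and is finite (this implies $Q_0f=0$). Local drift: $d(\omega,x)=E^x_\omega[X_1-X_0]$. For $f\in\mathcal H_{-1}$ it is known that $\frac1{\sqrt n}\big(\sum_{k=1}^n(f(\bar\omega_k)-Q_0f),\ \sum_{k=1}^nd(\bar\omega_k,0)\cdot\ell\big)$ converges in distribution under $\mathbb P_0$ to a two-dimensional centered normal vector $(N_1^f,N_1^d\cdot\ell)$, and $\Lambda f:=-\mathrm{Cov}(N_1^f,N_1^d\cdot\ell)$. *)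

theory Defs
  imports "HOL-Probability.Probability"
begin

definition rvec :: "int ^ 'd \<Rightarrow> real ^ 'd" where
  "rvec x = (\<chi> i. real_of_int (x $ i))"

definition units :: "(int ^ 'd::finite) set" where
  "units = {e. norm (rvec e) = 1}"

text \<open>A non-oriented bond is the set of its two end points.\<close>

definition bonds :: "(int ^ 'd::finite) set set" where
  "bonds = {{x, x + e} | x e. e \<in> units}"

type_synonym 'd env = "(int ^ 'd) set \<Rightarrow> real"
type_synonym 'd path = "nat \<Rightarrow> int ^ 'd"

definition env_space :: "'d::finite env measure" where
  "env_space = PiM bonds (\<lambda>_. restrict_space borel {0<..})"

definition path_space :: "'d::finite path measure" where
  "path_space = PiM UNIV (\<lambda>_. count_space UNIV)"

definition total_cond :: "'d::finite env \<Rightarrow> int ^ 'd \<Rightarrow> real" where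
  "total_cond \<omega> x = (\<Sum>e\<in>units. \<omega> {x, x + e})"

text \<open>The transition rule conditions on the whole past of the walk, so it contains the Markov
  property. Existence, uniqueness and measurability in the environment are proved below.\<close>

definition is_walk_law :: "'d::finite env \<Rightarrow> int ^ 'd \<Rightarrow> 'd path measure \<Rightarrow> bool" where
  "is_walk_law \<omega> x \<mu> \<longleftrightarrow>
     prob_space \<mu> \<and> sets \<mu> = sets path_space \<and>
     measure \<mu> {X. X 0 = x} = 1 \<and>
     (\<forall>n p. \<forall>e\<in>units.
        measure \<mu> {X. (\<forall>k\<le>n. X k = p k) \<and> X (Suc n) = p n + e} =
        measure \<mu> {X. \<forall>k\<le>n. X k = p k} * (\<omega> {p n, p n + e} / total_cond \<omega> (p n)))"

definition walk_law :: "'d::finite env \<Rightarrow> int ^ 'd \<Rightarrow> 'd path measure" where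
  "walk_law \<omega> x = (THE \<mu>. is_walk_law \<omega> x \<mu>)"

definition tilt :: "real ^ 'd::finite \<Rightarrow> real \<Rightarrow> 'd env \<Rightarrow> 'd env" where
  "tilt l lam \<omega> = (\<lambda>b\<in>bonds. \<omega> b * exp (lam * (l \<bullet> (\<Sum>x\<in>b. rvec x))))"

definition env_shift :: "int ^ 'd::finite \<Rightarrow> 'd env \<Rightarrow> 'd env" where
  "env_shift z \<omega> = (\<lambda>b\<in>bonds. \<omega> ((+) z ` b))"

definition iid_elliptic :: "'d::finite env measure \<Rightarrow> bool" where
  "iid_elliptic P \<longleftrightarrow>
     prob_space P \<and> sets P = sets env_space \<and>
     (\<exists>\<kappa>>1. AE \<omega> in P. \<forall>b\<in>bonds. inverse \<kappa> \<le> \<omega> b \<and> \<omega> b \<le> \<kappa>) \<and>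
     prob_space.indep_vars P (\<lambda>_. borel) (\<lambda>b \<omega>. \<omega> b) bonds \<and>
     (\<forall>b\<in>bonds. \<forall>b'\<in>bonds. distr P borel (\<lambda>\<omega>. \<omega> b) = distr P borel (\<lambda>\<omega>. \<omega> b'))"

definition Q0 :: "'d::finite env measure \<Rightarrow> 'd env measure" where
  "Q0 P = density P (\<lambda>\<omega>. ennreal (total_cond \<omega> 0 / (\<integral>\<omega>'. total_cond \<omega>' 0 \<partial>P)))"

text \<open>The joint law of the environment and the walk, i.e. the semidirect product of the law \<open>M\<close> of
  the environment and the kernel \<open>K\<close>.\<close>

definition annealed ::
  "'d::finite env measure \<Rightarrow> ('d env \<Rightarrow> 'd path measure) \<Rightarrow> ('d env \<times> 'd path) measure" where
  "annealed M K = M \<bind> (\<lambda>\<omega>. K \<omega> \<bind> (\<lambda>X. return (env_space \<Otimes>\<^sub>M path_space) (\<omega>, X)))"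

abbreviation walk0 :: "'d::finite env \<Rightarrow> 'd path measure" where
  "walk0 \<omega> \<equiv> walk_law \<omega> 0"

abbreviation walk_tilted :: "real ^ 'd::finite \<Rightarrow> real \<Rightarrow> 'd env \<Rightarrow> 'd path measure" where
  "walk_tilted l lam \<omega> \<equiv> walk_law (tilt l lam \<omega>) 0"

text \<open>The environment seen from the walk is formed from the untilted environment, also when the walk
  itself moves in the tilted one.\<close>

definition env_seen :: "nat \<Rightarrow> 'd::finite env \<times> 'd path \<Rightarrow> 'd env" where
  "env_seen n = (\<lambda>(\<omega>, X). env_shift (X n) \<omega>)"

definition H_minus_1 :: "'d::finite env measure \<Rightarrow> ('d env \<Rightarrow> real) set" where
  "H_minus_1 P = {f. f \<in> borel_measurable (Q0 P) \<and> integrable (Q0 P) (\<lambda>\<omega>. (f \<omega>)\<^sup>2) \<and>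
     convergent (\<lambda>n. (\<integral>z. (\<Sum>k=0..n. f (env_seen k z))\<^sup>2 \<partial>annealed (Q0 P) walk0) / real n)}"

definition drift :: "'d::finite env \<Rightarrow> int ^ 'd \<Rightarrow> real ^ 'd" where
  "drift \<omega> x = (\<integral>X. rvec (X 1) - rvec (X 0) \<partial>walk_law \<omega> x)"

definition clt_vector ::
  "'d::finite env measure \<Rightarrow> real ^ 'd \<Rightarrow> ('d env \<Rightarrow> real) \<Rightarrow> nat \<Rightarrow> 'd env \<times> 'd path \<Rightarrow> real \<times> real" where
  "clt_vector P l f n z = (1 / sqrt (real n)) *\<^sub>R
     (\<Sum>k=1..n. f (env_seen k z) - (\<integral>\<omega>. f \<omega> \<partial>Q0 P), \<Sum>k=1..n. drift (env_seen k z) 0 \<bullet> l)"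

definition conv_in_distr :: "(nat \<Rightarrow> 'a::topological_space measure) \<Rightarrow> 'a measure \<Rightarrow> bool" where
  "conv_in_distr \<mu> \<nu> \<longleftrightarrow>
     (\<forall>g::'a \<Rightarrow> real. continuous_on UNIV g \<and> bounded (range g) \<longrightarrow>
        (\<lambda>n. \<integral>x. g x \<partial>\<mu> n) \<longlonglongrightarrow> (\<integral>x. g x \<partial>\<nu>))"

text \<open>Gaussian laws may be degenerate: \<open>s = 0\<close> is the point mass at \<open>0\<close>.\<close>

definition centered_normal :: "real \<Rightarrow> real measure" where
  "centered_normal s =
     (if s = 0 then return borel 0 else density lborel (\<lambda>x. ennreal (normal_density 0 s x)))"

definition centered_normal2 :: "(real \<times> real) measure \<Rightarrow> bool" where
  "centered_normal2 N \<longleftrightarrow> sets N = sets borel \<and>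
     (\<forall>u. \<exists>s\<ge>0. distr N borel (\<lambda>x. u \<bullet> x) = centered_normal s)"

definition clt_limit ::
  "'d::finite env measure \<Rightarrow> real ^ 'd \<Rightarrow> ('d env \<Rightarrow> real) \<Rightarrow> (real \<times> real) measure" where
  "clt_limit P l f = (THE N. centered_normal2 N \<and>
     conv_in_distr (\<lambda>n. distr (annealed P walk0) borel (clt_vector P l f n)) N)"

definition covariance :: "(real \<times> real) measure \<Rightarrow> real" where
  "covariance N = (\<integral>x. (fst x - (\<integral>y. fst y \<partial>N)) * (snd x - (\<integral>y. snd y \<partial>N)) \<partial>N)"

definition Lambda :: "'d::finite env measure \<Rightarrow> real ^ 'd \<Rightarrow> ('d env \<Rightarrow> real) \<Rightarrow> real" where
  "Lambda P l f = - covariance (clt_limit P l f)"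


section \<open>The walk law and the joint law are well defined\<close>

lemma finite_units: "finite (units :: (int ^ 'd::finite) set)"
proof (rule finite_subset)
  show "units \<subseteq> vec_lambda ` (PiE UNIV (\<lambda>_. {-1..1::int}) :: ('d \<Rightarrow> int) set)"
  proof
    fix e :: "int ^ 'd" assume "e \<in> units"
    then have n: "norm (rvec e) = 1" by (simp add: units_def)
    have "\<bar>e $ i\<bar> \<le> 1" for i
      using component_le_norm_cart[of "rvec e" i] n by (simp add: rvec_def)
    then have "vec_nth e \<in> PiE UNIV (\<lambda>_. {-1..1})" by (auto simp: abs_le_iff minus_le_iff)
    then show "e \<in> vec_lambda ` (PiE UNIV (\<lambda>_. {-1..1::int}))"
      by (intro image_eqI[where x = "vec_nth e"]) auto
  qed
qed (auto intro!: finite_imageI finite_PiE)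

lemma units_nonempty: "(units :: (int ^ 'd::finite) set) \<noteq> {}"
proof -
  have "rvec (axis i 1 :: int ^ 'd) = axis i 1" for i
    by (simp add: rvec_def axis_def vec_eq_iff)
  then have "(axis i 1 :: int ^ 'd) \<in> units" for i by (simp add: units_def)
  then show ?thesis by blast
qed

lemma zero_notin_units: "0 \<notin> units"
  by (simp add: units_def rvec_def norm_eq_zero[THEN iffD2] vec_eq_iff)

lemma bondsI: "e \<in> units \<Longrightarrow> {x, x + e} \<in> bonds"
  by (auto simp: bonds_def)

lemma env_space_pos: "\<omega> \<in> space env_space \<Longrightarrow> b \<in> bonds \<Longrightarrow> 0 < \<omega> b"
  by (auto simp: env_space_def space_PiM PiE_iff)

lemma total_cond_pos: "\<omega> \<in> space env_space \<Longrightarrow> 0 < total_cond \<omega> x"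
  unfolding total_cond_def
  by (intro sum_pos finite_units units_nonempty) (auto intro: env_space_pos bondsI)

lemma tilt_bond:
  "e \<in> units \<Longrightarrow> tilt l lam \<omega> {x, x + e} = \<omega> {x, x + e} * exp (lam * (l \<bullet> (rvec x + rvec (x + e))))"
  by (cases "e = 0") (auto simp: zero_notin_units tilt_def bondsI)

lemma env_shift_bond: "e \<in> units \<Longrightarrow> env_shift z \<omega> {x, x + e} = \<omega> {z + x, z + x + e}"
  by (simp add: env_shift_def bondsI add.assoc)

definition trans_prob :: "'d::finite env \<Rightarrow> int ^ 'd \<Rightarrow> int ^ 'd \<Rightarrow> real" where
  "trans_prob \<omega> y z = (if z - y \<in> units then \<omega> {y, z} / total_cond \<omega> y else 0)"

definition cyl_prob :: "'d::finite env \<Rightarrow> int ^ 'd \<Rightarrow> nat \<Rightarrow> 'd path \<Rightarrow> real" where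
  "cyl_prob \<omega> x n p = (if p 0 = x then (\<Prod>k<n. trans_prob \<omega> (p k) (p (Suc k))) else 0)"

definition cyl :: "nat \<Rightarrow> 'd::finite path \<Rightarrow> 'd path set" where
  "cyl n p = {X. \<forall>k\<le>n. X k = p k}"

lemma space_path_space [simp]: "space path_space = UNIV"
  by (simp add: path_space_def space_PiM)

lemma coord_measurable [measurable]: "(\<lambda>X. X k) \<in> path_space \<rightarrow>\<^sub>M count_space UNIV"
  unfolding path_space_def by measurable

lemma cyl_sets [measurable]: "cyl n p \<in> sets path_space"
proof -
  have "{X \<in> space path_space. \<forall>k\<le>n. X k = p k} \<in> sets path_space" by measurable
  then show ?thesis by (simp add: cyl_def)
qed

lemma trans_prob_nonneg: "\<omega> \<in> space env_space \<Longrightarrow> 0 \<le> trans_prob \<omega> y z"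
  using env_space_pos[of \<omega> "{y, z}"] bondsI[of "z - y" y] total_cond_pos[of \<omega> y]
  by (auto simp: trans_prob_def)

lemma trans_prob_sum: "\<omega> \<in> space env_space \<Longrightarrow> (\<Sum>e\<in>units. trans_prob \<omega> y (y + e)) = 1"
  using total_cond_pos[of \<omega> y]
  by (simp add: trans_prob_def flip: sum_divide_distrib) (simp add: total_cond_def)

lemma cyl_prob_Suc: "cyl_prob \<omega> x (Suc n) p = cyl_prob \<omega> x n p * trans_prob \<omega> (p n) (p (Suc n))"
  by (simp add: cyl_prob_def)

lemma walk_law_cyl:
  assumes \<omega>: "\<omega> \<in> space env_space" and W: "is_walk_law \<omega> x \<mu>"
  shows "measure \<mu> (cyl n p) = cyl_prob \<omega> x n p"
proof -
  interpret prob_space \<mu> using W by (simp add: is_walk_law_def)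
  have [measurable_cong, simp]: "sets \<mu> = sets path_space" using W by (simp add: is_walk_law_def)
  have [simp]: "space \<mu> = UNIV" using sets_eq_imp_space_eq[of \<mu> path_space] by simp
  have start: "prob {X. X 0 = x} = 1" using W by (simp add: is_walk_law_def)
  have m0: "{X. X 0 = y} \<in> events" for y
    using cyl_sets[of 0 "\<lambda>_. y"] by (simp add: cyl_def)
  have step: "prob (cyl (Suc n) (q(Suc n := q n + e))) = prob (cyl n q) * trans_prob \<omega> (q n) (q n + e)"
    if "e \<in> units" for n q e
  proof -
    have "cyl (Suc n) (q(Suc n := q n + e)) = {X. (\<forall>k\<le>n. X k = q k) \<and> X (Suc n) = q n + e}"
      by (auto simp: cyl_def le_Suc_eq)
    then show ?thesis using W that
      by (simp add: is_walk_law_def trans_prob_def) (simp add: cyl_def)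
  qed
  show ?thesis
  proof (induction n arbitrary: p)
    case 0
    show ?case
    proof (cases "p 0 = x")
      case True
      then show ?thesis using start by (simp add: cyl_def cyl_prob_def)
    next
      case False
      have "prob (cyl 0 p) + prob {X. X 0 = x} = prob (cyl 0 p \<union> {X. X 0 = x})"
        using False m0 by (intro finite_measure_Union[symmetric]) (auto simp: cyl_def)
      also have "\<dots> \<le> 1" by (rule prob_le_1)
      finally have "prob (cyl 0 p) = 0" using start measure_nonneg[of \<mu> "cyl 0 p"] by linarith
      then show ?thesis using False by (simp add: cyl_prob_def)
    qed
  next
    case (Suc n)
    show ?case
    proof (cases "p (Suc n) - p n \<in> units")
      case True
      have "p(Suc n := p n + (p (Suc n) - p n)) = p" by auto
      then show ?thesis using step[OF True, of n p] Suc.IH[of p] by (simp add: cyl_prob_Suc)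
    next
      case False
      let ?U = "\<Union>e\<in>units. cyl (Suc n) (p(Suc n := p n + e))"
      have "prob ?U = (\<Sum>e\<in>units. prob (cyl (Suc n) (p(Suc n := p n + e))))"
      proof (intro finite_measure_finite_Union finite_units)
        show "disjoint_family_on (\<lambda>e. cyl (Suc n) (p(Suc n := p n + e))) units"
          by (auto simp: disjoint_family_on_def cyl_def)
      qed auto
      also have "\<dots> = prob (cyl n p)"
        by (simp add: step trans_prob_sum[OF \<omega>] flip: sum_distrib_left)
      finally have U: "prob ?U = prob (cyl n p)" .
      have "prob (cyl (Suc n) p) + prob ?U = prob (cyl (Suc n) p \<union> ?U)"
      proof (intro finite_measure_Union[symmetric])
        show "cyl (Suc n) p \<inter> ?U = {}"
        proof safe
          fix X e assume e: "e \<in> units" and "X \<in> cyl (Suc n) p" "X \<in> cyl (Suc n) (p(Suc n := p n + e))"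
          then have "X (Suc n) = p (Suc n)" "X (Suc n) = p n + e" by (auto simp: cyl_def)
          then have "p (Suc n) - p n = e" by (metis add_diff_cancel_left')
          with e False show "X \<in> {}" by simp
        qed
      qed (auto intro!: sets.finite_UN finite_units)
      also have "\<dots> \<le> prob (cyl n p)"
      proof (intro finite_measure_mono)
        show "cyl (Suc n) p \<union> ?U \<subseteq> cyl n p" by (auto simp: cyl_def)
      qed simp
      finally have "prob (cyl (Suc n) p) = 0" using U measure_nonneg[of \<mu> "cyl (Suc n) p"] by linarith
      then show ?thesis using False by (simp add: cyl_prob_Suc trans_prob_def)
    qed
  qed
qed

definition cyls :: "'d::finite path set set" where
  "cyls = insert {} {cyl n p | n p. True}"

lemma Int_stable_cyls: "Int_stable (cyls :: 'd::finite path set set)"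
proof (rule Int_stableI)
  fix A B :: "'d path set" assume A: "A \<in> cyls" and B: "B \<in> cyls"
  show "A \<inter> B \<in> cyls"
  proof (cases "A \<inter> B = {}")
    case True then show ?thesis by (simp add: cyls_def)
  next
    case False
    then obtain X where X: "X \<in> A" "X \<in> B" by auto
    with A B obtain n p m q where "A = cyl n p" "B = cyl m q" by (auto simp: cyls_def)
    with X have "A \<inter> B = cyl (max n m) X" by (auto simp: cyl_def le_max_iff_disj)
    then show ?thesis by (auto simp: cyls_def)
  qed
qed

lemma countable_all_cyls: "\<exists>C. countable C \<and> C \<subseteq> cyls \<and> (\<Union>C) = {X::'d::finite path. X k = y}"
proof -
  let ?F = "{xs :: (int ^ 'd) list. length xs = Suc k \<and> xs ! k = y}"
  let ?C = "(\<lambda>xs. cyl k (\<lambda>i. xs ! i)) ` ?F"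
  have "X \<in> (\<Union>?C)" if "X k = y" for X :: "'d path"
  proof (rule UnionI)
    show "cyl k (\<lambda>i. map X [0..<Suc k] ! i) \<in> ?C"
      by (rule image_eqI[where x = "map X [0..<Suc k]"]) (auto simp: that simp del: upt_Suc)
    show "X \<in> cyl k (\<lambda>i. map X [0..<Suc k] ! i)"
      by (auto simp: cyl_def simp del: upt_Suc)
  qed
  moreover have "X k = y" if "X \<in> (\<Union>?C)" for X using that by (auto simp: cyl_def)
  ultimately have "(\<Union>?C) = {X. X k = y}" by blast
  moreover have "?C \<subseteq> cyls" by (auto simp: cyls_def)
  moreover have "countable ?C" by simp
  ultimately show ?thesis by blast
qed

lemma sets_path_space: "sets path_space = sigma_sets UNIV (cyls :: 'd::finite path set set)"
proof
  have "(cyls :: 'd path set set) \<subseteq> sets path_space" by (auto simp: cyls_def)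
  then show "sigma_sets UNIV cyls \<subseteq> sets (path_space :: 'd path measure)"
    using sets.sigma_sets_subset[of cyls "path_space :: 'd path measure"] by simp
  have coord: "(\<lambda>X. X k) \<in> sigma UNIV cyls \<rightarrow>\<^sub>M (count_space UNIV :: (int ^ 'd) measure)" for k
  proof (rule measurable_count_space_eq_countable[THEN iffD2])
    show "(\<lambda>X. X k) \<in> space (sigma UNIV cyls) \<rightarrow> (UNIV :: (int ^ 'd) set) \<and>
      (\<forall>y\<in>UNIV. (\<lambda>X. X k) -` {y} \<inter> space (sigma UNIV (cyls :: 'd path set set)) \<in> sets (sigma UNIV cyls))"
    proof safe
      fix y :: "int ^ 'd"
      obtain C where C: "countable C" "C \<subseteq> cyls" "(\<Union>C) = {X::'d path. X k = y}"
        using countable_all_cyls[of k y] by metis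
      have "C \<subseteq> sets (sigma UNIV cyls)"
        using C(2) sigma_sets.Basic[of _ cyls UNIV] by auto
      with C(1) have "(\<Union>C) \<in> sets (sigma UNIV cyls)"
        by (rule sets.countable_Union)
      then show "(\<lambda>X. X k) -` {y} \<inter> space (sigma UNIV (cyls :: 'd path set set)) \<in> sets (sigma UNIV cyls)"
        by (simp add: C(3) vimage_def)
    qed simp
  qed simp
  have "(\<lambda>X. X) \<in> sigma UNIV cyls \<rightarrow>\<^sub>M (path_space :: 'd path measure)"
    unfolding path_space_def by (rule measurable_PiM_single') (auto intro: coord)
  then show "sets (path_space :: 'd path measure) \<subseteq> sigma_sets UNIV cyls"
    using measurable_sets[of "\<lambda>X. X" "sigma UNIV cyls" path_space] by (auto simp: vimage_def)
qed

lemma walk_law_unique: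
  assumes \<omega>: "\<omega> \<in> space env_space" and "is_walk_law \<omega> x \<mu>" "is_walk_law \<omega> x \<nu>"
  shows "\<mu> = \<nu>"
proof -
  interpret M: prob_space \<mu> using assms by (simp add: is_walk_law_def)
  interpret N: prob_space \<nu> using assms by (simp add: is_walk_law_def)
  show ?thesis
  proof (rule measure_eqI_generator_eq_countable[OF Int_stable_cyls])
    show "sets \<mu> = sigma_sets UNIV cyls" "sets \<nu> = sigma_sets UNIV cyls"
      using assms by (simp_all add: is_walk_law_def sets_path_space)
    show "emeasure \<mu> X = emeasure \<nu> X" if "X \<in> cyls" for X
      using that walk_law_cyl[OF \<omega> assms(2)] walk_law_cyl[OF \<omega> assms(3)]
      by (auto simp: cyls_def M.emeasure_eq_measure N.emeasure_eq_measure)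
    show "range (\<lambda>y. cyl 0 (\<lambda>_. y)) \<subseteq> (cyls :: 'a path set set)" by (auto simp: cyls_def)
    show "(\<Union>(range (\<lambda>y. cyl 0 (\<lambda>_. y)))) = (UNIV :: 'a path set)" by (auto simp: cyl_def)
  qed auto
qed

definition step_pmf :: "'d::finite env \<Rightarrow> int ^ 'd \<Rightarrow> (int ^ 'd) pmf" where
  "step_pmf \<omega> y = embed_pmf (trans_prob \<omega> y)"

lemma pmf_step:
  assumes \<omega>: "\<omega> \<in> space env_space"
  shows "pmf (step_pmf \<omega> y) z = trans_prob \<omega> y z"
  unfolding step_pmf_def
proof (rule pmf_embed_pmf)
  show "0 \<le> trans_prob \<omega> y z" for z by (rule trans_prob_nonneg[OF \<omega>])
  have "(\<integral>\<^sup>+z. ennreal (trans_prob \<omega> y z) \<partial>count_space UNIV) =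
        (\<integral>\<^sup>+z. ennreal (trans_prob \<omega> y z) \<partial>count_space ((+) y ` units))"
  proof (intro nn_integral_count_space_eq)
    fix z assume "z \<in> UNIV - (+) y ` units"
    then have "z - y \<notin> units" by (auto simp: image_iff dest!: bspec[of _ _ "z - y"])
    then show "ennreal (trans_prob \<omega> y z) = 0" by (simp add: trans_prob_def)
  qed simp
  also have "\<dots> = (\<Sum>z\<in>(+) y ` units. ennreal (trans_prob \<omega> y z))"
    by (simp add: nn_integral_count_space_finite finite_units)
  also have "\<dots> = ennreal (\<Sum>e\<in>units. trans_prob \<omega> y (y + e))"
    by (subst sum.reindex) (auto simp: trans_prob_nonneg[OF \<omega>])
  also have "\<dots> = 1" by (simp add: trans_prob_sum[OF \<omega>])
  finally show "(\<integral>\<^sup>+z. ennreal (trans_prob \<omega> y z) \<partial>count_space UNIV) = 1" .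
qed

lemma walk_law_exists:
  fixes x :: "int ^ 'd::finite"
  assumes \<omega>: "\<omega> \<in> space env_space"
  shows "\<exists>\<mu>. is_walk_law \<omega> x \<mu>"
proof -
  define K where "K i X = measure_pmf (case i of 0 \<Rightarrow> return_pmf x | Suc j \<Rightarrow> step_pmf \<omega> (X j))"
    for i and X :: "'d path"
  have K_meas: "K i \<in> PiM {0..<i} (\<lambda>_. count_space UNIV) \<rightarrow>\<^sub>M subprob_algebra (count_space UNIV)" for i
  proof (cases i)
    case 0
    have "K 0 = (\<lambda>_. measure_pmf (return_pmf x))" by (simp add: K_def fun_eq_iff)
    then show ?thesis using 0 by (simp add: measure_pmf_in_subprob_algebra)
  next
    case (Suc j)
    have "(\<lambda>X. measure_pmf (step_pmf \<omega> (X j))) \<in>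
      PiM {0..<i} (\<lambda>_. count_space UNIV) \<rightarrow>\<^sub>M subprob_algebra (count_space UNIV)"
      by (rule measurable_compose[OF measurable_component_singleton[of j "{0..<i}" "\<lambda>_. count_space UNIV"],
            of "\<lambda>y. measure_pmf (step_pmf \<omega> y)"])
         (auto simp: Suc measure_pmf_in_subprob_algebra)
    moreover have "K i = (\<lambda>X. measure_pmf (step_pmf \<omega> (X j)))" by (simp add: K_def Suc fun_eq_iff)
    ultimately show ?thesis by simp
  qed
  interpret IT: Ionescu_Tulcea K "\<lambda>_. count_space UNIV"
    by standard (use K_meas in \<open>auto simp: K_def measure_pmf.prob_space_axioms\<close>)
  let ?\<mu> = "IT.PF.lim"
  let ?M = "\<lambda>n. PiM {0..<n} (\<lambda>_. count_space UNIV :: (int ^ 'd) measure)"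
  let ?C = "\<lambda>n. IT.C 0 n (\<lambda>_. undefined)"
  let ?pt = "\<lambda>n p. {restrict p {0..<n}} :: 'd path set"
  have pt_PiE: "?pt n p = PiE {0..<n} (\<lambda>k. {p k})" for n p
  proof -
    have "PiE {0..<n} (\<lambda>k. {p k}) = PiE {0..<n} (\<lambda>k. {restrict p {0..<n} k})" by (rule PiE_cong) simp
    also have "\<dots> = ?pt n p" by (rule PiE_singleton) (rule restrict_extensional)
    finally show ?thesis by (rule sym)
  qed
  have pt: "?pt n p \<in> sets (?M n)" for n p
    unfolding pt_PiE by (intro sets_PiM_I_finite) auto
  have sets: "sets ?\<mu> = sets path_space" by (simp add: path_space_def IT.PF.sets_lim)
  have u0: "(\<lambda>_. undefined) \<in> space (?M 0)" by (simp add: space_PiM PiE_iff extensional_def)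
  have setsC: "sets (?C n) = sets (?M n)" for n using IT.sets_C[OF u0, of n] by simp
  have spaceC: "space (?C n) = space (?M n)" for n using IT.space_C[OF u0, of n] by simp
  have C_Suc: "emeasure (?C (Suc n)) (?pt (Suc n) p) =
      emeasure (?C n) (?pt n p) * ennreal (pmf (case n of 0 \<Rightarrow> return_pmf x | Suc j \<Rightarrow> step_pmf \<omega> (p j)) (p n))"
    for n p
  proof -
    have "emeasure (?C (Suc n)) (?pt (Suc n) p) = (\<integral>\<^sup>+X. emeasure (IT.eP n X) (?pt (Suc n) p) \<partial>?C n)"
    proof -
      have m: "IT.eP n \<in> ?C n \<rightarrow>\<^sub>M subprob_algebra (?M (Suc n))"
        by (subst measurable_cong_sets[OF setsC refl]) (rule IT.measurable_eP)
      have "space (?C n) \<noteq> {}"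
        by (rule prob_space.not_empty[OF IT.prob_space_C[OF u0]])
      from emeasure_bind[OF this m pt, of p]
      have "emeasure (?C n \<bind> IT.eP n) (?pt (Suc n) p) = (\<integral>\<^sup>+X. emeasure (IT.eP n X) (?pt (Suc n) p) \<partial>?C n)" .
      then show ?thesis by simp
    qed
    also have "\<dots> = (\<integral>\<^sup>+X. ennreal (pmf (case n of 0 \<Rightarrow> return_pmf x | Suc j \<Rightarrow> step_pmf \<omega> (p j)) (p n)) *
          indicator (?pt n p) X \<partial>?C n)"
    proof (intro nn_integral_cong)
      fix X assume "X \<in> space (?C n)"
      then have X: "X \<in> space (?M n)" by (simp only: spaceC)
      then have Xe: "X \<in> extensional {0..<n}" by (simp add: space_PiM PiE_iff)
      have eP: "emeasure (IT.eP n X) (?pt (Suc n) p) = emeasure (K n X) {y. X(n := y) = restrict p {0..<Suc n}}"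
        by (subst IT.emeasure_eP[OF X pt]) (simp add: vimage_def)
      have iff: "X(n := y) = restrict p {0..<Suc n} \<longleftrightarrow> y = p n \<and> X = restrict p {0..<n}" for y
      proof
        assume *: "X(n := y) = restrict p {0..<Suc n}"
        have "X k = restrict p {0..<n} k" for k
          using fun_cong[OF *, of k] Xe by (cases "k = n") (auto simp: extensional_def split: if_splits)
        then show "y = p n \<and> X = restrict p {0..<n}"
          using fun_cong[OF *, of n] by auto
      qed auto
      show "emeasure (IT.eP n X) (?pt (Suc n) p) =
          ennreal (pmf (case n of 0 \<Rightarrow> return_pmf x | Suc j \<Rightarrow> step_pmf \<omega> (p j)) (p n)) * indicator (?pt n p) X"
      proof (cases "X = restrict p {0..<n}")
        case True
        then have "{y. X(n := y) = restrict p {0..<Suc n}} = {p n}" using iff by auto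
        then have "emeasure (IT.eP n X) (?pt (Suc n) p) = emeasure (K n X) {p n}" unfolding eP by simp
        also have "\<dots> = ennreal (pmf (case n of 0 \<Rightarrow> return_pmf x | Suc j \<Rightarrow> step_pmf \<omega> (p j)) (p n))"
          unfolding K_def emeasure_pmf_single by (cases n) (auto simp: True)
        finally show ?thesis using True by simp
      next
        case False
        then have "{y. X(n := y) = restrict p {0..<Suc n}} = {}" using iff by auto
        then show ?thesis using False unfolding eP by simp
      qed
    qed
    also have "\<dots> = emeasure (?C n) (?pt n p) *
        ennreal (pmf (case n of 0 \<Rightarrow> return_pmf x | Suc j \<Rightarrow> step_pmf \<omega> (p j)) (p n))"
      by (subst nn_integral_cmult_indicator) (auto simp: setsC pt mult.commute simp del: restrict_apply IT.C.simps)
    finally show ?thesis .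
  qed
  have C0: "emeasure (?C 0) (?pt 0 p) = 1" for p
  proof -
    have "?pt 0 p = space (?C 0)" by (simp add: space_PiM PiE_empty_domain fun_eq_iff)
    then show ?thesis using prob_space.emeasure_space_1[OF IT.prob_space_C[OF u0, of 0]] by simp
  qed
  have C_cyl: "emeasure (?C (Suc n)) (?pt (Suc n) p) = ennreal (cyl_prob \<omega> x n p)" for n p
  proof (induction n)
    case 0
    show ?case unfolding C_Suc C0 by (auto simp: cyl_prob_def indicator_def)
  next
    case (Suc n)
    have "0 \<le> cyl_prob \<omega> x n p" by (auto simp: cyl_prob_def trans_prob_nonneg[OF \<omega>] intro!: prod_nonneg)
    then show ?case
      unfolding C_Suc[of "Suc n"] Suc by (simp add: cyl_prob_Suc pmf_step[OF \<omega>] ennreal_mult trans_prob_nonneg[OF \<omega>])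
  qed
  have lim_cyl: "emeasure ?\<mu> (cyl n p) = ennreal (cyl_prob \<omega> x n p)" for n p
  proof -
    have eq: "cyl n p = prod_emb UNIV (\<lambda>_. count_space UNIV) {0..<Suc n} (?pt (Suc n) p)"
      by (auto simp: cyl_def prod_emb_def space_PiM fun_eq_iff restrict_def less_Suc_eq_le split: if_splits)
    show ?thesis
      unfolding eq C_cyl[symmetric]
      unfolding IT.lim[OF finite_atLeastLessThan pt] IT.emeasure_CI[OF subset_refl pt]
      by (subst prod_emb_id) (auto simp: PiE_iff extensional_def)
  qed
  have meas: "measure ?\<mu> (cyl n p) = cyl_prob \<omega> x n p" for n p
  proof -
    have "0 \<le> cyl_prob \<omega> x n p"
      by (auto simp: cyl_prob_def trans_prob_nonneg[OF \<omega>] intro!: prod_nonneg)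
    then show ?thesis by (simp add: measure_def lim_cyl)
  qed
  have "is_walk_law \<omega> x ?\<mu>"
    unfolding is_walk_law_def
  proof (intro conjI allI ballI)
    show "sets ?\<mu> = sets path_space" by (fact sets)
    have c0: "cyl 0 (\<lambda>_. y) = {X. X 0 = y}" for y :: "int ^ 'd" by (simp add: cyl_def)
    show s: "measure ?\<mu> {X. X 0 = x} = 1" using meas[of 0 "\<lambda>_. x"] by (simp add: c0 cyl_prob_def)
    show "prob_space ?\<mu>"
    proof (rule prob_space_distrD)
      show "prob_space (distr ?\<mu> (?M 0) (\<lambda>X. restrict X {0..<0}))"
        using IT.PF.prob_space_P[of "{0..<0}"] by (subst IT.distr_lim) auto
      show "(\<lambda>X. restrict X {0..<0}) \<in> ?\<mu> \<rightarrow>\<^sub>M ?M 0"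
        by (subst measurable_cong_sets[OF IT.PF.sets_lim refl]) (rule measurable_restrict_subset, simp)
    qed
    fix n and p :: "'d path" and e :: "int ^ 'd" assume e: "e \<in> units"
    have "{X. (\<forall>k\<le>n. X k = p k) \<and> X (Suc n) = p n + e} = cyl (Suc n) (p(Suc n := p n + e))"
      by (auto simp: cyl_def le_Suc_eq)
    then have "measure ?\<mu> {X. (\<forall>k\<le>n. X k = p k) \<and> X (Suc n) = p n + e} =
      cyl_prob \<omega> x n (p(Suc n := p n + e)) * trans_prob \<omega> (p n) (p n + e)"
      by (simp add: meas cyl_prob_Suc)
    also have "cyl_prob \<omega> x n (p(Suc n := p n + e)) = cyl_prob \<omega> x n p"
      by (auto simp: cyl_prob_def intro!: prod.cong)
    finally show "measure ?\<mu> {X. (\<forall>k\<le>n. X k = p k) \<and> X (Suc n) = p n + e} =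
        measure ?\<mu> {X. \<forall>k\<le>n. X k = p k} * (\<omega> {p n, p n + e} / total_cond \<omega> (p n))"
      using e by (simp add: trans_prob_def flip: meas) (simp add: cyl_def)
  qed
  then show ?thesis by blast
qed

lemma walk_law_is_walk_law: "\<omega> \<in> space env_space \<Longrightarrow> is_walk_law \<omega> x (walk_law \<omega> x)"
  unfolding walk_law_def using walk_law_exists[of \<omega> x] walk_law_unique[of \<omega> x] by (metis theI)

lemma trans_prob_measurable [measurable]: "(\<lambda>\<omega>. trans_prob \<omega> y z) \<in> borel_measurable env_space"
proof -
  have coord: "(\<lambda>\<omega>. \<omega> b) \<in> borel_measurable env_space" if "b \<in> bonds" for b :: "(int ^ 'a) set"
    using measurable_component_singleton[OF that, of "\<lambda>_. restrict_space borel {0<..}"]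
    by (auto simp: env_space_def measurable_restrict_space2_iff)
  have tot: "(\<lambda>\<omega>. total_cond \<omega> y) \<in> borel_measurable env_space"
    unfolding total_cond_def by (intro borel_measurable_sum coord bondsI)
  show ?thesis
  proof (cases "z - y \<in> units")
    case True
    then have "{y, z} \<in> bonds" using bondsI[OF True, of y] by simp
    then show ?thesis using True coord tot by (simp add: trans_prob_def)
  qed (simp add: trans_prob_def)
qed

lemma walk_law_measurable: "(\<lambda>\<omega>. walk_law \<omega> x) \<in> env_space \<rightarrow>\<^sub>M prob_algebra path_space"
proof (rule measurable_prob_algebra_generated[OF sets_path_space Int_stable_cyls])
  fix \<omega> :: "'a env" assume \<omega>: "\<omega> \<in> space env_space"
  show "prob_space (walk_law \<omega> x)" "sets (walk_law \<omega> x) = sets path_space"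
    using walk_law_is_walk_law[OF \<omega>, of x] by (simp_all add: is_walk_law_def)
next
  fix A :: "'a path set" assume "A \<in> cyls"
  then consider "A = {}" | n p where "A = cyl n p" by (auto simp: cyls_def)
  then show "(\<lambda>\<omega>. emeasure (walk_law \<omega> x) A) \<in> borel_measurable env_space"
  proof cases
    case 2
    have "emeasure (walk_law \<omega> x) A = ennreal (cyl_prob \<omega> x n p)" if \<omega>: "\<omega> \<in> space env_space" for \<omega>
    proof -
      interpret prob_space "walk_law \<omega> x" using walk_law_is_walk_law[OF \<omega>] by (simp add: is_walk_law_def)
      show ?thesis using walk_law_cyl[OF \<omega> walk_law_is_walk_law[OF \<omega>]] by (simp add: 2 emeasure_eq_measure)
    qed
    moreover have "(\<lambda>\<omega>. ennreal (cyl_prob \<omega> x n p)) \<in> borel_measurable env_space"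
      unfolding cyl_prob_def by (cases "p 0 = x") auto
    ultimately show ?thesis by (simp cong: measurable_cong)
  qed simp
qed simp

lemma env_coord_measurable:
  "b \<in> bonds \<Longrightarrow> (\<lambda>\<omega>. \<omega> b) \<in> env_space \<rightarrow>\<^sub>M restrict_space borel {0<..}"
  unfolding env_space_def by (rule measurable_component_singleton)

lemma tilt_measurable: "tilt l lam \<in> env_space \<rightarrow>\<^sub>M env_space"
  unfolding tilt_def
proof (subst (2) env_space_def, rule measurable_restrict)
  fix b :: "(int ^ 'a) set" assume b: "b \<in> bonds"
  have "(\<lambda>\<omega>. \<omega> b) \<in> borel_measurable env_space"
    using env_coord_measurable[OF b] by (simp add: measurable_restrict_space2_iff)
  then show "(\<lambda>\<omega>. \<omega> b * exp (lam * (l \<bullet> (\<Sum>x\<in>b. rvec x)))) \<in> env_space \<rightarrow>\<^sub>M restrict_space borel {0<..}"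
    by (simp add: measurable_restrict_space2_iff env_space_pos[OF _ b])
qed

lemma env_shift_measurable: "env_shift z \<in> env_space \<rightarrow>\<^sub>M env_space"
  unfolding env_shift_def
proof (subst (2) env_space_def, rule measurable_restrict)
  fix b :: "(int ^ 'a) set" assume "b \<in> bonds"
  then have "(+) z ` b \<in> bonds" using bondsI[of _ "z + _"] by (auto simp: bonds_def add.assoc)
  then show "(\<lambda>\<omega>. \<omega> ((+) z ` b)) \<in> env_space \<rightarrow>\<^sub>M restrict_space borel {0<..}"
    by (rule env_coord_measurable)
qed

lemma env_seen_measurable: "env_seen n \<in> env_space \<Otimes>\<^sub>M path_space \<rightarrow>\<^sub>M env_space"
  unfolding env_seen_def case_prod_beta'
  by (rule measurable_compose_countable[where g = "\<lambda>z. snd z n"])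
    (auto intro: measurable_compose[OF measurable_fst env_shift_measurable]
      measurable_compose[OF measurable_snd coord_measurable])

lemma annealed_prob_space:
  assumes M: "prob_space M" "sets M = sets env_space" and K: "K \<in> env_space \<rightarrow>\<^sub>M prob_algebra path_space"
  shows "prob_space (annealed M K)" "sets (annealed M K) = sets (env_space \<Otimes>\<^sub>M path_space)"
proof -
  have [measurable]: "K \<in> env_space \<rightarrow>\<^sub>M prob_algebra path_space" by (fact K)
  have "(\<lambda>\<omega>. K \<omega> \<bind> (\<lambda>X. return (env_space \<Otimes>\<^sub>M path_space) (\<omega>, X)))
      \<in> env_space \<rightarrow>\<^sub>M prob_algebra (env_space \<Otimes>\<^sub>M path_space)" by measurable
  moreover have "M \<in> space (prob_algebra env_space)" using M by (simp add: space_prob_algebra)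
  then have "(\<lambda>_. M) \<in> count_space (UNIV :: unit set) \<rightarrow>\<^sub>M prob_algebra env_space" by simp
  ultimately have "(\<lambda>_. annealed M K) \<in> count_space (UNIV :: unit set) \<rightarrow>\<^sub>M prob_algebra (env_space \<Otimes>\<^sub>M path_space)"
    unfolding annealed_def by (rule measurable_bind_prob_space[rotated])
  then have "annealed M K \<in> space (prob_algebra (env_space \<Otimes>\<^sub>M path_space))" by auto
  then show "prob_space (annealed M K)" "sets (annealed M K) = sets (env_space \<Otimes>\<^sub>M path_space)"
    by (simp_all add: space_prob_algebra)
qed

end

theory Submission
  imports Defs
begin

text \<open>Under \<open>Q0\<close> the environment seen from the walk is a stationary reversible chain with transition
  operator \<open>R\<close>, and \<open>H_minus_1\<close> consists of the functions \<open>f\<close> that are bounded by \<open>\<surd>K\<close> times the square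
  root of the Dirichlet form, tested against bounded functions. Near-minimizers of a quadratic
  functional replace the resolvent: they give bounded \<open>v\<close> such that \<open>\<Sum> f(\<omega>\<^sub>k)\<close> is within \<open>\<eta> \<surd>n\<close> in
  \<open>L\<^sup>2\<close> of the martingale with increments \<open>v(\<omega>\<^sub>k\<^sub>+\<^sub>1) - R v(\<omega>\<^sub>k)\<close>.

  The tilted walk has density \<open>G\<^sub>n = \<Prod> (1 + \<lambda> \<zeta>\<^sub>k + O(\<lambda>\<^sup>2))\<close> with respect to the untilted one, where
  \<open>\<zeta>\<^sub>k\<close> are the increments of the martingale part \<open>M\<^sup>\<zeta>\<close> of \<open>X \<sqdot> l\<close>, and \<open>G\<^sub>n\<close> is bounded in \<open>L\<^sup>2\<close> up to times of
  order \<open>1 / \<lambda>\<^sup>2\<close>. The predictable covariation of \<open>M\<^sup>\<zeta>\<close> and the approximating martingale obeys a law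
  of large numbers, because ergodicity makes the coboundaries of bounded functions dense among the
  centred functions. So the quotient tends to \<open>lim n\<^sup>-\<^sup>1 E[\<Sum> f(\<omega>\<^sub>k) M\<^sup>\<zeta>\<^sub>n]\<close>. Finally
  \<open>M\<^sup>\<zeta>\<^sub>n = X\<^sub>n \<sqdot> l - \<Sum> d(\<omega>\<^sub>k) \<sqdot> l\<close>, and time reversal makes the displacement orthogonal to
  \<open>\<Sum> f(\<omega>\<^sub>k)\<close>, which leaves minus the asymptotic covariance of \<open>f\<close> and the drift. This is \<open>Lambda f\<close>
  by the central limit theorem for additive functionals, which holds under \<open>P\<close> as well since
  the characteristic functions converge jointly with any bounded function of the initial environment.\<close>

section \<open>Square-integrable functions\<close>

text \<open>All approximating functions are bounded. Martingale increments are then uniformly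
  bounded, so the central limit theorem needs no Lindeberg condition and products can be integrated
  against \<open>girs\<close> without moment conditions. The price is that minimizers over bounded
  functions need not exist: every variational equation carries an error \<eta> in squared form and
  is read off from a discriminant.

  The scaling shapes the final estimate. Functions of finite asymptotic variance have mean 0, so the
  quotient is lam/t times the tilted mean of a sum of about n = t/lam^2 terms. An L2 error \<eta>
  sqrt n in that sum, paired with a density of bounded L2 norm, costs O(\<eta>) after multiplication
  by lam. The second-order remainder of the density costs O(lam^2) per step, O(1) in total, and is
  killed by the remaining factor lam; its constant depends on v, so v must be fixed before lam tends
  to 0. Numerical constants such as 11 or 18 matter only in being uniform.\<close>

lemma quadratic_nonneg_imp_discriminant:
  fixes a b c :: real
  assumes a: "0 \<le> a" and nonneg: "\<And>s. 0 \<le> a * s\<^sup>2 + 2 * b * s + c"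
  shows "b\<^sup>2 \<le> a * c"
proof (cases "a = 0")
  case True
  have "b = 0"
  proof (rule ccontr)
    assume b: "b \<noteq> 0"
    have "2 * b * ((- c - 1) / (2 * b)) + c = -1" using b by (simp add: field_simps)
    then show False using nonneg[of "(- c - 1) / (2 * b)"] True by simp
  qed
  then show ?thesis using True by simp
next
  case False
  with a have a: "0 < a" by simp
  have "0 \<le> a * (- b / a)\<^sup>2 + 2 * b * (- b / a) + c" by (rule nonneg)
  also have "\<dots> = (a * c - b\<^sup>2) / a" using a by (simp add: field_simps power2_eq_square)
  finally show ?thesis using a by (simp add: zero_le_divide_iff)
qed

text \<open>Functions rather than classes modulo null sets, because \<open>env_seen\<close> and
  \<open>trans_op\<close> act pointwise; \<open>nrm\<close> is thus only a seminorm. For a function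
  whose square is not integrable the integral defaults to 0, which is why the triangle inequalities
  carry membership hypotheses.\<close>

definition L2 :: "'a measure \<Rightarrow> ('a \<Rightarrow> real) set" where
  "L2 M = {f \<in> borel_measurable M. integrable M (\<lambda>x. (f x)\<^sup>2)}"

definition nrm :: "'a measure \<Rightarrow> ('a \<Rightarrow> real) \<Rightarrow> real" where
  "nrm M f = sqrt (\<integral>x. (f x)\<^sup>2 \<partial>M)"

lemma L2_measurable: "f \<in> L2 M \<Longrightarrow> f \<in> borel_measurable M"
  by (simp add: L2_def)

lemma L2_integrable_sq: "f \<in> L2 M \<Longrightarrow> integrable M (\<lambda>x. (f x)\<^sup>2)"
  by (simp add: L2_def)

lemma nrm_nonneg [simp]: "0 \<le> nrm M f"
  by (simp add: nrm_def)

lemma nrm_sq: "(nrm M f)\<^sup>2 = (\<integral>x. (f x)\<^sup>2 \<partial>M)"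
  by (simp add: nrm_def)

lemma L2_integrable_mult:
  assumes f: "f \<in> L2 M" and g: "g \<in> L2 M"
  shows "integrable M (\<lambda>x. f x * g x)"
proof (rule Bochner_Integration.integrable_bound)
  show "integrable M (\<lambda>x. (f x)\<^sup>2 + (g x)\<^sup>2)" using f g by (simp add: L2_def)
  show "(\<lambda>x. f x * g x) \<in> borel_measurable M" using f g by (auto simp: L2_def)
  have "\<bar>a * b\<bar> \<le> a\<^sup>2 + b\<^sup>2" for a b :: real
    using sum_squares_bound[of "\<bar>a\<bar>" "\<bar>b\<bar>"] by (simp add: abs_mult) (use mult_nonneg_nonneg[of "\<bar>a\<bar>" "\<bar>b\<bar>"] in linarith)
  then show "AE x in M. norm (f x * g x) \<le> norm ((f x)\<^sup>2 + (g x)\<^sup>2)" by simp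
qed

lemma L2_add:
  assumes f: "f \<in> L2 M" and g: "g \<in> L2 M"
  shows "(\<lambda>x. f x + g x) \<in> L2 M"
  using f g L2_integrable_mult[OF f g] by (auto simp: L2_def power2_sum mult.assoc)

lemma L2_cmult: "f \<in> L2 M \<Longrightarrow> (\<lambda>x. c * f x) \<in> L2 M"
  by (auto simp: L2_def power_mult_distrib)

lemma L2_diff:
  assumes f: "f \<in> L2 M" and g: "g \<in> L2 M"
  shows "(\<lambda>x. f x - g x) \<in> L2 M"
  using L2_add[OF f L2_cmult[OF g, of "-1"]] by simp

lemma L2_zero: "(\<lambda>_. 0) \<in> L2 M"
  by (simp add: L2_def)

lemma L2_sum: "(\<And>i. i \<in> I \<Longrightarrow> f i \<in> L2 M) \<Longrightarrow> (\<lambda>x. \<Sum>i\<in>I. f i x) \<in> L2 M"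
  by (induction I rule: infinite_finite_induct) (auto intro: L2_add L2_zero)

lemma L2_integral_add_scaled_sq:
  assumes f: "f \<in> L2 M" and g: "g \<in> L2 M"
  shows "(\<integral>x. (f x + s * g x)\<^sup>2 \<partial>M) =
    (\<integral>x. (g x)\<^sup>2 \<partial>M) * s\<^sup>2 + 2 * (\<integral>x. f x * g x \<partial>M) * s + (\<integral>x. (f x)\<^sup>2 \<partial>M)"
proof -
  have "(\<integral>x. (f x + s * g x)\<^sup>2 \<partial>M) = (\<integral>x. (f x)\<^sup>2 + ((2 * s) * (f x * g x) + s\<^sup>2 * (g x)\<^sup>2) \<partial>M)"
    by (intro Bochner_Integration.integral_cong) (auto simp: power2_eq_square algebra_simps)
  also have "\<dots> = (\<integral>x. (f x)\<^sup>2 \<partial>M) + ((2 * s) * (\<integral>x. f x * g x \<partial>M) + s\<^sup>2 * (\<integral>x. (g x)\<^sup>2 \<partial>M))"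
    using L2_integrable_mult[OF f g] L2_integrable_sq[OF f] L2_integrable_sq[OF g]
    by (simp add: Bochner_Integration.integral_add)
  finally show ?thesis by (simp add: algebra_simps)
qed

lemma integral_Cauchy_Schwarz:
  assumes f: "f \<in> L2 M" and g: "g \<in> L2 M"
  shows "(\<integral>x. f x * g x \<partial>M)\<^sup>2 \<le> (\<integral>x. (f x)\<^sup>2 \<partial>M) * (\<integral>x. (g x)\<^sup>2 \<partial>M)"
proof -
  have "0 \<le> (\<integral>x. (g x)\<^sup>2 \<partial>M) * s\<^sup>2 + 2 * (\<integral>x. f x * g x \<partial>M) * s + (\<integral>x. (f x)\<^sup>2 \<partial>M)" for s
    unfolding L2_integral_add_scaled_sq[OF f g, symmetric] by (rule Bochner_Integration.integral_nonneg) simp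
  from quadratic_nonneg_imp_discriminant[OF _ this] show ?thesis by (simp add: mult.commute)
qed

lemma nrm_Cauchy_Schwarz:
  assumes f: "f \<in> L2 M" and g: "g \<in> L2 M"
  shows "\<bar>\<integral>x. f x * g x \<partial>M\<bar> \<le> nrm M f * nrm M g"
  using real_sqrt_le_mono[OF integral_Cauchy_Schwarz[OF f g]] by (simp add: nrm_def real_sqrt_mult)

lemma nrm_triangle:
  assumes f: "f \<in> L2 M" and g: "g \<in> L2 M"
  shows "nrm M (\<lambda>x. f x + g x) \<le> nrm M f + nrm M g"
proof (rule power2_le_imp_le)
  show "(nrm M (\<lambda>x. f x + g x))\<^sup>2 \<le> (nrm M f + nrm M g)\<^sup>2"
    using L2_integral_add_scaled_sq[OF f g, of 1] nrm_Cauchy_Schwarz[OF f g]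
    by (simp add: power2_sum nrm_sq)
qed simp

lemma nrm_cmult: "nrm M (\<lambda>x. c * f x) = \<bar>c\<bar> * nrm M f"
  by (simp add: nrm_def power_mult_distrib real_sqrt_mult)

lemma nrm_minus_commute: "nrm M (\<lambda>x. f x - g x) = nrm M (\<lambda>x. g x - f x)"
  by (simp add: nrm_def power2_commute)

lemma nrm_triangle_diff:
  assumes f: "f \<in> L2 M" and g: "g \<in> L2 M"
  shows "nrm M (\<lambda>x. f x - g x) \<le> nrm M f + nrm M g"
  using nrm_triangle[OF f L2_cmult[OF g, of "-1"]] nrm_cmult[of M "-1" g] by simp

lemma nrm_triangle_rev:
  assumes f: "f \<in> L2 M" and g: "g \<in> L2 M"
  shows "\<bar>nrm M f - nrm M g\<bar> \<le> nrm M (\<lambda>x. f x - g x)"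
  using nrm_triangle[OF L2_diff[OF f g] g] nrm_triangle[OF L2_diff[OF g f] f]
    nrm_minus_commute[of M f g] by simp

lemma nrm_sum:
  "(\<And>i. i \<in> I \<Longrightarrow> f i \<in> L2 M) \<Longrightarrow> nrm M (\<lambda>x. \<Sum>i\<in>I. f i x) \<le> (\<Sum>i\<in>I. nrm M (f i))"
proof (induction I rule: infinite_finite_induct)
  case (insert i I)
  then show ?case
    using nrm_triangle[of "f i" M "\<lambda>x. \<Sum>i\<in>I. f i x"] L2_sum[of I f M] by fastforce
qed (simp_all add: nrm_def)

context prob_space
begin

lemma L2_bounded:
  assumes "f \<in> borel_measurable M" "AE x in M. \<bar>f x\<bar> \<le> c"
  shows "f \<in> L2 M" "nrm M f \<le> \<bar>c\<bar>"
proof -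
  have *: "AE x in M. (f x)\<^sup>2 \<le> c\<^sup>2"
    using assms(2) by eventually_elim (simp add: abs_le_square_iff[symmetric])
  then have i: "integrable M (\<lambda>x. (f x)\<^sup>2)"
    using assms(1) by (intro integrable_const_bound[where B = "c\<^sup>2"]) auto
  then show "f \<in> L2 M" using assms(1) by (simp add: L2_def)
  have "(\<integral>x. (f x)\<^sup>2 \<partial>M) \<le> (\<integral>x. c\<^sup>2 \<partial>M)" using i * by (intro integral_mono_AE) auto
  then show "nrm M f \<le> \<bar>c\<bar>"
    unfolding nrm_def using real_sqrt_le_mono[of _ "c\<^sup>2"] by (simp add: prob_space)
qed

lemma L2_const: "(\<lambda>_. c) \<in> L2 M"
  by (simp add: L2_def)

lemma L2_integrable: "f \<in> L2 M \<Longrightarrow> integrable M f"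
  using L2_integrable_mult[OF _ L2_const, of f 1] by simp

lemma nrm_ge_integral_abs: "f \<in> L2 M \<Longrightarrow> (\<integral>x. \<bar>f x\<bar> \<partial>M) \<le> nrm M f"
proof -
  assume f: "f \<in> L2 M"
  then have a: "(\<lambda>x. \<bar>f x\<bar>) \<in> L2 M" by (auto simp: L2_def)
  show ?thesis
    using nrm_Cauchy_Schwarz[OF a L2_const[of 1]] by (simp add: nrm_def prob_space)
qed

end

section \<open>Characteristic functions of planar laws\<close>

lemma
  fixes f :: "'a \<Rightarrow> 'c::{real_normed_field,banach,second_countable_topology}" and g :: "'b \<Rightarrow> 'c"
  assumes M1: "sigma_finite_measure M1" and M2: "sigma_finite_measure M2"
    and f: "integrable M1 f" and g: "integrable M2 g"
  shows integrable_pair_mult: "integrable (M1 \<Otimes>\<^sub>M M2) (\<lambda>z. f (fst z) * g (snd z))"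
    and integral_pair_mult:
      "(\<integral>z. f (fst z) * g (snd z) \<partial>(M1 \<Otimes>\<^sub>M M2)) = (\<integral>x. f x \<partial>M1) * (\<integral>y. g y \<partial>M2)"
proof -
  interpret M1: sigma_finite_measure M1 by fact
  interpret M2: sigma_finite_measure M2 by fact
  interpret pair_sigma_finite M1 M2 ..
  have [measurable]: "f \<in> borel_measurable M1" "g \<in> borel_measurable M2" using f g by auto
  show i: "integrable (M1 \<Otimes>\<^sub>M M2) (\<lambda>z. f (fst z) * g (snd z))"
  proof (rule Fubini_integrable)
    show "integrable M1 (\<lambda>x. \<integral>y. norm (f (fst (x, y)) * g (snd (x, y))) \<partial>M2)"
      using f g by (simp add: norm_mult)
  qed (use g in auto)
  show "(\<integral>z. f (fst z) * g (snd z) \<partial>(M1 \<Otimes>\<^sub>M M2)) = (\<integral>x. f x \<partial>M1) * (\<integral>y. g y \<partial>M2)"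
    using integral_fst'[OF i] by simp
qed

abbreviation std_normal2 :: "(real \<times> real) measure" where
  "std_normal2 \<equiv> std_normal_distribution \<Otimes>\<^sub>M std_normal_distribution"

lemma prob_space_std_normal2: "prob_space std_normal2"
proof -
  interpret N: prob_space std_normal_distribution by (rule prob_space_normal_density) simp
  interpret pair_prob_space std_normal_distribution std_normal_distribution ..
  show ?thesis by unfold_locales
qed

lemma sets_std_normal2 [measurable_cong]: "sets std_normal2 = sets borel"
  by (simp add: borel_prod[symmetric] cong: sets_pair_measure_cong)

definition cf :: "'a::euclidean_space measure \<Rightarrow> 'a \<Rightarrow> complex" where
  "cf \<mu> u = (\<integral>x. iexp (u \<bullet> x) \<partial>\<mu>)"

lemma cf_std_normal2: "cf std_normal2 u = complex_of_real (exp (- (norm u)\<^sup>2 / 2))"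
proof -
  interpret N: real_distribution std_normal_distribution by (rule real_dist_normal_dist)
  have i: "integrable std_normal_distribution (\<lambda>x. iexp (a * x))" for a
    using N.integrable_iexp[of "\<lambda>x. complex_of_real (a * x)"] by simp
  have "cf std_normal2 u = (\<integral>w. iexp (fst u * fst w) * iexp (snd u * snd w) \<partial>std_normal2)"
    unfolding cf_def by (intro Bochner_Integration.integral_cong)
      (auto simp: inner_prod_def exp_add[symmetric] algebra_simps)
  also have "\<dots> = char std_normal_distribution (fst u) * char std_normal_distribution (snd u)"
    unfolding char_def
    by (rule integral_pair_mult[OF _ _ i i]) unfold_locales
  also have "\<dots> = complex_of_real (exp (- (norm u)\<^sup>2 / 2))"
    unfolding char_std_normal_distribution
    by (simp add: norm_prod_def exp_add[symmetric] add_divide_distrib flip: of_real_mult)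
  finally show ?thesis .
qed

text \<open>The Gaussian bump is itself the characteristic function of the standard normal law at
  s(x - y). Fubini moves the integral against \<mu> inside and produces \<open>cf \<mu>\<close>, so
  convergence of characteristic functions reaches Gaussian test functions by dominated convergence
  alone.\<close>

lemma integral_gauss_eq_cf:
  assumes \<mu>: "prob_space \<mu>" and [measurable_cong]: "sets \<mu> = sets (borel :: (real \<times> real) measure)"
  shows "complex_of_real (\<integral>x. exp (- (norm (s *\<^sub>R (x - y)))\<^sup>2 / 2) \<partial>\<mu>) =
    (\<integral>w. iexp (- ((s *\<^sub>R w) \<bullet> y)) * cf \<mu> (s *\<^sub>R w) \<partial>std_normal2)"
proof -
  interpret M: prob_space \<mu> by fact
  interpret G: prob_space std_normal2 by (rule prob_space_std_normal2)
  interpret pair_prob_space \<mu> std_normal2 ..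
  have i: "integrable (\<mu> \<Otimes>\<^sub>M std_normal2) (\<lambda>(x, w). iexp ((s *\<^sub>R (x - y)) \<bullet> w))"
    by (intro integrable_const_bound[where B = 1]) (auto simp: case_prod_beta')
  have "complex_of_real (\<integral>x. exp (- (norm (s *\<^sub>R (x - y)))\<^sup>2 / 2) \<partial>\<mu>) = (\<integral>x. cf std_normal2 (s *\<^sub>R (x - y)) \<partial>\<mu>)"
    unfolding cf_std_normal2 by (rule integral_complex_of_real[symmetric])
  also have "\<dots> = (\<integral>x. (\<integral>w. iexp ((s *\<^sub>R (x - y)) \<bullet> w) \<partial>std_normal2) \<partial>\<mu>)"
    by (simp add: cf_def)
  also have "\<dots> = (\<integral>w. (\<integral>x. iexp ((s *\<^sub>R (x - y)) \<bullet> w) \<partial>\<mu>) \<partial>std_normal2)"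
    by (rule Fubini_integral[symmetric]) (rule i)
  also have "\<dots> = (\<integral>w. iexp (- ((s *\<^sub>R w) \<bullet> y)) * cf \<mu> (s *\<^sub>R w) \<partial>std_normal2)"
  proof (rule Bochner_Integration.integral_cong[OF refl])
    fix w
    have "(\<integral>x. iexp ((s *\<^sub>R (x - y)) \<bullet> w) \<partial>\<mu>) =
        (\<integral>x. iexp (- ((s *\<^sub>R w) \<bullet> y)) * iexp ((s *\<^sub>R w) \<bullet> x) \<partial>\<mu>)"
      by (intro Bochner_Integration.integral_cong)
        (auto simp: exp_add[symmetric] inner_commute[of w] algebra_simps inner_diff_left)
    then show "(\<integral>x. iexp ((s *\<^sub>R (x - y)) \<bullet> w) \<partial>\<mu>) = iexp (- ((s *\<^sub>R w) \<bullet> y)) * cf \<mu> (s *\<^sub>R w)"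
      by (simp add: cf_def)
  qed
  finally show ?thesis .
qed

lemma borel_measurable_cf:
  assumes \<mu>: "prob_space \<mu>" and [measurable_cong]: "sets \<mu> = sets (borel :: (real \<times> real) measure)"
  shows "cf \<mu> \<in> borel_measurable borel"
proof -
  interpret M: prob_space \<mu> by fact
  show ?thesis unfolding cf_def by measurable
qed

lemma norm_cf_le_1:
  assumes \<mu>: "prob_space \<mu>" shows "norm (cf \<mu> u) \<le> 1"
proof -
  interpret prob_space \<mu> by fact
  have "norm (cf \<mu> u) \<le> (\<integral>x. norm (iexp (u \<bullet> x)) \<partial>\<mu>)"
    unfolding cf_def by (rule integral_norm_bound)
  also have "\<dots> = 1" by (simp add: prob_space)
  finally show ?thesis .
qed

lemma integral_gauss_tendsto:
  fixes \<mu> :: "nat \<Rightarrow> (real \<times> real) measure"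
  assumes \<mu>: "\<And>n. prob_space (\<mu> n)" "\<And>n. sets (\<mu> n) = sets borel"
    and \<nu>: "prob_space \<nu>" "sets \<nu> = sets borel"
    and lim: "\<And>u. (\<lambda>n. cf (\<mu> n) u) \<longlonglongrightarrow> cf \<nu> u"
  shows "(\<lambda>n. \<integral>x. exp (- (norm (s *\<^sub>R (x - y)))\<^sup>2 / 2) \<partial>\<mu> n) \<longlonglongrightarrow>
    (\<integral>x. exp (- (norm (s *\<^sub>R (x - y)))\<^sup>2 / 2) \<partial>\<nu>)"
proof -
  interpret G: prob_space std_normal2 by (rule prob_space_std_normal2)
  note [measurable] = borel_measurable_cf[OF \<nu>] borel_measurable_cf[OF \<mu>]
  have "(\<lambda>n. \<integral>w. iexp (- ((s *\<^sub>R w) \<bullet> y)) * cf (\<mu> n) (s *\<^sub>R w) \<partial>std_normal2) \<longlonglongrightarrow>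
      (\<integral>w. iexp (- ((s *\<^sub>R w) \<bullet> y)) * cf \<nu> (s *\<^sub>R w) \<partial>std_normal2)"
  proof (rule integral_dominated_convergence[where w = "\<lambda>_. 1"])
    show "AE w in std_normal2. (\<lambda>n. iexp (- ((s *\<^sub>R w) \<bullet> y)) * cf (\<mu> n) (s *\<^sub>R w)) \<longlonglongrightarrow>
        iexp (- ((s *\<^sub>R w) \<bullet> y)) * cf \<nu> (s *\<^sub>R w)"
      by (intro always_eventually allI tendsto_mult tendsto_const lim)
    show "AE w in std_normal2. norm (iexp (- ((s *\<^sub>R w) \<bullet> y)) * cf (\<mu> n) (s *\<^sub>R w)) \<le> 1" for n
      using norm_cf_le_1[OF \<mu>(1)[of n]] by (simp add: norm_mult del: of_real_minus)
  qed auto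
  then show ?thesis
    unfolding integral_gauss_eq_cf[OF \<mu>, symmetric] integral_gauss_eq_cf[OF \<nu>, symmetric]
    by (simp only: tendsto_of_real_iff)
qed

section \<open>Smoothing of test functions by Gaussian kernels\<close>

abbreviation lborel2 :: "(real \<times> real) measure" where
  "lborel2 \<equiv> lborel \<Otimes>\<^sub>M lborel"

text \<open>The kernel is symmetric: in y it is a probability density centred at x, in x it is a
  multiple of the Gaussian bump at y, to which \<open>integral_gauss_tendsto\<close>
  applies.\<close>

definition normal_kernel :: "real \<Rightarrow> real \<times> real \<Rightarrow> real \<times> real \<Rightarrow> real" where
  "normal_kernel \<tau> x y = normal_density (fst x) \<tau> (fst y) * normal_density (snd x) \<tau> (snd y)"

lemma normal_kernel_eq:
  assumes "0 < \<tau>"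
  shows "normal_kernel \<tau> x y = 1 / (2 * pi * \<tau>\<^sup>2) * exp (- (norm ((1 / \<tau>) *\<^sub>R (x - y)))\<^sup>2 / 2)"
proof -
  have "(norm ((1 / \<tau>) *\<^sub>R (x - y)))\<^sup>2 / 2 =
      (fst y - fst x)\<^sup>2 / (2 * \<tau>\<^sup>2) + (snd y - snd x)\<^sup>2 / (2 * \<tau>\<^sup>2)"
    using assms
    by (simp add: power_mult_distrib norm_prod_def power_divide field_simps)
       (simp add: power2_eq_square algebra_simps)
  then show ?thesis
    using assms by (simp add: normal_kernel_def normal_density_def exp_add[symmetric] real_sqrt_mult
      power2_eq_square field_simps)
qed

lemma normal_kernel_nonneg: "0 \<le> normal_kernel \<tau> x y"
  by (simp add: normal_kernel_def)

lemma normal_kernel_measurable [measurable]: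
  "(\<lambda>z. normal_kernel \<tau> (fst z) (snd z)) \<in> borel_measurable (borel \<Otimes>\<^sub>M borel)"
  unfolding normal_kernel_def normal_density_def borel_prod[symmetric] by measurable

lemma sigma_finite_lborel: "sigma_finite_measure (lborel :: real measure)" ..

lemma sigma_finite_lborel2: "sigma_finite_measure lborel2"
proof -
  interpret pair_sigma_finite "lborel :: real measure" "lborel :: real measure" ..
  show ?thesis by unfold_locales
qed

lemma sets_lborel2 [measurable_cong]: "sets lborel2 = sets borel"
  by (simp add: borel_prod[symmetric] cong: sets_pair_measure_cong)

lemma normal_kernel_integral:
  assumes "0 < \<tau>"
  shows "integrable lborel2 (normal_kernel \<tau> x)" "(\<integral>y. normal_kernel \<tau> x y \<partial>lborel2) = 1"
  using integrable_pair_mult[OF sigma_finite_lborel sigma_finite_lborel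
      integrable_normal_density[OF assms] integrable_normal_density[OF assms], of "fst x" "snd x"]
    integral_pair_mult[OF sigma_finite_lborel sigma_finite_lborel
      integrable_normal_density[OF assms] integrable_normal_density[OF assms], of "fst x" "snd x"] assms
  by (simp_all add: normal_kernel_def[abs_def])

lemma normal_kernel_variance:
  assumes "0 < \<tau>"
  shows "integrable lborel2 (\<lambda>y. (norm (y - x))\<^sup>2 * normal_kernel \<tau> x y)"
    "(\<integral>y. (norm (y - x))\<^sup>2 * normal_kernel \<tau> x y \<partial>lborel2) = 2 * \<tau>\<^sup>2"
proof -
  have m: "has_bochner_integral lborel (\<lambda>y. normal_density m \<tau> y * (y - m)\<^sup>2) (\<tau>\<^sup>2)" for m
    using normal_moment_even[OF assms, of m 1] assms by (simp add: eval_nat_numeral)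
  note i = integrable.intros[OF m] and v = has_bochner_integral_integral_eq[OF m]
  note n = integrable_normal_density[OF assms]
  let ?A = "\<lambda>y. (normal_density (fst x) \<tau> (fst y) * (fst y - fst x)\<^sup>2) * normal_density (snd x) \<tau> (snd y)"
  let ?B = "\<lambda>y. normal_density (fst x) \<tau> (fst y) * (normal_density (snd x) \<tau> (snd y) * (snd y - snd x)\<^sup>2)"
  have A: "integrable lborel2 ?A" "(\<integral>y. ?A y \<partial>lborel2) = \<tau>\<^sup>2"
    using integrable_pair_mult[OF sigma_finite_lborel sigma_finite_lborel i n]
      integral_pair_mult[OF sigma_finite_lborel sigma_finite_lborel i n] v assms by simp_all
  have B: "integrable lborel2 ?B" "(\<integral>y. ?B y \<partial>lborel2) = \<tau>\<^sup>2"
    using integrable_pair_mult[OF sigma_finite_lborel sigma_finite_lborel n i]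
      integral_pair_mult[OF sigma_finite_lborel sigma_finite_lborel n i] v assms by simp_all
  have eq: "(\<lambda>y. (norm (y - x))\<^sup>2 * normal_kernel \<tau> x y) = (\<lambda>y. ?A y + ?B y)"
    by (auto simp: fun_eq_iff norm_prod_def normal_kernel_def algebra_simps)
  show "integrable lborel2 (\<lambda>y. (norm (y - x))\<^sup>2 * normal_kernel \<tau> x y)"
    unfolding eq using A B by simp
  show "(\<integral>y. (norm (y - x))\<^sup>2 * normal_kernel \<tau> x y \<partial>lborel2) = 2 * \<tau>\<^sup>2"
    unfolding eq using A B by simp
qed

lemma gauss_bounded_uniformly_continuous:
  fixes g :: "real \<times> real \<Rightarrow> real"
  assumes g: "continuous_on UNIV g" and s: "0 < s"
    and b: "\<And>x. \<bar>g x\<bar> \<le> B * exp (- (norm (s *\<^sub>R x))\<^sup>2 / 2)" and e: "0 < e"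
  shows "\<exists>\<delta>>0. \<forall>x y. dist x y < \<delta> \<longrightarrow> dist (g x) (g y) < e"
proof -
  have B: "0 \<le> B" using b[of 0] by simp
  \<comment> \<open>Beyond radius R the exponent (s |x|)^2 / 2 exceeds 2B/e, and exp(-y) \<le> 1/(1
    + y) then pushes |g| below e/2.\<close>
  define R where "R = sqrt (4 * B / e) / s"
  have R: "0 \<le> R" using B e s by (simp add: R_def)
  have far: "\<bar>g x\<bar> < e / 2" if x: "norm x > R" for x
  proof -
    define y where "y = (norm (s *\<^sub>R x))\<^sup>2 / 2"
    have "s * R < s * norm x" using x s by simp
    then have "(s * R)\<^sup>2 < (s * norm x)\<^sup>2" using s R by (intro power_strict_mono) auto
    then have y: "2 * B / e < y"
      using s B e by (simp add: R_def y_def power_mult_distrib)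
    have y0: "0 \<le> y" by (simp add: y_def)
    have "B * exp (- y) \<le> B / (1 + y)"
      using mult_left_mono[OF exp_ge_add_one_self[of y], of B] B y0 by (simp add: exp_minus field_simps)
    also have "\<dots> < e / 2" using y y0 e by (simp add: field_simps)
    finally show ?thesis using b[of x] by (simp add: y_def)
  qed
  have "uniformly_continuous_on (cball 0 (R + 1)) g"
    using g by (intro compact_uniformly_continuous) (auto intro: continuous_on_subset)
  then obtain d where d: "d > 0"
    "\<And>x y. x \<in> cball 0 (R + 1) \<Longrightarrow> y \<in> cball 0 (R + 1) \<Longrightarrow> dist x y < d \<Longrightarrow> dist (g x) (g y) < e"
    using e unfolding uniformly_continuous_on_def by (metis dist_commute)
  show ?thesis
  proof (intro exI[of _ "min d 1"] conjI allI impI)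
    show "0 < min d 1" using d by simp
    fix x y :: "real \<times> real" assume xy: "dist x y < min d 1"
    show "dist (g x) (g y) < e"
    proof (cases "x \<in> cball 0 (R + 1) \<and> y \<in> cball 0 (R + 1)")
      case True then show ?thesis using d xy by auto
    next
      case False
      have "norm x \<le> norm y + dist x y" "norm y \<le> norm x + dist x y"
        using norm_triangle_ineq[of y "x - y"] norm_triangle_ineq[of x "y - x"]
        by (auto simp: dist_norm norm_minus_commute)
      with False xy have "norm x > R" "norm y > R" by auto
      then show ?thesis using far[of x] far[of y] by (auto simp: dist_real_def)
    qed
  qed
qed

lemma normal_smoothing_approx:
  fixes g :: "real \<times> real \<Rightarrow> real"
  assumes g: "continuous_on UNIV g" and s: "0 < s"
    and b: "\<And>x. \<bar>g x\<bar> \<le> B * exp (- (norm (s *\<^sub>R x))\<^sup>2 / 2)" and e: "0 < e"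
  shows "\<exists>\<tau>>0. \<forall>x. \<bar>(\<integral>y. g y * normal_kernel \<tau> x y \<partial>lborel2) - g x\<bar> \<le> e"
proof -
  have B: "0 \<le> B" using b[of 0] by simp
  have gB: "\<bar>g x\<bar> \<le> B" for x
    using b[of x] B mult_left_mono[of "exp (- (norm (s *\<^sub>R x))\<^sup>2 / 2)" 1 B] by simp
  have [measurable]: "g \<in> borel_measurable borel" using g by (rule borel_measurable_continuous_onI)
  obtain d where d: "d > 0" "\<And>x y. dist x y < d \<Longrightarrow> dist (g x) (g y) < e / 2"
    using gauss_bounded_uniformly_continuous[OF g s b, of "e / 2"] e by auto
  \<comment> \<open>Chosen for the far part: there |g y - g x| \<le> 2B is dominated by 2B/d^2 times
    the squared distance, and the kernel has second moment 2 \<tau>^2, so 4B \<tau>^2 / d^2 has to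
    stay below e/2.\<close>
  define \<tau> where "\<tau> = d * sqrt (e / (8 * (B + 1)))"
  have \<tau>: "0 < \<tau>" using d e B by (simp add: \<tau>_def)
  have \<tau>2: "4 * B / d\<^sup>2 * \<tau>\<^sup>2 \<le> e / 2"
    using d e B by (simp add: \<tau>_def power_mult_distrib field_simps)
  have "\<bar>(\<integral>y. g y * normal_kernel \<tau> x y \<partial>lborel2) - g x\<bar> \<le> e" for x
  proof -
    note k = normal_kernel_integral[OF \<tau>, of x] and v = normal_kernel_variance[OF \<tau>, of x]
    have km [measurable]: "normal_kernel \<tau> x \<in> borel_measurable lborel2" using k by auto
    have gk: "integrable lborel2 (\<lambda>y. g y * normal_kernel \<tau> x y)"
    proof (rule Bochner_Integration.integrable_bound)
      show "integrable lborel2 (\<lambda>y. B * normal_kernel \<tau> x y)" using k by simp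
      show "AE y in lborel2. norm (g y * normal_kernel \<tau> x y) \<le> norm (B * normal_kernel \<tau> x y)"
        using gB B normal_kernel_nonneg[of \<tau> x]
        by (auto simp: abs_mult intro!: always_eventually mult_right_mono)
    qed measurable
    have pt: "\<bar>g y - g x\<bar> \<le> e / 2 + 2 * B / d\<^sup>2 * (norm (y - x))\<^sup>2" for y
    proof (cases "dist x y < d")
      case True
      then have "\<bar>g y - g x\<bar> \<le> e / 2" using d(2)[of x y] by (simp add: dist_real_def abs_minus_commute)
      moreover have "0 \<le> 2 * B / d\<^sup>2 * (norm (y - x))\<^sup>2" using B by simp
      ultimately show ?thesis by linarith
    next
      case False
      then have "d\<^sup>2 \<le> (norm (y - x))\<^sup>2" using d by (intro power_mono) (auto simp: dist_norm norm_minus_commute)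
      then have "1 \<le> (norm (y - x))\<^sup>2 / d\<^sup>2" using d by simp
      then have "2 * B \<le> 2 * B * ((norm (y - x))\<^sup>2 / d\<^sup>2)" using B mult_left_mono[of 1 "(norm (y - x))\<^sup>2 / d\<^sup>2" "2 * B"] by simp
      then show ?thesis using gB[of x] gB[of y] e by simp
    qed
    have "(\<integral>y. g y * normal_kernel \<tau> x y \<partial>lborel2) - g x =
        (\<integral>y. g y * normal_kernel \<tau> x y \<partial>lborel2) - (\<integral>y. g x * normal_kernel \<tau> x y \<partial>lborel2)"
      using k by simp
    also have "\<dots> = (\<integral>y. g y * normal_kernel \<tau> x y - g x * normal_kernel \<tau> x y \<partial>lborel2)"
      using k gk by (subst Bochner_Integration.integral_diff) auto
    also have "\<bar>\<dots>\<bar> \<le> (\<integral>y. e / 2 * normal_kernel \<tau> x y + 2 * B / d\<^sup>2 * ((norm (y - x))\<^sup>2 * normal_kernel \<tau> x y) \<partial>lborel2)"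
    proof (rule integral_abs_bound_integral)
      fix y
      have "\<bar>g y * normal_kernel \<tau> x y - g x * normal_kernel \<tau> x y\<bar> = \<bar>g y - g x\<bar> * normal_kernel \<tau> x y"
        using normal_kernel_nonneg[of \<tau> x y] by (simp add: abs_mult left_diff_distrib[symmetric])
      also have "\<dots> \<le> (e / 2 + 2 * B / d\<^sup>2 * (norm (y - x))\<^sup>2) * normal_kernel \<tau> x y"
        by (intro mult_right_mono pt normal_kernel_nonneg)
      finally show "\<bar>g y * normal_kernel \<tau> x y - g x * normal_kernel \<tau> x y\<bar> \<le>
          e / 2 * normal_kernel \<tau> x y + 2 * B / d\<^sup>2 * ((norm (y - x))\<^sup>2 * normal_kernel \<tau> x y)"
        by (simp add: algebra_simps)
    qed (use k gk v in auto)
    also have "\<dots> = e / 2 * 1 + 2 * B / d\<^sup>2 * (2 * \<tau>\<^sup>2)"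
      using k v by (subst Bochner_Integration.integral_add) auto
    also have "\<dots> \<le> e" using \<tau>2 by simp
    finally show ?thesis .
  qed
  with \<tau> show ?thesis by blast
qed

text \<open>By Fubini the smoothed function is a superposition of Gaussian bumps with weight g; its
  integrals converge by dominated convergence in y from those of the bumps.\<close>

lemma normal_smoothing_integral_tendsto:
  fixes \<mu> :: "nat \<Rightarrow> (real \<times> real) measure"
  assumes \<mu>: "\<And>n. prob_space (\<mu> n)" "\<And>n. sets (\<mu> n) = sets borel"
    and \<nu>: "prob_space \<nu>" "sets \<nu> = sets borel"
    and lim: "\<And>u. (\<lambda>n. cf (\<mu> n) u) \<longlonglongrightarrow> cf \<nu> u"
    and g: "integrable lborel2 g" and \<tau>: "0 < \<tau>"
  shows "(\<lambda>n. \<integral>x. (\<integral>y. g y * normal_kernel \<tau> x y \<partial>lborel2) \<partial>\<mu> n) \<longlonglongrightarrow>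
    (\<integral>x. (\<integral>y. g y * normal_kernel \<tau> x y \<partial>lborel2) \<partial>\<nu>)"
proof -
  define C where "C = 1 / (2 * pi * \<tau>\<^sup>2)"
  have C: "0 \<le> C" by (simp add: C_def)
  have kC: "\<bar>normal_kernel \<tau> x y\<bar> \<le> C" for x y
    using \<tau> by (simp add: normal_kernel_eq C_def divide_right_mono)
  have [measurable]: "g \<in> borel_measurable lborel2" using g by auto
  have gb [measurable]: "g \<in> borel_measurable borel"
    using \<open>g \<in> borel_measurable lborel2\<close> by (simp add: measurable_cong_sets[OF sets_lborel2 refl])
  have fub: "(\<integral>x. (\<integral>y. g y * normal_kernel \<tau> x y \<partial>lborel2) \<partial>m) = (\<integral>y. g y * (\<integral>x. normal_kernel \<tau> x y \<partial>m) \<partial>lborel2)"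
    if m: "prob_space m" "sets m = sets borel" for m
  proof -
    interpret M: prob_space m by fact
    interpret L: sigma_finite_measure lborel2 by (rule sigma_finite_lborel2)
    interpret pair_sigma_finite m lborel2 ..
    note [measurable_cong] = m(2)
    have "integrable (m \<Otimes>\<^sub>M lborel2) (\<lambda>z. C * (1 * g (snd z)))"
      by (intro integrable_mult_right integrable_pair_mult[OF _ sigma_finite_lborel2 _ g]) (auto, unfold_locales)
    then have i: "integrable (m \<Otimes>\<^sub>M lborel2) (\<lambda>(x, y). g y * normal_kernel \<tau> x y)"
    proof (rule Bochner_Integration.integrable_bound)
      show "AE z in m \<Otimes>\<^sub>M lborel2. norm (case z of (x, y) \<Rightarrow> g y * normal_kernel \<tau> x y) \<le> norm (C * (1 * g (snd z)))"
        using kC C by (auto simp: abs_mult mult.commute[of C] intro!: always_eventually mult_left_mono)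
      have "(\<lambda>z. g (snd z) * normal_kernel \<tau> (fst z) (snd z)) \<in> borel_measurable (m \<Otimes>\<^sub>M lborel2)"
        by measurable
      then show "(\<lambda>(x, y). g y * normal_kernel \<tau> x y) \<in> borel_measurable (m \<Otimes>\<^sub>M lborel2)"
        by (simp add: case_prod_beta')
    qed
    from Fubini_integral[OF i] show ?thesis by simp
  qed
  have k: "(\<lambda>n. \<integral>x. normal_kernel \<tau> x y \<partial>\<mu> n) \<longlonglongrightarrow> (\<integral>x. normal_kernel \<tau> x y \<partial>\<nu>)" for y
    unfolding normal_kernel_eq[OF \<tau>] integral_mult_right_zero
    by (intro tendsto_mult_left integral_gauss_tendsto[OF \<mu> \<nu> lim])
  have km: "(\<lambda>y. \<integral>x. normal_kernel \<tau> x y \<partial>m) \<in> borel_measurable lborel2"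
    if m: "prob_space m" "sets m = sets borel" for m
  proof -
    interpret M: prob_space m by fact
    note [measurable_cong] = m(2)
    have "(\<lambda>z. normal_kernel \<tau> (snd z) (fst z)) \<in> borel_measurable (lborel2 \<Otimes>\<^sub>M m)"
      using measurable_compose[OF _ normal_kernel_measurable, of "\<lambda>z. (snd z, fst z)" "lborel2 \<Otimes>\<^sub>M m" \<tau>]
      by simp
    then show ?thesis using M.borel_measurable_lebesgue_integral[of "\<lambda>y x. normal_kernel \<tau> x y" lborel2]
      by (simp add: case_prod_beta')
  qed
  have bd: "\<bar>\<integral>x. normal_kernel \<tau> x y \<partial>m\<bar> \<le> C" if m: "prob_space m" "sets m = sets borel" for m y
  proof -
    interpret M: prob_space m by fact
    note [measurable_cong] = m(2)
    have "(\<lambda>x. normal_kernel \<tau> x y) \<in> borel_measurable m"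
      unfolding normal_kernel_eq[OF \<tau>] by measurable
    then have "integrable m (\<lambda>x. normal_kernel \<tau> x y)" using kC by (intro M.integrable_const_bound[of _ C]) auto
    then have "\<bar>\<integral>x. normal_kernel \<tau> x y \<partial>m\<bar> \<le> (\<integral>x. C \<partial>m)"
      using kC by (intro integral_abs_bound_integral) auto
    then show ?thesis by (simp add: M.prob_space)
  qed
  show ?thesis
    unfolding fub[OF \<mu>] fub[OF \<nu>]
  proof (rule integral_dominated_convergence[where w = "\<lambda>y. C * \<bar>g y\<bar>"])
    show "integrable lborel2 (\<lambda>y. C * \<bar>g y\<bar>)" using g by simp
    show "AE y in lborel2. (\<lambda>n. g y * (\<integral>x. normal_kernel \<tau> x y \<partial>\<mu> n)) \<longlonglongrightarrow> g y * (\<integral>x. normal_kernel \<tau> x y \<partial>\<nu>)"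
      by (intro always_eventually allI tendsto_mult_left k)
    show "AE y in lborel2. norm (g y * (\<integral>x. normal_kernel \<tau> x y \<partial>\<mu> n)) \<le> C * \<bar>g y\<bar>" for n
      using bd[OF \<mu>] by (auto simp: abs_mult mult.commute[of C] intro!: always_eventually mult_left_mono)
  qed (use km[OF \<mu>] km[OF \<nu>] in auto)
qed

text \<open>Multiplying the test function by a wide Gaussian makes it integrable and controls the tails, so
  that no separate tightness argument is needed.\<close>

lemma conv_in_distr_of_cf:
  fixes \<mu> :: "nat \<Rightarrow> (real \<times> real) measure"
  assumes \<mu>: "\<And>n. prob_space (\<mu> n)" "\<And>n. sets (\<mu> n) = sets borel"
    and \<nu>: "prob_space \<nu>" "sets \<nu> = sets borel"
    and lim: "\<And>u. (\<lambda>n. cf (\<mu> n) u) \<longlonglongrightarrow> cf \<nu> u"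
  shows "conv_in_distr \<mu> \<nu>"
  unfolding conv_in_distr_def
proof (intro allI impI, elim conjE)
  fix g :: "real \<times> real \<Rightarrow> real" assume g: "continuous_on UNIV g" and bg: "bounded (range g)"
  obtain B where B: "0 < B" "\<And>x. \<bar>g x\<bar> \<le> B"
    using bg unfolding bounded_pos by auto
  have [measurable]: "g \<in> borel_measurable borel" using g by (rule borel_measurable_continuous_onI)
  define ct where "ct s x = exp (- (norm (s *\<^sub>R (x::real \<times> real)))\<^sup>2 / 2)" for s x
  have ct01: "0 \<le> ct s x" "ct s x \<le> 1" for s x by (auto simp: ct_def)
  have ctm [measurable]: "ct s \<in> borel_measurable borel" for s unfolding ct_def by measurable
  have ctc: "continuous_on UNIV (ct s)" for s
    unfolding ct_def by (intro continuous_intros) auto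
  have int: "integrable m h" if "prob_space m" "sets m = sets borel" "h \<in> borel_measurable borel"
    "\<And>x. \<bar>h x\<bar> \<le> c" for m :: "(real \<times> real) measure" and h :: "real \<times> real \<Rightarrow> real" and c
  proof -
    interpret prob_space m by fact
    note [measurable_cong] = that(2) and [measurable] = that(3)
    show ?thesis using that(4) by (intro integrable_const_bound[of _ c]) auto
  qed
  note int\<mu> = int[OF \<mu>] and int\<nu> = int[OF \<nu>]
  interpret N: prob_space \<nu> by fact
  note [measurable_cong] = \<nu>(2)
  have ct\<nu>: "(\<lambda>m. \<integral>x. ct (1 / real (Suc m)) x \<partial>\<nu>) \<longlonglongrightarrow> (\<integral>x. 1 \<partial>\<nu>)"
  proof (rule integral_dominated_convergence[where w = "\<lambda>_. 1"])
    have "(\<lambda>m. ct (1 / real (Suc m)) x) \<longlonglongrightarrow> exp (- (norm (0 *\<^sub>R x))\<^sup>2 / 2)" for x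
      unfolding ct_def by (intro tendsto_intros LIMSEQ_Suc lim_1_over_n) auto
    then show "AE x in \<nu>. (\<lambda>m. ct (1 / real (Suc m)) x) \<longlonglongrightarrow> 1" by simp
  qed (use ct01 in auto)
  have ct\<mu>: "(\<lambda>n. \<integral>x. ct s x \<partial>\<mu> n) \<longlonglongrightarrow> (\<integral>x. ct s x \<partial>\<nu>)" for s
    using integral_gauss_tendsto[OF \<mu> \<nu> lim, of s 0] by (simp add: ct_def)
  show "(\<lambda>n. \<integral>x. g x \<partial>\<mu> n) \<longlonglongrightarrow> (\<integral>x. g x \<partial>\<nu>)"
  proof (rule LIMSEQ_I)
    fix r :: real assume r: "0 < r"
    \<comment> \<open>Three errors enter: e (B + 1) = r/6 for each of the two laws from cut-off and
      smoothing, and e \<le> r/6 from the convergence of the smoothed integrals.\<close>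
    define e where "e = r / 6 / (B + 1)"
    have e: "0 < e" using r B by (simp add: e_def)
    have "eventually (\<lambda>m. 1 - e < (\<integral>x. ct (1 / real (Suc m)) x \<partial>\<nu>)) sequentially"
      using order_tendstoD(1)[OF ct\<nu>, of "1 - e"] e by (simp add: N.prob_space)
    then obtain m where m: "1 - e < (\<integral>x. ct (1 / real (Suc m)) x \<partial>\<nu>)"
      by (auto simp: eventually_sequentially)
    define s where "s = 1 / real (Suc m)"
    have s: "0 < s" by (simp add: s_def)
    define g0 where "g0 x = g x * ct s x" for x
    have g0m [measurable]: "g0 \<in> borel_measurable borel" unfolding g0_def by measurable
    have g0c: "continuous_on UNIV g0" unfolding g0_def by (intro continuous_on_mult g ctc)
    have g0b: "\<bar>g0 x\<bar> \<le> B * exp (- (norm (s *\<^sub>R x))\<^sup>2 / 2)" for x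
      using B(2)[of x] ct01[of s x] by (auto simp: g0_def ct_def abs_mult intro!: mult_right_mono)
    have g0B: "\<bar>g0 x\<bar> \<le> B" for x
      using mult_mono[OF B(2)[of x] ct01(2)[of s x]] B ct01(1)[of s x] by (simp add: g0_def abs_mult)
    have g0i: "integrable lborel2 g0"
    proof (rule Bochner_Integration.integrable_bound)
      have "0 < 1 / s" using s by simp
      note k = normal_kernel_integral(1)[OF this, of 0]
      then show "integrable lborel2 (\<lambda>x. (B * (2 * pi / s\<^sup>2)) * normal_kernel (1 / s) 0 x)" by simp
      show "AE x in lborel2. norm (g0 x) \<le> norm ((B * (2 * pi / s\<^sup>2)) * normal_kernel (1 / s) 0 x)"
        using g0b B s by (auto simp: normal_kernel_eq power_divide)
    qed measurable
    obtain \<tau> where \<tau>: "0 < \<tau>" "\<And>x. \<bar>(\<integral>y. g0 y * normal_kernel \<tau> x y \<partial>lborel2) - g0 x\<bar> \<le> e"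
      using normal_smoothing_approx[OF g0c s g0b e] by blast
    define G where "G x = (\<integral>y. g0 y * normal_kernel \<tau> x y \<partial>lborel2)" for x
    have Gm [measurable]: "G \<in> borel_measurable borel"
    proof -
      have "(\<lambda>z. g0 (snd z) * normal_kernel \<tau> (fst z) (snd z)) \<in> borel_measurable (borel \<Otimes>\<^sub>M lborel2)"
        by measurable
      then show ?thesis unfolding G_def
        using sigma_finite_measure.borel_measurable_lebesgue_integral[OF sigma_finite_lborel2, of "\<lambda>x y. g0 y * normal_kernel \<tau> x y" borel]
        by (simp add: case_prod_beta')
    qed
    have Gb: "\<bar>G x\<bar> \<le> B + e" for x using \<tau>(2)[of x] g0B[of x] by (simp add: G_def)
    have "(\<lambda>n. \<integral>x. G x \<partial>\<mu> n) \<longlonglongrightarrow> (\<integral>x. G x \<partial>\<nu>)"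
      unfolding G_def by (rule normal_smoothing_integral_tendsto[OF \<mu> \<nu> lim g0i \<tau>(1)])
    then have "eventually (\<lambda>n. dist (\<integral>x. G x \<partial>\<mu> n) (\<integral>x. G x \<partial>\<nu>) < e) sequentially"
      using e by (rule tendstoD)
    moreover have "eventually (\<lambda>n. 1 - e < (\<integral>x. ct s x \<partial>\<mu> n)) sequentially"
      using m by (intro order_tendstoD(1)[OF ct\<mu>]) (simp add: s_def)
    ultimately have "eventually (\<lambda>n. norm ((\<integral>x. g x \<partial>\<mu> n) - (\<integral>x. g x \<partial>\<nu>)) < r) sequentially"
    proof eventually_elim
      case (elim n)
      have key: "\<bar>(\<integral>x. g x \<partial>m) - (\<integral>x. G x \<partial>m)\<bar> \<le> B * e + e"
        if pm: "prob_space m" "sets m = sets borel" "1 - e < (\<integral>x. ct s x \<partial>m)" for m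
      proof -
        interpret M: prob_space m by fact
        note i = int[OF pm(1,2)]
        have ig: "integrable m g" using B by (intro i[of _ B]) auto
        have iG: "integrable m G" using Gb by (intro i[of _ "B + e"]) auto
        have ict: "integrable m (ct s)" using ct01 by (intro i[of _ 1]) auto
        have "(\<integral>x. g x \<partial>m) - (\<integral>x. G x \<partial>m) = (\<integral>x. g x - G x \<partial>m)" using ig iG by simp
        also have "\<bar>\<dots>\<bar> \<le> (\<integral>x. B * (1 - ct s x) + e \<partial>m)"
        proof (rule integral_abs_bound_integral)
          fix x
          have "g x - g0 x = g x * (1 - ct s x)" by (simp add: g0_def algebra_simps)
          then have "\<bar>g x - g0 x\<bar> = \<bar>g x\<bar> * (1 - ct s x)"
            using ct01[of s x] by (simp add: abs_mult)
          also have "\<dots> \<le> B * (1 - ct s x)" using B ct01 by (intro mult_right_mono) auto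
          finally show "\<bar>g x - G x\<bar> \<le> B * (1 - ct s x) + e" using \<tau>(2)[of x] by (simp add: G_def)
        qed (use ig iG ict in auto)
        also have "\<dots> = B * (1 - (\<integral>x. ct s x \<partial>m)) + e"
          using ict by (simp add: M.prob_space)
        also have "\<dots> \<le> B * e + e" using pm(3) B by simp
        finally show ?thesis .
      qed
      have "B * e + e = e * (B + 1)" by (simp add: algebra_simps)
      moreover have "B + 1 \<noteq> 0" using B by simp
      then have "e * (B + 1) = r / 6"
        using nonzero_eq_divide_eq[of "B + 1" e "r / 6"] e_def by blast
      ultimately have "B * e + e = r / 6" by simp
      moreover have "e \<le> r / 6" using B r by (simp add: e_def field_simps)
      ultimately show ?case
        using key[OF \<mu> elim(2)] key[OF \<nu>] m elim(1) r by (simp add: s_def dist_real_def)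
    qed
    then show "\<exists>no. \<forall>n\<ge>no. norm ((\<integral>x. g x \<partial>\<mu> n) - (\<integral>x. g x \<partial>\<nu>)) < r"
      by (simp add: eventually_sequentially)
  qed
qed

section \<open>Laws determined by test functions, and centred Gaussian laws\<close>

lemma measure_eq_of_bounded_continuous:
  fixes \<mu> \<nu> :: "'a::metric_space measure"
  assumes \<mu>: "prob_space \<mu>" "sets \<mu> = sets borel" and \<nu>: "prob_space \<nu>" "sets \<nu> = sets borel"
    and eq: "\<And>g::'a \<Rightarrow> real. continuous_on UNIV g \<Longrightarrow> bounded (range g) \<Longrightarrow> (\<integral>x. g x \<partial>\<mu>) = (\<integral>x. g x \<partial>\<nu>)"
  shows "\<mu> = \<nu>"
proof -
  \<comment> \<open>Closed sets form an intersection-stable generator, and the indicator of a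
    nonempty one is the limit of bounded Lipschitz functions of the distance to it.\<close>
  have closed: "(\<lambda>n. \<integral>x. max 0 (1 - real n * infdist x C) \<partial>m) \<longlonglongrightarrow> measure m C"
    if m: "prob_space m" "sets m = sets borel" and C: "closed C" "C \<noteq> {}" for m :: "'a measure" and C
  proof -
    interpret prob_space m by fact
    note [measurable_cong] = m(2)
    have [measurable]: "C \<in> sets borel" using C by simp
    have "(\<lambda>n. \<integral>x. max 0 (1 - real n * infdist x C) \<partial>m) \<longlonglongrightarrow> (\<integral>x. indicator C x \<partial>m)"
    proof (rule integral_dominated_convergence[where w = "\<lambda>_. 1"])
      have "(\<lambda>n. max 0 (1 - real n * infdist x C)) \<longlonglongrightarrow> indicator C x" for x
      proof (cases "x \<in> C")
        case False
        then have d: "0 < infdist x C"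
          using in_closed_iff_infdist_zero[OF C, of x] infdist_nonneg[of x C] by linarith
        obtain k :: nat where k: "1 / infdist x C < k" using reals_Archimedean2 by blast
        have "eventually (\<lambda>n. max 0 (1 - real n * infdist x C) = 0) sequentially"
          unfolding eventually_sequentially
        proof (intro exI[of _ k] allI impI)
          fix n assume "k \<le> n"
          then have "1 / infdist x C < real n" using k by linarith
          then show "max 0 (1 - real n * infdist x C) = 0" using d by (simp add: field_simps)
        qed
        then show ?thesis using False by (simp add: tendsto_eventually)
      qed simp
      then show "AE x in m. (\<lambda>n. max 0 (1 - real n * infdist x C)) \<longlonglongrightarrow> indicator C x" by simp
      show "(\<lambda>x. max 0 (1 - real n * infdist x C)) \<in> borel_measurable m" for n
        by (intro borel_measurable_max borel_measurable_diff borel_measurable_times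
          borel_measurable_continuous_onI measurable_const)
          (auto simp: m measurable_cong_sets[OF m(2) refl] intro!: borel_measurable_continuous_onI continuous_intros)
      show "AE x in m. norm (max 0 (1 - real n * infdist x C)) \<le> 1" for n
        by (auto simp: infdist_nonneg)
    qed auto
    then show ?thesis using C by (simp add: m sets_eq_imp_space_eq[OF m(2)])
  qed
  show ?thesis
  proof (rule measure_eqI_generator_eq[where E = "Collect closed" and \<Omega> = UNIV and A = "\<lambda>_. UNIV"])
    show "Int_stable (Collect closed :: 'a set set)" by (auto simp: Int_stable_def)
    show "sets \<mu> = sigma_sets UNIV (Collect closed)" "sets \<nu> = sigma_sets UNIV (Collect closed)"
      unfolding \<mu> \<nu> borel_eq_closed by (rule sets_measure_of; simp)+
    show "emeasure \<mu> UNIV \<noteq> \<infinity>" for i :: nat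
      using finite_measure.emeasure_finite[OF prob_space.finite_measure[OF \<mu>(1)]] by auto
    fix C :: "'a set" assume "C \<in> Collect closed"
    then have C: "closed C" by simp
    show "emeasure \<mu> C = emeasure \<nu> C"
    \<comment> \<open>The distance \<open>infdist\<close> to the empty set is 0 by convention, so
      the approximation would converge to 1 there; this case is split off.\<close>
    proof (cases "C = {}")
      case False
      have "(\<integral>x. max 0 (1 - real n * infdist x C) \<partial>\<mu>) = (\<integral>x. max 0 (1 - real n * infdist x C) \<partial>\<nu>)" for n
      proof (rule eq)
        show "continuous_on UNIV (\<lambda>x. max 0 (1 - real n * infdist x C))" by (intro continuous_intros)
        show "bounded (range (\<lambda>x. max 0 (1 - real n * infdist x C)))"
          by (rule boundedI[of _ 1]) (auto simp: infdist_nonneg)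
      qed
      then have "measure \<mu> C = measure \<nu> C"
        using closed[OF \<mu> C False] closed[OF \<nu> C False] LIMSEQ_unique by simp
      then show ?thesis
        by (simp add: finite_measure.emeasure_eq_measure[OF prob_space.finite_measure] \<mu>(1) \<nu>(1))
    qed simp
  qed auto
qed

text \<open>One formula covers degenerate and nondegenerate laws, so that moments and characteristic
  functions follow from the standard normal law without case distinctions.\<close>

lemma centered_normal_eq_distr:
  assumes "0 \<le> s"
  shows "centered_normal s = distr std_normal_distribution borel (\<lambda>x. s * x)"
proof -
  interpret N: prob_space std_normal_distribution by (rule prob_space_normal_density) simp
  show ?thesis
  proof (cases "s = 0")
    case True
    then show ?thesis by (simp add: centered_normal_def N.distr_const)
  next
    case False
    then have s: "0 < s" using assms by simp
    have "distributed std_normal_distribution lborel (\<lambda>x. x) (\<lambda>x. ennreal (std_normal_density x))"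
      by (auto simp: distributed_def distr_id2)
    from N.normal_density_affine[OF this, of s 0] s
    have "distr std_normal_distribution lborel (\<lambda>x. s * x) = density lborel (\<lambda>x. ennreal (normal_density 0 s x))"
      by (simp add: distributed_def)
    moreover have "distr std_normal_distribution borel (\<lambda>x. s * x) = distr std_normal_distribution lborel (\<lambda>x. s * x)"
      by (intro distr_cong) auto
    ultimately show ?thesis using s by (simp add: centered_normal_def)
  qed
qed

lemma centered_normal_prob: "0 \<le> s \<Longrightarrow> prob_space (centered_normal s)"
  by (simp add: centered_normal_eq_distr prob_space.prob_space_distr[OF prob_space_normal_density])

lemma char_centered_normal:
  assumes "0 \<le> s"
  shows "char (centered_normal s) t = complex_of_real (exp (- (s * t)\<^sup>2 / 2))"
proof -
  have "char (centered_normal s) t = char std_normal_distribution (s * t)"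
    unfolding char_def centered_normal_eq_distr[OF assms]
    by (subst integral_distr) (auto simp: algebra_simps)
  then show ?thesis by (simp add: char_std_normal_distribution)
qed

lemma centered_normal_moments:
  assumes "0 \<le> s"
  shows "integrable (centered_normal s) (\<lambda>x. x)" "(\<integral>x. x \<partial>centered_normal s) = 0"
    "integrable (centered_normal s) (\<lambda>x. x\<^sup>2)" "(\<integral>x. x\<^sup>2 \<partial>centered_normal s) = s\<^sup>2"
proof -
  let ?N = "std_normal_distribution"
  have m: "(\<lambda>x. s * x) \<in> ?N \<rightarrow>\<^sub>M borel" by simp
  have 1: "integrable ?N (\<lambda>x. x)" "(\<integral>x. x \<partial>?N) = 0"
    using integrable_std_normal_distribution_moment[of 1] integral_std_normal_distribution_moment_odd[of 1]
    by (simp_all only: power_one_right odd_one not_False_eq_True)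
  have 2: "integrable ?N (\<lambda>x. x\<^sup>2)" "(\<integral>x. x\<^sup>2 \<partial>?N) = 1"
    using integrable_std_normal_distribution_moment[of 2] std_normal_distribution_even_moments(1)[of 1]
    by (simp_all only: power_one_right mult_1_right) (simp add: eval_nat_numeral)
  note eq = centered_normal_eq_distr[OF assms] and d = integral_distr[OF m] and i = integrable_distr_eq[OF m]
  show "integrable (centered_normal s) (\<lambda>x. x)" unfolding eq by (subst i) (auto intro: 1(1))
  show "(\<integral>x. x \<partial>centered_normal s) = 0" unfolding eq by (subst d) (simp_all only: integral_mult_right_zero 1, simp_all)
  show "integrable (centered_normal s) (\<lambda>x. x\<^sup>2)"
    unfolding eq by (subst i) (auto simp only: power_mult_distrib intro: integrable_mult_right 2(1), measurable)
  show "(\<integral>x. x\<^sup>2 \<partial>centered_normal s) = s\<^sup>2"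
    unfolding eq by (subst d) (simp_all only: power_mult_distrib integral_mult_right_zero 2, measurable)
qed

lemma distr_std_normal2_inner: "distr std_normal2 borel (\<lambda>w. v \<bullet> w) = centered_normal (norm v)"
proof (rule Levy_uniqueness)
  interpret G: prob_space std_normal2 by (rule prob_space_std_normal2)
  have m: "(\<lambda>w. v \<bullet> w) \<in> borel_measurable std_normal2" by measurable
  show "real_distribution (distr std_normal2 borel (\<lambda>w. v \<bullet> w))"
    by (rule G.real_distribution_distr[OF m])
  show "real_distribution (centered_normal (norm v))"
    unfolding real_distribution_def real_distribution_axioms_def
    using centered_normal_prob[of "norm v"] centered_normal_eq_distr[of "norm v"] by simp
  show "char (distr std_normal2 borel (\<lambda>w. v \<bullet> w)) = char (centered_normal (norm v))"
  proof
    fix t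
    have "char (distr std_normal2 borel (\<lambda>w. v \<bullet> w)) t = cf std_normal2 (t *\<^sub>R v)"
      unfolding char_def cf_def using m by (subst integral_distr) auto
    also have "\<dots> = char (centered_normal (norm v)) t"
      unfolding char_centered_normal[OF norm_ge_zero] cf_std_normal2
      by (simp add: power_mult_distrib mult.commute)
    finally show "char (distr std_normal2 borel (\<lambda>w. v \<bullet> w)) t = char (centered_normal (norm v)) t" .
  qed
qed

text \<open>The law is the image of two independent standard normals under the lower triangular
  Cholesky factor of the covariance matrix with diagonal A, C and off-diagonal entry B.\<close>

lemma centered_normal2_exists:
  fixes A B C :: real
  assumes A: "0 \<le> A" and C: "0 \<le> C" and AC: "B\<^sup>2 \<le> A * C"
  defines "q \<equiv> \<lambda>u. A * (fst u)\<^sup>2 + 2 * B * fst u * snd u + C * (snd u)\<^sup>2"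
  shows "\<exists>N. prob_space N \<and> sets N = sets borel \<and>
    (\<forall>u. 0 \<le> q u \<and> distr N borel (\<lambda>x. u \<bullet> x) = centered_normal (sqrt (q u)) \<and>
      cf N u = complex_of_real (exp (- q u / 2)))"
proof -
  interpret G: prob_space std_normal2 by (rule prob_space_std_normal2)
  define \<alpha> where "\<alpha> = sqrt A"
  \<comment> \<open>For A = 0 the quotient is 0 by convention, which is the right value because
    \<open>AC\<close> then forces B = 0.\<close>
  define \<beta> where "\<beta> = B / \<alpha>"
  define \<gamma> where "\<gamma> = sqrt (C - \<beta>\<^sup>2)"
  have B0: "B = 0" if "A = 0" using AC that by simp
  have \<alpha>: "\<alpha>\<^sup>2 = A" using A by (simp add: \<alpha>_def)
  have \<alpha>\<beta>: "\<alpha> * \<beta> = B" using B0 by (auto simp: \<beta>_def \<alpha>_def)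
  have "\<beta>\<^sup>2 \<le> C"
  proof (cases "A = 0")
    case True then show ?thesis using C by (simp add: \<beta>_def \<alpha>_def)
  next
    case False
    then show ?thesis using A AC by (simp add: \<beta>_def power_divide \<alpha> field_simps)
  qed
  then have \<gamma>: "\<beta>\<^sup>2 + \<gamma>\<^sup>2 = C" by (simp add: \<gamma>_def)
  define T where "T w = (\<alpha> * fst w, \<beta> * fst w + \<gamma> * snd w)" for w :: "real \<times> real"
  define v where "v u = (fst u * \<alpha> + snd u * \<beta>, snd u * \<gamma>)" for u :: "real \<times> real"
  have uT: "u \<bullet> T w = v u \<bullet> w" for u w by (simp add: T_def v_def inner_prod_def algebra_simps)
  have nv: "(norm (v u))\<^sup>2 = q u" for u
  proof -
    have "(norm (v u))\<^sup>2 = \<alpha>\<^sup>2 * (fst u)\<^sup>2 + 2 * (\<alpha> * \<beta>) * fst u * snd u + (\<beta>\<^sup>2 + \<gamma>\<^sup>2) * (snd u)\<^sup>2"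
      by (simp add: v_def norm_prod_def) (simp add: power2_eq_square algebra_simps)
    then show ?thesis by (simp only: \<alpha> \<alpha>\<beta> \<gamma> q_def)
  qed
  have "T = (\<lambda>w. (\<alpha> * fst w, \<beta> * fst w + \<gamma> * snd w))" by (simp add: T_def fun_eq_iff)
  then have "continuous_on UNIV T" by (simp add: continuous_intros)
  then have T: "T \<in> borel_measurable std_normal2"
    by (simp add: measurable_cong_sets[OF sets_std_normal2 refl] borel_measurable_continuous_onI)
  define N where "N = distr std_normal2 borel T"
  show ?thesis
  proof (intro exI[of _ N] conjI allI)
    show "prob_space N" unfolding N_def using T by (rule G.prob_space_distr)
    show "sets N = sets borel" by (simp add: N_def)
    fix u
    show "0 \<le> q u" unfolding nv[symmetric] by simp
    have "distr N borel (\<lambda>x. u \<bullet> x) = distr std_normal2 borel (\<lambda>w. v u \<bullet> w)"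
      unfolding N_def using T by (subst distr_distr) (auto simp: comp_def uT)
    also have "\<dots> = centered_normal (sqrt (q u))"
      unfolding distr_std_normal2_inner nv[symmetric] by simp
    finally show "distr N borel (\<lambda>x. u \<bullet> x) = centered_normal (sqrt (q u))" .
    have "cf N u = cf std_normal2 (v u)"
      unfolding cf_def N_def using T by (subst integral_distr) (auto simp: uT)
    then show "cf N u = complex_of_real (exp (- q u / 2))" by (simp add: cf_std_normal2 nv)
  qed
qed

text \<open>The projection along u = 0 preserves the total mass, and its image is one of the laws
  \<open>centered_normal s\<close>.\<close>

lemma centered_normal2_prob:
  assumes "centered_normal2 N" shows "prob_space N"
proof -
  have s: "sets N = sets borel" using assms by (simp add: centered_normal2_def)
  obtain s where "0 \<le> s" "distr N borel (\<lambda>x. 0 \<bullet> x) = centered_normal s"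
    using assms unfolding centered_normal2_def by blast
  then have "prob_space (distr N borel (\<lambda>x. 0 \<bullet> x))" using centered_normal_prob by simp
  then show ?thesis by (rule prob_space_distrD[rotated]) simp
qed

text \<open>The limit law is constructed explicitly and is the only one, since bounded continuous
  functions separate laws; hence the definite description denotes it. Its covariance is obtained by
  polarization from the variances along (1,1), (1,0) and (0,1).\<close>

lemma covariance_of_clt:
  fixes \<mu> :: "nat \<Rightarrow> (real \<times> real) measure" and A B C :: real
  assumes A: "0 \<le> A" and C: "0 \<le> C" and AC: "B\<^sup>2 \<le> A * C"
    and \<mu>: "\<And>n. prob_space (\<mu> n)" "\<And>n. sets (\<mu> n) = sets borel"
    and lim: "\<And>u. (\<lambda>n. cf (\<mu> n) u) \<longlonglongrightarrow>
      complex_of_real (exp (- (A * (fst u)\<^sup>2 + 2 * B * fst u * snd u + C * (snd u)\<^sup>2) / 2))"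
  shows "covariance (THE N. centered_normal2 N \<and> conv_in_distr \<mu> N) = B"
proof -
  define q where "q u = A * (fst u)\<^sup>2 + 2 * B * fst u * snd u + C * (snd u)\<^sup>2" for u :: "real \<times> real"
  obtain N where N: "prob_space N" "sets N = sets borel" "\<And>u. 0 \<le> q u"
    "\<And>u. distr N borel (\<lambda>x. u \<bullet> x) = centered_normal (sqrt (q u))"
    "\<And>u. cf N u = complex_of_real (exp (- q u / 2))"
    using centered_normal2_exists[OF A C AC] unfolding q_def by blast
  have conv: "conv_in_distr \<mu> N"
    using lim by (intro conv_in_distr_of_cf[OF \<mu> N(1,2)]) (simp add: N(5) q_def)
  have cn: "centered_normal2 N"
    unfolding centered_normal2_def using N(2,3,4) real_sqrt_ge_zero by blast
  have the: "(THE N. centered_normal2 N \<and> conv_in_distr \<mu> N) = N"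
  proof (rule the_equality)
    fix N' assume N': "centered_normal2 N' \<and> conv_in_distr \<mu> N'"
    show "N' = N"
    proof (rule measure_eq_of_bounded_continuous)
      fix g :: "real \<times> real \<Rightarrow> real" assume "continuous_on UNIV g" "bounded (range g)"
      then have "(\<lambda>n. \<integral>x. g x \<partial>\<mu> n) \<longlonglongrightarrow> (\<integral>x. g x \<partial>N')" "(\<lambda>n. \<integral>x. g x \<partial>\<mu> n) \<longlonglongrightarrow> (\<integral>x. g x \<partial>N)"
        using N' conv by (auto simp: conv_in_distr_def)
      then show "(\<integral>x. g x \<partial>N') = (\<integral>x. g x \<partial>N)" by (rule LIMSEQ_unique)
    qed (use N' N centered_normal2_prob in \<open>auto simp: centered_normal2_def\<close>)
  qed (use cn conv in simp)
  have m [measurable]: "(\<lambda>x. u \<bullet> x) \<in> borel_measurable N" for u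
    using N(2) by (simp add: measurable_cong_sets[OF N(2) refl])
  note M = centered_normal_moments[OF real_sqrt_ge_zero[OF N(3)]]
  have m1: "(\<integral>x. u \<bullet> x \<partial>N) = 0" for u
    using M(2)[of u] unfolding N(4)[symmetric] by (simp add: integral_distr)
  have m2: "integrable N (\<lambda>x. (u \<bullet> x)\<^sup>2)" "(\<integral>x. (u \<bullet> x)\<^sup>2 \<partial>N) = q u" for u
    using M(3,4)[of u] N(3)[of u] unfolding N(4)[symmetric] by (simp_all add: integral_distr integrable_distr_eq)
  have "covariance N = (\<integral>x. (((1, 1) \<bullet> x)\<^sup>2 - ((1, 0) \<bullet> x)\<^sup>2 - ((0, 1) \<bullet> x)\<^sup>2) / 2 \<partial>N)"
    using m1[of "(1, 0)"] m1[of "(0, 1)"] unfolding covariance_def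
    by (intro Bochner_Integration.integral_cong)
      (auto simp: inner_prod_def power2_eq_square algebra_simps)
  also have "\<dots> = (q (1, 1) - q (1, 0) - q (0, 1)) / 2"
    using m2 by simp
  also have "\<dots> = B" by (simp add: q_def)
  finally show ?thesis unfolding the .
qed

section \<open>Cylinder events of the walk\<close>

text \<open>Freezing the path after the new step makes it a function of finitely many coordinates,
  so that \<open>paths (Suc n)\<close> is in bijection with \<open>paths n\<close> \<times>
  \<open>units\<close>.\<close>

definition extend_path :: "nat \<Rightarrow> 'd::finite path \<Rightarrow> int ^ 'd \<Rightarrow> 'd path" where
  "extend_path n p e = (\<lambda>k. if k \<le> n then p k else p n + e)"

text \<open>The nearest-neighbour paths with \<open>n\<close> steps from the origin, made constant after time \<open>n\<close>.\<close>

primrec paths :: "nat \<Rightarrow> 'd::finite path set" where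
  "paths 0 = {\<lambda>_. 0}"
| "paths (Suc n) = (\<lambda>(p, e). extend_path n p e) ` (paths n \<times> units)"

lemma extend_path_simps [simp]:
  "k \<le> n \<Longrightarrow> extend_path n p e k = p k"
  "extend_path n p e (Suc n) = p n + e"
  by (simp_all add: extend_path_def)

lemma finite_paths: "finite (paths n)"
  by (induction n) (auto simp: finite_units)

lemma paths_start: "p \<in> paths n \<Longrightarrow> p 0 = 0"
  by (induction n arbitrary: p) (auto simp: extend_path_def)

lemma paths_frozen: "p \<in> paths n \<Longrightarrow> n \<le> k \<Longrightarrow> p k = p n"
  by (induction n arbitrary: p) (auto simp: extend_path_def)

lemma paths_eqI:
  assumes "p \<in> paths n" "q \<in> paths n" "\<And>k. k \<le> n \<Longrightarrow> p k = q k"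
  shows "p = q"
proof
  fix k
  have "p n = q n" by (rule assms(3)) simp
  then show "p k = q k"
    using assms(3)[of k] paths_frozen[OF assms(1), of k] paths_frozen[OF assms(2), of k]
    by (metis nat_le_linear)
qed

lemma inj_on_extend_path: "inj_on (\<lambda>(p, e). extend_path n p e) (paths n \<times> units)"
proof (rule inj_onI, clarify)
  fix p q :: "'a path" and e e'
  assume p: "p \<in> paths n" "q \<in> paths n" and eq: "extend_path n p e = extend_path n q e'"
  have "p k = q k" if "k \<le> n" for k using fun_cong[OF eq, of k] that by simp
  then have "p = q" using p by (intro paths_eqI) auto
  then show "p = q \<and> e = e'" using fun_cong[OF eq, of "Suc n"] by simp
qed

lemma sum_paths_Suc: "(\<Sum>q\<in>paths (Suc n). F q) = (\<Sum>p\<in>paths n. \<Sum>e\<in>units. F (extend_path n p e))"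
  unfolding paths.simps sum.reindex[OF inj_on_extend_path] sum.cartesian_product
  by (simp add: case_prod_beta' comp_def)

lemma cyl_prob_extend: "cyl_prob \<omega> x (Suc n) (extend_path n p e) =
    cyl_prob \<omega> x n p * trans_prob \<omega> (p n) (p n + e)"
proof -
  have "cyl_prob \<omega> x n (extend_path n p e) = cyl_prob \<omega> x n p"
    by (auto simp: cyl_prob_def intro!: prod.cong)
  then show ?thesis by (simp add: cyl_prob_Suc)
qed

lemma cyl_prob_nonneg: "\<omega> \<in> space env_space \<Longrightarrow> 0 \<le> cyl_prob \<omega> x n p"
  by (auto simp: cyl_prob_def trans_prob_nonneg intro!: prod_nonneg)

lemma cyl_prob_measurable [measurable]: "(\<lambda>\<omega>. cyl_prob \<omega> x n p) \<in> borel_measurable env_space"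
  unfolding cyl_prob_def by (cases "p 0 = x") auto

lemma sum_cyl_prob:
  "\<omega> \<in> space env_space \<Longrightarrow> (\<Sum>p\<in>paths n. cyl_prob \<omega> 0 n p) = 1"
proof (induction n)
  case 0 then show ?case by (simp add: cyl_prob_def)
next
  case (Suc n)
  then show ?case
    by (simp only: sum_paths_Suc cyl_prob_extend sum_distrib_left[symmetric] trans_prob_sum mult_1_right)
qed

lemma cyl_disjoint: "p \<in> paths n \<Longrightarrow> q \<in> paths n \<Longrightarrow> X \<in> cyl n p \<Longrightarrow> X \<in> cyl n q \<Longrightarrow> p = q"
  by (rule paths_eqI) (auto simp: cyl_def)

lemma sum_indicator_cyl:
  fixes F :: "'d::finite path \<Rightarrow> 'b::real_vector"
  assumes "p \<in> paths n" "X \<in> cyl n p"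
  shows "(\<Sum>q\<in>paths n. indicator (cyl n q) X *\<^sub>R F q) = F p"
proof -
  have "(\<Sum>q\<in>paths n. indicator (cyl n q) X *\<^sub>R F q) = (\<Sum>q\<in>paths n. if q = p then F q else 0)"
    using assms cyl_disjoint[OF assms(1)] by (intro sum.cong) (auto simp: indicator_def)
  then show ?thesis using assms by (simp add: finite_paths)
qed

section \<open>Expectations of functionals of finitely many steps\<close>

lemma walk_law_props:
  assumes "\<omega> \<in> space env_space"
  shows "prob_space (walk_law \<omega> x)" "sets (walk_law \<omega> x) = sets path_space"
    "measure (walk_law \<omega> x) (cyl n p) = cyl_prob \<omega> x n p"
    "emeasure (walk_law \<omega> x) (cyl n p) = ennreal (cyl_prob \<omega> x n p)"
proof -
  note W = walk_law_is_walk_law[OF assms, of x]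
  then show P: "prob_space (walk_law \<omega> x)" "sets (walk_law \<omega> x) = sets path_space"
    by (simp_all add: is_walk_law_def)
  show m: "measure (walk_law \<omega> x) (cyl n p) = cyl_prob \<omega> x n p" by (rule walk_law_cyl[OF assms W])
  interpret prob_space "walk_law \<omega> x" by (rule P)
  show "emeasure (walk_law \<omega> x) (cyl n p) = ennreal (cyl_prob \<omega> x n p)"
    by (simp add: emeasure_eq_measure m)
qed

text \<open>The cylinders over \<open>paths n\<close> are disjoint and have total probability 1, so
  a functional of the first coordinates is almost surely a finite sum of indicators.\<close>

lemma walk_law_integral:
  fixes F :: "'d::finite path \<Rightarrow> 'b::{banach,second_countable_topology}"
  assumes \<omega>: "\<omega> \<in> space env_space" and F: "F \<in> borel_measurable path_space"
    and dep: "\<And>X X'. (\<And>k. k \<le> n \<Longrightarrow> X k = X' k) \<Longrightarrow> F X = F X'"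
  shows "(\<integral>X. F X \<partial>walk_law \<omega> 0) = (\<Sum>p\<in>paths n. cyl_prob \<omega> 0 n p *\<^sub>R F p)"
proof -
  note W = walk_law_props[OF \<omega>, of 0]
  interpret prob_space "walk_law \<omega> 0" by (rule W)
  note [measurable_cong] = W(2)
  have c: "cyl n p \<in> events" for p by (simp add: W(2))
  have "prob (\<Union>p\<in>paths n. cyl n p) = (\<Sum>p\<in>paths n. prob (cyl n p))"
    using c cyl_disjoint by (intro finite_measure_finite_Union finite_paths) (auto simp: disjoint_family_on_def)
  then have "prob (\<Union>p\<in>paths n. cyl n p) = 1" by (simp add: W(3) sum_cyl_prob[OF \<omega>])
  then have "AE X in walk_law \<omega> 0. X \<in> (\<Union>p\<in>paths n. cyl n p)"
    using c by (subst AE_in_set_eq_1) (auto intro!: sets.finite_UN finite_paths)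
  then have "(\<integral>X. F X \<partial>walk_law \<omega> 0) = (\<integral>X. (\<Sum>p\<in>paths n. indicator (cyl n p) X *\<^sub>R F p) \<partial>walk_law \<omega> 0)"
  proof (intro integral_cong_AE)
    show "F \<in> borel_measurable (walk_law \<omega> 0)" using F by simp
    assume ae: "AE X in walk_law \<omega> 0. X \<in> (\<Union>p\<in>paths n. cyl n p)"
    then show "AE X in walk_law \<omega> 0. F X = (\<Sum>p\<in>paths n. indicator (cyl n p) X *\<^sub>R F p)"
    proof eventually_elim
      case (elim X)
      then obtain p where p: "p \<in> paths n" "X \<in> cyl n p" by auto
      then have "F X = F p" by (intro dep) (auto simp: cyl_def)
      then show ?case using sum_indicator_cyl[OF p, of F] by simp
    qed
  qed (use c in auto)
  also have "\<dots> = (\<Sum>p\<in>paths n. prob (cyl n p) *\<^sub>R F p)"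
    using c by (subst Bochner_Integration.integral_sum) (auto simp: emeasure_eq_measure)
  finally show ?thesis by (simp add: W(3))
qed

text \<open>Only the trajectory is restricted: the whole environment counts as known at time
  0.\<close>

definition depends_upto :: "nat \<Rightarrow> ('d::finite env \<times> 'd path \<Rightarrow> 'b) \<Rightarrow> bool" where
  "depends_upto n F \<longleftrightarrow> (\<forall>\<omega> X X'. (\<forall>k\<le>n. X k = X' k) \<longrightarrow> F (\<omega>, X) = F (\<omega>, X'))"

text \<open>The map \<tau> allows one set of computations to serve the untilted walk, started from
  \<open>Q0 P\<close> or from P, and the tilted walk with \<tau> = \<open>tilt l lam\<close>. The
  first component of the joint law is the untilted environment in every case.\<close>

locale annealed_walk =
  fixes N :: "'d::finite env measure" and \<tau> :: "'d env \<Rightarrow> 'd env"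
  assumes N: "prob_space N" "sets N = sets env_space" and \<tau>: "\<tau> \<in> env_space \<rightarrow>\<^sub>M env_space"
begin

abbreviation (input) "A \<equiv> annealed N (\<lambda>\<omega>. walk_law (\<tau> \<omega>) 0)"

lemma kernel: "(\<lambda>\<omega>. walk_law (\<tau> \<omega>) 0) \<in> env_space \<rightarrow>\<^sub>M prob_algebra path_space"
  by (rule measurable_compose[OF \<tau> walk_law_measurable])

lemma prob_space_A: "prob_space A" and sets_A: "sets A = sets (env_space \<Otimes>\<^sub>M path_space)"
  using annealed_prob_space[OF N kernel] by auto

lemma space_N: "space N = space env_space"
  by (rule sets_eq_imp_space_eq[OF N(2)])

lemma space_A: "space A = space env_space \<times> UNIV"
  using sets_eq_imp_space_eq[OF sets_A] by (simp add: space_pair_measure)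

lemma nn_integral_A:
  assumes F: "F \<in> borel_measurable (env_space \<Otimes>\<^sub>M path_space)"
  shows "(\<integral>\<^sup>+z. F z \<partial>A) = (\<integral>\<^sup>+\<omega>. (\<integral>\<^sup>+X. F (\<omega>, X) \<partial>walk_law (\<tau> \<omega>) 0) \<partial>N)"
proof -
  note [measurable] = kernel F
  note [measurable_cong] = N(2)
  have k: "(\<lambda>\<omega>. walk_law (\<tau> \<omega>) 0 \<bind> (\<lambda>X. return (env_space \<Otimes>\<^sub>M path_space) (\<omega>, X)))
      \<in> N \<rightarrow>\<^sub>M subprob_algebra (env_space \<Otimes>\<^sub>M path_space)"
    by (intro measurable_prob_algebraD) measurable
  have "(\<integral>\<^sup>+z. F z \<partial>A) = (\<integral>\<^sup>+\<omega>. (\<integral>\<^sup>+z. F z \<partial>(walk_law (\<tau> \<omega>) 0 \<bind> (\<lambda>X. return (env_space \<Otimes>\<^sub>M path_space) (\<omega>, X)))) \<partial>N)"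
    unfolding annealed_def by (rule nn_integral_bind[OF F k])
  also have "\<dots> = (\<integral>\<^sup>+\<omega>. (\<integral>\<^sup>+X. F (\<omega>, X) \<partial>walk_law (\<tau> \<omega>) 0) \<partial>N)"
  proof (rule nn_integral_cong)
    fix \<omega> assume "\<omega> \<in> space N"
    then have \<omega>: "\<omega> \<in> space env_space" by (simp add: space_N)
    have "\<tau> \<omega> \<in> space env_space" using \<omega> by (rule measurable_space[OF \<tau>])
    then have s: "sets (walk_law (\<tau> \<omega>) 0) = sets path_space" by (rule walk_law_props)
    have k: "(\<lambda>X. return (env_space \<Otimes>\<^sub>M path_space) (\<omega>, X)) \<in> walk_law (\<tau> \<omega>) 0 \<rightarrow>\<^sub>M
        subprob_algebra (env_space \<Otimes>\<^sub>M path_space)"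
      unfolding measurable_cong_sets[OF s refl]
      by (rule measurable_compose[OF measurable_Pair1'[OF \<omega>] return_measurable])
    have "(\<integral>\<^sup>+z. F z \<partial>(walk_law (\<tau> \<omega>) 0 \<bind> (\<lambda>X. return (env_space \<Otimes>\<^sub>M path_space) (\<omega>, X)))) =
        (\<integral>\<^sup>+X. (\<integral>\<^sup>+z. F z \<partial>return (env_space \<Otimes>\<^sub>M path_space) (\<omega>, X)) \<partial>walk_law (\<tau> \<omega>) 0)"
      by (rule nn_integral_bind[OF F k])
    also have "\<dots> = (\<integral>\<^sup>+X. F (\<omega>, X) \<partial>walk_law (\<tau> \<omega>) 0)"
      using \<omega> by (intro nn_integral_cong nn_integral_return F) (simp add: space_pair_measure)
    finally show "(\<integral>\<^sup>+z. F z \<partial>(walk_law (\<tau> \<omega>) 0 \<bind> (\<lambda>X. return (env_space \<Otimes>\<^sub>M path_space) (\<omega>, X)))) =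
        (\<integral>\<^sup>+X. F (\<omega>, X) \<partial>walk_law (\<tau> \<omega>) 0)" .
  qed
  finally show ?thesis .
qed

lemma nn_integral_cyl:
  assumes F: "F \<in> borel_measurable env_space"
  shows "(\<integral>\<^sup>+z. F (fst z) * indicator (cyl n p) (snd z) \<partial>A) =
    (\<integral>\<^sup>+\<omega>. F \<omega> * ennreal (cyl_prob (\<tau> \<omega>) 0 n p) \<partial>N)"
proof -
  note [measurable] = F
  have "(\<integral>\<^sup>+z. F (fst z) * indicator (cyl n p) (snd z) \<partial>A) =
      (\<integral>\<^sup>+\<omega>. (\<integral>\<^sup>+X. F \<omega> * indicator (cyl n p) X \<partial>walk_law (\<tau> \<omega>) 0) \<partial>N)"
    by (subst nn_integral_A) auto
  also have "\<dots> = (\<integral>\<^sup>+\<omega>. F \<omega> * ennreal (cyl_prob (\<tau> \<omega>) 0 n p) \<partial>N)"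
  proof (rule nn_integral_cong)
    fix \<omega> assume "\<omega> \<in> space N"
    then have "\<tau> \<omega> \<in> space env_space" using measurable_space[OF \<tau>] by (simp add: space_N)
    note W = walk_law_props[OF this, of 0]
    show "(\<integral>\<^sup>+X. F \<omega> * indicator (cyl n p) X \<partial>walk_law (\<tau> \<omega>) 0) = F \<omega> * ennreal (cyl_prob (\<tau> \<omega>) 0 n p)"
      by (subst nn_integral_cmult_indicator) (auto simp: W)
  qed
  finally show ?thesis .
qed

lemma cyl_prob_\<tau>_measurable: "(\<lambda>\<omega>. cyl_prob (\<tau> \<omega>) 0 n p) \<in> borel_measurable env_space"
  by (rule measurable_compose[OF \<tau> cyl_prob_measurable])

text \<open>Formulated for measures and not for integrals, so that integrability and value of
  Banach-valued integrands both follow from the rules for densities and image measures.\<close>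

lemma distr_fst_cyl:
  "distr (density A (\<lambda>z. indicator (cyl n p) (snd z))) env_space fst =
    density N (\<lambda>\<omega>. ennreal (cyl_prob (\<tau> \<omega>) 0 n p))" (is "?L = ?R")
proof (rule measure_eqI)
  note [measurable_cong] = N(2) sets_A
  note [measurable] = cyl_prob_\<tau>_measurable
  show "sets ?L = sets ?R" by (simp add: N)
  fix B assume "B \<in> sets ?L"
  then have B [measurable]: "B \<in> sets env_space" by simp
  have m: "fst \<in> density A (\<lambda>z. indicator (cyl n p) (snd z)) \<rightarrow>\<^sub>M env_space" by measurable
  have "emeasure ?L B = emeasure (density A (\<lambda>z. indicator (cyl n p) (snd z))) (fst -` B \<inter> space A)"
    using B m by (subst emeasure_distr) auto
  also have "\<dots> = (\<integral>\<^sup>+z. indicator (cyl n p) (snd z) * indicator (fst -` B \<inter> space A) z \<partial>A)"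
    by (subst emeasure_density) (auto simp: measurable_sets[OF _ B])
  also have "\<dots> = (\<integral>\<^sup>+z. indicator B (fst z) * indicator (cyl n p) (snd z) \<partial>A)"
    by (intro nn_integral_cong) (auto simp: indicator_def)
  also have "\<dots> = (\<integral>\<^sup>+\<omega>. indicator B \<omega> * ennreal (cyl_prob (\<tau> \<omega>) 0 n p) \<partial>N)"
    by (rule nn_integral_cyl) simp
  also have "\<dots> = emeasure ?R B"
    by (subst emeasure_density) (auto simp: N mult.commute)
  finally show "emeasure ?L B = emeasure ?R B" .
qed

lemma
  fixes G :: "'d env \<Rightarrow> 'b::{banach,second_countable_topology}"
  assumes G: "G \<in> borel_measurable env_space"
  shows integrable_cyl_iff: "integrable A (\<lambda>z. indicator (cyl n p) (snd z) *\<^sub>R G (fst z)) \<longleftrightarrow>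
      integrable N (\<lambda>\<omega>. cyl_prob (\<tau> \<omega>) 0 n p *\<^sub>R G \<omega>)" (is ?thesis1)
    and integral_cyl: "(\<integral>z. indicator (cyl n p) (snd z) *\<^sub>R G (fst z) \<partial>A) =
      (\<integral>\<omega>. cyl_prob (\<tau> \<omega>) 0 n p *\<^sub>R G \<omega> \<partial>N)" (is ?thesis2)
proof -
  note [measurable_cong] = N(2) sets_A
  note [measurable] = cyl_prob_\<tau>_measurable G
  let ?D = "density A (\<lambda>z. ennreal (indicator (cyl n p) (snd z)))"
  have m: "fst \<in> ?D \<rightarrow>\<^sub>M env_space" by measurable
  have d: "distr ?D env_space fst = density N (\<lambda>\<omega>. ennreal (cyl_prob (\<tau> \<omega>) 0 n p))"
    using distr_fst_cyl[of n p] by (simp add: ennreal_indicator)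
  have nn: "AE \<omega> in N. 0 \<le> cyl_prob (\<tau> \<omega>) 0 n p"
    using measurable_space[OF \<tau>] by (intro AE_I2 cyl_prob_nonneg) (auto simp: space_N)
  have "integrable A (\<lambda>z. indicator (cyl n p) (snd z) *\<^sub>R G (fst z)) \<longleftrightarrow> integrable ?D (\<lambda>z. G (fst z))"
    by (subst integrable_density) auto
  also have "\<dots> \<longleftrightarrow> integrable (distr ?D env_space fst) G"
    by (rule integrable_distr_eq[symmetric, OF m G])
  also have "\<dots> \<longleftrightarrow> integrable N (\<lambda>\<omega>. cyl_prob (\<tau> \<omega>) 0 n p *\<^sub>R G \<omega>)"
    unfolding d using nn by (subst integrable_density) auto
  finally show ?thesis1 .
  have "(\<integral>z. indicator (cyl n p) (snd z) *\<^sub>R G (fst z) \<partial>A) = (\<integral>z. G (fst z) \<partial>?D)"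
    by (subst integral_density) auto
  also have "\<dots> = (\<integral>\<omega>. G \<omega> \<partial>distr ?D env_space fst)"
    by (rule integral_distr[symmetric, OF m G])
  also have "\<dots> = (\<integral>\<omega>. cyl_prob (\<tau> \<omega>) 0 n p *\<^sub>R G \<omega> \<partial>N)"
    unfolding d using nn by (subst integral_density) auto
  finally show ?thesis2 .
qed

lemma AE_paths: "AE z in A. \<exists>p\<in>paths n. snd z \<in> cyl n p"
proof -
  note [measurable_cong] = N(2) sets_A
  note [measurable] = cyl_prob_\<tau>_measurable
  interpret A: prob_space A by (rule prob_space_A)
  interpret N: prob_space N by (rule N)
  let ?F = "\<lambda>z. \<Sum>p\<in>paths n. indicator (cyl n p) (snd z) *\<^sub>R (1::real)"
  have "(\<integral>z. ?F z \<partial>A) = (\<Sum>p\<in>paths n. \<integral>z. indicator (cyl n p) (snd z) *\<^sub>R 1 \<partial>A)"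
    by (intro Bochner_Integration.integral_sum A.integrable_const_bound[where B = 1]) auto
  also have "\<dots> = (\<Sum>p\<in>paths n. \<integral>\<omega>. cyl_prob (\<tau> \<omega>) 0 n p \<partial>N)"
    by (intro sum.cong refl) (subst integral_cyl, auto)
  also have "\<dots> = (\<integral>\<omega>. (\<Sum>p\<in>paths n. cyl_prob (\<tau> \<omega>) 0 n p) \<partial>N)"
  proof (rule Bochner_Integration.integral_sum[symmetric])
    fix p :: "'d path"
    show "integrable N (\<lambda>\<omega>. cyl_prob (\<tau> \<omega>) 0 n p)" if "p \<in> paths n"
    proof (rule N.integrable_const_bound[where B = 1])
      show "AE \<omega> in N. norm (cyl_prob (\<tau> \<omega>) 0 n p) \<le> 1"
      proof (rule AE_I2)
        fix \<omega> assume "\<omega> \<in> space N"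
        then have t: "\<tau> \<omega> \<in> space env_space" using measurable_space[OF \<tau>] by (simp add: space_N)
        have "cyl_prob (\<tau> \<omega>) 0 n p \<le> (\<Sum>p\<in>paths n. cyl_prob (\<tau> \<omega>) 0 n p)"
          using that by (intro member_le_sum cyl_prob_nonneg[OF t] finite_paths)
        then show "norm (cyl_prob (\<tau> \<omega>) 0 n p) \<le> 1"
          using cyl_prob_nonneg[OF t] by (simp add: sum_cyl_prob[OF t])
      qed
    qed simp
  qed
  also have "\<dots> = (\<integral>\<omega>. 1 \<partial>N)"
    using measurable_space[OF \<tau>]
    by (intro Bochner_Integration.integral_cong refl sum_cyl_prob) (auto simp: space_N)
  finally have 1: "(\<integral>z. ?F z \<partial>A) = 1" by (simp add: N.prob_space)
  have F: "?F z = indicator {z. \<exists>p\<in>paths n. snd z \<in> cyl n p} z" for z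
  proof (cases "\<exists>p\<in>paths n. snd z \<in> cyl n p")
    case True
    then show ?thesis using sum_indicator_cyl[of _ n "snd z" "\<lambda>_. 1::real"] by auto
  next
    case False
    then show ?thesis by (auto simp: indicator_def intro!: sum.neutral)
  qed
  have i: "integrable A ?F"
    by (intro Bochner_Integration.integrable_sum A.integrable_const_bound[where B = 1]) auto
  have "(\<integral>z. 1 - ?F z \<partial>A) = 0" using 1 i by (simp add: A.prob_space)
  then have "AE z in A. 1 - ?F z = 0"
    using i by (subst (asm) integral_nonneg_eq_0_iff_AE) (unfold F, auto simp: indicator_def simp del: real_scaleR_def)
  then show ?thesis by eventually_elim (unfold F, auto simp: indicator_def split: if_splits)
qed

lemma AE_step: "AE z in A. snd z (Suc n) - snd z n \<in> units"
  using AE_paths[of "Suc n"] by eventually_elim (auto simp: cyl_def)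

text \<open>The Markov property, the change of measure for the tilted walk and the change of initial
  law are all verified path by path through this reduction to finite sums.\<close>

lemma
  fixes F :: "'d env \<times> 'd path \<Rightarrow> 'b::{banach,second_countable_topology}"
  assumes F: "F \<in> borel_measurable (env_space \<Otimes>\<^sub>M path_space)" and dep: "depends_upto n F"
  shows integrable_iff_paths: "integrable A F \<longleftrightarrow>
      (\<forall>p\<in>paths n. integrable N (\<lambda>\<omega>. cyl_prob (\<tau> \<omega>) 0 n p *\<^sub>R F (\<omega>, p)))"
    and integral_paths: "integrable A F \<Longrightarrow>
      (\<integral>z. F z \<partial>A) = (\<Sum>p\<in>paths n. \<integral>\<omega>. cyl_prob (\<tau> \<omega>) 0 n p *\<^sub>R F (\<omega>, p) \<partial>N)"
proof -
  note [measurable_cong] = N(2) sets_A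
  have Fm: "F \<in> borel_measurable A" using F by simp
  have Fp [measurable]: "(\<lambda>\<omega>. F (\<omega>, p)) \<in> borel_measurable env_space" for p
    by (rule measurable_compose[OF _ F]) (simp add: measurable_Pair2')
  let ?S = "\<lambda>z. \<Sum>p\<in>paths n. indicator (cyl n p) (snd z) *\<^sub>R F (fst z, p)"
  have pt: "indicator (cyl n p) (snd z) *\<^sub>R F z = indicator (cyl n p) (snd z) *\<^sub>R F (fst z, p)" for p z
    using dep unfolding depends_upto_def by (cases z) (auto simp: cyl_def indicator_def)
  have ae: "AE z in A. F z = ?S z"
    using AE_paths[of n]
  proof eventually_elim
    case (elim z)
    then obtain p where p: "p \<in> paths n" "snd z \<in> cyl n p" by auto
    have "F z = F (fst z, p)" using pt[of p z] p by simp
    then show ?case using sum_indicator_cyl[OF p, of "\<lambda>p. F (fst z, p)"] by simp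
  qed
  have Sm: "?S \<in> borel_measurable A" by measurable
  show iff: "integrable A F \<longleftrightarrow>
      (\<forall>p\<in>paths n. integrable N (\<lambda>\<omega>. cyl_prob (\<tau> \<omega>) 0 n p *\<^sub>R F (\<omega>, p)))"
  proof
    assume i: "integrable A F"
    show "\<forall>p\<in>paths n. integrable N (\<lambda>\<omega>. cyl_prob (\<tau> \<omega>) 0 n p *\<^sub>R F (\<omega>, p))"
    proof
      fix p :: "'d path"
      have "integrable A (\<lambda>z. indicator (cyl n p) (snd z) *\<^sub>R F z)"
        by (rule Bochner_Integration.integrable_bound[OF i]) (use Fm in \<open>auto simp: indicator_def\<close>)
      then show "integrable N (\<lambda>\<omega>. cyl_prob (\<tau> \<omega>) 0 n p *\<^sub>R F (\<omega>, p))"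
        unfolding pt by (subst (asm) integrable_cyl_iff) auto
    qed
  next
    assume "\<forall>p\<in>paths n. integrable N (\<lambda>\<omega>. cyl_prob (\<tau> \<omega>) 0 n p *\<^sub>R F (\<omega>, p))"
    then have "integrable A ?S"
      by (intro Bochner_Integration.integrable_sum integrable_cyl_iff[OF Fp, THEN iffD2]) blast
    then show "integrable A F" using ae Fm Sm integrable_cong_AE by blast
  qed
  assume i: "integrable A F"
  have "(\<integral>z. F z \<partial>A) = (\<integral>z. ?S z \<partial>A)" by (rule integral_cong_AE[OF Fm Sm ae])
  also have "\<dots> = (\<Sum>p\<in>paths n. \<integral>z. indicator (cyl n p) (snd z) *\<^sub>R F (fst z, p) \<partial>A)"
    using i unfolding iff
    by (intro Bochner_Integration.integral_sum integrable_cyl_iff[OF Fp, THEN iffD2]) blast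
  also have "\<dots> = (\<Sum>p\<in>paths n. \<integral>\<omega>. cyl_prob (\<tau> \<omega>) 0 n p *\<^sub>R F (\<omega>, p) \<partial>N)"
    by (intro sum.cong refl integral_cyl Fp)
  finally show "(\<integral>z. F z \<partial>A) = (\<Sum>p\<in>paths n. \<integral>\<omega>. cyl_prob (\<tau> \<omega>) 0 n p *\<^sub>R F (\<omega>, p) \<partial>N)" .
qed

end

section \<open>Translation invariance, mixing and reversibility\<close>

lemma rvec_uminus: "rvec (- x) = - rvec x" and rvec_add: "rvec (x + y) = rvec x + rvec y"
  and rvec_0: "rvec 0 = 0"
  by (simp_all add: rvec_def vec_eq_iff)

lemma uminus_units: "e \<in> units \<Longrightarrow> - e \<in> units"
  by (simp add: units_def rvec_uminus)

lemma bij_betw_uminus_units: "bij_betw uminus (units :: (int ^ 'd::finite) set) units"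
  by (rule bij_betwI[where g = uminus]) (auto intro: uminus_units)

lemma image_translate_image: "(+) a ` (+) b ` c = (+) (a + b) ` (c :: (int ^ 'd::finite) set)"
  by (simp add: image_image add.assoc)

lemma translate_image_back [simp]: "(\<lambda>x. x - z) ` (+) z ` c = (c :: (int ^ 'd::finite) set)"
  by (simp add: image_image)

lemma bonds_translate: "b \<in> bonds \<Longrightarrow> (+) z ` b \<in> bonds"
proof -
  assume "b \<in> bonds"
  then obtain x e where "e \<in> units" "b = {x, x + e}" by (auto simp: bonds_def)
  then show ?thesis using bondsI[of e "z + x"] by (simp add: add.assoc)
qed

lemma bonds_nonempty: "(bonds :: (int ^ 'd::finite) set set) \<noteq> {}"
  using units_nonempty bondsI by blast

lemma env_shift_env_shift: "env_shift a (env_shift b \<omega>) = env_shift (b + a) \<omega>"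
  by (rule ext) (simp add: env_shift_def bonds_translate image_translate_image)

lemma env_shift_zero: "\<omega> \<in> space env_space \<Longrightarrow> env_shift 0 \<omega> = \<omega>"
  by (rule ext) (auto simp: env_shift_def env_space_def space_PiM PiE_iff extensional_def)

lemma env_shift_space: "\<omega> \<in> space env_space \<Longrightarrow> env_shift z \<omega> \<in> space env_space"
  by (rule measurable_space[OF env_shift_measurable])

lemma trans_prob_env_shift: "e \<in> units \<Longrightarrow> trans_prob (env_shift x \<omega>) 0 e = trans_prob \<omega> x (x + e)"
  unfolding trans_prob_def total_cond_def
  using env_shift_bond[of _ x \<omega> 0] by simp

lemma env_coord_borel: "b \<in> bonds \<Longrightarrow> (\<lambda>\<omega>. \<omega> b) \<in> borel_measurable env_space"
  using env_coord_measurable[of b] by (simp add: measurable_restrict_space2_iff)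

lemma total_cond_measurable [measurable]: "(\<lambda>\<omega>. total_cond \<omega> x) \<in> borel_measurable env_space"
  unfolding total_cond_def by (intro borel_measurable_sum env_coord_borel bondsI)

definition env_box :: "(int ^ 'd) set set \<Rightarrow> ((int ^ 'd) set \<Rightarrow> real set) \<Rightarrow> 'd::finite env set" where
  "env_box J B = {\<omega> \<in> space env_space. \<forall>j\<in>J. \<omega> j \<in> B j}"

lemma env_box_sets:
  assumes "finite J" "J \<subseteq> bonds" "\<And>j. j \<in> J \<Longrightarrow> B j \<in> sets borel"
  shows "env_box J B \<in> sets env_space"
proof -
  have "{\<omega> \<in> space env_space. \<omega> j \<in> B j} \<in> sets env_space" if "j \<in> J" for j
    using measurable_sets[OF env_coord_borel, of j "B j"] that assms
    by (auto simp: vimage_def Int_def conj_commute)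
  then show ?thesis
    unfolding env_box_def using assms(1) by (intro sets.sets_Collect_finite_All) auto
qed

definition env_boxes :: "'d::finite env set set" where
  "env_boxes = {env_box J B | J B. finite J \<and> J \<subseteq> bonds \<and> (\<forall>j\<in>J. B j \<in> sets borel)}"

lemma prod_emb_env_box:
  assumes "J \<subseteq> bonds"
  shows "prod_emb bonds (\<lambda>_. restrict_space borel {0<..}) J (PiE J B) = env_box J B"
  using assms by (auto simp: prod_emb_def env_box_def env_space_def space_PiM PiE_iff extensional_def)

lemma prod_algebra_env_boxes:
  "prod_algebra bonds (\<lambda>_. restrict_space borel {0<..}) \<subseteq> (env_boxes :: 'd::finite env set set)"
proof
  fix A :: "'d env set" assume "A \<in> prod_algebra bonds (\<lambda>_. restrict_space borel {0<..})"
  then obtain J E where A: "A = prod_emb bonds (\<lambda>_. restrict_space borel {0<..}) J (PiE J E)"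
    "finite J" "J \<subseteq> bonds" "\<And>i. i \<in> J \<Longrightarrow> E i \<in> sets (restrict_space borel {0::real<..})"
    by (rule prod_algebraE) blast
  then have "E i \<in> sets borel" if "i \<in> J" for i
    using that by (auto simp: sets_restrict_space_iff)
  then show "A \<in> env_boxes" using A(2,3) unfolding A(1) prod_emb_env_box[OF A(3)] env_boxes_def by blast
qed

text \<open>Dynkin's argument as an induction rule: the product algebra generates the events, is
  stable under intersections and is contained in the boxes.\<close>

lemma env_boxes_induct [consumes 1, case_names box compl union]:
  assumes A: "A \<in> sets (env_space :: 'd::finite env measure)"
    and box: "\<And>J B. finite J \<Longrightarrow> J \<subseteq> bonds \<Longrightarrow> (\<And>j. j \<in> J \<Longrightarrow> B j \<in> sets borel) \<Longrightarrow> P (env_box J B)"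
    and compl: "\<And>A. A \<in> sets env_space \<Longrightarrow> P A \<Longrightarrow> P (space env_space - A)"
    and union: "\<And>A. disjoint_family A \<Longrightarrow> range A \<subseteq> sets env_space \<Longrightarrow> (\<And>i. P (A i)) \<Longrightarrow> P (\<Union>i::nat. A i)"
  shows "P A"
proof -
  let ?G = "prod_algebra bonds (\<lambda>_. restrict_space borel {0::real<..}) :: 'd env set set"
  let ?\<Omega> = "space (env_space :: 'd env measure)"
  have s: "sets (env_space :: 'd env measure) = sigma_sets ?\<Omega> ?G"
    by (simp add: env_space_def sets_PiM space_PiM)
  have b: "P A" if "A \<in> ?G" for A
    using set_mp[OF prod_algebra_env_boxes that] box by (auto simp: env_boxes_def)
  have "?\<Omega> = env_box {} (\<lambda>_. {})" by (simp add: env_box_def)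
  then have e: "P ?\<Omega>" using box[of "{}" "\<lambda>_. {}"] by simp
  have G: "?G \<subseteq> Pow ?\<Omega>"
    unfolding env_space_def space_PiM by (rule prod_algebra_sets_into_space)
  show ?thesis
    using Int_stable_prod_algebra G A[unfolded s]
  proof (induction rule: sigma_sets_induct_disjoint)
    show "P {}" using compl[OF _ e] by simp
  qed (use b compl union in \<open>simp_all add: s\<close>)
qed

locale rcm =
  fixes P :: "'d::finite env measure"
  assumes iid: "iid_elliptic P"
begin

sublocale P: prob_space P
  using iid by (simp add: iid_elliptic_def)

lemma sets_P [measurable_cong]: "sets P = sets env_space"
  using iid by (simp add: iid_elliptic_def)

lemma space_P: "space P = space env_space"
  by (rule sets_eq_imp_space_eq[OF sets_P])

definition marginal :: "real measure" where
  "marginal = distr P borel (\<lambda>\<omega>. \<omega> (SOME b. b \<in> bonds))"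

lemma prob_env_box:
  assumes J: "finite J" "J \<subseteq> bonds" and B: "\<And>j. j \<in> J \<Longrightarrow> B j \<in> sets borel"
  shows "P.prob (env_box J B) = (\<Prod>j\<in>J. measure marginal (B j))"
proof (cases "J = {}")
  case True
  then show ?thesis using P.prob_space by (simp add: env_box_def space_P)
next
  case False
  have ind: "P.indep_vars (\<lambda>_. borel) (\<lambda>b \<omega>. \<omega> b) bonds" using iid by (simp add: iid_elliptic_def)
  have "P.prob (\<Inter>j\<in>J. (\<lambda>\<omega>. \<omega> j) -` B j \<inter> space P) = (\<Prod>j\<in>J. P.prob ((\<lambda>\<omega>. \<omega> j) -` B j \<inter> space P))"
    using ind[unfolded P.indep_vars_def2] J B False by (intro P.indep_setsD) auto
  moreover have "(\<Inter>j\<in>J. (\<lambda>\<omega>. \<omega> j) -` B j \<inter> space P) = env_box J B"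
    using False by (auto simp: env_box_def space_P)
  moreover have "P.prob ((\<lambda>\<omega>. \<omega> j) -` B j \<inter> space P) = measure marginal (B j)" if j: "j \<in> J" for j
  proof -
    have jb: "j \<in> bonds" using j J by auto
    have sb: "(SOME b. b \<in> bonds) \<in> (bonds :: (int ^ 'd) set set)"
      using bonds_nonempty by (simp add: some_in_eq)
    have "distr P borel (\<lambda>\<omega>. \<omega> j) = marginal"
      using iid jb sb unfolding iid_elliptic_def marginal_def by blast
    moreover have "(\<lambda>\<omega>. \<omega> j) \<in> borel_measurable P" using env_coord_borel[OF jb] by simp
    ultimately show ?thesis using B[OF j] by (metis measure_distr)
  qed
  ultimately show ?thesis by simp
qed

lemma vimage_env_shift_box:
  assumes "J \<subseteq> bonds"
  shows "env_shift z -` env_box J B \<inter> space env_space =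
    env_box ((`) ((+) z) ` J) (\<lambda>b. B ((+) (- z) ` b))"
proof -
  have "env_shift z \<omega> j \<in> B j \<longleftrightarrow> \<omega> ((+) z ` j) \<in> B ((+) (- z) ` (+) z ` j)" if "j \<in> J" for j \<omega>
    using that assms by (auto simp: env_shift_def image_translate_image subset_iff)
  then show ?thesis
    using env_shift_space[of _ z] by (auto simp: env_box_def)
qed

lemma inj_translate_bonds: "inj ((`) ((+) z) :: (int ^ 'd) set \<Rightarrow> _)"
proof (rule injI)
  fix x y :: "(int ^ 'd) set" assume "(+) z ` x = (+) z ` y"
  then have "(+) (- z) ` (+) z ` x = (+) (- z) ` (+) z ` y" by simp
  then show "x = y" by (simp add: image_translate_image)
qed

text \<open>The preimage of a box is a box over the translated bonds, and its probability is the
  same product because all bonds share one marginal.\<close>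

lemma P_shift: "distr P env_space (env_shift z) = P"
proof (rule measure_eqI_PiM_infinite[where I = bonds and M = "\<lambda>_. restrict_space borel {0<..}"])
  show "sets (distr P env_space (env_shift z)) = sets (PiM bonds (\<lambda>_. restrict_space borel {0<..}))"
    "sets P = sets (PiM bonds (\<lambda>_. restrict_space borel {0<..}))"
    by (simp_all add: sets_P env_space_def[symmetric])
  have m: "env_shift z \<in> P \<rightarrow>\<^sub>M env_space" using env_shift_measurable by (simp add: measurable_cong_sets[OF sets_P refl])
  show "finite_measure (distr P env_space (env_shift z))"
    by (intro prob_space.finite_measure P.prob_space_distr m)
  fix A :: "(int ^ 'd) set \<Rightarrow> real set" and J :: "(int ^ 'd) set set"
  assume J: "finite J" "J \<subseteq> bonds" and A: "\<And>i. i \<in> J \<Longrightarrow> A i \<in> sets (restrict_space borel {0<..})"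
  have A': "A i \<in> sets borel" if "i \<in> J" for i using A[OF that] by (auto simp: sets_restrict_space_iff)
  have "emeasure (distr P env_space (env_shift z)) (env_box J A) =
      P.prob (env_box ((`) ((+) z) ` J) (\<lambda>b. A ((+) (- z) ` b)))"
    using emeasure_distr[OF m env_box_sets[OF J A']]
    by (simp add: space_P vimage_env_shift_box[OF J(2)] P.emeasure_eq_measure)
  also have "P.prob (env_box ((`) ((+) z) ` J) (\<lambda>b. A ((+) (- z) ` b))) =
      (\<Prod>b\<in>(`) ((+) z) ` J. measure marginal (A ((+) (- z) ` b)))"
    using J A' by (intro prob_env_box) (auto simp: image_translate_image intro: bonds_translate)
  also have "\<dots> = (\<Prod>j\<in>J. measure marginal (A j))"
    by (subst prod.reindex) (auto simp: image_translate_image intro: inj_on_subset[OF inj_translate_bonds])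
  also have "\<dots> = P.prob (env_box J A)" by (rule prob_env_box[symmetric, OF J A'])
  finally show "emeasure (distr P env_space (env_shift z)) (prod_emb bonds (\<lambda>_. restrict_space borel {0<..}) J (Pi\<^sub>E J A)) =
      emeasure P (prod_emb bonds (\<lambda>_. restrict_space borel {0<..}) J (Pi\<^sub>E J A))"
    unfolding prod_emb_env_box[OF J(2)] by (simp add: P.emeasure_eq_measure)
qed

lemma prob_shift:
  assumes "B \<in> sets env_space"
  shows "P.prob (env_shift z -` B \<inter> space env_space) = P.prob B"
proof -
  have m: "env_shift z \<in> P \<rightarrow>\<^sub>M env_space" using env_shift_measurable by (simp add: measurable_cong_sets[OF sets_P refl])
  have "measure (distr P env_space (env_shift z)) B = P.prob (env_shift z -` B \<inter> space P)"
    using m assms by (rule measure_distr)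
  then show ?thesis by (simp add: P_shift space_P)
qed

definition ray :: "nat \<Rightarrow> int ^ 'd" where
  "ray k = (\<chi> i. int k * (SOME e. e \<in> units) $ i)"

lemma eventually_disjoint_ray:
  assumes J: "finite J" "J \<subseteq> bonds" and K: "finite K" "K \<subseteq> bonds"
  shows "eventually (\<lambda>k. J \<inter> (`) ((+) (ray k)) ` K = {}) sequentially"
proof -
  define e where "e = (SOME e. e \<in> (units :: (int ^ 'd) set))"
  have "e \<in> units" unfolding e_def using units_nonempty by (simp add: some_in_eq)
  then have "e \<noteq> 0" using zero_notin_units by auto
  then obtain i where i: "e $ i \<noteq> 0" by (auto simp: vec_eq_iff)
  have fb: "finite b" "b \<noteq> {}" if "b \<in> bonds" for b :: "(int ^ 'd) set"
    using that by (auto simp: bonds_def)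
  define V where "V = \<Union>(J \<union> K)"
  have V: "finite V" unfolding V_def using J K fb by auto
  \<comment> \<open>A bound for the i-th coordinates in the finite vertex set V; a displacement by
    more than 2m in this coordinate moves every vertex out of V.\<close>
  define m where "m = (\<Sum>x\<in>V. \<bar>x $ i\<bar>)"
  have m: "\<bar>x $ i\<bar> \<le> m" if "x \<in> V" for x
    unfolding m_def using V that by (intro member_le_sum) auto
  have "J \<inter> (`) ((+) (ray k)) ` K = {}" if k: "nat (2 * m + 1) \<le> k" for k
  proof (rule ccontr)
    assume "J \<inter> (`) ((+) (ray k)) ` K \<noteq> {}"
    then obtain b where b: "b \<in> K" "(+) (ray k) ` b \<in> J" by auto
    obtain x where x: "x \<in> b" using fb(2)[of b] b K by auto
    have "x \<in> V" "ray k + x \<in> V" using b x by (auto simp: V_def)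
    note m[OF this(1)] m[OF this(2)]
    then have le: "\<bar>int k * e $ i\<bar> \<le> 2 * m" by (simp add: ray_def e_def[symmetric])
    have "int k * 1 \<le> int k * \<bar>e $ i\<bar>" using i by (intro mult_left_mono) auto
    with le k show False by (simp add: abs_mult)
  qed
  then show ?thesis unfolding eventually_sequentially by blast
qed

text \<open>Dynkin's argument in one of the two events, with the moving event T k of constant
  probability c. For a disjoint union the limit is exchanged with the series by Tannery's theorem,
  the probabilities of the A i being a summable bound.\<close>

lemma mixing_step:
  fixes T :: "nat \<Rightarrow> 'd env set"
  assumes T: "\<And>k. T k \<in> sets env_space" and pT: "\<And>k. P.prob (T k) = c"
    and A: "A \<in> sets env_space"
    and box: "\<And>J B. finite J \<Longrightarrow> J \<subseteq> bonds \<Longrightarrow> (\<And>j. j \<in> J \<Longrightarrow> B j \<in> sets borel) \<Longrightarrow>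
      (\<lambda>k. P.prob (env_box J B \<inter> T k)) \<longlonglongrightarrow> P.prob (env_box J B) * c"
  shows "(\<lambda>k. P.prob (A \<inter> T k)) \<longlonglongrightarrow> P.prob A * c"
  using A
proof (induction rule: env_boxes_induct)
  case (box J B) then show ?case by (rule assms(4))
next
  case (compl A)
  have [measurable]: "A \<in> sets P" "T k \<in> sets P" for k using compl(1) T by (auto simp: sets_P)
  have "P.prob ((space env_space - A) \<inter> T k) = c - P.prob (A \<inter> T k)" for k
  proof -
    have "(space env_space - A) \<inter> T k = T k - A \<inter> T k"
      using sets.sets_into_space[OF T[of k]] by auto
    moreover have "P.prob (T k - A \<inter> T k) = P.prob (T k) - P.prob (A \<inter> T k)"
      by (rule P.finite_measure_Diff) auto
    ultimately show ?thesis using pT by simp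
  qed
  moreover have "P.prob (space env_space - A) = 1 - P.prob A"
    using P.prob_compl[of A] by (simp add: space_P)
  then have "P.prob (space env_space - A) * c = c - P.prob A * c" by (simp add: left_diff_distrib)
  ultimately show ?case using compl(2) by (auto intro!: tendsto_diff)
next
  case (union A)
  have A [measurable]: "A i \<in> sets P" "T k \<in> sets P" for i k using union(2) T by (auto simp: sets_P)
  have s: "(\<lambda>i. P.prob (A i)) sums P.prob (\<Union>i. A i)"
    using A union(1) by (intro P.finite_measure_UNION) auto
  have eq: "P.prob ((\<Union>i. A i) \<inter> T k) = (\<Sum>i. P.prob (A i \<inter> T k))" for k
  proof -
    have "(\<lambda>i. P.prob (A i \<inter> T k)) sums P.prob (\<Union>i. A i \<inter> T k)"
      using A union(1) by (intro P.finite_measure_UNION) (auto simp: disjoint_family_on_def)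
    then show ?thesis by (simp add: sums_iff)
  qed
  have "(\<lambda>k. \<Sum>i. P.prob (A i \<inter> T k)) \<longlonglongrightarrow> (\<Sum>i. P.prob (A i) * c)"
  proof (rule tannerys_theorem[THEN conjunct2, THEN conjunct2])
    show "eventually (\<lambda>(i, k). norm (P.prob (A i \<inter> T k)) \<le> P.prob (A i)) (at_top \<times>\<^sub>F sequentially)"
      by (intro always_eventually) (auto intro!: P.finite_measure_mono)
    show "summable (\<lambda>i. P.prob (A i))" using s by (rule sums_summable)
  qed (use union(3) in auto)
  also have "(\<Sum>i. P.prob (A i) * c) = P.prob (\<Union>i. A i) * c"
    using sums_mult2[OF s, of c] by (simp add: sums_iff)
  finally show ?case by (simp add: eq)
qed

text \<open>Boxes over disjoint sets of bonds are independent, and far shifts make the sets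
  disjoint. \<open>mixing_step\<close> is applied to each event in turn; \<open>shift_back\<close>
  uses the invariance of P to transfer the shift from one event to the other in between.\<close>

lemma mixing:
  assumes A: "A \<in> sets env_space" and B: "B \<in> sets env_space"
  shows "(\<lambda>k. P.prob (A \<inter> (env_shift (ray k) -` B \<inter> space env_space))) \<longlonglongrightarrow> P.prob A * P.prob B"
proof (rule mixing_step[OF _ prob_shift[OF B] A])
  show "env_shift (ray k) -` B \<inter> space env_space \<in> sets env_space" for k
    by (rule measurable_sets[OF env_shift_measurable B])
  fix J :: "(int ^ 'd) set set" and F :: "(int ^ 'd) set \<Rightarrow> real set"
  assume J: "finite J" "J \<subseteq> bonds" "\<And>j. j \<in> J \<Longrightarrow> F j \<in> sets borel"
  note F = env_box_sets[OF J]
  have shift_back: "P.prob (C \<inter> (env_shift (- ray k) -` env_box J F \<inter> space env_space)) =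
      P.prob (env_box J F \<inter> (env_shift (ray k) -` C \<inter> space env_space))" if "C \<in> sets env_space" for C k
  proof -
    have m: "C \<inter> (env_shift (- ray k) -` env_box J F \<inter> space env_space) \<in> sets env_space"
      using that measurable_sets[OF env_shift_measurable F] by auto
    have "env_shift (ray k) -` (C \<inter> (env_shift (- ray k) -` env_box J F \<inter> space env_space)) \<inter> space env_space =
        env_box J F \<inter> (env_shift (ray k) -` C \<inter> space env_space)"
      using sets.sets_into_space[OF F] env_shift_space[of _ "ray k"]
      by (auto simp: env_shift_env_shift env_shift_zero)
    then show ?thesis using prob_shift[OF m, where z = "ray k"] by simp
  qed
  have "(\<lambda>k. P.prob (B \<inter> (env_shift (- ray k) -` env_box J F \<inter> space env_space))) \<longlonglongrightarrow>
      P.prob B * P.prob (env_box J F)"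
  proof (rule mixing_step[OF _ prob_shift[OF F] B])
    show "env_shift (- ray k) -` env_box J F \<inter> space env_space \<in> sets env_space" for k
      by (rule measurable_sets[OF env_shift_measurable F])
    fix K :: "(int ^ 'd) set set" and G :: "(int ^ 'd) set \<Rightarrow> real set"
    assume K: "finite K" "K \<subseteq> bonds" "\<And>j. j \<in> K \<Longrightarrow> G j \<in> sets borel"
    have "eventually (\<lambda>k. P.prob (env_box J F \<inter> (env_shift (ray k) -` env_box K G \<inter> space env_space)) =
        P.prob (env_box J F) * P.prob (env_box K G)) sequentially"
      using eventually_disjoint_ray[OF J(1,2) K(1,2)]
    proof eventually_elim
      case (elim k)
      let ?K = "(`) ((+) (ray k)) ` K" and ?G = "\<lambda>b. G ((+) (- ray k) ` b)"
      let ?H = "\<lambda>b. if b \<in> J then F b else ?G b"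
      have K': "finite ?K" "?K \<subseteq> bonds" "\<And>j. j \<in> ?K \<Longrightarrow> ?G j \<in> sets borel"
        using K by (auto simp: image_translate_image intro: bonds_translate)
      have "j \<notin> J" if "j \<in> ?K" for j using elim that by blast
      then have "env_box J F \<inter> env_box ?K ?G = env_box (J \<union> ?K) ?H"
        unfolding env_box_def by (simp only: ball_Un) (auto simp del: image_iff)
      moreover have "P.prob (env_box (J \<union> ?K) ?H) = (\<Prod>j\<in>J \<union> ?K. measure marginal (?H j))"
      proof (rule prob_env_box)
        fix j assume j: "j \<in> J \<union> ?K"
        show "?H j \<in> sets borel"
        proof (cases "j \<in> J")
          case True then show ?thesis using J(3) by simp
        next
          case False
          then have "j \<in> ?K" using j by blast
          from K'(3)[OF this] show ?thesis using False by simp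
        qed
      qed (use J K' in auto)
      moreover have "\<dots> = (\<Prod>j\<in>J. measure marginal (?H j)) * (\<Prod>j\<in>?K. measure marginal (?H j))"
        using J K' elim by (intro prod.union_disjoint) auto
      moreover have "(\<Prod>j\<in>J. measure marginal (?H j)) = P.prob (env_box J F)"
        by (rule trans[OF prod.cong[OF refl] prob_env_box[OF J, symmetric]]) auto
      moreover have "(\<Prod>j\<in>?K. measure marginal (?H j)) = P.prob (env_box ?K ?G)"
        by (rule trans[OF prod.cong[OF refl] prob_env_box[OF K', symmetric]]) (use elim in auto)
      moreover have "P.prob (env_box ?K ?G) = P.prob (env_box K G)"
        using prob_shift[OF env_box_sets[OF K], where z = "ray k"] by (simp add: vimage_env_shift_box[OF K(2)])
      ultimately show ?case by (simp add: vimage_env_shift_box[OF K(2)])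
    qed
    then have "(\<lambda>k. P.prob (env_box J F \<inter> (env_shift (ray k) -` env_box K G \<inter> space env_space))) \<longlonglongrightarrow>
        P.prob (env_box J F) * P.prob (env_box K G)"
      by (rule tendsto_eventually)
    then show "(\<lambda>k. P.prob (env_box K G \<inter> (env_shift (- ray k) -` env_box J F \<inter> space env_space))) \<longlonglongrightarrow>
        P.prob (env_box K G) * P.prob (env_box J F)"
      by (simp add: shift_back[OF env_box_sets[OF K]] mult.commute)
  qed
  then show "(\<lambda>k. P.prob (env_box J F \<inter> (env_shift (ray k) -` B \<inter> space env_space))) \<longlonglongrightarrow>
      P.prob (env_box J F) * P.prob B"
    by (simp add: shift_back[OF B] mult.commute)
qed

lemma AE_shift:
  assumes "AE \<omega> in P. R \<omega>"
  shows "AE \<omega> in P. R (env_shift z \<omega>)"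
proof (rule AE_distrD[of "env_shift z" P env_space R])
  show "env_shift z \<in> P \<rightarrow>\<^sub>M env_space"
    by (simp add: measurable_cong_sets[OF sets_P refl] env_shift_measurable)
  show "AE \<omega> in distr P env_space (env_shift z). R \<omega>" unfolding P_shift by (rule assms)
qed

text \<open>Mixing gives p = p * p for the probability p of every sublevel set of r, so the
  distribution function of r takes only the values 0 and 1. The constant is the infimum of the
  levels with value 1.\<close>

lemma invariant_constant:
  assumes r: "r \<in> borel_measurable env_space"
    and inv: "\<And>e. e \<in> units \<Longrightarrow> AE \<omega> in P. r (env_shift e \<omega>) = (r \<omega> :: real)"
  shows "\<exists>c. AE \<omega> in P. r \<omega> = c"
proof -
  define e where "e = (SOME e. e \<in> (units :: (int ^ 'd) set))"
  have e: "e \<in> units" unfolding e_def using units_nonempty by (simp add: some_in_eq)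
  have ray_Suc: "ray (Suc k) = ray k + e" for k
    by (simp add: ray_def e_def[symmetric] vec_eq_iff algebra_simps)
  have rk: "AE \<omega> in P. r (env_shift (ray k) \<omega>) = r \<omega>" for k
  proof (induction k)
    case 0
    have "ray 0 = 0" by (simp add: ray_def vec_eq_iff)
    then show ?case by (intro AE_I2) (simp add: env_shift_zero space_P)
  next
    case (Suc k)
    from AE_shift[OF inv[OF e], of "ray k"] Suc show ?case
      by eventually_elim (simp add: env_shift_env_shift ray_Suc)
  qed
  have zo: "P.prob {\<omega> \<in> space env_space. r \<omega> \<le> c} \<in> {0, 1}" for c
  proof -
    let ?A = "{\<omega> \<in> space env_space. r \<omega> \<le> c}"
    have A: "?A \<in> sets env_space" using r by measurable
    have A': "?A \<in> sets P" "env_shift (ray k) -` ?A \<inter> space env_space \<in> sets P" for k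
      using A measurable_sets[OF env_shift_measurable A] by (simp_all add: sets_P)
    have "P.prob (?A \<inter> (env_shift (ray k) -` ?A \<inter> space env_space)) = P.prob ?A" for k
    proof (rule P.finite_measure_eq_AE)
      show "AE \<omega> in P. (\<omega> \<in> ?A \<inter> (env_shift (ray k) -` ?A \<inter> space env_space)) = (\<omega> \<in> ?A)"
        using rk[of k] by eventually_elim (auto intro: env_shift_space)
    qed (use A' in auto)
    then have "P.prob ?A = P.prob ?A * P.prob ?A"
      using mixing[OF A A] by (simp only: LIMSEQ_const_iff)
    then show ?thesis by simp
  qed
  interpret D: real_distribution "distr P borel r"
    using r by (intro P.real_distribution_distr) simp
  have cdf: "cdf (distr P borel r) c = P.prob {\<omega> \<in> space env_space. r \<omega> \<le> c}" for c
    using r by (simp add: cdf_def measure_distr vimage_def space_P Int_def conj_commute)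
  define S where "S = {c. P.prob {\<omega> \<in> space env_space. r \<omega> \<le> c} = 1}"
  have "eventually (\<lambda>c. cdf (distr P borel r) c > 0) at_top"
    using D.cdf_lim_at_top_prob by (rule order_tendstoD) simp
  then obtain c1 where "cdf (distr P borel r) c1 > 0" using eventually_happens[of _ "at_top :: real filter"] by auto
  then have c1: "c1 \<in> S" using zo[of c1] by (auto simp: S_def cdf)
  have "eventually (\<lambda>c. cdf (distr P borel r) c < 1) at_bot"
    using D.cdf_lim_at_bot by (rule order_tendstoD) simp
  then obtain c0 where c0: "cdf (distr P borel r) c0 < 1" using eventually_happens[of _ "at_bot :: real filter"] by auto
  have lb: "c0 \<le> c" if "c \<in> S" for c
  proof (rule ccontr)
    assume "\<not> c0 \<le> c"
    then have "cdf (distr P borel r) c \<le> cdf (distr P borel r) c0" by (intro D.cdf_nondecreasing) simp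
    with that c0 show False by (simp add: S_def cdf)
  qed
  then have bdd: "bdd_below S" by (auto simp: bdd_below_def)
  define c where "c = Inf S"
  have "AE \<omega> in P. r \<omega> \<le> c + 1 / real (Suc n) \<and> c - 1 / real (Suc n) < r \<omega>" for n
  proof -
    obtain c' where c': "c' \<in> S" "c' < c + 1 / real (Suc n)"
      using cInf_lessD[of S "c + 1 / real (Suc n)"] c1 by (auto simp: c_def)
    have "AE \<omega> in P. \<omega> \<in> {\<omega> \<in> space env_space. r \<omega> \<le> c'}"
      using c'(1) r by (subst P.AE_in_set_eq_1) (auto simp: S_def)
    then have 1: "AE \<omega> in P. r \<omega> \<le> c + 1 / real (Suc n)" by eventually_elim (use c'(2) in auto)
    have "c - 1 / real (Suc n) \<notin> S"
    proof
      assume "c - 1 / real (Suc n) \<in> S"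
      then have "c \<le> c - 1 / real (Suc n)" unfolding c_def using bdd by (rule cInf_lower)
      moreover have "0 < 1 / real (Suc n)" by simp
      ultimately show False by linarith
    qed
    then have "P.prob {\<omega> \<in> space env_space. r \<omega> \<le> c - 1 / real (Suc n)} = 0"
      using zo[of "c - 1 / real (Suc n)"] by (auto simp: S_def)
    then have "AE \<omega> in P. \<omega> \<notin> {\<omega> \<in> space env_space. r \<omega> \<le> c - 1 / real (Suc n)}"
      using r by (subst (asm) P.prob_eq_0) auto
    then have "AE \<omega> in P. c - 1 / real (Suc n) < r \<omega>"
      using AE_space by eventually_elim (auto simp: space_P)
    with 1 show ?thesis by eventually_elim simp
  qed
  then have "AE \<omega> in P. \<forall>n. r \<omega> \<le> c + 1 / real (Suc n) \<and> c - 1 / real (Suc n) < r \<omega>"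
    by (simp add: AE_all_countable)
  then have "AE \<omega> in P. r \<omega> = c"
  proof eventually_elim
    case (elim \<omega>)
    have "(\<lambda>n. c + 1 / real (Suc n)) \<longlonglongrightarrow> c + 0" "(\<lambda>n. c - 1 / real (Suc n)) \<longlonglongrightarrow> c - 0"
      by (intro tendsto_intros LIMSEQ_Suc lim_1_over_n)+
    then have "r \<omega> \<le> c + 0" "c - 0 \<le> r \<omega>"
      using elim by (auto intro: LIMSEQ_le_const LIMSEQ_le_const2 less_imp_le)
    then show ?case by simp
  qed
  then show ?thesis by blast
qed

section \<open>Ellipticity, the law \<open>Q0\<close> and detailed balance\<close>

definition ellipticity :: real where
  "ellipticity = (SOME k. k > 1 \<and> (AE \<omega> in P. \<forall>b\<in>bonds. inverse k \<le> \<omega> b \<and> \<omega> b \<le> k))"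

lemma ellipticity: "ellipticity > 1" "AE \<omega> in P. \<forall>b\<in>bonds. inverse ellipticity \<le> \<omega> b \<and> \<omega> b \<le> ellipticity"
proof -
  have "\<exists>k. k > 1 \<and> (AE \<omega> in P. \<forall>b\<in>bonds. inverse k \<le> \<omega> b \<and> \<omega> b \<le> k)"
    using iid by (auto simp: iid_elliptic_def)
  from someI_ex[OF this] show "ellipticity > 1"
    "AE \<omega> in P. \<forall>b\<in>bonds. inverse ellipticity \<le> \<omega> b \<and> \<omega> b \<le> ellipticity"
    by (auto simp: ellipticity_def)
qed

lemma AE_total_cond_bounds:
  "AE \<omega> in P. card (units :: (int ^ 'd) set) * inverse ellipticity \<le> total_cond \<omega> 0 \<and>
    total_cond \<omega> 0 \<le> card (units :: (int ^ 'd) set) * ellipticity"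
  using ellipticity(2)
proof eventually_elim
  case (elim \<omega>)
  have "inverse ellipticity \<le> \<omega> {0, 0 + e} \<and> \<omega> {0, 0 + e} \<le> ellipticity" if "e \<in> units" for e
    using elim bondsI[OF that, of 0] by blast
  then show ?case
    using sum_bounded_below[of units "inverse ellipticity" "\<lambda>e. \<omega> {0, 0 + e}"]
      sum_bounded_above[of units "\<lambda>e. \<omega> {0, 0 + e}" ellipticity]
    by (simp add: total_cond_def)
qed

lemma card_units_pos: "0 < card (units :: (int ^ 'd) set)"
  using finite_units units_nonempty by (simp add: card_gt_0_iff)

definition Z :: real where
  "Z = (\<integral>\<omega>. total_cond \<omega> 0 \<partial>P)"

lemma integrable_total_cond: "integrable P (\<lambda>\<omega>. total_cond \<omega> 0)"
proof (rule P.integrable_const_bound)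
  show "AE \<omega> in P. norm (total_cond \<omega> 0) \<le> card (units :: (int ^ 'd) set) * ellipticity"
    using AE_total_cond_bounds AE_space
    by eventually_elim (simp add: space_P total_cond_pos less_imp_le)
qed simp

lemma Z_pos: "0 < Z"
proof -
  have "(\<integral>\<omega>. card (units :: (int ^ 'd) set) * inverse ellipticity \<partial>P) \<le> Z"
    unfolding Z_def using AE_total_cond_bounds integrable_total_cond
    by (intro integral_mono_AE) (auto elim!: AE_mp)
  moreover have "0 < card (units :: (int ^ 'd) set) * inverse ellipticity"
    using card_units_pos ellipticity(1) by simp
  ultimately show ?thesis by (simp add: P.prob_space)
qed

abbreviation Q :: "'d env measure" where
  "Q \<equiv> Q0 P"

lemma Q_eq: "Q = density P (\<lambda>\<omega>. ennreal (total_cond \<omega> 0 / Z))"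
  by (simp add: Q0_def Z_def)

lemma sets_Q [measurable_cong]: "sets Q = sets env_space"
  by (simp add: Q0_def sets_P)

lemma space_Q: "space Q = space env_space"
  by (rule sets_eq_imp_space_eq[OF sets_Q])

lemma total_cond_nonneg_P: "AE \<omega> in P. 0 \<le> total_cond \<omega> 0 / Z"
  by (intro AE_I2 divide_nonneg_pos Z_pos less_imp_le[OF total_cond_pos]) (simp add: space_P)

sublocale Q: prob_space Q
proof
  have "emeasure Q (space Q) = (\<integral>\<^sup>+\<omega>. ennreal (total_cond \<omega> 0 / Z) \<partial>P)"
    unfolding Q_eq by (subst emeasure_density) (auto intro!: nn_integral_cong)
  also have "\<dots> = ennreal (\<integral>\<omega>. total_cond \<omega> 0 / Z \<partial>P)"
    using integrable_total_cond total_cond_nonneg_P by (intro nn_integral_eq_integral) auto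
  also have "\<dots> = 1" using Z_pos by (simp add: Z_def[symmetric])
  finally show "emeasure Q (space Q) = 1" .
qed

lemma AE_Q_iff: "(AE \<omega> in Q. R \<omega>) \<longleftrightarrow> (AE \<omega> in P. R \<omega>)"
proof -
  have "(AE \<omega> in Q. R \<omega>) \<longleftrightarrow> (AE \<omega> in P. 0 < ennreal (total_cond \<omega> 0 / Z) \<longrightarrow> R \<omega>)"
    unfolding Q_eq by (rule AE_density) simp
  also have "\<dots> \<longleftrightarrow> (AE \<omega> in P. R \<omega>)"
    by (intro AE_cong) (simp add: space_P total_cond_pos Z_pos)
  finally show ?thesis .
qed

lemma
  fixes g :: "'d env \<Rightarrow> 'b::{banach,second_countable_topology}"
  assumes g [measurable]: "g \<in> borel_measurable env_space"
  shows integral_Q: "(\<integral>\<omega>. g \<omega> \<partial>Q) = (\<integral>\<omega>. (total_cond \<omega> 0 / Z) *\<^sub>R g \<omega> \<partial>P)"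
    and integrable_Q_iff: "integrable Q g \<longleftrightarrow> integrable P (\<lambda>\<omega>. (total_cond \<omega> 0 / Z) *\<^sub>R g \<omega>)"
  unfolding Q_eq using total_cond_nonneg_P by (auto simp: integral_density integrable_density)

text \<open>The density of P with respect to \<open>Q0 P\<close>; it is bounded by ellipticity and
  carries limit theorems from the stationary law back to P.\<close>

definition P_density :: "'d env \<Rightarrow> real" where
  "P_density \<omega> = Z / total_cond \<omega> 0"

lemma P_density_measurable [measurable]: "P_density \<in> borel_measurable env_space"
  unfolding P_density_def by measurable

lemma integral_P:
  fixes g :: "'d env \<Rightarrow> 'b::{banach,second_countable_topology}"
  assumes g [measurable]: "g \<in> borel_measurable env_space"
  shows "(\<integral>\<omega>. g \<omega> \<partial>P) = (\<integral>\<omega>. P_density \<omega> *\<^sub>R g \<omega> \<partial>Q)"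
proof -
  have "total_cond \<omega> 0 / Z * P_density \<omega> = 1" if "\<omega> \<in> space P" for \<omega>
    using that total_cond_pos[of \<omega> 0] Z_pos by (simp add: P_density_def space_P)
  note d = this
  have "(\<integral>\<omega>. P_density \<omega> *\<^sub>R g \<omega> \<partial>Q) = (\<integral>\<omega>. (total_cond \<omega> 0 / Z) *\<^sub>R (P_density \<omega> *\<^sub>R g \<omega>) \<partial>P)"
    by (rule integral_Q) measurable
  also have "\<dots> = (\<integral>\<omega>. g \<omega> \<partial>P)"
    by (rule Bochner_Integration.integral_cong[OF refl]) (simp only: scaleR_scaleR d scaleR_one)
  finally show ?thesis by simp
qed

lemma AE_P_density_bound: "AE \<omega> in Q. \<bar>P_density \<omega>\<bar> \<le> Z * ellipticity"
  unfolding AE_Q_iff using AE_total_cond_bounds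
proof eventually_elim
  case (elim \<omega>)
  have 1: "1 \<le> real (card (units :: (int ^ 'd) set))" using card_units_pos by linarith
  then have "1 * inverse ellipticity \<le> real (card (units :: (int ^ 'd) set)) * inverse ellipticity"
    using ellipticity(1) by (intro mult_right_mono) auto
  with elim have le: "inverse ellipticity \<le> total_cond \<omega> 0" by simp
  have pos: "0 < inverse ellipticity" using ellipticity(1) by simp
  have "inverse (total_cond \<omega> 0) \<le> inverse (inverse ellipticity)" using le pos by (rule le_imp_inverse_le)
  then have "Z * inverse (total_cond \<omega> 0) \<le> Z * ellipticity" using Z_pos by (intro mult_left_mono) auto
  moreover have "0 < total_cond \<omega> 0" using le pos by linarith
  ultimately show ?case using Z_pos by (simp add: P_density_def divide_inverse)
qed

text \<open>Detailed balance. The density of \<open>Q0 P\<close> cancels the normalization of the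
  transition probability and leaves the conductance of {0, e}, which is that of {0, - e} seen from
  e; invariance of P under the shift by e finishes the argument.\<close>

lemma
  assumes e: "e \<in> units" and g [measurable]: "g \<in> borel_measurable env_space"
  shows one_step_reversal: "(\<integral>\<omega>. trans_prob \<omega> 0 e * g (env_shift e \<omega>) \<partial>Q) =
      (\<integral>\<omega>. trans_prob \<omega> 0 (- e) * g \<omega> \<partial>Q)" (is ?thesis1)
    and one_step_reversal_integrable: "integrable Q (\<lambda>\<omega>. trans_prob \<omega> 0 e * g (env_shift e \<omega>)) \<longleftrightarrow>
      integrable Q (\<lambda>\<omega>. trans_prob \<omega> 0 (- e) * g \<omega>)" (is ?thesis2)
proof -
  have sm [measurable]: "env_shift e \<in> env_space \<rightarrow>\<^sub>M env_space" by (rule env_shift_measurable)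
  have bond: "{0, - e} \<in> bonds" using bondsI[OF uminus_units[OF e], of 0] by simp
  note [measurable] = env_coord_borel[OF bond]
  have tc: "total_cond \<omega> 0 \<noteq> 0" if "\<omega> \<in> space P" for \<omega>
    using total_cond_pos[of \<omega> 0] that by (simp add: space_P)
  have shift_back: "\<omega> {0, e} = env_shift e \<omega> {0, - e}" for \<omega> :: "'d env"
    using env_shift_bond[OF uminus_units[OF e], of e \<omega> 0] by (simp add: insert_commute)
  have 1: "total_cond \<omega> 0 / Z * (trans_prob \<omega> 0 e * g (env_shift e \<omega>)) =
      env_shift e \<omega> {0, - e} / Z * g (env_shift e \<omega>)" if "\<omega> \<in> space P" for \<omega>
    using tc[OF that] e shift_back[of \<omega>] by (simp add: trans_prob_def)
  have 2: "total_cond \<omega> 0 / Z * (trans_prob \<omega> 0 (- e) * g \<omega>) = \<omega> {0, - e} / Z * g \<omega>"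
    if "\<omega> \<in> space P" for \<omega>
    using tc[OF that] uminus_units[OF e] by (simp add: trans_prob_def)
  have shiftP: "env_shift e \<in> P \<rightarrow>\<^sub>M env_space" by simp
  have h: "(\<lambda>\<omega>. \<omega> {0, - e} / Z * g \<omega>) \<in> borel_measurable env_space" by measurable
  have m1 [measurable]: "(\<lambda>\<omega>. trans_prob \<omega> 0 e * g (env_shift e \<omega>)) \<in> borel_measurable env_space"
    by measurable
  have m2 [measurable]: "(\<lambda>\<omega>. trans_prob \<omega> 0 (- e) * g \<omega>) \<in> borel_measurable env_space"
    by measurable
  have "(\<integral>\<omega>. trans_prob \<omega> 0 e * g (env_shift e \<omega>) \<partial>Q) =
      (\<integral>\<omega>. env_shift e \<omega> {0, - e} / Z * g (env_shift e \<omega>) \<partial>P)"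
    unfolding integral_Q[OF m1] real_scaleR_def
    by (rule Bochner_Integration.integral_cong[OF refl]) (rule 1)
  also have "\<dots> = (\<integral>\<omega>. \<omega> {0, - e} / Z * g \<omega> \<partial>distr P env_space (env_shift e))"
    by (rule integral_distr[symmetric, OF shiftP h])
  also have "\<dots> = (\<integral>\<omega>. trans_prob \<omega> 0 (- e) * g \<omega> \<partial>Q)"
    unfolding P_shift integral_Q[OF m2] real_scaleR_def
    by (rule Bochner_Integration.integral_cong[OF refl]) (rule 2[symmetric])
  finally show ?thesis1 .
  have "integrable Q (\<lambda>\<omega>. trans_prob \<omega> 0 e * g (env_shift e \<omega>)) \<longleftrightarrow>
      integrable P (\<lambda>\<omega>. env_shift e \<omega> {0, - e} / Z * g (env_shift e \<omega>))"
    unfolding integrable_Q_iff[OF m1] real_scaleR_def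
    by (rule Bochner_Integration.integrable_cong[OF refl]) (rule 1)
  also have "\<dots> \<longleftrightarrow> integrable (distr P env_space (env_shift e)) (\<lambda>\<omega>. \<omega> {0, - e} / Z * g \<omega>)"
    by (rule integrable_distr_eq[symmetric, OF shiftP h])
  also have "\<dots> \<longleftrightarrow> integrable Q (\<lambda>\<omega>. trans_prob \<omega> 0 (- e) * g \<omega>)"
    unfolding P_shift integrable_Q_iff[OF m2] real_scaleR_def
    by (rule Bochner_Integration.integrable_cong[OF refl]) (rule 2[symmetric])
  finally show ?thesis2 .
qed

end

section \<open>The stationary environment process\<close>

definition step :: "nat \<Rightarrow> 'd::finite env \<times> 'd path \<Rightarrow> int ^ 'd" where
  "step n z = snd z (Suc n) - snd z n"

text \<open>The conditional expectation, given the past, of a function \<phi> of the current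
  environment and of the next step.\<close>

definition mean_step :: "('d::finite env \<Rightarrow> int ^ 'd \<Rightarrow> real) \<Rightarrow> 'd env \<Rightarrow> real" where
  "mean_step \<phi> \<omega> = (\<Sum>e\<in>units. trans_prob \<omega> 0 e * \<phi> \<omega> e)"

definition trans_op :: "('d::finite env \<Rightarrow> real) \<Rightarrow> 'd env \<Rightarrow> real" where
  "trans_op g = mean_step (\<lambda>\<omega> e. g (env_shift e \<omega>))"

text \<open>Adaptedness at time n, expressed without a filtration. The range is general because real
  sums, complex products and planar vectors all occur.\<close>

definition past :: "nat \<Rightarrow> ('d::finite env \<times> 'd path \<Rightarrow> 'b::topological_space) \<Rightarrow> bool" where
  "past n F \<longleftrightarrow> F \<in> borel_measurable (env_space \<Otimes>\<^sub>M path_space) \<and> depends_upto n F"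

text \<open>Bounded everywhere and not merely almost everywhere, so that shifts and
  \<open>trans_op\<close> preserve the class pointwise and no exceptional sets have to be carried
  along.\<close>

definition bdd_env :: "('d::finite env \<Rightarrow> real) \<Rightarrow> bool" where
  "bdd_env g \<longleftrightarrow> g \<in> borel_measurable env_space \<and> (\<exists>c. \<forall>\<omega>\<in>space env_space. \<bar>g \<omega>\<bar> \<le> c)"

definition step_measurable :: "('d::finite env \<Rightarrow> int ^ 'd \<Rightarrow> real) \<Rightarrow> bool" where
  "step_measurable \<phi> \<longleftrightarrow> (\<forall>e. (\<lambda>\<omega>. \<phi> \<omega> e) \<in> borel_measurable env_space)"

definition bdd_step :: "('d::finite env \<Rightarrow> int ^ 'd \<Rightarrow> real) \<Rightarrow> bool" where
  "bdd_step \<phi> \<longleftrightarrow> step_measurable \<phi> \<and> (\<exists>c. \<forall>\<omega>\<in>space env_space. \<forall>e\<in>units. \<bar>\<phi> \<omega> e\<bar> \<le> c)"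

lemma measurable_snd_coord: "(\<lambda>z. snd z n) \<in> env_space \<Otimes>\<^sub>M path_space \<rightarrow>\<^sub>M count_space UNIV"
  by (rule measurable_compose[OF measurable_snd coord_measurable])

lemma measurable_step: "step n \<in> env_space \<Otimes>\<^sub>M path_space \<rightarrow>\<^sub>M count_space UNIV"
  unfolding step_def[abs_def]
  by (rule measurable_compose_countable[OF _ measurable_snd_coord])
    (rule measurable_compose[OF measurable_snd_coord], simp)

lemma measurable_step_fun:
  assumes "step_measurable \<phi>"
  shows "(\<lambda>z. \<phi> (env_seen n z) (step n z)) \<in> borel_measurable (env_space \<Otimes>\<^sub>M path_space)"
proof (rule measurable_compose_countable[OF _ measurable_step])
  fix e
  show "(\<lambda>z. \<phi> (env_seen n z) e) \<in> borel_measurable (env_space \<Otimes>\<^sub>M path_space)"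
    by (rule measurable_compose[OF env_seen_measurable]) (use assms in \<open>simp add: step_measurable_def\<close>)
qed

lemma env_seen_Suc: "env_seen (Suc n) z = env_shift (step n z) (env_seen n z)"
  by (cases z) (simp add: env_seen_def env_shift_env_shift step_def)

lemma env_seen_space: "z \<in> space env_space \<times> UNIV \<Longrightarrow> env_seen n z \<in> space env_space"
  by (cases z) (auto simp: env_seen_def intro: env_shift_space)

lemma env_seen_past:
  "k \<le> n \<Longrightarrow> g \<in> borel_measurable env_space \<Longrightarrow> past n (\<lambda>z. g (env_seen k z))"
  unfolding past_def depends_upto_def
  by (auto simp: env_seen_def intro: measurable_compose[OF env_seen_measurable[unfolded env_seen_def]])

lemma step_past: "k < n \<Longrightarrow> step_measurable \<phi> \<Longrightarrow> past n (\<lambda>z. \<phi> (env_seen k z) (step k z))"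
  unfolding past_def depends_upto_def
  using measurable_step_fun[of \<phi> k] by (auto simp: env_seen_def step_def)

lemma past_mono: "past n F \<Longrightarrow> n \<le> m \<Longrightarrow> past m F"
  by (auto simp: past_def depends_upto_def)

lemma past_const: "past n (\<lambda>_. c)"
  by (simp add: past_def depends_upto_def)

lemma pastD: "past n F \<Longrightarrow> (\<And>k. k \<le> n \<Longrightarrow> X k = X' k) \<Longrightarrow> F (\<omega>, X) = F (\<omega>, X')"
  by (auto simp: past_def depends_upto_def)

lemma pastI:
  assumes "F \<in> borel_measurable (env_space \<Otimes>\<^sub>M path_space)"
    and "\<And>\<omega> X X'. (\<And>k. k \<le> n \<Longrightarrow> X k = X' k) \<Longrightarrow> F (\<omega>, X) = F (\<omega>, X')"
  shows "past n F"
  unfolding past_def depends_upto_def by (intro conjI allI impI assms) blast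

lemma past_borel: "past n F \<Longrightarrow> F \<in> borel_measurable (env_space \<Otimes>\<^sub>M path_space)"
  by (simp add: past_def)

lemma past_mult:
  fixes F G :: "'d::finite env \<times> 'd path \<Rightarrow> 'b::{real_normed_algebra,second_countable_topology}"
  assumes "past n F" "past n G"
  shows "past n (\<lambda>z. F z * G z)"
  using pastD[OF assms(1)] pastD[OF assms(2)] assms[THEN past_borel]
  by (intro pastI borel_measurable_times arg_cong2[where f = "(*)"]) blast+

lemma past_add:
  fixes F G :: "'d::finite env \<times> 'd path \<Rightarrow> 'b::{real_normed_vector,second_countable_topology}"
  assumes "past n F" "past n G"
  shows "past n (\<lambda>z. F z + G z)"
  using pastD[OF assms(1)] pastD[OF assms(2)] assms[THEN past_borel]
  by (intro pastI borel_measurable_add arg_cong2[where f = "(+)"]) blast+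

lemma past_sum: "(\<And>i. i \<in> I \<Longrightarrow> past n (F i)) \<Longrightarrow> past n (\<lambda>z. \<Sum>i\<in>I. F i z :: real)"
  by (induction I rule: infinite_finite_induct) (auto intro: past_const past_add)

lemma past_prod:
  fixes F :: "'i \<Rightarrow> 'd::finite env \<times> 'd path \<Rightarrow> 'b::{real_normed_field,second_countable_topology}"
  shows "(\<And>i. i \<in> I \<Longrightarrow> past n (F i)) \<Longrightarrow> past n (\<lambda>z. \<Prod>i\<in>I. F i z)"
  by (induction I rule: infinite_finite_induct) (auto intro: past_const past_mult)

section \<open>Conditional means and the classes of bounded functions\<close>

lemma trans_prob_le_1:
  assumes "\<omega> \<in> space env_space" "e \<in> units" shows "trans_prob \<omega> y (y + e) \<le> 1"
proof -
  have "trans_prob \<omega> y (y + e) \<le> (\<Sum>e\<in>units. trans_prob \<omega> y (y + e))"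
    using assms by (intro member_le_sum finite_units trans_prob_nonneg) auto
  then show ?thesis by (simp add: trans_prob_sum assms)
qed

lemma sum_trans_prob_0: "\<omega> \<in> space env_space \<Longrightarrow> (\<Sum>e\<in>units. trans_prob \<omega> 0 e) = 1"
  using trans_prob_sum[of \<omega> 0] by simp

lemma mean_step_add: "mean_step (\<lambda>\<omega> e. \<phi> \<omega> e + \<psi> \<omega> e) \<omega> = mean_step \<phi> \<omega> + mean_step \<psi> \<omega>"
  by (simp add: mean_step_def algebra_simps sum.distrib)

lemma mean_step_diff: "mean_step (\<lambda>\<omega> e. \<phi> \<omega> e - \<psi> \<omega> e) \<omega> = mean_step \<phi> \<omega> - mean_step \<psi> \<omega>"
  by (simp add: mean_step_def algebra_simps sum_subtractf)

lemma mean_step_mult: "mean_step (\<lambda>\<omega> e. h \<omega> * \<phi> \<omega> e) \<omega> = h \<omega> * mean_step \<phi> \<omega>"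
  by (simp add: mean_step_def algebra_simps sum_distrib_left)

lemma mean_step_const: "\<omega> \<in> space env_space \<Longrightarrow> mean_step (\<lambda>\<omega> e. h \<omega>) \<omega> = h \<omega>"
  using trans_prob_sum[of \<omega> 0] by (simp add: mean_step_def sum_distrib_right[symmetric])

lemma mean_step_mono:
  "\<omega> \<in> space env_space \<Longrightarrow> (\<And>e. e \<in> units \<Longrightarrow> \<phi> \<omega> e \<le> \<psi> \<omega> e) \<Longrightarrow> mean_step \<phi> \<omega> \<le> mean_step \<psi> \<omega>"
  unfolding mean_step_def by (intro sum_mono mult_left_mono trans_prob_nonneg)

lemma mean_step_bound:
  assumes "\<omega> \<in> space env_space" "\<And>e. e \<in> units \<Longrightarrow> \<bar>\<phi> \<omega> e\<bar> \<le> c"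
  shows "\<bar>mean_step \<phi> \<omega>\<bar> \<le> c"
proof -
  have "mean_step \<phi> \<omega> \<le> mean_step (\<lambda>_ _. c) \<omega>" "mean_step (\<lambda>_ _. - c) \<omega> \<le> mean_step \<phi> \<omega>"
    using assms(2) by (auto intro!: mean_step_mono assms(1) simp: abs_le_iff minus_le_iff)
  then show ?thesis using mean_step_const[OF assms(1), of "\<lambda>_. c"] mean_step_const[OF assms(1), of "\<lambda>_. - c"]
    by simp
qed

lemma mean_step_square_le:
  assumes \<omega>: "\<omega> \<in> space env_space"
  shows "(mean_step \<phi> \<omega>)\<^sup>2 \<le> mean_step (\<lambda>\<omega> e. (\<phi> \<omega> e)\<^sup>2) \<omega>"
proof -
  define m where "m = mean_step \<phi> \<omega>"
  have "0 \<le> mean_step (\<lambda>\<omega> e. (\<phi> \<omega> e - m)\<^sup>2) \<omega>"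
    unfolding mean_step_def by (intro sum_nonneg mult_nonneg_nonneg trans_prob_nonneg \<omega>) auto
  also have "\<dots> = (\<Sum>e\<in>units. trans_prob \<omega> 0 e * (\<phi> \<omega> e)\<^sup>2 - (2 * m) * (trans_prob \<omega> 0 e * \<phi> \<omega> e) + m\<^sup>2 * trans_prob \<omega> 0 e)"
    unfolding mean_step_def by (intro sum.cong refl) (simp add: power2_eq_square algebra_simps)
  also have "\<dots> = mean_step (\<lambda>\<omega> e. (\<phi> \<omega> e)\<^sup>2) \<omega> - (2 * m) * m + m\<^sup>2 * 1"
    using trans_prob_sum[OF \<omega>, of 0]
    by (simp add: sum.distrib sum_subtractf sum_distrib_left[symmetric] m_def mean_step_def)
  finally show ?thesis by (simp add: m_def power2_eq_square)
qed

lemma mean_step_measurable: "step_measurable \<phi> \<Longrightarrow> mean_step \<phi> \<in> borel_measurable env_space"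
  unfolding mean_step_def[abs_def] step_measurable_def by (intro borel_measurable_sum borel_measurable_times) auto

lemma step_measurable_shift: "g \<in> borel_measurable env_space \<Longrightarrow> step_measurable (\<lambda>\<omega> e. g (env_shift e \<omega>))"
  unfolding step_measurable_def by (auto intro: measurable_compose[OF env_shift_measurable])

lemma step_measurable_base: "g \<in> borel_measurable env_space \<Longrightarrow> step_measurable (\<lambda>\<omega> e. g \<omega>)"
  unfolding step_measurable_def by auto

lemma step_measurable_step: "step_measurable (\<lambda>\<omega> e. c e)"
  unfolding step_measurable_def by auto

lemma step_measurable_arith:
  assumes "step_measurable \<phi>" "step_measurable \<psi>"
  shows "step_measurable (\<lambda>\<omega> e. \<phi> \<omega> e + \<psi> \<omega> e)" "step_measurable (\<lambda>\<omega> e. \<phi> \<omega> e - \<psi> \<omega> e)"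
    "step_measurable (\<lambda>\<omega> e. \<phi> \<omega> e * \<psi> \<omega> e)"
  using assms unfolding step_measurable_def
  by (simp_all add: borel_measurable_add borel_measurable_diff borel_measurable_times)

lemma step_measurable_reverse:
  "step_measurable \<phi> \<Longrightarrow> step_measurable (\<lambda>\<omega> e. \<phi> (env_shift e \<omega>) (- e))"
  unfolding step_measurable_def by (auto intro: measurable_compose[OF env_shift_measurable])

lemma trans_op_measurable: "g \<in> borel_measurable env_space \<Longrightarrow> trans_op g \<in> borel_measurable env_space"
  unfolding trans_op_def by (intro mean_step_measurable step_measurable_shift)

lemma bdd_envD: "bdd_env g \<Longrightarrow> g \<in> borel_measurable env_space"
  by (simp add: bdd_env_def)

lemma bdd_env_trans_op: "bdd_env g \<Longrightarrow> bdd_env (trans_op g)"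
  unfolding bdd_env_def using trans_op_measurable[of g]
  by (auto simp: trans_op_def intro!: mean_step_bound env_shift_space)

lemma bdd_env_const: "bdd_env (\<lambda>_. c)"
  by (auto simp: bdd_env_def)

lemma bdd_env_add: "bdd_env f \<Longrightarrow> bdd_env g \<Longrightarrow> bdd_env (\<lambda>\<omega>. f \<omega> + g \<omega>)"
proof -
  assume f: "bdd_env f" and g: "bdd_env g"
  then obtain a b where ab: "\<And>\<omega>. \<omega> \<in> space env_space \<Longrightarrow> \<bar>f \<omega>\<bar> \<le> a"
    "\<And>\<omega>. \<omega> \<in> space env_space \<Longrightarrow> \<bar>g \<omega>\<bar> \<le> b" by (auto simp: bdd_env_def)
  have "\<bar>f \<omega> + g \<omega>\<bar> \<le> a + b" if "\<omega> \<in> space env_space" for \<omega> using ab[OF that] by linarith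
  then show ?thesis using f g by (auto simp: bdd_env_def)
qed

lemma bdd_env_cmult: "bdd_env f \<Longrightarrow> bdd_env (\<lambda>\<omega>. c * f \<omega>)"
proof -
  assume f: "bdd_env f"
  then obtain a where "\<And>\<omega>. \<omega> \<in> space env_space \<Longrightarrow> \<bar>f \<omega>\<bar> \<le> a" by (auto simp: bdd_env_def)
  then have "\<bar>c * f \<omega>\<bar> \<le> \<bar>c\<bar> * a" if "\<omega> \<in> space env_space" for \<omega>
    using that by (simp add: abs_mult mult_left_mono)
  then show ?thesis using f by (auto simp: bdd_env_def)
qed

lemma bdd_env_diff: "bdd_env f \<Longrightarrow> bdd_env g \<Longrightarrow> bdd_env (\<lambda>\<omega>. f \<omega> - g \<omega>)"
  using bdd_env_add[OF _ bdd_env_cmult[of g "-1"], of f] by simp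

lemma bdd_step_measurable: "bdd_step \<phi> \<Longrightarrow> step_measurable \<phi>"
  by (simp add: bdd_step_def)

lemma bdd_step_mean: "bdd_step \<phi> \<Longrightarrow> bdd_env (mean_step \<phi>)"
  unfolding bdd_step_def bdd_env_def using mean_step_measurable[of \<phi>] by (auto intro!: mean_step_bound)

lemma bdd_step_shift: "bdd_env g \<Longrightarrow> bdd_step (\<lambda>\<omega> e. g (env_shift e \<omega>))"
  unfolding bdd_env_def bdd_step_def using step_measurable_shift[of g] by (auto intro: env_shift_space)

lemma bdd_step_base: "bdd_env g \<Longrightarrow> bdd_step (\<lambda>\<omega> e. g \<omega>)"
  unfolding bdd_env_def bdd_step_def using step_measurable_base[of g] by auto

lemma bdd_step_step: "bdd_step (\<lambda>\<omega> e. c e)"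
proof -
  have "\<bar>c e\<bar> \<le> (\<Sum>e\<in>units. \<bar>c e\<bar>)" if "e \<in> units" for e :: "int ^ 'a"
    using that by (intro member_le_sum finite_units) auto
  then show ?thesis unfolding bdd_step_def using step_measurable_step[of c] by auto
qed

lemma bdd_step_mult: "bdd_step \<phi> \<Longrightarrow> bdd_step \<psi> \<Longrightarrow> bdd_step (\<lambda>\<omega> e. \<phi> \<omega> e * \<psi> \<omega> e)"
proof -
  assume f: "bdd_step \<phi>" and g: "bdd_step \<psi>"
  then obtain a b where ab: "\<And>\<omega> e. \<omega> \<in> space env_space \<Longrightarrow> e \<in> units \<Longrightarrow> \<bar>\<phi> \<omega> e\<bar> \<le> a"
    "\<And>\<omega> e. \<omega> \<in> space env_space \<Longrightarrow> e \<in> units \<Longrightarrow> \<bar>\<psi> \<omega> e\<bar> \<le> b" by (auto simp: bdd_step_def) blast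
  have "\<bar>\<phi> \<omega> e * \<psi> \<omega> e\<bar> \<le> a * b" if "\<omega> \<in> space env_space" "e \<in> units" for \<omega> e
    using mult_mono[OF ab(1)[OF that] ab(2)[OF that]] abs_ge_zero[of "\<phi> \<omega> e"] ab(1)[OF that] by (simp add: abs_mult)
  then show ?thesis using f g step_measurable_arith(3)[of \<phi> \<psi>] by (auto simp: bdd_step_def)
qed

lemma bdd_step_add: "bdd_step \<phi> \<Longrightarrow> bdd_step \<psi> \<Longrightarrow> bdd_step (\<lambda>\<omega> e. \<phi> \<omega> e + \<psi> \<omega> e)"
proof -
  assume f: "bdd_step \<phi>" and g: "bdd_step \<psi>"
  then obtain a b where ab: "\<And>\<omega> e. \<omega> \<in> space env_space \<Longrightarrow> e \<in> units \<Longrightarrow> \<bar>\<phi> \<omega> e\<bar> \<le> a"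
    "\<And>\<omega> e. \<omega> \<in> space env_space \<Longrightarrow> e \<in> units \<Longrightarrow> \<bar>\<psi> \<omega> e\<bar> \<le> b" by (auto simp: bdd_step_def) blast
  have "\<bar>\<phi> \<omega> e + \<psi> \<omega> e\<bar> \<le> a + b" if "\<omega> \<in> space env_space" "e \<in> units" for \<omega> e
    using ab(1)[OF that] ab(2)[OF that] by linarith
  then show ?thesis using f g step_measurable_arith(1)[of \<phi> \<psi>] by (auto simp: bdd_step_def)
qed

lemma bdd_step_diff: "bdd_step \<phi> \<Longrightarrow> bdd_step \<psi> \<Longrightarrow> bdd_step (\<lambda>\<omega> e. \<phi> \<omega> e - \<psi> \<omega> e)"
  using bdd_step_add[OF _ bdd_step_mult[OF bdd_step_step[of "\<lambda>_. -1"]], of \<phi> \<psi>] by simp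

section \<open>Markov property, reversal and stationarity under \<open>Q0\<close>\<close>

context rcm
begin

sublocale W: annealed_walk Q "\<lambda>\<omega>. \<omega>"
  by unfold_locales (auto simp: Q.prob_space_axioms sets_Q)

abbreviation A :: "('d env \<times> 'd path) measure" where
  "A \<equiv> annealed Q walk0"

sublocale A: prob_space A
  by (rule W.prob_space_A)

lemma sets_A [measurable_cong]: "sets A = sets (env_space \<Otimes>\<^sub>M path_space)"
  by (rule W.sets_A)

lemma env_seen_A [measurable]: "env_seen n \<in> A \<rightarrow>\<^sub>M env_space"
  by (simp add: measurable_cong_sets[OF sets_A refl] env_seen_measurable)

lemma env_seen_space_A: "z \<in> space A \<Longrightarrow> env_seen n z \<in> space env_space"
  by (rule env_seen_space) (simp add: W.space_A)

lemma past_measurable: "past n F \<Longrightarrow> F \<in> borel_measurable A"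
  by (simp add: past_def measurable_cong_sets[OF sets_A refl])

lemma measurable_step_fun_A: "step_measurable \<phi> \<Longrightarrow> (\<lambda>z. \<phi> (env_seen n z) (step n z)) \<in> borel_measurable A"
  using measurable_step_fun[of \<phi> n] by (simp add: measurable_cong_sets[OF sets_A refl])

text \<open>Extending a path by e multiplies its cylinder probability by the transition probability
  in the environment seen from its end, and summation over e yields \<open>mean_step\<close>. The
  functional F is Banach-valued because complex exponential martingales are treated in the same
  way.\<close>

lemma
  fixes F :: "'d env \<times> 'd path \<Rightarrow> 'b::{banach,second_countable_topology}"
  assumes F: "past n F" and \<phi>: "step_measurable \<phi>"
    and i: "integrable A (\<lambda>z. \<phi> (env_seen n z) (step n z) *\<^sub>R F z)"
  shows markov_integrable: "integrable A (\<lambda>z. mean_step \<phi> (env_seen n z) *\<^sub>R F z)"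
    and markov: "(\<integral>z. \<phi> (env_seen n z) (step n z) *\<^sub>R F z \<partial>A) =
      (\<integral>z. mean_step \<phi> (env_seen n z) *\<^sub>R F z \<partial>A)"
proof -
  let ?G = "\<lambda>z. \<phi> (env_seen n z) (step n z) *\<^sub>R F z"
  let ?H = "\<lambda>z. mean_step \<phi> (env_seen n z) *\<^sub>R F z"
  let ?c = "\<lambda>p \<omega>. cyl_prob \<omega> 0 n p"
  have Fd: "F (\<omega>, X) = F (\<omega>, X')" if "\<And>k. k \<le> n \<Longrightarrow> X k = X' k" for \<omega> X X'
    using F that by (auto simp: past_def depends_upto_def)
  have Gm: "?G \<in> borel_measurable (env_space \<Otimes>\<^sub>M path_space)"
    using F measurable_step_fun[OF \<phi>, of n] by (auto simp: past_def)
  have Gd: "depends_upto (Suc n) ?G"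
    unfolding depends_upto_def
  proof (intro allI impI)
    fix \<omega> and X X' :: "'d path" assume *: "\<forall>k\<le>Suc n. X k = X' k"
    then have "F (\<omega>, X) = F (\<omega>, X')" by (intro Fd) simp
    then show "?G (\<omega>, X) = ?G (\<omega>, X')" using * by (simp add: env_seen_def step_def)
  qed
  have Hm: "?H \<in> borel_measurable (env_space \<Otimes>\<^sub>M path_space)"
    using F measurable_compose[OF env_seen_measurable mean_step_measurable[OF \<phi>], of n] by (auto simp: past_def)
  have Hd: "depends_upto n ?H"
    unfolding depends_upto_def
  proof (intro allI impI)
    fix \<omega> and X X' :: "'d path" assume *: "\<forall>k\<le>n. X k = X' k"
    then have "F (\<omega>, X) = F (\<omega>, X')" by (intro Fd) simp
    then show "?H (\<omega>, X) = ?H (\<omega>, X')" using * by (simp add: env_seen_def)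
  qed
  have ext: "cyl_prob \<omega> 0 (Suc n) (extend_path n p e) *\<^sub>R ?G (\<omega>, extend_path n p e) =
      (?c p \<omega> * (trans_prob (env_shift (p n) \<omega>) 0 e * \<phi> (env_shift (p n) \<omega>) e)) *\<^sub>R F (\<omega>, p)"
    if "e \<in> units" for p e \<omega>
  proof -
    have "F (\<omega>, extend_path n p e) = F (\<omega>, p)" by (rule Fd) simp
    then show ?thesis
      using that by (simp add: cyl_prob_extend trans_prob_env_shift env_seen_def step_def mult.assoc)
  qed
  have sumH: "(\<Sum>e\<in>units. (?c p \<omega> * (trans_prob (env_shift (p n) \<omega>) 0 e * \<phi> (env_shift (p n) \<omega>) e)) *\<^sub>R F (\<omega>, p)) =
      ?c p \<omega> *\<^sub>R ?H (\<omega>, p)" for p \<omega>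
    by (simp add: mean_step_def env_seen_def scaleR_sum_left[symmetric] sum_distrib_left[symmetric])
  have iG: "integrable Q (\<lambda>\<omega>. cyl_prob \<omega> 0 (Suc n) q *\<^sub>R ?G (\<omega>, q))" if "q \<in> paths (Suc n)" for q
    using W.integrable_iff_paths[OF Gm Gd] i that by blast
  have ie: "integrable Q (\<lambda>\<omega>. (?c p \<omega> * (trans_prob (env_shift (p n) \<omega>) 0 e * \<phi> (env_shift (p n) \<omega>) e)) *\<^sub>R F (\<omega>, p))"
    if "p \<in> paths n" "e \<in> units" for p e
  proof -
    have "extend_path n p e \<in> paths (Suc n)" using that by auto
    from iG[OF this] show ?thesis by (simp only: ext[OF that(2)])
  qed
  show iH: "integrable A ?H"
    unfolding W.integrable_iff_paths[OF Hm Hd] sumH[symmetric]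
    by (intro ballI Bochner_Integration.integrable_sum ie)
  have "(\<integral>z. ?G z \<partial>A) = (\<Sum>p\<in>paths n. \<Sum>e\<in>units. \<integral>\<omega>. cyl_prob \<omega> 0 (Suc n) (extend_path n p e) *\<^sub>R ?G (\<omega>, extend_path n p e) \<partial>Q)"
    unfolding W.integral_paths[OF Gm Gd i] by (rule sum_paths_Suc)
  also have "\<dots> = (\<Sum>p\<in>paths n. \<Sum>e\<in>units. \<integral>\<omega>. (?c p \<omega> * (trans_prob (env_shift (p n) \<omega>) 0 e * \<phi> (env_shift (p n) \<omega>) e)) *\<^sub>R F (\<omega>, p) \<partial>Q)"
    by (intro sum.cong refl Bochner_Integration.integral_cong ext)
  also have "\<dots> = (\<Sum>p\<in>paths n. \<integral>\<omega>. ?c p \<omega> *\<^sub>R ?H (\<omega>, p) \<partial>Q)"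
    unfolding sumH[symmetric]
    by (intro sum.cong refl Bochner_Integration.integral_sum[symmetric] ie)
  also have "\<dots> = (\<integral>z. ?H z \<partial>A)" by (rule W.integral_paths[OF Hm Hd iH, symmetric])
  finally show "(\<integral>z. ?G z \<partial>A) = (\<integral>z. ?H z \<partial>A)" .
qed

lemma
  assumes \<phi>: "step_measurable \<phi>" and i: "integrable A (\<lambda>z. \<phi> (env_seen n z) (step n z))"
  shows markov1_integrable: "integrable A (\<lambda>z. mean_step \<phi> (env_seen n z))"
    and markov1: "(\<integral>z. \<phi> (env_seen n z) (step n z) \<partial>A) = (\<integral>z. mean_step \<phi> (env_seen n z) \<partial>A)"
  using markov_integrable[OF past_const[of n "1::real"] \<phi>] markov[OF past_const[of n "1::real"] \<phi>] i by simp_all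

lemma
  fixes g :: "'d env \<Rightarrow> real"
  assumes g: "g \<in> borel_measurable env_space"
  shows integrable_env_seen_0: "integrable A (\<lambda>z. g (env_seen 0 z)) \<longleftrightarrow> integrable Q g"
    and integral_env_seen_0: "integrable Q g \<Longrightarrow> (\<integral>z. g (env_seen 0 z) \<partial>A) = (\<integral>\<omega>. g \<omega> \<partial>Q)"
proof -
  have m: "(\<lambda>z. g (env_seen 0 z)) \<in> borel_measurable (env_space \<Otimes>\<^sub>M path_space)"
    and d: "depends_upto 0 (\<lambda>z. g (env_seen 0 z))"
    using env_seen_past[OF order.refl g, of 0] by (auto simp: past_def)
  have eq: "cyl_prob \<omega> 0 0 (\<lambda>_. 0) *\<^sub>R g (env_seen 0 (\<omega>, \<lambda>_. 0)) = g \<omega>" if "\<omega> \<in> space Q" for \<omega>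
    using that by (simp add: cyl_prob_def env_seen_def env_shift_zero space_Q)
  show iff: "integrable A (\<lambda>z. g (env_seen 0 z)) \<longleftrightarrow> integrable Q g"
    unfolding W.integrable_iff_paths[OF m d]
    by (simp add: Bochner_Integration.integrable_cong[OF refl eq] del: real_scaleR_def)
  assume "integrable Q g"
  then have "integrable A (\<lambda>z. g (env_seen 0 z))" by (simp add: iff)
  from W.integral_paths[OF m d this] show "(\<integral>z. g (env_seen 0 z) \<partial>A) = (\<integral>\<omega>. g \<omega> \<partial>Q)"
    by (simp add: Bochner_Integration.integral_cong[OF refl eq] del: real_scaleR_def)
qed

lemma
  assumes \<phi>: "step_measurable \<phi>"
  shows integrable_first_step: "integrable A (\<lambda>z. \<phi> (env_seen 0 z) (step 0 z)) \<longleftrightarrow>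
      (\<forall>e\<in>units. integrable Q (\<lambda>\<omega>. trans_prob \<omega> 0 e * \<phi> \<omega> e))"
    and integral_first_step: "integrable A (\<lambda>z. \<phi> (env_seen 0 z) (step 0 z)) \<Longrightarrow>
      (\<integral>z. \<phi> (env_seen 0 z) (step 0 z) \<partial>A) = (\<Sum>e\<in>units. \<integral>\<omega>. trans_prob \<omega> 0 e * \<phi> \<omega> e \<partial>Q)"
proof -
  let ?G = "\<lambda>z. \<phi> (env_seen 0 z) (step 0 z)"
  have m: "?G \<in> borel_measurable (env_space \<Otimes>\<^sub>M path_space)" and d: "depends_upto (Suc 0) ?G"
    using step_past[OF _ \<phi>, of 0 "Suc 0"] by (auto simp: past_def)
  have eq: "cyl_prob \<omega> 0 (Suc 0) (extend_path 0 (\<lambda>_. 0) e) *\<^sub>R ?G (\<omega>, extend_path 0 (\<lambda>_. 0) e) =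
      trans_prob \<omega> 0 e * \<phi> \<omega> e" if "\<omega> \<in> space Q" for \<omega> e
    using that unfolding cyl_prob_extend
    by (simp add: env_seen_def step_def env_shift_zero space_Q cyl_prob_def)
  show "integrable A ?G \<longleftrightarrow> (\<forall>e\<in>units. integrable Q (\<lambda>\<omega>. trans_prob \<omega> 0 e * \<phi> \<omega> e))"
    unfolding W.integrable_iff_paths[OF m d]
    by (simp add: Bochner_Integration.integrable_cong[OF refl eq] del: real_scaleR_def)
  assume i: "integrable A ?G"
  show "(\<integral>z. ?G z \<partial>A) = (\<Sum>e\<in>units. \<integral>\<omega>. trans_prob \<omega> 0 e * \<phi> \<omega> e \<partial>Q)"
    unfolding W.integral_paths[OF m d i] sum_paths_Suc
    by (simp add: Bochner_Integration.integral_cong[OF refl eq] del: real_scaleR_def)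
qed

text \<open>Detailed balance summed over the steps: the first environment together with the first
  step has the same law as the second environment together with the reversed step.\<close>

lemma
  assumes \<phi>: "step_measurable \<phi>" and i: "integrable A (\<lambda>z. \<phi> (env_seen 0 z) (step 0 z))"
  shows reversal_integrable: "integrable A (\<lambda>z. \<phi> (env_seen (Suc 0) z) (- step 0 z))"
    and reversal: "(\<integral>z. \<phi> (env_seen 0 z) (step 0 z) \<partial>A) = (\<integral>z. \<phi> (env_seen (Suc 0) z) (- step 0 z) \<partial>A)"
proof -
  let ?\<psi> = "\<lambda>\<omega> e. \<phi> (env_shift e \<omega>) (- e)"
  have \<psi>: "step_measurable ?\<psi>" using \<phi> by (rule step_measurable_reverse)
  have m: "(\<lambda>\<omega>. \<phi> \<omega> e) \<in> borel_measurable env_space" for e using \<phi> by (simp add: step_measurable_def)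
  have eq: "\<phi> (env_seen (Suc 0) z) (- step 0 z) = ?\<psi> (env_seen 0 z) (step 0 z)" for z
    by (simp add: env_seen_Suc)
  have i': "\<forall>e\<in>units. integrable Q (\<lambda>\<omega>. trans_prob \<omega> 0 e * \<phi> \<omega> e)"
    using i integrable_first_step[OF \<phi>] by simp
  then have "\<forall>e\<in>units. integrable Q (\<lambda>\<omega>. trans_prob \<omega> 0 e * ?\<psi> \<omega> e)"
    using one_step_reversal_integrable[OF _ m] uminus_units by auto
  then show I: "integrable A (\<lambda>z. \<phi> (env_seen (Suc 0) z) (- step 0 z))"
    unfolding eq using integrable_first_step[OF \<psi>] by simp
  have "(\<integral>z. \<phi> (env_seen (Suc 0) z) (- step 0 z) \<partial>A) = (\<Sum>e\<in>units. \<integral>\<omega>. trans_prob \<omega> 0 e * ?\<psi> \<omega> e \<partial>Q)"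
    using I unfolding eq by (rule integral_first_step[OF \<psi>])
  also have "\<dots> = (\<Sum>e\<in>units. \<integral>\<omega>. trans_prob \<omega> 0 (- e) * \<phi> \<omega> (- e) \<partial>Q)"
    by (intro sum.cong refl one_step_reversal m)
  also have "\<dots> = (\<Sum>e\<in>units. \<integral>\<omega>. trans_prob \<omega> 0 e * \<phi> \<omega> e \<partial>Q)"
    by (rule sum.reindex_bij_betw[OF bij_betw_uminus_units])
  also have "\<dots> = (\<integral>z. \<phi> (env_seen 0 z) (step 0 z) \<partial>A)"
    using i by (rule integral_first_step[OF \<phi>, symmetric])
  finally show "(\<integral>z. \<phi> (env_seen 0 z) (step 0 z) \<partial>A) = (\<integral>z. \<phi> (env_seen (Suc 0) z) (- step 0 z) \<partial>A)" by simp
qed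

lemma prob_env_seen: "A.prob (env_seen n -` B \<inter> space A) = (\<integral>z. indicator B (env_seen n z) \<partial>A)"
proof -
  have "(\<integral>z. indicator B (env_seen n z) \<partial>A) = (\<integral>z. indicator (env_seen n -` B \<inter> space A) z \<partial>A :: real)"
    by (intro Bochner_Integration.integral_cong) (auto simp: indicator_def)
  then show ?thesis by simp
qed

text \<open>Stationarity by induction: the Markov property reduces the claim to one step, where
  detailed balance turns the shifted event into the event itself with e replaced by - e.\<close>

lemma distr_env_seen: "distr A env_space (env_seen n) = Q"
proof (induction n)
  case 0
  show ?case
  proof (rule measure_eqI)
    fix B assume "B \<in> sets (distr A env_space (env_seen 0))"
    then have B [measurable]: "B \<in> sets env_space" by simp
    have "A.prob (env_seen 0 -` B \<inter> space A) = (\<integral>z. indicator B (env_seen 0 z) \<partial>A)"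
      by (rule prob_env_seen)
    also have "\<dots> = (\<integral>\<omega>. indicator B \<omega> \<partial>Q)"
      by (rule integral_env_seen_0) (auto intro!: Q.integrable_const_bound[where B = 1])
    also have "\<dots> = Q.prob B"
      using sets.sets_into_space[OF B] by (simp add: space_Q Int_absorb2)
    finally show "emeasure (distr A env_space (env_seen 0)) B = emeasure Q B"
      by (simp add: emeasure_distr A.emeasure_eq_measure Q.emeasure_eq_measure)
  qed (simp add: sets_Q)
next
  case (Suc n)
  show ?case
  proof (rule measure_eqI)
    fix B assume "B \<in> sets (distr A env_space (env_seen (Suc n)))"
    then have B [measurable]: "B \<in> sets env_space" by simp
    let ?\<phi> = "\<lambda>\<omega> e. indicator B (env_shift e \<omega>) :: real"
    have \<phi>: "step_measurable ?\<phi>" by (rule step_measurable_shift) simp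
    have bd: "\<bar>?\<phi> \<omega> e\<bar> \<le> 1" for \<omega> e by (simp add: indicator_def)
    have "A.prob (env_seen (Suc n) -` B \<inter> space A) = (\<integral>z. indicator B (env_seen (Suc n) z) \<partial>A)"
      by (rule prob_env_seen)
    also have "\<dots> = (\<integral>z. ?\<phi> (env_seen n z) (step n z) \<partial>A)" by (simp only: env_seen_Suc)
    also have "\<dots> = (\<integral>z. mean_step ?\<phi> (env_seen n z) \<partial>A)"
      using measurable_step_fun_A[OF \<phi>] bd
      by (intro markov1[OF \<phi>] A.integrable_const_bound[where B = 1]) auto
    also have "\<dots> = (\<integral>\<omega>. mean_step ?\<phi> \<omega> \<partial>Q)"
      using integral_distr[OF env_seen_A mean_step_measurable[OF \<phi>], of n] by (simp only: Suc)
    also have "\<dots> = (\<Sum>e\<in>units. \<integral>\<omega>. trans_prob \<omega> 0 e * ?\<phi> \<omega> e \<partial>Q)"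
      unfolding mean_step_def
    proof (intro Bochner_Integration.integral_sum Q.integrable_const_bound[where B = 1])
      fix e :: "int ^ 'd" assume e: "e \<in> units"
      show "AE \<omega> in Q. norm (trans_prob \<omega> 0 e * ?\<phi> \<omega> e) \<le> 1"
        using trans_prob_le_1[OF _ e, of _ 0] trans_prob_nonneg[of _ 0 e]
        by (intro AE_I2) (auto simp: space_Q indicator_def)
      show "(\<lambda>\<omega>. trans_prob \<omega> 0 e * ?\<phi> \<omega> e) \<in> borel_measurable Q"
        using \<phi> by (simp add: step_measurable_def measurable_cong_sets[OF sets_Q refl] borel_measurable_times)
    qed
    also have "\<dots> = (\<Sum>e\<in>units. \<integral>\<omega>. trans_prob \<omega> 0 (- e) * indicator B \<omega> \<partial>Q)"
      by (intro sum.cong refl one_step_reversal) auto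
    also have "\<dots> = (\<Sum>e\<in>units. \<integral>\<omega>. trans_prob \<omega> 0 e * indicator B \<omega> \<partial>Q)"
      by (rule sum.reindex_bij_betw[OF bij_betw_uminus_units])
    also have "\<dots> = (\<integral>\<omega>. (\<Sum>e\<in>units. trans_prob \<omega> 0 e * indicator B \<omega>) \<partial>Q)"
    proof (rule Bochner_Integration.integral_sum[symmetric], rule Q.integrable_const_bound[where B = 1])
      fix e :: "int ^ 'd" assume e: "e \<in> units"
      show "AE \<omega> in Q. norm (trans_prob \<omega> 0 e * indicator B \<omega>) \<le> 1"
        using trans_prob_le_1[OF _ e, of _ 0] trans_prob_nonneg[of _ 0 e]
        by (intro AE_I2) (auto simp: space_Q indicator_def)
    qed simp
    also have "\<dots> = (\<integral>\<omega>. indicator B \<omega> \<partial>Q)"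
      by (intro Bochner_Integration.integral_cong)
        (simp_all add: space_Q sum_distrib_right[symmetric] sum_trans_prob_0)
    also have "\<dots> = Q.prob B"
      using sets.sets_into_space[OF B] by (simp add: space_Q Int_absorb2)
    finally show "emeasure (distr A env_space (env_seen (Suc n))) B = emeasure Q B"
      by (simp add: emeasure_distr A.emeasure_eq_measure Q.emeasure_eq_measure)
  qed (simp add: sets_Q)
qed

lemma
  fixes g :: "'d env \<Rightarrow> real"
  assumes g: "g \<in> borel_measurable env_space"
  shows integrable_env_seen: "integrable A (\<lambda>z. g (env_seen n z)) \<longleftrightarrow> integrable Q g"
    and integral_env_seen: "(\<integral>z. g (env_seen n z) \<partial>A) = (\<integral>\<omega>. g \<omega> \<partial>Q)"
  using integrable_distr_eq[OF env_seen_A g, of n] integral_distr[OF env_seen_A g, of n]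
  by (simp_all only: distr_env_seen)

lemma measurable_Q_iff: "g \<in> borel_measurable Q \<longleftrightarrow> g \<in> borel_measurable env_space"
  by (simp add: measurable_cong_sets[OF sets_Q refl])

lemma L2_Q_measurable: "g \<in> L2 Q \<Longrightarrow> g \<in> borel_measurable env_space"
  by (simp add: L2_def measurable_Q_iff)

lemma
  assumes g: "g \<in> L2 Q"
  shows L2_env_seen: "(\<lambda>z. g (env_seen n z)) \<in> L2 A"
    and nrm_env_seen: "nrm A (\<lambda>z. g (env_seen n z)) = nrm Q g"
proof -
  have m: "g \<in> borel_measurable env_space" "(\<lambda>\<omega>. (g \<omega>)\<^sup>2) \<in> borel_measurable env_space"
    using L2_Q_measurable[OF g] by auto
  show "(\<lambda>z. g (env_seen n z)) \<in> L2 A"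
    using g m integrable_env_seen[OF m(2), of n] by (auto simp: L2_def measurable_compose[OF env_seen_A m(1)])
  show "nrm A (\<lambda>z. g (env_seen n z)) = nrm Q g"
    using integral_env_seen[OF m(2), of n] by (simp add: nrm_def)
qed

lemma bdd_env_L2: "bdd_env g \<Longrightarrow> g \<in> L2 Q"
  unfolding bdd_env_def by (auto simp: space_Q measurable_Q_iff intro!: Q.L2_bounded AE_I2)

lemma AE_step_units: "AE z in A. step n z \<in> units"
  using W.AE_step[of n] by (simp add: step_def)

lemma bdd_step_AE:
  assumes "bdd_step \<phi>"
  obtains c where "0 \<le> c" "\<And>n. AE z in A. \<bar>\<phi> (env_seen n z) (step n z)\<bar> \<le> c"
proof -
  obtain c where c: "\<And>\<omega> e. \<omega> \<in> space env_space \<Longrightarrow> e \<in> units \<Longrightarrow> \<bar>\<phi> \<omega> e\<bar> \<le> c"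
    using assms by (auto simp: bdd_step_def)
  have "AE z in A. \<bar>\<phi> (env_seen n z) (step n z)\<bar> \<le> \<bar>c\<bar>" for n
    using AE_step_units[of n] AE_space
  proof eventually_elim
    case (elim z)
    then show ?case using c[OF env_seen_space_A[OF elim(2)] elim(1), of n] by linarith
  qed
  then show ?thesis using that[of "\<bar>c\<bar>"] by simp
qed

lemma bdd_step_L2:
  assumes "bdd_step \<phi>"
  shows "(\<lambda>z. \<phi> (env_seen n z) (step n z)) \<in> L2 A"
proof -
  obtain c where "0 \<le> c" "\<And>n. AE z in A. \<bar>\<phi> (env_seen n z) (step n z)\<bar> \<le> c"
    by (rule bdd_step_AE[OF assms]) blast
  from A.L2_bounded(1)[OF measurable_step_fun_A[OF bdd_step_measurable[OF assms]] this(2)] show ?thesis .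
qed

lemma trans_op_L2:
  assumes g: "g \<in> L2 Q"
  shows "trans_op g \<in> L2 Q"
proof -
  have m: "g \<in> borel_measurable env_space" by (rule L2_Q_measurable[OF g])
  let ?\<phi> = "\<lambda>\<omega> e. (g (env_shift e \<omega>))\<^sup>2"
  have \<phi>: "step_measurable ?\<phi>" using step_measurable_shift[of "\<lambda>\<omega>. (g \<omega>)\<^sup>2"] m by simp
  have "integrable A (\<lambda>z. ?\<phi> (env_seen 0 z) (step 0 z))"
    using L2_integrable_sq[OF L2_env_seen[OF g, of "Suc 0"]] by (simp add: env_seen_Suc)
  from markov1_integrable[OF \<phi> this]
  have i: "integrable Q (mean_step ?\<phi>)" using integrable_env_seen[OF mean_step_measurable[OF \<phi>]] by simp
  have tm: "trans_op g \<in> borel_measurable Q" using trans_op_measurable[OF m] by (simp add: measurable_Q_iff)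
  have "integrable Q (\<lambda>\<omega>. (trans_op g \<omega>)\<^sup>2)"
  proof (rule Bochner_Integration.integrable_bound[OF i])
    show "AE \<omega> in Q. norm ((trans_op g \<omega>)\<^sup>2) \<le> norm (mean_step ?\<phi> \<omega>)"
      using mean_step_square_le[of _ "\<lambda>\<omega> e. g (env_shift e \<omega>)"]
      by (intro AE_I2) (auto simp: trans_op_def space_Q intro: order_trans[OF _ abs_ge_self])
  qed (use tm in auto)
  then show ?thesis using tm by (simp add: L2_def)
qed

end

section \<open>The space of functions of finite asymptotic variance\<close>

definition mdiff :: "('d::finite env \<Rightarrow> real) \<Rightarrow> 'd env \<Rightarrow> int ^ 'd \<Rightarrow> real" where
  "mdiff v = (\<lambda>\<omega> e. v (env_shift e \<omega>) - trans_op v \<omega>)"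

text \<open>The upper index is excluded, so a sum up to N inclusive is
  \<open>ssum f (Suc N)\<close>. This sum is known at time N, whereas \<open>mart \<phi> n\<close>
  needs the position at time n.\<close>

definition ssum :: "('d::finite env \<Rightarrow> real) \<Rightarrow> nat \<Rightarrow> 'd env \<times> 'd path \<Rightarrow> real" where
  "ssum f n z = (\<Sum>k<n. f (env_seen k z))"

definition mart :: "('d::finite env \<Rightarrow> int ^ 'd \<Rightarrow> real) \<Rightarrow> nat \<Rightarrow> 'd env \<times> 'd path \<Rightarrow> real" where
  "mart \<phi> n z = (\<Sum>k<n. \<phi> (env_seen k z) (step k z))"

lemma trans_op_add: "trans_op (\<lambda>\<omega>. f \<omega> + g \<omega>) \<omega> = trans_op f \<omega> + trans_op g \<omega>"
  by (simp add: trans_op_def mean_step_add)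

lemma trans_op_cmult: "trans_op (\<lambda>\<omega>. c * f \<omega>) \<omega> = c * trans_op f \<omega>"
  by (simp add: trans_op_def mean_step_def sum_distrib_left algebra_simps)

lemma trans_op_sum: "trans_op (\<lambda>\<omega>. \<Sum>i\<in>I. f i \<omega>) \<omega> = (\<Sum>i\<in>I. trans_op (f i) \<omega>)"
proof -
  have "(\<Sum>e\<in>units. \<Sum>i\<in>I. trans_prob \<omega> 0 e * f i (env_shift e \<omega>)) =
      (\<Sum>i\<in>I. \<Sum>e\<in>units. trans_prob \<omega> 0 e * f i (env_shift e \<omega>))"
    by (rule sum.swap)
  then show ?thesis by (simp add: trans_op_def mean_step_def sum_distrib_left)
qed

lemma mdiff_bdd: "bdd_env v \<Longrightarrow> bdd_step (mdiff v)"
  unfolding mdiff_def by (intro bdd_step_diff bdd_step_shift bdd_step_base bdd_env_trans_op)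

lemma mean_step_mdiff: "\<omega> \<in> space env_space \<Longrightarrow> mean_step (mdiff v) \<omega> = 0"
  by (simp add: mdiff_def mean_step_diff mean_step_const) (simp add: trans_op_def)

lemma ssum_coboundary:
  "ssum (\<lambda>\<omega>. v \<omega> - trans_op v \<omega>) n z = mart (mdiff v) n z + v (env_seen 0 z) - v (env_seen n z)"
  by (induction n) (auto simp: ssum_def mart_def mdiff_def env_seen_Suc)

text \<open>The conditional mean minimizes the mean square deviation, so centring at v \<omega> can
  only increase it. This bounds martingale variances by the Dirichlet form.\<close>

lemma mean_step_mdiff_sq_le:
  assumes \<omega>: "\<omega> \<in> space env_space"
  shows "mean_step (\<lambda>\<omega> e. (mdiff v \<omega> e)\<^sup>2) \<omega> \<le> mean_step (\<lambda>\<omega> e. (v (env_shift e \<omega>) - v \<omega>)\<^sup>2) \<omega>"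
proof -
  let ?c = "v \<omega> - trans_op v \<omega>"
  have "mean_step (\<lambda>\<omega> e. (v (env_shift e \<omega>) - v \<omega>)\<^sup>2) \<omega> =
      (\<Sum>e\<in>units. trans_prob \<omega> 0 e * (mdiff v \<omega> e)\<^sup>2 - 2 * ?c * (trans_prob \<omega> 0 e * mdiff v \<omega> e) + ?c\<^sup>2 * trans_prob \<omega> 0 e)"
    unfolding mean_step_def mdiff_def by (intro sum.cong refl) (simp add: power2_eq_square algebra_simps)
  also have "\<dots> = mean_step (\<lambda>\<omega> e. (mdiff v \<omega> e)\<^sup>2) \<omega> - 2 * ?c * mean_step (mdiff v) \<omega> + ?c\<^sup>2 * (\<Sum>e\<in>units. trans_prob \<omega> 0 e)"
    unfolding mean_step_def by (simp only: sum.distrib sum_subtractf sum_distrib_left)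
  finally show ?thesis by (simp add: mean_step_mdiff[OF \<omega>] sum_trans_prob_0[OF \<omega>])
qed

lemma ssum_past: "f \<in> borel_measurable env_space \<Longrightarrow> past n (ssum f (Suc n))"
  unfolding ssum_def[abs_def] by (intro past_sum env_seen_past) auto

lemma mart_past: "step_measurable \<phi> \<Longrightarrow> past n (mart \<phi> n)"
  unfolding mart_def[abs_def] by (intro past_sum step_past) auto

lemma ssum_Suc: "ssum f (Suc n) z = ssum f n z + f (env_seen n z)"
  by (simp add: ssum_def)

lemma mart_Suc: "mart \<phi> (Suc n) z = mart \<phi> n z + \<phi> (env_seen n z) (step n z)"
  by (simp add: mart_def)

lemma ssum_add: "ssum (\<lambda>\<omega>. f \<omega> + g \<omega>) n z = ssum f n z + ssum g n z"
  by (simp add: ssum_def sum.distrib)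

lemma ssum_cmult: "ssum (\<lambda>\<omega>. c * f \<omega>) n z = c * ssum f n z"
  by (simp add: ssum_def sum_distrib_left)

context rcm
begin

section \<open>Inner product, Dirichlet form and approximate Poisson equations\<close>

definition ip :: "('d env \<Rightarrow> real) \<Rightarrow> ('d env \<Rightarrow> real) \<Rightarrow> real" where
  "ip f g = (\<integral>\<omega>. f \<omega> * g \<omega> \<partial>Q)"

definition incr :: "('d env \<Rightarrow> real) \<Rightarrow> 'd env \<times> 'd path \<Rightarrow> real" where
  "incr g z = g (env_seen (Suc 0) z) - g (env_seen 0 z)"

text \<open>The Dirichlet form of I - R (see \<open>energy_eq\<close>), written on path space, where
  symmetry and positivity are evident.\<close>

definition energy :: "('d env \<Rightarrow> real) \<Rightarrow> ('d env \<Rightarrow> real) \<Rightarrow> real" where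
  "energy g h = (1 / 2) * (\<integral>z. incr g z * incr h z \<partial>A)"

definition hm1 :: "real \<Rightarrow> ('d env \<Rightarrow> real) \<Rightarrow> bool" where
  "hm1 K f \<longleftrightarrow> f \<in> L2 Q \<and> (\<forall>g. bdd_env g \<longrightarrow> (ip f g)\<^sup>2 \<le> K * energy g g)"

lemma ip_commute: "ip f g = ip g f"
  by (simp add: ip_def mult.commute)

lemma ip_add: "f \<in> L2 Q \<Longrightarrow> g \<in> L2 Q \<Longrightarrow> h \<in> L2 Q \<Longrightarrow> ip (\<lambda>\<omega>. f \<omega> + g \<omega>) h = ip f h + ip g h"
  by (simp add: ip_def distrib_right L2_integrable_mult)

lemma ip_diff: "f \<in> L2 Q \<Longrightarrow> g \<in> L2 Q \<Longrightarrow> h \<in> L2 Q \<Longrightarrow> ip (\<lambda>\<omega>. f \<omega> - g \<omega>) h = ip f h - ip g h"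
  by (simp add: ip_def left_diff_distrib L2_integrable_mult)

lemma ip_cmult: "ip (\<lambda>\<omega>. c * f \<omega>) h = c * ip f h"
  by (simp add: ip_def mult.assoc)

lemma ip_sum: "(\<And>i. i \<in> I \<Longrightarrow> f i \<in> L2 Q) \<Longrightarrow> h \<in> L2 Q \<Longrightarrow>
    ip (\<lambda>\<omega>. \<Sum>i\<in>I. f i \<omega>) h = (\<Sum>i\<in>I. ip (f i) h)"
  by (simp add: ip_def sum_distrib_right L2_integrable_mult)

lemma ip_self: "ip f f = (nrm Q f)\<^sup>2"
  by (simp add: nrm_sq) (simp add: ip_def power2_eq_square)

lemma ip_Cauchy_Schwarz: "f \<in> L2 Q \<Longrightarrow> g \<in> L2 Q \<Longrightarrow> \<bar>ip f g\<bar> \<le> nrm Q f * nrm Q g"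
  unfolding ip_def by (rule nrm_Cauchy_Schwarz)

lemma integral_env_seen_mult:
  "f \<in> L2 Q \<Longrightarrow> g \<in> L2 Q \<Longrightarrow> (\<integral>z. f (env_seen n z) * g (env_seen n z) \<partial>A) = ip f g"
  unfolding ip_def by (rule integral_env_seen) (auto dest!: L2_Q_measurable)

lemma markov_L2:
  assumes F: "past n F" "F \<in> L2 A" and \<phi>: "step_measurable \<phi>"
    and \<phi>L: "(\<lambda>z. \<phi> (env_seen n z) (step n z)) \<in> L2 A"
  shows "(\<integral>z. \<phi> (env_seen n z) (step n z) * F z \<partial>A) = (\<integral>z. mean_step \<phi> (env_seen n z) * F z \<partial>A)"
  using markov[OF F(1) \<phi>] L2_integrable_mult[OF \<phi>L F(2)] by simp

lemma markov_trans_op: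
  assumes F: "past n F" "F \<in> L2 A" and g: "g \<in> L2 Q"
  shows "(\<integral>z. g (env_seen (Suc n) z) * F z \<partial>A) = (\<integral>z. trans_op g (env_seen n z) * F z \<partial>A)"
  using markov_L2[OF F step_measurable_shift[OF L2_Q_measurable[OF g]]] L2_env_seen[OF g, of "Suc n"]
  by (simp add: env_seen_Suc trans_op_def)

lemma env_shift_back: "z \<in> space A \<Longrightarrow> env_shift (- step n z) (env_seen (Suc n) z) = env_seen n z"
  by (simp add: env_seen_Suc env_shift_env_shift env_shift_zero env_seen_space_A)

lemma ip_trans_op:
  assumes g: "g \<in> L2 Q" and h: "h \<in> L2 Q"
  shows "(\<integral>z. g (env_seen (Suc 0) z) * h (env_seen 0 z) \<partial>A) = ip (trans_op g) h"
  using markov_trans_op[OF env_seen_past[OF le_refl L2_Q_measurable[OF h]] L2_env_seen[OF h] g, of 0]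
    integral_env_seen_mult[OF trans_op_L2[OF g] h] by simp

text \<open>Reversal exchanges the two environments of a single step.\<close>

lemma ip_trans_op_symmetric:
  assumes g: "g \<in> L2 Q" and h: "h \<in> L2 Q"
  shows "ip (trans_op g) h = ip g (trans_op h)"
proof -
  let ?\<phi> = "\<lambda>\<omega> e. g (env_shift e \<omega>) * h \<omega>"
  have \<phi>: "step_measurable ?\<phi>"
    using g h by (intro step_measurable_arith(3) step_measurable_shift step_measurable_base L2_Q_measurable)
  have i: "integrable A (\<lambda>z. ?\<phi> (env_seen 0 z) (step 0 z))"
    using L2_integrable_mult[OF L2_env_seen[OF g, of "Suc 0"] L2_env_seen[OF h, of 0]] by (simp add: env_seen_Suc)
  have "ip (trans_op g) h = (\<integral>z. ?\<phi> (env_seen 0 z) (step 0 z) \<partial>A)"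
    using ip_trans_op[OF g h] by (simp add: env_seen_Suc)
  also have "\<dots> = (\<integral>z. ?\<phi> (env_seen (Suc 0) z) (- step 0 z) \<partial>A)" by (rule reversal[OF \<phi> i])
  also have "\<dots> = (\<integral>z. h (env_seen (Suc 0) z) * g (env_seen 0 z) \<partial>A)"
    by (intro Bochner_Integration.integral_cong) (auto simp: env_shift_back)
  also have "\<dots> = ip g (trans_op h)" using ip_trans_op[OF h g] by (simp add: ip_commute)
  finally show ?thesis .
qed

lemma incr_L2: "g \<in> L2 Q \<Longrightarrow> incr g \<in> L2 A"
  unfolding incr_def[abs_def] by (intro L2_diff L2_env_seen)

lemma energy_eq:
  assumes g: "g \<in> L2 Q" and h: "h \<in> L2 Q"
  shows "energy g h = ip g h - ip (trans_op g) h"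
proof -
  let ?g = "\<lambda>k z. g (env_seen k z)" and ?h = "\<lambda>k z. h (env_seen k z)"
  have i: "integrable A (\<lambda>z. ?g j z * ?h k z)" for j k
    by (rule L2_integrable_mult[OF L2_env_seen[OF g] L2_env_seen[OF h]])
  have "(\<integral>z. incr g z * incr h z \<partial>A) =
      (\<integral>z. (?g (Suc 0) z * ?h (Suc 0) z + ?g 0 z * ?h 0 z) - (?g (Suc 0) z * ?h 0 z + ?g 0 z * ?h (Suc 0) z) \<partial>A)"
    by (intro Bochner_Integration.integral_cong) (auto simp: incr_def algebra_simps)
  also have "\<dots> = (ip g h + ip g h) - (ip (trans_op g) h + (\<integral>z. ?g 0 z * ?h (Suc 0) z \<partial>A))"
    using i by (simp add: integral_env_seen_mult[OF g h] ip_trans_op[OF g h])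
  also have "(\<integral>z. ?g 0 z * ?h (Suc 0) z \<partial>A) = ip (trans_op g) h"
    using ip_trans_op[OF h g] ip_trans_op_symmetric[OF g h] by (simp add: ip_commute mult.commute)
  finally show ?thesis by (simp add: energy_def)
qed

lemma energy_nonneg: "0 \<le> energy g g"
  by (simp add: energy_def)

lemma energy_self: "energy g g = (nrm A (incr g))\<^sup>2 / 2"
  by (simp add: nrm_sq) (simp add: energy_def power2_eq_square)

lemma energy_le: "g \<in> L2 Q \<Longrightarrow> energy g g \<le> 2 * ip g g"
proof -
  assume g: "g \<in> L2 Q"
  have "nrm A (incr g) \<le> 2 * nrm Q g"
    using nrm_triangle_diff[OF L2_env_seen[OF g, of "Suc 0"] L2_env_seen[OF g, of 0]]
    by (simp add: incr_def[abs_def] nrm_env_seen[OF g])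
  then have "(nrm A (incr g))\<^sup>2 \<le> (2 * nrm Q g)\<^sup>2" by (intro power_mono) auto
  then show ?thesis by (simp add: energy_self ip_self power_mult_distrib)
qed

lemma energy_Cauchy_Schwarz:
  assumes g: "g \<in> L2 Q" and h: "h \<in> L2 Q"
  shows "(energy g h)\<^sup>2 \<le> energy g g * energy h h"
  using integral_Cauchy_Schwarz[OF incr_L2[OF g] incr_L2[OF h]]
  by (simp add: energy_def power2_eq_square)

lemma energy_add_scaled:
  assumes g: "g \<in> L2 Q" and h: "h \<in> L2 Q"
  shows "energy (\<lambda>\<omega>. g \<omega> + s * h \<omega>) (\<lambda>\<omega>. g \<omega> + s * h \<omega>) = energy h h * s\<^sup>2 + 2 * energy g h * s + energy g g"
proof -
  have "incr (\<lambda>\<omega>. g \<omega> + s * h \<omega>) = (\<lambda>z. incr g z + s * incr h z)"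
    by (simp add: incr_def fun_eq_iff algebra_simps)
  then show ?thesis
    using L2_integral_add_scaled_sq[OF incr_L2[OF g] incr_L2[OF h], of s]
    by (simp add: energy_def power2_eq_square algebra_simps)
qed

lemma hm1_L2: "hm1 K f \<Longrightarrow> f \<in> L2 Q"
  by (simp add: hm1_def)

lemma hm1D: "hm1 K f \<Longrightarrow> bdd_env g \<Longrightarrow> (ip f g)\<^sup>2 \<le> K * energy g g"
  by (simp add: hm1_def)

lemma hm1_add:
  assumes f: "hm1 K f" and g: "hm1 L g"
  shows "hm1 (2 * (K + L)) (\<lambda>\<omega>. f \<omega> + g \<omega>)"
  unfolding hm1_def
proof (intro conjI allI impI)
  show "(\<lambda>\<omega>. f \<omega> + g \<omega>) \<in> L2 Q" using f g by (intro L2_add hm1_L2)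
  fix h :: "'d env \<Rightarrow> real" assume h: "bdd_env h"
  have "(ip (\<lambda>\<omega>. f \<omega> + g \<omega>) h)\<^sup>2 = (ip f h + ip g h)\<^sup>2"
    using f g h by (simp add: ip_add hm1_L2 bdd_env_L2)
  also have "\<dots> \<le> 2 * (ip f h)\<^sup>2 + 2 * (ip g h)\<^sup>2"
    using sum_squares_bound[of "ip f h" "ip g h"] by (simp add: power2_sum)
  also have "\<dots> \<le> 2 * (K * energy h h) + 2 * (L * energy h h)"
    using hm1D[OF f h] hm1D[OF g h] by simp
  finally show "(ip (\<lambda>\<omega>. f \<omega> + g \<omega>) h)\<^sup>2 \<le> 2 * (K + L) * energy h h" by (simp add: algebra_simps)
qed

lemma hm1_cmult:
  assumes f: "hm1 K f"
  shows "hm1 (c\<^sup>2 * K) (\<lambda>\<omega>. c * f \<omega>)"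
  unfolding hm1_def
proof (intro conjI allI impI)
  show "(\<lambda>\<omega>. c * f \<omega>) \<in> L2 Q" using f by (intro L2_cmult hm1_L2)
  fix h :: "'d env \<Rightarrow> real" assume "bdd_env h"
  from mult_left_mono[OF hm1D[OF f this], of "c\<^sup>2"]
  show "(ip (\<lambda>\<omega>. c * f \<omega>) h)\<^sup>2 \<le> c\<^sup>2 * K * energy h h" by (simp add: ip_cmult power_mult_distrib)
qed

text \<open>Constants have no energy, so testing with 1 forces the mean to vanish. In the main limit
  this removes the centring term.\<close>

lemma hm1_mean_zero:
  assumes "hm1 K f" shows "(\<integral>\<omega>. f \<omega> \<partial>Q) = 0"
  using hm1D[OF assms bdd_env_const[of 1]] by (simp add: ip_def energy_def incr_def)

text \<open>A near-minimizer of \<open>\<epsilon> |v|^2 + energy v v - 2 ip f v\<close> over bounded functions is an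
  approximate solution of the resolvent equation, or of the Poisson equation if \<open>\<epsilon> = 0\<close>.\<close>

lemma near_minimizer:
  assumes f: "f \<in> L2 Q" and \<epsilon>: "0 \<le> \<epsilon>" and \<eta>: "0 < \<eta>"
    and K: "\<And>g. bdd_env g \<Longrightarrow> (ip f g)\<^sup>2 \<le> K * (\<epsilon> * ip g g + energy g g)"
  shows "\<exists>v. bdd_env v \<and> \<epsilon> * ip v v + energy v v \<le> 2 * ip f v + \<eta> \<and>
    (\<forall>g. bdd_env g \<longrightarrow> (ip f g - \<epsilon> * ip v g - energy v g)\<^sup>2 \<le> \<eta> * (\<epsilon> * ip g g + energy g g))"
proof -
  define T where "T g = \<epsilon> * ip g g + energy g g" for g
  define J where "J g = T g - 2 * ip f g" for g
  have T0: "0 \<le> T g" for g using \<epsilon> energy_nonneg[of g] by (simp add: T_def ip_self)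
  \<comment> \<open>The functional is bounded below: the dual bound and the inequality of arithmetic
    and geometric means give 2 |ip f g| \<le> |K| + T g.\<close>
  have low: "- \<bar>K\<bar> \<le> J g" if "bdd_env g" for g
  proof -
    have "(ip f g)\<^sup>2 \<le> \<bar>K\<bar> * T g"
      using K[OF that] mult_right_mono[OF abs_ge_self[of K] T0[of g]] by (simp add: T_def)
    also have "\<dots> \<le> ((\<bar>K\<bar> + T g) / 2)\<^sup>2"
      using sum_squares_bound[of "\<bar>K\<bar>" "T g"] by (simp add: power2_eq_square field_simps)
    finally have "\<bar>ip f g\<bar> \<le> \<bar>(\<bar>K\<bar> + T g) / 2\<bar>" by (simp only: abs_le_square_iff)
    then show ?thesis using T0[of g] by (simp add: J_def)
  qed
  then have bdd: "bdd_below (J ` Collect bdd_env)" by (auto simp: bdd_below_def)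
  have ne: "J ` Collect bdd_env \<noteq> {}" using bdd_env_const by auto
  obtain v where v: "bdd_env v" "J v < Inf (J ` Collect bdd_env) + \<eta>"
    using cInf_lessD[OF ne, of "Inf (J ` Collect bdd_env) + \<eta>"] \<eta> by auto
  have min: "J v - \<eta> \<le> J g" if "bdd_env g" for g
    using cInf_lower[OF _ bdd, of "J g"] that v(2) by force
  have "J (\<lambda>_. 0) = 0" by (simp add: J_def T_def ip_def energy_def incr_def)
  then have Jv: "J v \<le> \<eta>" using min[OF bdd_env_const[of 0]] by simp
  have "(ip f g - \<epsilon> * ip v g - energy v g)\<^sup>2 \<le> \<eta> * T g" if g: "bdd_env g" for g
  proof -
    note vL = bdd_env_L2[OF v(1)] and gL = bdd_env_L2[OF g]
    \<comment> \<open>Near-minimality of v along the line v + s g is a quadratic inequality in s;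
      its discriminant is an Euler equation with error \<eta>.\<close>
    have "0 \<le> T g * s\<^sup>2 + 2 * (\<epsilon> * ip v g + energy v g - ip f g) * s + \<eta>" for s
    proof -
      let ?w = "\<lambda>\<omega>. v \<omega> + s * g \<omega>"
      have "ip ?w ?w = ip g g * s\<^sup>2 + 2 * ip v g * s + ip v v"
        using L2_integral_add_scaled_sq[OF vL gL, of s] by (simp add: ip_def power2_eq_square)
      moreover have "ip f ?w = ip f v + s * ip f g"
        using ip_add[OF vL L2_cmult[OF gL] f, of s] by (simp add: ip_commute[of f] ip_cmult)
      ultimately have "J ?w = J v + (T g * s\<^sup>2 + 2 * (\<epsilon> * ip v g + energy v g - ip f g) * s)"
        using energy_add_scaled[OF vL gL, of s] by (simp add: J_def T_def algebra_simps)
      then show ?thesis using min[OF bdd_env_add[OF v(1) bdd_env_cmult[OF g]], of s] by simp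
    qed
    from quadratic_nonneg_imp_discriminant[OF T0 this]
    have "(\<epsilon> * ip v g + energy v g - ip f g)\<^sup>2 \<le> T g * \<eta>" .
    then show ?thesis by (simp add: power2_commute[of "ip f g - \<epsilon> * ip v g"] algebra_simps)
      (simp add: power2_eq_square algebra_simps)
  qed
  then show ?thesis using v(1) Jv by (intro exI[of _ v]) (simp add: J_def T_def)
qed

text \<open>With \<epsilon> = 0 the approximate Euler equation says precisely that the residual of
  the Poisson equation has dual norm at most sqrt \<eta>, which is the sense of smallness that
  \<open>nrm_ssum_hm1\<close> can exploit.\<close>

lemma hm1_approx:
  assumes f: "hm1 K f" and \<eta>: "0 < \<eta>"
  shows "\<exists>v. bdd_env v \<and> hm1 \<eta> (\<lambda>\<omega>. f \<omega> - (v \<omega> - trans_op v \<omega>))"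
proof -
  obtain v where v: "bdd_env v" "\<And>g. bdd_env g \<Longrightarrow> (ip f g - energy v g)\<^sup>2 \<le> \<eta> * energy g g"
    using near_minimizer[OF hm1_L2[OF f], of 0 \<eta> K] \<eta> hm1D[OF f] by auto
  note vL = bdd_env_L2[OF v(1)]
  have "hm1 \<eta> (\<lambda>\<omega>. f \<omega> - (v \<omega> - trans_op v \<omega>))"
    unfolding hm1_def
  proof (intro conjI allI impI)
    show "(\<lambda>\<omega>. f \<omega> - (v \<omega> - trans_op v \<omega>)) \<in> L2 Q"
      by (intro L2_diff hm1_L2[OF f] vL trans_op_L2)
    fix g :: "'d env \<Rightarrow> real" assume g: "bdd_env g"
    have "ip (\<lambda>\<omega>. f \<omega> - (v \<omega> - trans_op v \<omega>)) g = ip f g - energy v g"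
      using bdd_env_L2[OF g] by (simp add: ip_diff hm1_L2[OF f] vL trans_op_L2 L2_diff energy_eq)
    then show "(ip (\<lambda>\<omega>. f \<omega> - (v \<omega> - trans_op v \<omega>)) g)\<^sup>2 \<le> \<eta> * energy g g" using v(2)[OF g] by simp
  qed
  with v(1) show ?thesis by blast
qed

text \<open>The test functions are the truncations g of r at height N: they satisfy ip r g = ip g g,
  so the hypothesis gives ip g g \<le> c, and dominated convergence removes the truncation.\<close>

lemma nrm_le_of_bounded_tests:
  assumes r: "r \<in> L2 Q" and c: "\<And>g. bdd_env g \<Longrightarrow> (ip r g)\<^sup>2 \<le> c * ip g g"
  shows "(nrm Q r)\<^sup>2 \<le> c"
proof -
  have rm [measurable]: "r \<in> borel_measurable env_space" by (rule L2_Q_measurable[OF r])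
  define g where "g N \<omega> = (if \<bar>r \<omega>\<bar> \<le> real N then r \<omega> else 0)" for N \<omega>
  have g: "bdd_env (g N)" for N
    unfolding bdd_env_def by (auto simp: g_def[abs_def] intro!: exI[of _ "real N"])
  have gc: "ip (g N) (g N) \<le> c" for N
  proof -
    have eq: "ip r (g N) = ip (g N) (g N)"
      unfolding ip_def by (intro Bochner_Integration.integral_cong) (auto simp: g_def)
    have "ip (g N) (g N) * ip (g N) (g N) \<le> c * ip (g N) (g N)"
      using c[OF g[of N]] by (simp add: eq power2_eq_square)
    moreover have "0 \<le> ip (g N) (g N)" by (simp add: ip_self)
    moreover have "0 \<le> c * ip (\<lambda>_. 1) (\<lambda>_. 1)"
      using order_trans[OF zero_le_power2 c[OF bdd_env_const[of 1]]] .
    then have "0 \<le> c" by (simp add: ip_def Q.prob_space)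
    ultimately show ?thesis by (cases "ip (g N) (g N) = 0") (auto simp: mult_le_cancel_right)
  qed
  have "(\<lambda>N. \<integral>\<omega>. g N \<omega> * g N \<omega> \<partial>Q) \<longlonglongrightarrow> (\<integral>\<omega>. (r \<omega>)\<^sup>2 \<partial>Q)"
  proof (rule integral_dominated_convergence[where w = "\<lambda>\<omega>. (r \<omega>)\<^sup>2"])
    show "integrable Q (\<lambda>\<omega>. (r \<omega>)\<^sup>2)" by (rule L2_integrable_sq[OF r])
    show "AE \<omega> in Q. (\<lambda>N. g N \<omega> * g N \<omega>) \<longlonglongrightarrow> (r \<omega>)\<^sup>2"
    proof (rule AE_I2)
      fix \<omega>
      obtain k :: nat where "\<bar>r \<omega>\<bar> \<le> real k" using real_arch_simple by blast
      then have "eventually (\<lambda>N. g N \<omega> * g N \<omega> = (r \<omega>)\<^sup>2) sequentially"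
        unfolding eventually_sequentially
        by (intro exI[of _ k]) (auto simp: g_def power2_eq_square)
      then show "(\<lambda>N. g N \<omega> * g N \<omega>) \<longlonglongrightarrow> (r \<omega>)\<^sup>2" by (rule tendsto_eventually)
    qed
    show "AE \<omega> in Q. norm (g N \<omega> * g N \<omega>) \<le> (r \<omega>)\<^sup>2" for N
      by (auto simp: g_def power2_eq_square)
    show "(\<lambda>\<omega>. g N \<omega> * g N \<omega>) \<in> borel_measurable Q" for N
      using bdd_envD[OF g[of N]] by (auto simp: measurable_Q_iff)
    show "(\<lambda>\<omega>. (r \<omega>)\<^sup>2) \<in> borel_measurable Q" using rm by (auto simp: measurable_Q_iff)
  qed
  then show ?thesis
    using gc unfolding nrm_sq ip_def by (intro LIMSEQ_le_const2) auto
qed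

section \<open>Variance bounds and martingale approximation\<close>

lemma ssum_L2: "f \<in> L2 Q \<Longrightarrow> ssum f n \<in> L2 A"
  unfolding ssum_def[abs_def] by (intro L2_sum L2_env_seen)

lemma nrm_ssum_le: "f \<in> L2 Q \<Longrightarrow> nrm A (ssum f n) \<le> real n * nrm Q f"
  unfolding ssum_def[abs_def]
  using nrm_sum[of "{..<n}" "\<lambda>k z. f (env_seen k z)" A] by (simp add: L2_env_seen nrm_env_seen)

lemma mart_L2: "bdd_step \<phi> \<Longrightarrow> mart \<phi> n \<in> L2 A"
  unfolding mart_def[abs_def] by (intro L2_sum bdd_step_L2)

lemma integral_bdd_step:
  assumes "bdd_step \<phi>"
  shows "(\<integral>z. \<phi> (env_seen n z) (step n z) \<partial>A) = (\<integral>\<omega>. mean_step \<phi> \<omega> \<partial>Q)"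
  using markov1[OF bdd_step_measurable[OF assms] A.L2_integrable[OF bdd_step_L2[OF assms]]]
    integral_env_seen[OF mean_step_measurable[OF bdd_step_measurable[OF assms]]] by simp

lemma martingale_orthogonal:
  assumes F: "past n F" "F \<in> L2 A" and \<phi>: "bdd_step \<phi>"
    and m: "\<And>\<omega>. \<omega> \<in> space env_space \<Longrightarrow> mean_step \<phi> \<omega> = 0"
  shows "(\<integral>z. \<phi> (env_seen n z) (step n z) * F z \<partial>A) = 0"
proof -
  have "(\<integral>z. \<phi> (env_seen n z) (step n z) * F z \<partial>A) = (\<integral>z. mean_step \<phi> (env_seen n z) * F z \<partial>A)"
    by (rule markov_L2[OF F bdd_step_measurable[OF \<phi>] bdd_step_L2[OF \<phi>]])
  also have "\<dots> = (\<integral>z. 0 \<partial>A)"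
    by (intro Bochner_Integration.integral_cong) (auto simp: m env_seen_space_A)
  finally show ?thesis by simp
qed

lemma mart_covariance:
  assumes \<phi>: "bdd_step \<phi>" "\<And>\<omega>. \<omega> \<in> space env_space \<Longrightarrow> mean_step \<phi> \<omega> = 0"
    and \<psi>: "bdd_step \<psi>" "\<And>\<omega>. \<omega> \<in> space env_space \<Longrightarrow> mean_step \<psi> \<omega> = 0"
  shows "(\<integral>z. mart \<phi> n z * mart \<psi> n z \<partial>A) = real n * (\<integral>\<omega>. mean_step (\<lambda>\<omega> e. \<phi> \<omega> e * \<psi> \<omega> e) \<omega> \<partial>Q)"
proof (induction n)
  case 0 then show ?case by (simp add: mart_def)
next
  case (Suc n)
  let ?a = "\<lambda>z. \<phi> (env_seen n z) (step n z)" and ?b = "\<lambda>z. \<psi> (env_seen n z) (step n z)"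
  note L = mart_L2[OF \<phi>(1), of n] mart_L2[OF \<psi>(1), of n] bdd_step_L2[OF \<phi>(1), of n] bdd_step_L2[OF \<psi>(1), of n]
  have "(\<integral>z. mart \<phi> (Suc n) z * mart \<psi> (Suc n) z \<partial>A) =
      (\<integral>z. mart \<phi> n z * mart \<psi> n z + (?b z * mart \<phi> n z + (?a z * mart \<psi> n z + ?a z * ?b z)) \<partial>A)"
    by (intro Bochner_Integration.integral_cong) (auto simp: mart_Suc algebra_simps)
  also have "\<dots> = (\<integral>z. mart \<phi> n z * mart \<psi> n z \<partial>A) + ((\<integral>z. ?b z * mart \<phi> n z \<partial>A) +
      ((\<integral>z. ?a z * mart \<psi> n z \<partial>A) + (\<integral>z. ?a z * ?b z \<partial>A)))"
    using L by (simp add: L2_integrable_mult)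
  also have "(\<integral>z. ?b z * mart \<phi> n z \<partial>A) = 0"
    by (rule martingale_orthogonal[OF mart_past[OF bdd_step_measurable[OF \<phi>(1)]] L(1) \<psi>])
  also have "(\<integral>z. ?a z * mart \<psi> n z \<partial>A) = 0"
    by (rule martingale_orthogonal[OF mart_past[OF bdd_step_measurable[OF \<psi>(1)]] L(2) \<phi>])
  also have "(\<integral>z. ?a z * ?b z \<partial>A) = (\<integral>\<omega>. mean_step (\<lambda>\<omega> e. \<phi> \<omega> e * \<psi> \<omega> e) \<omega> \<partial>Q)"
    using integral_bdd_step[OF bdd_step_mult[OF \<phi>(1) \<psi>(1)], of n] by simp
  finally show ?case using Suc by (simp add: algebra_simps)
qed

lemma nrm_mart:
  assumes \<phi>: "bdd_step \<phi>" "\<And>\<omega>. \<omega> \<in> space env_space \<Longrightarrow> mean_step \<phi> \<omega> = 0"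
  shows "nrm A (mart \<phi> n) = sqrt (real n) * sqrt (\<integral>\<omega>. mean_step (\<lambda>\<omega> e. \<phi> \<omega> e * \<phi> \<omega> e) \<omega> \<partial>Q)"
  using mart_covariance[OF \<phi> \<phi>, of n] by (simp add: nrm_def power2_eq_square real_sqrt_mult)

lemma mdiff_variance_le:
  assumes v: "bdd_env v"
  shows "(\<integral>\<omega>. mean_step (\<lambda>\<omega> e. mdiff v \<omega> e * mdiff v \<omega> e) \<omega> \<partial>Q) \<le> 2 * energy v v"
proof -
  let ?\<psi> = "\<lambda>\<omega> e. v (env_shift e \<omega>) - v \<omega>"
  have \<psi>: "bdd_step ?\<psi>" using v by (intro bdd_step_diff bdd_step_shift bdd_step_base)
  have i: "integrable Q (mean_step (\<lambda>\<omega> e. \<phi> \<omega> e * \<phi> \<omega> e))" if "bdd_step \<phi>" for \<phi>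
    by (rule Q.L2_integrable[OF bdd_env_L2[OF bdd_step_mean[OF bdd_step_mult[OF that that]]]])
  have "(\<integral>\<omega>. mean_step (\<lambda>\<omega> e. mdiff v \<omega> e * mdiff v \<omega> e) \<omega> \<partial>Q) \<le> (\<integral>\<omega>. mean_step (\<lambda>\<omega> e. ?\<psi> \<omega> e * ?\<psi> \<omega> e) \<omega> \<partial>Q)"
    using mean_step_mdiff_sq_le[of _ v]
    by (intro integral_mono i[OF mdiff_bdd[OF v]] i[OF \<psi>]) (auto simp: space_Q power2_eq_square)
  also have "\<dots> = (\<integral>z. ?\<psi> (env_seen 0 z) (step 0 z) * ?\<psi> (env_seen 0 z) (step 0 z) \<partial>A)"
    using integral_bdd_step[OF bdd_step_mult[OF \<psi> \<psi>], of 0] by simp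
  also have "\<dots> = 2 * energy v v"
    by (simp add: energy_def incr_def env_seen_Suc)
  finally show ?thesis .
qed

lemma nrm_mart_mdiff_le:
  assumes v: "bdd_env v"
  shows "nrm A (mart (mdiff v) n) \<le> sqrt (real n) * sqrt (2 * energy v v)"
  by (subst nrm_mart[OF mdiff_bdd[OF v] mean_step_mdiff], assumption)
    (auto intro!: mult_left_mono real_sqrt_le_mono mdiff_variance_le[OF v])

text \<open>An approximate resolvent solution v at scale \<epsilon> = 1/n splits f into a residual
  r, the term \<epsilon> v and the coboundary v - R v. Residual sum, \<epsilon>-term, martingale and
  boundary terms are each of order sqrt (K n).\<close>

lemma nrm_ssum_hm1:
  assumes f: "hm1 K f" and K: "0 < K" and n: "1 \<le> n"
  shows "nrm A (ssum f n) \<le> 11 * (sqrt K * sqrt (real n))"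
proof -
  \<comment> \<open>With \<epsilon> = 1/n the sum of n terms \<epsilon> v has norm at most that of
    v; with \<eta> = K/n the n residuals together have norm at most n sqrt (3 \<eta>) = sqrt (3 K
    n).\<close>
  define \<epsilon> where "\<epsilon> = 1 / real n"
  define \<eta> where "\<eta> = K / real n"
  have \<epsilon>: "0 < \<epsilon>" "\<epsilon> \<le> 1" and \<eta>: "0 < \<eta>" "\<eta> \<le> K"
    using n K by (auto simp: \<epsilon>_def \<eta>_def field_simps)
  note fL = hm1_L2[OF f]
  have "(ip f g)\<^sup>2 \<le> K * (\<epsilon> * ip g g + energy g g)" if "bdd_env g" for g
  proof -
    have "K * energy g g \<le> K * (\<epsilon> * ip g g + energy g g)"
      using K \<epsilon> by (intro mult_left_mono) (auto simp: ip_self)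
    then show ?thesis using hm1D[OF f that] by linarith
  qed
  from near_minimizer[OF fL less_imp_le[OF \<epsilon>(1)] \<eta>(1) this]
  obtain v where v: "bdd_env v" and T: "\<epsilon> * ip v v + energy v v \<le> 2 * ip f v + \<eta>"
    and res: "\<And>g. bdd_env g \<Longrightarrow> (ip f g - \<epsilon> * ip v g - energy v g)\<^sup>2 \<le> \<eta> * (\<epsilon> * ip g g + energy g g)"
    by auto
  note vL = bdd_env_L2[OF v]
  \<comment> \<open>The inequality K E \<le> (K + E/4)^2, with E the energy of v, lets half of the
    energy be absorbed on the left of \<open>T\<close>; this produces the constants 6 and 3
    below.\<close>
  have "(ip f v)\<^sup>2 \<le> K * energy v v" by (rule hm1D[OF f v])
  also have "\<dots> \<le> (K + energy v v / 4)\<^sup>2"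
    using sum_squares_bound[of K "energy v v / 4"] by (simp add: power2_eq_square field_simps)
  finally have "\<bar>ip f v\<bar> \<le> \<bar>K + energy v v / 4\<bar>" by (simp only: abs_le_square_iff)
  then have fv: "ip f v \<le> K + energy v v / 4" using K energy_nonneg[of v] by linarith
  have e0: "0 \<le> \<epsilon> * ip v v" using \<epsilon> by (simp add: ip_self)
  have E: "energy v v \<le> 6 * K" using T fv \<eta>(2) e0 by linarith
  have "\<epsilon> * ip v v \<le> 3 * K" using T fv \<eta>(2) energy_nonneg[of v] by linarith
  then have "(nrm Q v)\<^sup>2 \<le> 3 * K * real n" using n by (simp add: \<epsilon>_def ip_self field_simps)
  then have "nrm Q v \<le> sqrt (3 * K * real n)" by (intro real_le_rsqrt)
  then have nv: "nrm Q v \<le> sqrt 3 * (sqrt K * sqrt (real n))" by (simp add: real_sqrt_mult)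
  define r where "r \<omega> = f \<omega> - \<epsilon> * v \<omega> - (v \<omega> - trans_op v \<omega>)" for \<omega>
  have rL: "r \<in> L2 Q"
    unfolding r_def[abs_def] by (intro L2_diff fL L2_cmult vL trans_op_L2)
  have "(nrm Q r)\<^sup>2 \<le> 3 * \<eta>"
  proof (rule nrm_le_of_bounded_tests[OF rL])
    fix g :: "'d env \<Rightarrow> real" assume g: "bdd_env g"
    note gL = bdd_env_L2[OF g]
    have "ip r g = ip f g - \<epsilon> * ip v g - energy v g"
      unfolding r_def[abs_def]
      by (simp add: ip_diff fL gL vL trans_op_L2 L2_diff L2_cmult energy_eq ip_cmult)
    then have "(ip r g)\<^sup>2 \<le> \<eta> * (\<epsilon> * ip g g + energy g g)" using res[OF g] by simp
    also have "\<dots> \<le> \<eta> * (1 * ip g g + 2 * ip g g)"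
      using \<eta> \<epsilon> energy_le[OF gL] by (intro mult_left_mono add_mono mult_right_mono) (auto simp: ip_self)
    finally show "(ip r g)\<^sup>2 \<le> 3 * \<eta> * ip g g" by simp
  qed
  then have "nrm Q r \<le> sqrt (3 * \<eta>)" by (intro real_le_rsqrt)
  then have "real n * nrm Q r \<le> real n * sqrt (3 * K / real n)"
    by (intro mult_left_mono) (auto simp: \<eta>_def)
  also have "\<dots> = sqrt 3 * (sqrt K * sqrt (real n))"
    using n by (simp add: real_sqrt_mult real_sqrt_divide field_simps)
  finally have nr: "real n * nrm Q r \<le> sqrt 3 * (sqrt K * sqrt (real n))" .
  have eq: "ssum f n = (\<lambda>z. (ssum r n z + \<epsilon> * ssum v n z) + (mart (mdiff v) n z + (v (env_seen 0 z) - v (env_seen n z))))"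
  proof
    fix z
    have "ssum f n z = ssum r n z + \<epsilon> * ssum v n z + ssum (\<lambda>\<omega>. v \<omega> - trans_op v \<omega>) n z"
      unfolding ssum_def r_def by (simp add: sum.distrib sum_subtractf sum_distrib_left)
    then show "ssum f n z = (ssum r n z + \<epsilon> * ssum v n z) + (mart (mdiff v) n z + (v (env_seen 0 z) - v (env_seen n z)))"
      by (simp add: ssum_coboundary)
  qed
  note L = ssum_L2[OF rL, of n] L2_cmult[OF ssum_L2[OF vL], of \<epsilon> n] mart_L2[OF mdiff_bdd[OF v], of n]
    L2_env_seen[OF vL]
  have s1: "nrm A (\<lambda>z. ssum r n z + \<epsilon> * ssum v n z) \<le> real n * nrm Q r + nrm Q v"
  proof -
    have "\<epsilon> * nrm A (ssum v n) \<le> \<epsilon> * (real n * nrm Q v)"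
      using \<epsilon> by (intro mult_left_mono nrm_ssum_le[OF vL]) auto
    also have "\<dots> = nrm Q v" using n by (simp add: \<epsilon>_def)
    finally show ?thesis
      using nrm_triangle[OF L(1,2)] nrm_ssum_le[OF rL, of n] \<epsilon> by (simp add: nrm_cmult)
  qed
  have s2: "nrm A (\<lambda>z. v (env_seen 0 z) - v (env_seen n z)) \<le> 2 * nrm Q v"
    using nrm_triangle_diff[OF L(4) L(4), of 0 n] by (simp add: nrm_env_seen[OF vL])
  have s3: "nrm A (mart (mdiff v) n) \<le> sqrt 12 * (sqrt K * sqrt (real n))"
  proof -
    have "nrm A (mart (mdiff v) n) \<le> sqrt (real n) * sqrt (2 * energy v v)"
      by (rule nrm_mart_mdiff_le[OF v])
    also have "\<dots> \<le> sqrt (real n) * sqrt (12 * K)" using E by (intro mult_left_mono) auto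
    finally show ?thesis by (simp add: real_sqrt_mult mult_ac)
  qed
  have "nrm A (ssum f n) \<le> real n * nrm Q r + nrm Q v + (sqrt 12 * (sqrt K * sqrt (real n)) + 2 * nrm Q v)"
    unfolding eq
    using nrm_triangle[OF L2_add[OF L(1,2)] L2_add[OF L(3) L2_diff[OF L(4) L(4)]], of 0 n]
      nrm_triangle[OF L(3) L2_diff[OF L(4) L(4)], of 0 n] s1 s2 s3 by linarith
  \<comment> \<open>Contributions: sqrt 3 from the residual, sqrt 3 from the \<epsilon>-term, 2 sqrt
    3 from the two boundary terms and sqrt 12 from the martingale.\<close>
  also have "\<dots> \<le> (4 * sqrt 3 + sqrt 12) * (sqrt K * sqrt (real n))"
    using nr nv by (simp add: algebra_simps)
  also have "\<dots> \<le> 11 * (sqrt K * sqrt (real n))"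
  proof (intro mult_right_mono)
    have "sqrt 3 \<le> 7 / 4" by (rule real_le_lsqrt; simp add: power2_eq_square)
    moreover have "sqrt 12 \<le> 7 / 2" by (rule real_le_lsqrt; simp add: power2_eq_square)
    ultimately show "4 * sqrt 3 + sqrt 12 \<le> 11" by linarith
  qed (use K in auto)
  finally show ?thesis .
qed

text \<open>The variance bound, applied to the residual of the Poisson equation, is uniform in n;
  hence one bounded v serves all large n, as the limits below require.\<close>

lemma martingale_approx:
  assumes f: "hm1 K f" and \<eta>: "0 < \<eta>"
  shows "\<exists>v N. bdd_env v \<and> (\<forall>n\<ge>N. nrm A (\<lambda>z. ssum f n z - mart (mdiff v) n z) \<le> \<eta> * sqrt (real n))"
proof -
  \<comment> \<open>The constant 11 of the variance bound turns \<eta>/22 into \<eta>/2; the other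
    half is left for the boundary terms.\<close>
  have \<eta>': "0 < (\<eta> / 22)\<^sup>2" using \<eta> by simp
  obtain v where v: "bdd_env v" and h: "hm1 ((\<eta> / 22)\<^sup>2) (\<lambda>\<omega>. f \<omega> - (v \<omega> - trans_op v \<omega>))" (is "hm1 _ ?r")
    using hm1_approx[OF f \<eta>'] by blast
  note vL = bdd_env_L2[OF v]
  obtain N :: nat where N: "(4 * nrm Q v / \<eta>)\<^sup>2 \<le> real N" using real_arch_simple by blast
  have "nrm A (\<lambda>z. ssum f n z - mart (mdiff v) n z) \<le> \<eta> * sqrt (real n)" if n: "max 1 N \<le> n" for n
  proof -
    have eq: "(\<lambda>z. ssum f n z - mart (mdiff v) n z) = (\<lambda>z. ssum ?r n z + (v (env_seen 0 z) - v (env_seen n z)))"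
    proof
      fix z
      have "ssum f n z = ssum ?r n z + ssum (\<lambda>\<omega>. v \<omega> - trans_op v \<omega>) n z"
        by (simp add: ssum_def flip: sum.distrib)
      then show "ssum f n z - mart (mdiff v) n z = ssum ?r n z + (v (env_seen 0 z) - v (env_seen n z))"
        by (simp add: ssum_coboundary)
    qed
    have "(4 * nrm Q v / \<eta>)\<^sup>2 \<le> real n" using N n by linarith
    then have "4 * nrm Q v / \<eta> \<le> sqrt (real n)" by (rule real_le_rsqrt)
    then have b: "2 * nrm Q v \<le> \<eta> / 2 * sqrt (real n)" using \<eta> by (simp add: field_simps)
    have "nrm A (ssum ?r n) \<le> \<eta> / 2 * sqrt (real n)"
      using nrm_ssum_hm1[OF h \<eta>', of n] n \<eta> by simp
    moreover have "nrm A (\<lambda>z. v (env_seen 0 z) - v (env_seen n z)) \<le> 2 * nrm Q v"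
      using nrm_triangle_diff[OF L2_env_seen[OF vL, of 0] L2_env_seen[OF vL, of n]] by (simp add: nrm_env_seen[OF vL])
    ultimately show ?thesis
      unfolding eq
      using nrm_triangle[OF ssum_L2[OF hm1_L2[OF h]] L2_diff[OF L2_env_seen[OF vL] L2_env_seen[OF vL]], of n 0 n] b
      by linarith
  qed
  with v show ?thesis by blast
qed

section \<open>From bounded variances to the dual bound\<close>

lemma funpow_trans_op_L2: "f \<in> L2 Q \<Longrightarrow> (trans_op ^^ k) f \<in> L2 Q"
  by (induction k) (auto intro: trans_op_L2)

lemma integral_env_seen_lag:
  assumes f: "f \<in> L2 Q" and h: "h \<in> L2 Q"
  shows "(\<integral>z. f (env_seen k z) * h (env_seen (k + m) z) \<partial>A) = ip f ((trans_op ^^ m) h)"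
  using h
proof (induction m arbitrary: h)
  case 0
  then show ?case using integral_env_seen_mult[OF f, of h k] by simp
next
  case (Suc m)
  have "(\<integral>z. h (env_seen (Suc (k + m)) z) * f (env_seen k z) \<partial>A) =
      (\<integral>z. trans_op h (env_seen (k + m) z) * f (env_seen k z) \<partial>A)"
    by (rule markov_trans_op[OF env_seen_past[OF _ L2_Q_measurable[OF f]] L2_env_seen[OF f] Suc.prems]) simp
  then show ?case using Suc.IH[OF trans_op_L2[OF Suc.prems]]
    by (simp add: mult.commute funpow_swap1)
qed

text \<open>The Cesaro means \<open>w n\<close> of the partial sums of the Neumann series of \<open>f\<close> solve the Poisson equation up to
  an error that the variance bound makes small, and their energy is bounded.\<close>

lemma hm1_of_variance_bound:
  assumes f: "f \<in> L2 Q" and K: "0 \<le> K" "\<And>n. nrm A (ssum f n) \<le> K * sqrt (real n)"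
  shows "\<exists>C. hm1 C f"
proof -
  define s where "s j \<omega> = (\<Sum>k<j. (trans_op ^^ k) f \<omega>)" for j \<omega>
  have sL: "s j \<in> L2 Q" for j
    unfolding s_def[abs_def] by (intro L2_sum funpow_trans_op_L2 f)
  have ip_s: "ip h (s j) = (\<integral>z. h (env_seen 0 z) * ssum f j z \<partial>A)" if h: "h \<in> L2 Q" for h j
  proof -
    have "ip h (s j) = (\<Sum>k<j. ip h ((trans_op ^^ k) f))"
      unfolding s_def[abs_def] ip_commute[of h] by (rule ip_sum) (auto intro: funpow_trans_op_L2 f h)
    also have "\<dots> = (\<Sum>k<j. \<integral>z. h (env_seen 0 z) * f (env_seen k z) \<partial>A)"
      using integral_env_seen_lag[OF h f, of 0] by simp
    also have "\<dots> = (\<integral>z. (\<Sum>k<j. h (env_seen 0 z) * f (env_seen k z)) \<partial>A)"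
      by (rule Bochner_Integration.integral_sum[symmetric])
        (rule L2_integrable_mult[OF L2_env_seen[OF h] L2_env_seen[OF f]])
    finally show ?thesis by (simp add: ssum_def sum_distrib_left)
  qed
  \<comment> \<open>By \<open>ip_s\<close>, s j represents the conditional expectation of
    \<open>ssum f j\<close> given the initial environment; testing with s j itself bounds its
    norm.\<close>
  have ns: "nrm Q (s j) \<le> K * sqrt (real j)" for j
  proof -
    have "nrm Q (s j) * nrm Q (s j) = (\<integral>z. s j (env_seen 0 z) * ssum f j z \<partial>A)"
      using ip_s[OF sL, of j j] ip_self[of "s j"] by (simp add: power2_eq_square)
    also have "\<dots> \<le> nrm Q (s j) * nrm A (ssum f j)"
      using nrm_Cauchy_Schwarz[OF L2_env_seen[OF sL[of j], of 0] ssum_L2[OF f, of j]] by (simp add: nrm_env_seen[OF sL])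
    finally have "nrm Q (s j) \<le> nrm A (ssum f j)"
      using nrm_nonneg[of Q "s j"] nrm_nonneg[of A "ssum f j"] by (cases "nrm Q (s j) = 0") (auto simp: mult_le_cancel_left)
    then show ?thesis using K(2)[of j] by linarith
  qed
  \<comment> \<open>By stationarity the new term meets the old ones with the lags 1 to j.
    \<open>s (Suc j)\<close> collects these and also lag 0, hence the correction by the square norm
    of f.\<close>
  have var: "(nrm A (ssum f (Suc j)))\<^sup>2 = (nrm A (ssum f j))\<^sup>2 + 2 * ip f (s (Suc j)) - (nrm Q f)\<^sup>2" for j
  proof -
    have i: "integrable A (\<lambda>z. f (env_seen k z) * f (env_seen j z))" for k
      by (rule L2_integrable_mult[OF L2_env_seen[OF f] L2_env_seen[OF f]])
    have "(\<integral>z. ssum f j z * f (env_seen j z) \<partial>A) = (\<Sum>k<j. \<integral>z. f (env_seen k z) * f (env_seen j z) \<partial>A)"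
      unfolding ssum_def sum_distrib_right by (rule Bochner_Integration.integral_sum) (rule i)
    also have "\<dots> = (\<Sum>k<j. ip f ((trans_op ^^ (j - k)) f))"
    proof (intro sum.cong refl)
      fix k assume "k \<in> {..<j}"
      then show "(\<integral>z. f (env_seen k z) * f (env_seen j z) \<partial>A) = ip f ((trans_op ^^ (j - k)) f)"
        using integral_env_seen_lag[OF f f, of k "j - k"] by simp
    qed
    also have "\<dots> = (\<Sum>k<j. ip f ((trans_op ^^ Suc k) f))"
      by (subst sum.nat_diff_reindex[symmetric]) (auto intro!: sum.cong simp del: funpow.simps simp: Suc_diff_Suc)
    also have "\<dots> = (\<Sum>k<Suc j. ip f ((trans_op ^^ k) f)) - ip f f"
      by (subst sum.lessThan_Suc_shift) simp
    also have "(\<Sum>k<Suc j. ip f ((trans_op ^^ k) f)) = ip f (s (Suc j))"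
      unfolding s_def[abs_def] ip_commute[of f] by (rule ip_sum[symmetric]) (auto intro: funpow_trans_op_L2 f)
    finally have c: "(\<integral>z. ssum f j z * f (env_seen j z) \<partial>A) = ip f (s (Suc j)) - (nrm Q f)\<^sup>2" by (simp add: ip_self)
    have "(nrm A (ssum f (Suc j)))\<^sup>2 = (\<integral>z. (ssum f j z + 1 * f (env_seen j z))\<^sup>2 \<partial>A)"
      by (simp add: nrm_sq ssum_Suc)
    also have "\<dots> = (nrm A (\<lambda>z. f (env_seen j z)))\<^sup>2 + 2 * (\<integral>z. ssum f j z * f (env_seen j z) \<partial>A) + (nrm A (ssum f j))\<^sup>2"
      using L2_integral_add_scaled_sq[OF ssum_L2[OF f] L2_env_seen[OF f], of j 1 j] by (simp add: nrm_sq)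
    finally show ?thesis by (simp add: c nrm_env_seen[OF f])
  qed
  have var': "(nrm A (ssum f n))\<^sup>2 = 2 * (\<Sum>j<n. ip f (s (Suc j))) - real n * (nrm Q f)\<^sup>2" for n
    by (induction n) (simp_all add: var algebra_simps, simp add: ssum_def nrm_def)
  \<comment> \<open>Averaging over j is dictated by \<open>var'\<close>: the pairing of f with w n
    is half of the normalized variance plus half of the square norm of f, hence bounded.\<close>
  define w where "w n \<omega> = (1 / real n) * (\<Sum>j<n. s (Suc j) \<omega>)" for n \<omega>
  have wL: "w n \<in> L2 Q" for n unfolding w_def[abs_def] by (intro L2_cmult L2_sum sL)
  have nw: "nrm Q (w n) \<le> K * sqrt (real n)" for n
  proof (cases "n = 0")
    case True then show ?thesis by (simp add: w_def nrm_def)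
  next
    case False
    have "nrm Q (w n) \<le> (1 / real n) * (\<Sum>j<n. nrm Q (s (Suc j)))"
      unfolding w_def[abs_def] nrm_cmult using nrm_sum[of "{..<n}" "\<lambda>j. s (Suc j)" Q] sL
      by (simp add: divide_right_mono)
    also have "\<dots> \<le> (1 / real n) * (\<Sum>j<n. K * sqrt (real n))"
    proof (intro mult_left_mono sum_mono)
      fix j assume "j \<in> {..<n}"
      then have "K * sqrt (real (Suc j)) \<le> K * sqrt (real n)" using K(1) by (intro mult_left_mono) auto
      then show "nrm Q (s (Suc j)) \<le> K * sqrt (real n)" using ns[of "Suc j"] by linarith
    qed auto
    finally show ?thesis using False by simp
  qed
  have trans_s: "trans_op (s j) \<omega> = s (Suc j) \<omega> - f \<omega>" for j \<omega>
    unfolding s_def[abs_def] trans_op_sum by (subst sum.lessThan_Suc_shift) simp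
  \<comment> \<open>The error in the Poisson equation for w n. Its norm is of order 1/sqrt n while
    that of w n is of order sqrt n, so their inner product stays bounded.\<close>
  define a where "a n \<omega> = (1 / real n) * (s (Suc n) \<omega> - f \<omega>)" for n \<omega>
  have aL: "a n \<in> L2 Q" for n unfolding a_def[abs_def] by (intro L2_cmult L2_diff sL f)
  have wa: "w n \<omega> - trans_op (w n) \<omega> = f \<omega> - a n \<omega>" if n: "n \<noteq> 0" for n \<omega>
  proof -
    have "(\<Sum>j<n. s (Suc j) \<omega> - trans_op (s (Suc j)) \<omega>) = (\<Sum>j<n. f \<omega> - (trans_op ^^ Suc j) f \<omega>)"
      by (intro sum.cong refl) (simp only: trans_s, simp add: s_def)
    also have "\<dots> = real n * f \<omega> - (s (Suc n) \<omega> - f \<omega>)"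
      by (simp only: sum_subtractf s_def sum.lessThan_Suc_shift) simp
    finally show ?thesis
      using n unfolding w_def[abs_def] trans_op_cmult trans_op_sum a_def right_diff_distrib[symmetric] sum_subtractf[symmetric]
      by (simp add: field_simps)
  qed
  \<comment> \<open>The first summand bounds ip f (w n), the second the absolute value of ip (a n)
    (w n).\<close>
  define C where "C = (K\<^sup>2 + (nrm Q f)\<^sup>2) / 2 + (2 * K\<^sup>2 + K * nrm Q f)"
  have na: "nrm Q (a n) \<le> (1 / real n) * (K * sqrt (real (Suc n)) + nrm Q f)" for n
    unfolding a_def[abs_def] nrm_cmult
    using nrm_triangle_diff[OF sL f, of "Suc n"] ns[of "Suc n"] by (auto intro!: divide_right_mono)
  have Ew: "energy (w n) (w n) \<le> C" if n: "n \<noteq> 0" for n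
  proof -
    have "energy (w n) (w n) = ip (\<lambda>\<omega>. w n \<omega> - trans_op (w n) \<omega>) (w n)"
      by (simp add: energy_eq wL ip_diff trans_op_L2)
    also have "\<dots> = ip f (w n) - ip (a n) (w n)"
      by (simp add: wa[OF n] ip_diff f aL wL)
    finally have e: "energy (w n) (w n) = ip f (w n) - ip (a n) (w n)" .
    have "ip f (w n) = (1 / real n) * (\<Sum>j<n. ip f (s (Suc j)))"
      unfolding w_def[abs_def] ip_commute[of f] ip_cmult using f sL by (simp add: ip_sum)
    also have "\<dots> = ((nrm A (ssum f n))\<^sup>2 / real n + (nrm Q f)\<^sup>2) / 2"
      using n by (simp add: var' field_simps)
    also have "\<dots> \<le> (K\<^sup>2 + (nrm Q f)\<^sup>2) / 2"
    proof -
      have "(nrm A (ssum f n))\<^sup>2 \<le> (K * sqrt (real n))\<^sup>2" by (intro power_mono K(2)) auto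
      then show ?thesis using n by (simp add: power_mult_distrib field_simps)
    qed
    finally have 1: "ip f (w n) \<le> (K\<^sup>2 + (nrm Q f)\<^sup>2) / 2" .
    have "\<bar>ip (a n) (w n)\<bar> \<le> nrm Q (a n) * nrm Q (w n)" by (rule ip_Cauchy_Schwarz[OF aL wL])
    also have "\<dots> \<le> ((1 / real n) * (K * sqrt (real (Suc n)) + nrm Q f)) * (K * sqrt (real n))"
      using na[of n] nw[of n] K(1) by (intro mult_mono) auto
    also have "\<dots> \<le> ((1 / real n) * (K * (2 * sqrt (real n)) + nrm Q f * sqrt (real n))) * (K * sqrt (real n))"
    proof (intro mult_right_mono mult_left_mono add_mono)
      have "sqrt (real (Suc n)) \<le> sqrt (4 * real n)" using n by (intro real_sqrt_le_mono) simp
      then show "sqrt (real (Suc n)) \<le> 2 * sqrt (real n)" by (simp add: real_sqrt_mult)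
      show "nrm Q f \<le> nrm Q f * sqrt (real n)" using n mult_left_mono[of 1 "sqrt (real n)" "nrm Q f"] by simp
    qed (use K(1) in auto)
    also have "\<dots> = (1 / real n) * ((2 * K\<^sup>2 + K * nrm Q f) * (sqrt (real n) * sqrt (real n)))"
    proof -
      have "(c * (K * (2 * q) + b * q)) * (K * q) = c * ((2 * K\<^sup>2 + K * b) * (q * q))" for b c q :: real
        by (simp add: power2_eq_square algebra_simps)
      then show ?thesis .
    qed
    also have "\<dots> = 2 * K\<^sup>2 + K * nrm Q f"
    proof -
      have "sqrt (real n) * sqrt (real n) = real n" by simp
      then show ?thesis using n by (simp only:) simp
    qed
    finally show ?thesis
      using e 1 abs_ge_minus_self[of "ip (a n) (w n)"] unfolding C_def by linarith
  qed
  have C0: "0 \<le> C" using Ew[of 1] energy_nonneg[of "w 1"] by simp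
  have "hm1 C f"
    unfolding hm1_def
  proof (intro conjI allI impI f)
    fix g :: "'d env \<Rightarrow> real" assume g: "bdd_env g"
    note gL = bdd_env_L2[OF g]
    \<comment> \<open>The energy of w n is bounded uniformly and a n tends to 0 in norm, so in the
      limit only the Dirichlet form of g remains.\<close>
    have bound: "\<bar>ip f g\<bar> \<le> sqrt (C * energy g g) + nrm Q (a n) * nrm Q g" if n: "n \<noteq> 0" for n
    proof -
      have "energy (w n) g = ip (\<lambda>\<omega>. w n \<omega> - trans_op (w n) \<omega>) g"
        by (simp add: energy_eq wL gL ip_diff trans_op_L2)
      then have "ip f g = energy (w n) g + ip (a n) g"
        by (simp add: wa[OF n] ip_diff f aL gL)
      moreover have "\<bar>energy (w n) g\<bar> \<le> sqrt (C * energy g g)"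
      proof (rule real_le_rsqrt)
        have "(energy (w n) g)\<^sup>2 \<le> energy (w n) (w n) * energy g g" by (rule energy_Cauchy_Schwarz[OF wL gL])
        also have "\<dots> \<le> C * energy g g" by (intro mult_right_mono Ew[OF n] energy_nonneg)
        finally show "\<bar>energy (w n) g\<bar>\<^sup>2 \<le> C * energy g g" by simp
      qed
      ultimately show ?thesis using ip_Cauchy_Schwarz[OF aL gL, of n] by linarith
    qed
    have "(\<lambda>n. sqrt (C * energy g g) + ((1 / real (Suc n)) * (K * (2 * sqrt (real (Suc n))) + nrm Q f)) * nrm Q g) \<longlonglongrightarrow>
        sqrt (C * energy g g) + ((2 * K) * 0 + 0 * nrm Q f) * nrm Q g"
    proof (intro tendsto_intros)
      have eq: "(1 / real (Suc n)) * (K * (2 * sqrt (real (Suc n))) + nrm Q f) =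
          2 * K * inverse (sqrt (real (Suc n))) + inverse (real (Suc n)) * nrm Q f" for n
        by (simp add: field_simps del: of_nat_Suc)
      have "(\<lambda>n. inverse (sqrt (real (Suc n)))) \<longlonglongrightarrow> 0"
        using filterlim_compose[OF sqrt_at_top filterlim_compose[OF filterlim_real_sequentially filterlim_Suc]]
        by (intro tendsto_inverse_0_at_top)
      moreover have "(\<lambda>n. inverse (real (Suc n))) \<longlonglongrightarrow> 0" by (rule LIMSEQ_inverse_real_of_nat)
      ultimately show "(\<lambda>n. (1 / real (Suc n)) * (K * (2 * sqrt (real (Suc n))) + nrm Q f)) \<longlonglongrightarrow> 2 * K * 0 + 0 * nrm Q f"
        unfolding eq by (intro tendsto_intros)
    qed
    moreover have "\<bar>ip f g\<bar> \<le> sqrt (C * energy g g) + ((1 / real (Suc n)) * (K * (2 * sqrt (real (Suc n))) + nrm Q f)) * nrm Q g" for n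
    proof -
      have "sqrt (real (Suc (Suc n))) \<le> sqrt (4 * real (Suc n))" by (intro real_sqrt_le_mono) simp
      also have "\<dots> = 2 * sqrt (real (Suc n))" by (simp only: real_sqrt_mult real_sqrt_four)
      finally have "K * sqrt (real (Suc (Suc n))) \<le> K * (2 * sqrt (real (Suc n)))"
        using K(1) by (intro mult_left_mono)
      then have "(1 / real (Suc n)) * (K * sqrt (real (Suc (Suc n))) + nrm Q f) \<le> (1 / real (Suc n)) * (K * (2 * sqrt (real (Suc n))) + nrm Q f)"
        by (intro mult_left_mono) auto
      then have "nrm Q (a (Suc n)) \<le> (1 / real (Suc n)) * (K * (2 * sqrt (real (Suc n))) + nrm Q f)"
        using na[of "Suc n"] by linarith
      then have "nrm Q (a (Suc n)) * nrm Q g \<le> ((1 / real (Suc n)) * (K * (2 * sqrt (real (Suc n))) + nrm Q f)) * nrm Q g"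
        by (intro mult_right_mono) auto
      then show ?thesis using bound[of "Suc n"] by linarith
    qed
    ultimately have "\<bar>ip f g\<bar> \<le> sqrt (C * energy g g) + ((2 * K) * 0 + 0 * nrm Q f) * nrm Q g"
      by (intro LIMSEQ_le_const) auto
    then have "\<bar>ip f g\<bar> \<le> sqrt (C * energy g g)" by simp
    then have "\<bar>ip f g\<bar>\<^sup>2 \<le> (sqrt (C * energy g g))\<^sup>2" by (intro power_mono) auto
    then show "(ip f g)\<^sup>2 \<le> C * energy g g" using C0 energy_nonneg[of g] by simp
  qed
  then show ?thesis by blast
qed

end

section \<open>Approximation by coboundaries\<close>

text \<open>Cauchy sequences converge almost everywhere along a subsequence, and Fatou's lemma
  passes the bound to the limit. The rate \<epsilon> is kept, so the whole sequence converges at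
  that rate.\<close>

lemma (in prob_space) L2_complete:
  fixes f :: "nat \<Rightarrow> 'a \<Rightarrow> real"
  assumes f: "\<And>n. f n \<in> L2 M"
    and cauchy: "\<And>n k. n \<le> k \<Longrightarrow> (nrm M (\<lambda>x. f n x - f k x))\<^sup>2 \<le> \<epsilon> n" and \<epsilon>: "\<epsilon> \<longlonglongrightarrow> 0"
  shows "\<exists>r\<in>L2 M. \<forall>n. (nrm M (\<lambda>x. r x - f n x))\<^sup>2 \<le> \<epsilon> n"
proof -
  have [measurable]: "f n \<in> borel_measurable M" for n using f by (rule L2_measurable)
  have int: "integrable M (f n)" for n by (rule L2_integrable[OF f])
  have eps0: "0 \<le> \<epsilon> n" for n using order_trans[OF zero_le_power2 cauchy[of n n]] by simp
  have "\<exists>N. \<forall>i\<ge>N. \<forall>j\<ge>N. (\<integral>x. norm (f i x - f j x) \<partial>M) < e" if e: "0 < e" for e :: real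
  proof -
    have "eventually (\<lambda>n. \<epsilon> n < (e / 2)\<^sup>2) sequentially" using \<epsilon> e by (intro order_tendstoD) auto
    then obtain N where N: "\<epsilon> N < (e / 2)\<^sup>2" by (auto simp: eventually_sequentially)
    have close: "nrm M (\<lambda>x. f N x - f i x) < e / 2" if "N \<le> i" for i
    proof -
      have "(nrm M (\<lambda>x. f N x - f i x))\<^sup>2 < (e / 2)\<^sup>2" using cauchy[OF that] N by linarith
      then show ?thesis by (rule power2_less_imp_less) (use e in simp)
    qed
    have "(\<integral>x. norm (f i x - f j x) \<partial>M) < e" if "N \<le> i" "N \<le> j" for i j
    proof -
      have "(\<integral>x. norm (f i x - f j x) \<partial>M) \<le> nrm M (\<lambda>x. f i x - f j x)"
        using nrm_ge_integral_abs[OF L2_diff[OF f f], of i j] by simp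
      also have "\<dots> \<le> nrm M (\<lambda>x. f N x - f j x) + nrm M (\<lambda>x. f N x - f i x)"
        using nrm_triangle_diff[OF L2_diff[OF f f] L2_diff[OF f f], of N j N i] by simp
      also have "\<dots> < e" using close[OF that(1)] close[OF that(2)] by simp
      finally show ?thesis .
    qed
    then show ?thesis by blast
  qed
  from cauchy_L1_AE_cauchy_subseq[OF int this]
  obtain \<rho> where \<rho>: "strict_mono \<rho>" "AE x in M. Cauchy (\<lambda>i. f (\<rho> i) x)" by metis
  \<comment> \<open>On the null set where the subsequence diverges the value of \<open>lim\<close>
    is unspecified, but r is measurable all the same.\<close>
  define r where "r x = lim (\<lambda>i. f (\<rho> i) x)" for x
  have rm [measurable]: "r \<in> borel_measurable M" unfolding r_def[abs_def] by measurable
  have lim: "AE x in M. (\<lambda>i. f (\<rho> i) x) \<longlonglongrightarrow> r x"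
    using \<rho>(2) by eventually_elim (simp add: r_def Cauchy_convergent_iff convergent_LIMSEQ_iff)
  have bound: "(\<integral>\<^sup>+x. ennreal ((r x - f n x)\<^sup>2) \<partial>M) \<le> ennreal (\<epsilon> n)" for n
  proof -
    have "(\<integral>\<^sup>+x. ennreal ((r x - f n x)\<^sup>2) \<partial>M) = (\<integral>\<^sup>+x. liminf (\<lambda>i. ennreal ((f (\<rho> i) x - f n x)\<^sup>2)) \<partial>M)"
    proof (rule nn_integral_cong_AE)
      show "AE x in M. ennreal ((r x - f n x)\<^sup>2) = liminf (\<lambda>i. ennreal ((f (\<rho> i) x - f n x)\<^sup>2))"
        using lim
      proof eventually_elim
        case (elim x)
        have "(\<lambda>i. ennreal ((f (\<rho> i) x - f n x)\<^sup>2)) \<longlonglongrightarrow> ennreal ((r x - f n x)\<^sup>2)"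
          using elim by (intro tendsto_ennrealI tendsto_intros)
        then show ?case by (intro lim_imp_Liminf[symmetric]) auto
      qed
    qed
    also have "\<dots> \<le> liminf (\<lambda>i. \<integral>\<^sup>+x. ennreal ((f (\<rho> i) x - f n x)\<^sup>2) \<partial>M)"
      by (rule nn_integral_liminf) measurable
    also have "\<dots> \<le> limsup (\<lambda>i. \<integral>\<^sup>+x. ennreal ((f (\<rho> i) x - f n x)\<^sup>2) \<partial>M)"
      by (rule Liminf_le_Limsup) simp
    also have "\<dots> \<le> ennreal (\<epsilon> n)"
    proof (rule Limsup_bounded)
      have "eventually (\<lambda>i. n \<le> \<rho> i) sequentially"
        using filterlim_subseq[OF \<rho>(1)] by (simp add: filterlim_at_top)
      then show "eventually (\<lambda>i. (\<integral>\<^sup>+x. ennreal ((f (\<rho> i) x - f n x)\<^sup>2) \<partial>M) \<le> ennreal (\<epsilon> n)) sequentially"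
      proof eventually_elim
        case (elim i)
        have "(\<integral>\<^sup>+x. ennreal ((f (\<rho> i) x - f n x)\<^sup>2) \<partial>M) = ennreal (\<integral>x. (f (\<rho> i) x - f n x)\<^sup>2 \<partial>M)"
          by (rule nn_integral_eq_integral[OF L2_integrable_sq[OF L2_diff[OF f f]]]) simp
        also have "(\<integral>x. (f (\<rho> i) x - f n x)\<^sup>2 \<partial>M) = (nrm M (\<lambda>x. f n x - f (\<rho> i) x))\<^sup>2"
          by (simp add: nrm_sq power2_commute)
        finally show ?case using cauchy[OF elim] by (simp add: ennreal_leI)
      qed
    qed
    finally show ?thesis .
  qed
  have i: "integrable M (\<lambda>x. (r x - f n x)\<^sup>2)" for n
    using bound[of n] by (intro integrableI_nonneg) (auto simp: less_top[symmetric] top_unique)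
  then have "(\<lambda>x. r x - f 0 x) \<in> L2 M" by (auto simp: L2_def)
  from L2_add[OF this f[of 0]] have rL: "r \<in> L2 M" by simp
  have "(nrm M (\<lambda>x. r x - f n x))\<^sup>2 \<le> \<epsilon> n" for n
  proof -
    have "ennreal (\<integral>x. (r x - f n x)\<^sup>2 \<partial>M) \<le> ennreal (\<epsilon> n)"
      using bound[of n] nn_integral_eq_integral[OF i, of n] by simp
    then show ?thesis using eps0[of n] by (simp add: nrm_sq ennreal_le_iff)
  qed
  with rL show ?thesis by blast
qed

context rcm
begin

lemma trans_prob_pos: "\<omega> \<in> space env_space \<Longrightarrow> e \<in> units \<Longrightarrow> 0 < trans_prob \<omega> 0 e"
  using env_space_pos[of \<omega> "{0, e}"] bondsI[of e 0] total_cond_pos[of \<omega> 0] by (simp add: trans_prob_def)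

text \<open>Every step has positive probability, so vanishing energy makes r almost surely invariant
  under each unit shift; \<open>invariant_constant\<close> applies.\<close>

lemma energy_zero_imp_constant:
  assumes r: "r \<in> L2 Q" and E: "energy r r \<le> 0"
  shows "\<exists>c. AE \<omega> in Q. r \<omega> = c"
proof -
  have rm: "r \<in> borel_measurable env_space" by (rule L2_Q_measurable[OF r])
  let ?\<phi> = "\<lambda>\<omega> e. (r (env_shift e \<omega>) - r \<omega>)\<^sup>2"
  have \<phi>: "step_measurable ?\<phi>"
    unfolding power2_eq_square using rm
    by (intro step_measurable_arith step_measurable_shift step_measurable_base)
  have eq: "(incr r z)\<^sup>2 = ?\<phi> (env_seen 0 z) (step 0 z)" for z by (simp add: incr_def env_seen_Suc)
  have i: "integrable A (\<lambda>z. ?\<phi> (env_seen 0 z) (step 0 z))"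
    using L2_integrable_sq[OF incr_L2[OF r]] by (simp add: eq)
  have ie: "integrable Q (\<lambda>\<omega>. trans_prob \<omega> 0 e * ?\<phi> \<omega> e)" if "e \<in> units" for e
    using i that unfolding integrable_first_step[OF \<phi>] by blast
  have nn: "AE \<omega> in Q. 0 \<le> trans_prob \<omega> 0 e * ?\<phi> \<omega> e" if "e \<in> units" for e
    using trans_prob_nonneg by (intro AE_I2 mult_nonneg_nonneg) (auto simp: space_Q)
  have "(\<Sum>e\<in>units. \<integral>\<omega>. trans_prob \<omega> 0 e * ?\<phi> \<omega> e \<partial>Q) = (\<integral>z. (incr r z)\<^sup>2 \<partial>A)"
    unfolding eq by (rule integral_first_step[OF \<phi> i, symmetric])
  also have "\<dots> = 2 * energy r r" by (simp add: energy_def power2_eq_square)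
  finally have s: "(\<Sum>e\<in>units. \<integral>\<omega>. trans_prob \<omega> 0 e * ?\<phi> \<omega> e \<partial>Q) = 0"
    using E energy_nonneg[of r] by simp
  have "AE \<omega> in P. r (env_shift e \<omega>) = r \<omega>" if e: "e \<in> units" for e
  proof -
    have "(\<integral>\<omega>. trans_prob \<omega> 0 e * ?\<phi> \<omega> e \<partial>Q) = 0"
      using s e integral_nonneg_AE[OF nn] by (subst (asm) sum_nonneg_eq_0_iff) (auto simp: finite_units)
    then have "AE \<omega> in Q. trans_prob \<omega> 0 e * ?\<phi> \<omega> e = 0"
      using integral_nonneg_eq_0_iff_AE[OF ie[OF e] nn[OF e]] by simp
    then have "AE \<omega> in Q. r (env_shift e \<omega>) = r \<omega>"
      using AE_space
    proof eventually_elim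
      case (elim \<omega>)
      then show ?case using trans_prob_pos[OF _ e, of \<omega>] by (simp add: space_Q)
    qed
    then show ?thesis by (simp add: AE_Q_iff)
  qed
  from invariant_constant[OF rm this] show ?thesis by (simp add: AE_Q_iff)
qed

text \<open>The residuals of a minimizing sequence are Cauchy; their limit is orthogonal to all coboundaries,
  so its Dirichlet form vanishes, and by ergodicity it is constant.\<close>

lemma coboundary_dense:
  assumes h: "h \<in> L2 Q" and h0: "(\<integral>\<omega>. h \<omega> \<partial>Q) = 0" and \<eta>: "0 < \<eta>"
  shows "\<exists>w. bdd_env w \<and> nrm Q (\<lambda>\<omega>. h \<omega> - (w \<omega> - trans_op w \<omega>)) \<le> \<eta>"
proof -
  define res where "res w \<omega> = h \<omega> - (w \<omega> - trans_op w \<omega>)" for w \<omega>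
  define \<Phi> where "\<Phi> w = (nrm Q (res w))\<^sup>2" for w
  define m where "m = Inf (\<Phi> ` Collect bdd_env)"
  have resL: "res w \<in> L2 Q" if "bdd_env w" for w
    unfolding res_def[abs_def] by (intro L2_diff h bdd_env_L2 that trans_op_L2)
  have bdd: "bdd_below (\<Phi> ` Collect bdd_env)" by (auto simp: bdd_below_def \<Phi>_def intro: exI[of _ 0])
  have ne: "\<Phi> ` Collect bdd_env \<noteq> {}" using bdd_env_const by auto
  have low: "m \<le> \<Phi> w" if "bdd_env w" for w
    unfolding m_def using that bdd by (intro cInf_lower) auto
  have "\<exists>w. bdd_env w \<and> \<Phi> w < m + 1 / real (Suc n)" for n
    using cInf_lessD[OF ne, of "m + 1 / real (Suc n)"] by (auto simp: m_def)
  then obtain w where w: "\<And>n. bdd_env (w n)" "\<And>n. \<Phi> (w n) < m + 1 / real (Suc n)" by metis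
  define r where "r n = res (w n)" for n
  have rL: "r n \<in> L2 Q" for n unfolding r_def by (rule resL[OF w(1)])
  \<comment> \<open>Parallelogram identity: the residual of the midpoint of w n and w k is the mean
    of the two residuals, and its square norm is at least m.\<close>
  have cauchy: "(nrm Q (\<lambda>\<omega>. r n \<omega> - r k \<omega>))\<^sup>2 \<le> 4 / real (Suc n)" if "n \<le> k" for n k
  proof -
    let ?u = "\<lambda>\<omega>. (1 / 2) * (w n \<omega> + w k \<omega>)"
    have u: "bdd_env ?u" by (intro bdd_env_cmult bdd_env_add w)
    have ru: "res ?u = (\<lambda>\<omega>. (1 / 2) * (r n \<omega> + 1 * r k \<omega>))"
      unfolding r_def res_def trans_op_cmult trans_op_add by (simp add: fun_eq_iff field_simps)
    have "m \<le> (nrm Q (\<lambda>\<omega>. r n \<omega> + 1 * r k \<omega>))\<^sup>2 / 4"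
      using low[OF u] unfolding \<Phi>_def ru nrm_cmult by (simp add: power_divide)
    moreover have "(nrm Q (\<lambda>\<omega>. r n \<omega> + 1 * r k \<omega>))\<^sup>2 + (nrm Q (\<lambda>\<omega>. r n \<omega> + (-1) * r k \<omega>))\<^sup>2 =
        2 * \<Phi> (w n) + 2 * \<Phi> (w k)"
      unfolding nrm_sq \<Phi>_def L2_integral_add_scaled_sq[OF rL rL] r_def[symmetric] by simp
    ultimately have "(nrm Q (\<lambda>\<omega>. r n \<omega> - r k \<omega>))\<^sup>2 \<le> 2 * (1 / real (Suc n)) + 2 * (1 / real (Suc k))"
      using w(2)[of n] w(2)[of k] by simp
    also have "1 / real (Suc k) \<le> 1 / real (Suc n)" using that by (intro divide_left_mono) auto
    finally show ?thesis by simp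
  qed
  have e0: "(\<lambda>n. 4 / real (Suc n)) \<longlonglongrightarrow> 0"
    using tendsto_mult_right_zero[OF LIMSEQ_inverse_real_of_nat, of 4] by (simp add: divide_inverse)
  obtain \<rho> where \<rho>: "\<rho> \<in> L2 Q" "\<And>n. (nrm Q (\<lambda>\<omega>. \<rho> \<omega> - r n \<omega>))\<^sup>2 \<le> 4 / real (Suc n)"
    using Q.L2_complete[OF rL cauchy e0] by blast
  have conv: "(\<lambda>n. nrm Q (\<lambda>\<omega>. \<rho> \<omega> - r n \<omega>)) \<longlonglongrightarrow> 0"
  proof -
    have "(\<lambda>n. (nrm Q (\<lambda>\<omega>. \<rho> \<omega> - r n \<omega>))\<^sup>2) \<longlonglongrightarrow> 0"
      by (rule tendsto_sandwich[OF _ _ tendsto_const e0]) (use \<rho>(2) in auto)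
    from tendsto_real_sqrt[OF this] show ?thesis by simp
  qed
  have ipconv: "(\<lambda>n. ip (r n) g) \<longlonglongrightarrow> ip \<rho> g" if g: "g \<in> L2 Q" for g
  proof (rule LIM_zero_cancel, rule Lim_null_comparison)
    show "eventually (\<lambda>n. norm (ip (r n) g - ip \<rho> g) \<le> nrm Q (\<lambda>\<omega>. \<rho> \<omega> - r n \<omega>) * nrm Q g) sequentially"
    proof (intro always_eventually allI)
      fix n
      have "ip (\<lambda>\<omega>. \<rho> \<omega> - r n \<omega>) g = ip \<rho> g - ip (r n) g" by (rule ip_diff[OF \<rho>(1) rL g])
      then show "norm (ip (r n) g - ip \<rho> g) \<le> nrm Q (\<lambda>\<omega>. \<rho> \<omega> - r n \<omega>) * nrm Q g"
        using ip_Cauchy_Schwarz[OF L2_diff[OF \<rho>(1) rL] g, of n] by simp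
    qed
    show "(\<lambda>n. nrm Q (\<lambda>\<omega>. \<rho> \<omega> - r n \<omega>) * nrm Q g) \<longlonglongrightarrow> 0"
      by (rule tendsto_mult_left_zero[OF conv])
  qed
  \<comment> \<open>Moving w n in the direction - g lowers \<Phi> by less than 1/(n + 1); the
    discriminant bounds the pairing of r n with the coboundary, and n tends to infinity.\<close>
  have orth: "ip \<rho> (\<lambda>\<omega>. g \<omega> - trans_op g \<omega>) = 0" if g: "bdd_env g" for g
  proof -
    let ?d = "\<lambda>\<omega>. g \<omega> - trans_op g \<omega>"
    have dL: "?d \<in> L2 Q" by (intro L2_diff bdd_env_L2 g trans_op_L2)
    have "(ip (r n) ?d)\<^sup>2 \<le> (nrm Q ?d)\<^sup>2 * (1 / real (Suc n))" for n
    proof (rule quadratic_nonneg_imp_discriminant)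
      fix s
      have b: "bdd_env (\<lambda>\<omega>. w n \<omega> + (- s) * g \<omega>)" by (intro bdd_env_add bdd_env_cmult w g)
      have "res (\<lambda>\<omega>. w n \<omega> + (- s) * g \<omega>) = (\<lambda>\<omega>. r n \<omega> + s * ?d \<omega>)"
        unfolding r_def res_def trans_op_cmult trans_op_add by (simp add: fun_eq_iff algebra_simps)
      then have "m \<le> (\<integral>\<omega>. (?d \<omega>)\<^sup>2 \<partial>Q) * s\<^sup>2 + 2 * (\<integral>\<omega>. r n \<omega> * ?d \<omega> \<partial>Q) * s + (\<integral>\<omega>. (r n \<omega>)\<^sup>2 \<partial>Q)"
        using low[OF b] L2_integral_add_scaled_sq[OF rL dL, of n s] by (simp add: \<Phi>_def nrm_sq)
      then show "0 \<le> (nrm Q ?d)\<^sup>2 * s\<^sup>2 + 2 * ip (r n) ?d * s + 1 / real (Suc n)"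
        using w(2)[of n] by (simp add: \<Phi>_def nrm_sq ip_def r_def)
    qed simp
    moreover have "(\<lambda>n. (nrm Q ?d)\<^sup>2 * (1 / real (Suc n))) \<longlonglongrightarrow> (nrm Q ?d)\<^sup>2 * 0"
      by (intro tendsto_intros LIMSEQ_Suc lim_1_over_n)
    moreover have "(\<lambda>n. (ip (r n) ?d)\<^sup>2) \<longlonglongrightarrow> (ip \<rho> ?d)\<^sup>2" by (intro tendsto_intros ipconv dL)
    ultimately have "(ip \<rho> ?d)\<^sup>2 \<le> (nrm Q ?d)\<^sup>2 * 0" by (intro LIMSEQ_le[of "\<lambda>n. (ip (r n) ?d)\<^sup>2"]) auto
    then show ?thesis by simp
  qed
  let ?k = "\<lambda>\<omega>. \<rho> \<omega> - trans_op \<rho> \<omega>"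
  have kL: "?k \<in> L2 Q" by (intro L2_diff \<rho> trans_op_L2)
  \<comment> \<open>Symmetry of \<open>trans_op\<close> turns orthogonality to coboundaries into
    \<rho> = R \<rho>, tested against bounded functions.\<close>
  have "(nrm Q ?k)\<^sup>2 \<le> 0"
  proof (rule nrm_le_of_bounded_tests[OF kL])
    fix g :: "'d env \<Rightarrow> real" assume g: "bdd_env g"
    note gL = bdd_env_L2[OF g]
    have "ip ?k g = ip \<rho> (\<lambda>\<omega>. g \<omega> - trans_op g \<omega>)"
      using ip_diff[OF gL trans_op_L2[OF gL] \<rho>(1)]
      by (simp add: ip_diff \<rho>(1) trans_op_L2 gL ip_trans_op_symmetric ip_commute[of \<rho>] ip_commute[of "trans_op \<rho>"])
    then show "(ip ?k g)\<^sup>2 \<le> 0 * ip g g" by (simp add: orth[OF g])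
  qed
  then have "nrm Q ?k = 0" by simp
  moreover have "energy \<rho> \<rho> = ip ?k \<rho>" by (simp add: energy_eq ip_diff \<rho>(1) trans_op_L2)
  ultimately have "energy \<rho> \<rho> \<le> 0" using ip_Cauchy_Schwarz[OF kL \<rho>(1)] by simp
  then obtain c where c: "AE \<omega> in Q. \<rho> \<omega> = c" using energy_zero_imp_constant[OF \<rho>(1)] by blast
  \<comment> \<open>Coboundaries and h have mean 0, hence so have all residuals and their limit; the
    constant must be 0.\<close>
  have "ip (r n) (\<lambda>_. 1) = 0" for n
  proof -
    note wL = bdd_env_L2[OF w(1)[of n]]
    have "ip (r n) (\<lambda>_. 1) = ip h (\<lambda>_. 1) - energy (w n) (\<lambda>_. 1)"
      unfolding r_def res_def[abs_def]
      by (simp add: ip_diff h wL trans_op_L2 L2_diff energy_eq Q.L2_const)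
    then show ?thesis by (simp add: ip_def h0 energy_def incr_def)
  qed
  then have "ip \<rho> (\<lambda>_. 1) = 0" using ipconv[OF Q.L2_const[of 1]] by (simp add: LIMSEQ_const_iff)
  moreover have "ip \<rho> (\<lambda>_. 1) = (\<integral>\<omega>. c \<partial>Q)"
    unfolding ip_def using c L2_measurable[OF \<rho>(1)] by (intro integral_cong_AE) auto
  ultimately have "c = 0" by (simp add: Q.prob_space)
  then have "(nrm Q \<rho>)\<^sup>2 = (\<integral>\<omega>. 0 \<partial>Q)"
    unfolding nrm_sq using c L2_measurable[OF \<rho>(1)] by (intro integral_cong_AE) auto
  then have n0: "nrm Q \<rho> = 0" by simp
  have "eventually (\<lambda>n. nrm Q (\<lambda>\<omega>. \<rho> \<omega> - r n \<omega>) < \<eta>) sequentially"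
    using conv \<eta> by (rule order_tendstoD)
  then obtain n where n: "nrm Q (\<lambda>\<omega>. \<rho> \<omega> - r n \<omega>) < \<eta>" by (auto simp: eventually_sequentially)
  have "nrm Q (r n) \<le> nrm Q \<rho> + nrm Q (\<lambda>\<omega>. \<rho> \<omega> - r n \<omega>)"
    using nrm_triangle_diff[OF \<rho>(1) L2_diff[OF \<rho>(1) rL], of n] by simp
  then have "nrm Q (r n) \<le> \<eta>" using n n0 by simp
  then show ?thesis using w(1)[of n] unfolding r_def res_def[abs_def] by blast
qed

section \<open>Laws of large numbers in the mean square\<close>

lemma real_nat_sqrt_tendsto: "(\<lambda>n. c / sqrt (real n)) \<longlonglongrightarrow> 0"
proof -
  have "(\<lambda>n. c * inverse (sqrt (real n))) \<longlonglongrightarrow> c * 0"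
    by (intro tendsto_mult tendsto_const tendsto_inverse_0_at_top
      filterlim_compose[OF sqrt_at_top filterlim_real_sequentially])
  then show ?thesis by (simp add: divide_inverse)
qed

text \<open>The sum over a coboundary is a martingale plus boundary terms, of order sqrt n; the
  remainder of small norm contributes at most n times that norm. Convergence in \<open>nrm\<close>
  is the form needed later, when the average is paired with a density bounded in L2.\<close>

lemma ssum_lln:
  assumes h: "bdd_env h"
  shows "(\<lambda>n. nrm A (\<lambda>z. ssum h n z / real n - (\<integral>\<omega>. h \<omega> \<partial>Q))) \<longlonglongrightarrow> 0"
proof (rule LIMSEQ_I)
  fix \<eta> :: real assume \<eta>: "0 < \<eta>"
  define m where "m = (\<integral>\<omega>. h \<omega> \<partial>Q)"
  let ?h = "\<lambda>\<omega>. h \<omega> - m"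
  have h0: "bdd_env ?h" using h by (intro bdd_env_diff bdd_env_const)
  have "(\<integral>\<omega>. ?h \<omega> \<partial>Q) = 0"
    using Q.L2_integrable[OF bdd_env_L2[OF h]] by (simp add: m_def Q.prob_space)
  then obtain w where w: "bdd_env w" "nrm Q (\<lambda>\<omega>. ?h \<omega> - (w \<omega> - trans_op w \<omega>)) \<le> \<eta> / 2"
    using coboundary_dense[OF bdd_env_L2[OF h0], of "\<eta> / 2"] \<eta> by auto
  let ?r = "\<lambda>\<omega>. ?h \<omega> - (w \<omega> - trans_op w \<omega>)"
  note wL = bdd_env_L2[OF w(1)]
  have rL: "?r \<in> L2 Q" by (intro L2_diff bdd_env_L2[OF h0] wL trans_op_L2)
  define C where "C = sqrt (2 * energy w w) + 2 * nrm Q w"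
  have bound: "nrm A (\<lambda>z. ssum h n z / real n - m) \<le> \<eta> / 2 + C / sqrt (real n)" if n: "1 \<le> n" for n
  proof -
    have eq: "(\<lambda>z. ssum h n z / real n - m) =
        (\<lambda>z. (1 / real n) * (ssum ?r n z + (mart (mdiff w) n z + (w (env_seen 0 z) - w (env_seen n z)))))"
    proof
      fix z
      have "ssum ?r n z = ssum h n z - real n * m - ssum (\<lambda>\<omega>. w \<omega> - trans_op w \<omega>) n z"
        by (simp add: ssum_def sum_subtractf)
      then have "ssum ?r n z + (mart (mdiff w) n z + (w (env_seen 0 z) - w (env_seen n z))) = ssum h n z - real n * m"
        by (simp add: ssum_coboundary)
      then show "ssum h n z / real n - m = (1 / real n) * (ssum ?r n z + (mart (mdiff w) n z + (w (env_seen 0 z) - w (env_seen n z))))"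
        using n by (simp add: field_simps)
    qed
    have bL: "(\<lambda>z. w (env_seen 0 z) - w (env_seen n z)) \<in> L2 A" by (intro L2_diff L2_env_seen wL)
    note mL = mart_L2[OF mdiff_bdd[OF w(1)], of n]
    have 1: "nrm A (ssum ?r n) \<le> real n * (\<eta> / 2)"
      using nrm_ssum_le[OF rL, of n] mult_left_mono[OF w(2), of "real n"] by simp
    have 2: "nrm A (mart (mdiff w) n) \<le> sqrt (real n) * sqrt (2 * energy w w)" by (rule nrm_mart_mdiff_le[OF w(1)])
    have 3: "nrm A (\<lambda>z. w (env_seen 0 z) - w (env_seen n z)) \<le> sqrt (real n) * (2 * nrm Q w)"
    proof -
      have "nrm A (\<lambda>z. w (env_seen 0 z) - w (env_seen n z)) \<le> 1 * (2 * nrm Q w)"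
        using nrm_triangle_diff[OF L2_env_seen[OF wL, of 0] L2_env_seen[OF wL, of n]] by (simp add: nrm_env_seen[OF wL])
      also have "\<dots> \<le> sqrt (real n) * (2 * nrm Q w)" using n by (intro mult_right_mono) auto
      finally show ?thesis .
    qed
    have "nrm A (\<lambda>z. ssum ?r n z + (mart (mdiff w) n z + (w (env_seen 0 z) - w (env_seen n z)))) \<le>
        real n * (\<eta> / 2) + sqrt (real n) * C"
      using nrm_triangle[OF ssum_L2[OF rL] L2_add[OF mL bL], of n] nrm_triangle[OF mL bL] 1 2 3
      unfolding C_def distrib_left by linarith
    then have "nrm A (\<lambda>z. ssum h n z / real n - m) \<le> (1 / real n) * (real n * (\<eta> / 2) + sqrt (real n) * C)"
      unfolding eq nrm_cmult by (simp add: divide_right_mono)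
    also have "\<dots> = \<eta> / 2 + C * (sqrt (real n) / real n)"
      using n by (simp add: field_simps)
    also have "sqrt (real n) / real n = 1 / sqrt (real n)" by (simp only: sqrt_divide_self_eq[OF of_nat_0_le_iff] inverse_eq_divide)
    finally show ?thesis by simp
  qed
  have "eventually (\<lambda>n. C / sqrt (real n) < \<eta> / 2) sequentially"
    using real_nat_sqrt_tendsto \<eta> by (intro order_tendstoD) auto
  then obtain N where N: "\<And>n. N \<le> n \<Longrightarrow> C / sqrt (real n) < \<eta> / 2" by (auto simp: eventually_sequentially)
  show "\<exists>no. \<forall>n\<ge>no. norm (nrm A (\<lambda>z. ssum h n z / real n - (\<integral>\<omega>. h \<omega> \<partial>Q)) - 0) < \<eta>"
    unfolding m_def[symmetric]
  proof (intro exI[of _ "max 1 N"] allI impI)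
    fix n assume "max 1 N \<le> n"
    then have "nrm A (\<lambda>z. ssum h n z / real n - m) < \<eta>"
      using bound[of n] N[of n] by linarith
    then show "norm (nrm A (\<lambda>z. ssum h n z / real n - m) - 0) < \<eta>" by simp
  qed
qed

text \<open>Subtracting the conditional means leaves a martingale of order sqrt n, and the
  conditional means are covered by \<open>ssum_lln\<close>.\<close>

lemma mart_lln:
  assumes \<phi>: "bdd_step \<phi>"
  shows "(\<lambda>n. nrm A (\<lambda>z. mart \<phi> n z / real n - (\<integral>\<omega>. mean_step \<phi> \<omega> \<partial>Q))) \<longlonglongrightarrow> 0"
proof -
  let ?\<psi> = "\<lambda>\<omega> e. \<phi> \<omega> e - mean_step \<phi> \<omega>"
  define m where "m = (\<integral>\<omega>. mean_step \<phi> \<omega> \<partial>Q)"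
  note h = bdd_step_mean[OF \<phi>]
  have \<psi>: "bdd_step ?\<psi>" by (intro bdd_step_diff \<phi> bdd_step_base h)
  have \<psi>0: "mean_step ?\<psi> \<omega> = 0" if "\<omega> \<in> space env_space" for \<omega>
    using that by (simp add: mean_step_diff mean_step_const)
  define c where "c = sqrt (\<integral>\<omega>. mean_step (\<lambda>\<omega> e. ?\<psi> \<omega> e * ?\<psi> \<omega> e) \<omega> \<partial>Q)"
  have bound: "nrm A (\<lambda>z. mart \<phi> n z / real n - m) \<le> c / sqrt (real n) + nrm A (\<lambda>z. ssum (mean_step \<phi>) n z / real n - m)" for n
  proof -
    have eq: "(\<lambda>z. mart \<phi> n z / real n - m) = (\<lambda>z. (1 / real n) * mart ?\<psi> n z + (ssum (mean_step \<phi>) n z / real n - m))"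
      by (simp add: fun_eq_iff mart_def ssum_def sum_subtractf diff_divide_distrib)
    have sL: "(\<lambda>z. ssum (mean_step \<phi>) n z / real n - m) \<in> L2 A"
      using L2_diff[OF L2_cmult[OF ssum_L2[OF bdd_env_L2[OF h]]] A.L2_const, of "1 / real n" n m] by simp
    have "nrm A (\<lambda>z. (1 / real n) * mart ?\<psi> n z) = (1 / real n) * (sqrt (real n) * c)"
      unfolding nrm_cmult c_def using nrm_mart[OF \<psi> \<psi>0, of n] by simp
    also have "\<dots> = c * (sqrt (real n) / real n)" by simp
    also have "sqrt (real n) / real n = 1 / sqrt (real n)" by (simp only: sqrt_divide_self_eq[OF of_nat_0_le_iff] inverse_eq_divide)
    finally show ?thesis
      unfolding eq using nrm_triangle[OF L2_cmult[OF mart_L2[OF \<psi>]] sL, of "1 / real n" n] by simp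
  qed
  have "(\<lambda>n. c / sqrt (real n) + nrm A (\<lambda>z. ssum (mean_step \<phi>) n z / real n - m)) \<longlonglongrightarrow> 0 + 0"
    unfolding m_def by (intro tendsto_add real_nat_sqrt_tendsto ssum_lln h)
  then have lim: "(\<lambda>n. c / sqrt (real n) + nrm A (\<lambda>z. ssum (mean_step \<phi>) n z / real n - m)) \<longlonglongrightarrow> 0" by simp
  show ?thesis
    unfolding m_def[symmetric]
  proof (rule tendsto_sandwich[OF _ _ tendsto_const lim])
    show "eventually (\<lambda>n. 0 \<le> nrm A (\<lambda>z. mart \<phi> n z / real n - m)) sequentially" by simp
  qed (intro always_eventually allI bound)
qed

end

section \<open>A martingale central limit theorem\<close>

text \<open>The quadratics 1 - y + y^2/2 and 1 + y + y^2/2 multiply to 1 + y^4/4, so the lower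
  Taylor bound for exp y inverts to an upper bound for exp (- y).\<close>

lemma exp_minus_le_quadratic:
  fixes y :: real assumes "0 \<le> y" shows "exp (- y) \<le> 1 - y + y\<^sup>2 / 2"
proof -
  have 1: "1 + y + y\<^sup>2 / 2 \<le> exp y" by (rule exp_lower_Taylor_quadratic[OF assms])
  have pos: "0 < 1 + y + y\<^sup>2 / 2" using assms by (simp add: add_pos_nonneg)
  have "(1 - y + y\<^sup>2 / 2) * (1 + y + y\<^sup>2 / 2) = 1 + y ^ 4 / 4"
    by (simp add: power2_eq_square power4_eq_xxxx field_simps)
  then have "1 \<le> (1 - y + y\<^sup>2 / 2) * (1 + y + y\<^sup>2 / 2)" by simp
  then have "1 / (1 + y + y\<^sup>2 / 2) \<le> 1 - y + y\<^sup>2 / 2" using pos by (simp add: pos_divide_le_eq)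
  moreover have "exp (- y) \<le> 1 / (1 + y + y\<^sup>2 / 2)"
    using le_imp_inverse_le[OF 1 pos] by (simp only: exp_minus inverse_eq_divide)
  ultimately show ?thesis by linarith
qed

text \<open>McLeish's device: up to the third order, \<open>iexp x\<close> is a factor of mean \<open>1\<close> for a martingale
  increment \<open>x\<close>, times a factor that involves only the square of \<open>x\<close>.\<close>

lemma iexp_factor_approx:
  assumes x: "\<bar>x\<bar> \<le> 1"
  shows "cmod (iexp x - (1 + \<i> * of_real x) * of_real (exp (- x\<^sup>2 / 2))) \<le> \<bar>x\<bar> ^ 3"
proof -
  define y where "y = x\<^sup>2 / 2"
  define d where "d = exp (- y) - (1 - y)"
  have y: "0 \<le> y" by (simp add: y_def)
  have "1 + (- y) \<le> exp (- y)" by (rule exp_ge_add_one_self)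
  then have d: "0 \<le> d" "d \<le> y\<^sup>2 / 2" using exp_minus_le_quadratic[OF y] by (auto simp: d_def)
  have "(\<Sum>k\<le>2. (\<i> * complex_of_real x) ^ k / fact k) = 1 + \<i> * of_real x - of_real y"
    by (simp add: eval_nat_numeral y_def field_simps)
  then have 1: "cmod (iexp x - (1 + \<i> * of_real x - of_real y)) \<le> \<bar>x\<bar> ^ 3 / 6"
    using iexp_approx1[of x 2] by (simp add: eval_nat_numeral)
  have "(1 + \<i> * of_real x) * of_real (exp (- y)) - (1 + \<i> * of_real x - of_real y) =
      (1 + \<i> * of_real x) * of_real d - \<i> * of_real (x * y)"
    by (simp add: d_def algebra_simps)
  also have "cmod \<dots> \<le> (1 + \<bar>x\<bar>) * \<bar>d\<bar> + \<bar>x * y\<bar>"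
  proof (rule order_trans[OF norm_triangle_ineq4], rule add_mono)
    have "cmod (1 + \<i> * of_real x) \<le> 1 + \<bar>x\<bar>"
      using norm_triangle_ineq[of 1 "\<i> * complex_of_real x"] by (simp add: norm_mult)
    then show "cmod ((1 + \<i> * of_real x) * of_real d) \<le> (1 + \<bar>x\<bar>) * \<bar>d\<bar>"
      by (simp add: norm_mult mult_right_mono)
  qed (simp add: norm_mult)
  also have "\<dots> \<le> 2 * (y\<^sup>2 / 2) + \<bar>x * y\<bar>"
    using x d by (intro add_mono mult_mono) auto
  also have "\<dots> = \<bar>x\<bar> ^ 3 * \<bar>x\<bar> / 4 + \<bar>x\<bar> ^ 3 / 2"
    by (simp add: y_def abs_mult power_divide eval_nat_numeral)
  also have "\<dots> \<le> \<bar>x\<bar> ^ 3 * 1 / 4 + \<bar>x\<bar> ^ 3 / 2"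
    using x by (intro add_mono divide_right_mono mult_left_mono) auto
  finally have 2: "cmod ((1 + \<i> * of_real x) * of_real (exp (- y)) - (1 + \<i> * of_real x - of_real y)) \<le> 3 / 4 * \<bar>x\<bar> ^ 3"
    by simp
  have "cmod (iexp x - (1 + \<i> * of_real x) * of_real (exp (- y))) \<le> \<bar>x\<bar> ^ 3 / 6 + 3 / 4 * \<bar>x\<bar> ^ 3"
    using norm_triangle_ineq4[of "iexp x - (1 + \<i> * of_real x - of_real y)"
        "(1 + \<i> * of_real x) * of_real (exp (- y)) - (1 + \<i> * of_real x - of_real y)"] 1 2 by simp
  also have "\<dots> \<le> \<bar>x\<bar> ^ 3" by simp
  finally show ?thesis by (simp add: y_def)
qed

text \<open>Multiplied by exp (- x^2/2) the factor has modulus at most 1, as a telescoping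
  comparison of products requires.\<close>

lemma cmod_one_plus_i_le: "cmod (1 + \<i> * of_real x) \<le> exp (x\<^sup>2 / 2)"
proof -
  have "(cmod (1 + \<i> * of_real x))\<^sup>2 = 1 + x\<^sup>2" by (simp add: cmod_power2)
  also have "\<dots> \<le> exp (x\<^sup>2)" by (rule exp_ge_add_one_self)
  also have "\<dots> = (exp (x\<^sup>2 / 2))\<^sup>2" by (simp add: exp_double[symmetric])
  finally show ?thesis by (rule power2_le_imp_le) simp
qed

lemma exp_minus_Lipschitz:
  fixes a b :: real assumes "0 \<le> a" "0 \<le> b" shows "\<bar>exp (- a) - exp (- b)\<bar> \<le> \<bar>a - b\<bar>"
proof -
  have *: "exp (- a) - exp (- b) \<le> b - a" if "0 \<le> a" "a \<le> b" for a b :: real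
  proof -
    have "exp (- a) - exp (- b) = exp (- a) * (1 - exp (- (b - a)))"
      by (simp add: right_diff_distrib exp_add[symmetric])
    also have "\<dots> \<le> 1 * (b - a)"
    proof (rule mult_mono)
      show "1 - exp (- (b - a)) \<le> b - a" using exp_ge_add_one_self[of "- (b - a)"] by linarith
    qed (use that in auto)
    finally show ?thesis by simp
  qed
  show ?thesis using *[of a b] *[of b a] assms by (cases "a \<le> b") auto
qed

lemma iexp_Lipschitz: "cmod (iexp a - iexp b) \<le> \<bar>a - b\<bar>"
proof -
  have "iexp a - iexp b = iexp b * (iexp (a - b) - 1)" by (simp add: exp_add[symmetric] algebra_simps)
  then have "cmod (iexp a - iexp b) = cmod (iexp (a - b) - 1)" by (simp only: norm_mult norm_exp_i_times mult_1_left)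
  also have "\<dots> \<le> \<bar>a - b\<bar>" using iexp_approx1[of "a - b" 0] by simp
  finally show ?thesis .
qed

lemma integral_norm_bound_AE:
  fixes f :: "'a \<Rightarrow> 'b::{banach,second_countable_topology}"
  assumes "integrable M f" "integrable M g" "AE x in M. norm (f x) \<le> g x"
  shows "norm (\<integral>x. f x \<partial>M) \<le> (\<integral>x. g x \<partial>M)"
  by (rule order_trans[OF integral_norm_bound integral_mono_AE]) (use assms in auto)

lemma mean_step_square_nonneg:
  "\<omega> \<in> space env_space \<Longrightarrow> 0 \<le> mean_step (\<lambda>\<omega> e. \<phi> \<omega> e * \<phi> \<omega> e) \<omega>"
  unfolding mean_step_def by (intro sum_nonneg mult_nonneg_nonneg[OF trans_prob_nonneg zero_le_square])

context rcm
begin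

definition mcleish :: "('d env \<Rightarrow> int ^ 'd \<Rightarrow> real) \<Rightarrow> real \<Rightarrow> nat \<Rightarrow> 'd env \<times> 'd path \<Rightarrow> complex" where
  "mcleish \<phi> s n z = (\<Prod>k<n. 1 + \<i> * of_real (s * \<phi> (env_seen k z) (step k z)))"

lemma past_of_real: "past n F \<Longrightarrow> past n (\<lambda>z. complex_of_real (F z))"
proof -
  assume F: "past n F"
  show ?thesis
    by (rule pastI) (use past_borel[OF F] in simp, rule arg_cong[OF pastD[OF F]])
qed

lemma mcleish_past: "step_measurable \<phi> \<Longrightarrow> past n (mcleish \<phi> s n)"
  unfolding mcleish_def[abs_def]
  by (intro past_prod past_add past_const past_mult past_of_real step_past) auto

text \<open>Each new factor adds an increment with conditional mean 0. The weight \<psi> depends on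
  the initial environment only and is therefore part of the past of every step; it will be the
  density of P.\<close>

lemma mcleish_mean:
  assumes \<phi>: "bdd_step \<phi>" "\<And>\<omega>. \<omega> \<in> space env_space \<Longrightarrow> mean_step \<phi> \<omega> = 0"
    and \<psi>: "\<psi> \<in> borel_measurable env_space" "AE \<omega> in Q. \<bar>\<psi> \<omega>\<bar> \<le> C"
  shows "integrable A (\<lambda>z. of_real (\<psi> (env_seen 0 z)) * mcleish \<phi> s n z)"
    and "(\<integral>z. of_real (\<psi> (env_seen 0 z)) * mcleish \<phi> s n z \<partial>A) = of_real (\<integral>\<omega>. \<psi> \<omega> \<partial>Q)"
proof -
  have \<phi>m: "step_measurable \<phi>" by (rule bdd_step_measurable[OF \<phi>(1)])
  obtain c where c: "0 \<le> c" "\<And>n. AE z in A. \<bar>\<phi> (env_seen n z) (step n z)\<bar> \<le> c"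
    by (rule bdd_step_AE[OF \<phi>(1)]) blast
  have c': "AE z in A. \<forall>n. \<bar>\<phi> (env_seen n z) (step n z)\<bar> \<le> c" using c(2) by (simp add: AE_all_countable)
  have \<psi>': "AE z in A. \<bar>\<psi> (env_seen 0 z)\<bar> \<le> C"
    by (rule AE_distrD[OF env_seen_A, of "\<lambda>\<omega>. \<bar>\<psi> \<omega>\<bar> \<le> C" 0]) (simp only: distr_env_seen \<psi>(2))
  have pF: "past n (\<lambda>z. of_real (\<psi> (env_seen 0 z)) * mcleish \<phi> s n z)" for n
    by (intro past_mult past_of_real env_seen_past \<psi>(1) mcleish_past \<phi>m) simp
  have nb: "AE z in A. norm (of_real (\<psi> (env_seen 0 z)) * mcleish \<phi> s n z) \<le> \<bar>C\<bar> * (1 + \<bar>s\<bar> * c) ^ n" for n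
    using c' \<psi>'
  proof eventually_elim
    case (elim z)
    have "norm (mcleish \<phi> s n z) \<le> (\<Prod>k<n. 1 + \<bar>s\<bar> * c)"
      unfolding mcleish_def prod_norm[symmetric]
    proof (rule prod_mono, intro conjI norm_ge_zero)
      fix k
      have "norm (1 + \<i> * complex_of_real (s * \<phi> (env_seen k z) (step k z))) \<le> 1 + \<bar>s\<bar> * \<bar>\<phi> (env_seen k z) (step k z)\<bar>"
        using norm_triangle_ineq[of 1 "\<i> * complex_of_real (s * \<phi> (env_seen k z) (step k z))"]
        by (simp add: norm_mult)
      also have "\<dots> \<le> 1 + \<bar>s\<bar> * c" using elim by (intro add_left_mono mult_left_mono) auto
      finally show "norm (1 + \<i> * complex_of_real (s * \<phi> (env_seen k z) (step k z))) \<le> 1 + \<bar>s\<bar> * c" .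
    qed
    then have "norm (mcleish \<phi> s n z) \<le> (1 + \<bar>s\<bar> * c) ^ n" by simp
    moreover have "\<bar>\<psi> (env_seen 0 z)\<bar> \<le> \<bar>C\<bar>" using elim by linarith
    ultimately show ?case by (simp add: norm_mult mult_mono)
  qed
  have int: "integrable A (\<lambda>z. of_real (\<psi> (env_seen 0 z)) * mcleish \<phi> s n z)" for n
    by (rule A.integrable_const_bound[OF nb past_measurable[OF pF]])
  then show "integrable A (\<lambda>z. of_real (\<psi> (env_seen 0 z)) * mcleish \<phi> s n z)" .
  show "(\<integral>z. of_real (\<psi> (env_seen 0 z)) * mcleish \<phi> s n z \<partial>A) = of_real (\<integral>\<omega>. \<psi> \<omega> \<partial>Q)"
  proof (induction n)
    case 0
    have "(\<integral>z. complex_of_real (\<psi> (env_seen 0 z)) \<partial>A) = of_real (\<integral>z. \<psi> (env_seen 0 z) \<partial>A)"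
      by (rule integral_complex_of_real)
    then show ?case using integral_env_seen[OF \<psi>(1), of 0] by (simp add: mcleish_def)
  next
    case (Suc n)
    let ?F = "\<lambda>z. \<i> * of_real s * (of_real (\<psi> (env_seen 0 z)) * mcleish \<phi> s n z)"
    let ?G = "\<lambda>z. \<phi> (env_seen n z) (step n z) *\<^sub>R ?F z"
    have F: "past n ?F" by (intro past_mult past_const pF)
    have eq: "of_real (\<psi> (env_seen 0 z)) * mcleish \<phi> s (Suc n) z =
        of_real (\<psi> (env_seen 0 z)) * mcleish \<phi> s n z + ?G z" for z
      by (simp add: mcleish_def scaleR_conv_of_real algebra_simps)
    have iG: "integrable A ?G"
      using Bochner_Integration.integrable_diff[OF int[of "Suc n"] int[of n]] by (simp add: eq)
    have "(\<integral>z. ?G z \<partial>A) = (\<integral>z. mean_step \<phi> (env_seen n z) *\<^sub>R ?F z \<partial>A)"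
      by (rule markov[OF F \<phi>m iG])
    also have "\<dots> = (\<integral>z. 0 \<partial>A)"
      by (intro Bochner_Integration.integral_cong) (auto simp: \<phi>(2) env_seen_space_A)
    finally show ?case using Suc int[of n] iG by (simp only: eq Bochner_Integration.integral_add) simp
  qed
qed

text \<open>Up to third order \<open>iexp\<close> of the normalized martingale is T exp (- V/2),
  where T is the product of mean-one factors and V the normalized sum of squares. Bounded increments
  bound T by exp (c^2/2), and V tends to v by \<open>mart_lln\<close>, so V can be replaced by the
  constant v before taking means.\<close>

lemma bounded_martingale_clt:
  assumes \<phi>: "bdd_step \<phi>" "\<And>\<omega>. \<omega> \<in> space env_space \<Longrightarrow> mean_step \<phi> \<omega> = 0"
    and \<psi>: "\<psi> \<in> borel_measurable env_space" "AE \<omega> in Q. \<bar>\<psi> \<omega>\<bar> \<le> C"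
  defines "v \<equiv> \<integral>\<omega>. mean_step (\<lambda>\<omega> e. \<phi> \<omega> e * \<phi> \<omega> e) \<omega> \<partial>Q"
  shows "(\<lambda>n. \<integral>z. of_real (\<psi> (env_seen 0 z)) * iexp (mart \<phi> n z / sqrt (real n)) \<partial>A) \<longlonglongrightarrow>
    of_real (\<integral>\<omega>. \<psi> \<omega> \<partial>Q) * of_real (exp (- v / 2))"
proof -
  have \<phi>m: "step_measurable \<phi>" by (rule bdd_step_measurable[OF \<phi>(1)])
  note \<phi>2 = bdd_step_mult[OF \<phi>(1) \<phi>(1)]
  obtain c where c: "0 \<le> c" "\<And>n. AE z in A. \<bar>\<phi> (env_seen n z) (step n z)\<bar> \<le> c"
    by (rule bdd_step_AE[OF \<phi>(1)]) blast
  have c': "AE z in A. \<forall>n. \<bar>\<phi> (env_seen n z) (step n z)\<bar> \<le> c" using c(2) by (simp add: AE_all_countable)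
  have \<psi>': "AE z in A. \<bar>\<psi> (env_seen 0 z)\<bar> \<le> C"
    by (rule AE_distrD[OF env_seen_A, of "\<lambda>\<omega>. \<bar>\<psi> \<omega>\<bar> \<le> C" 0]) (simp only: distr_env_seen \<psi>(2))
  have \<psi>m [measurable]: "(\<lambda>z. \<psi> (env_seen 0 z)) \<in> borel_measurable A"
    by (rule measurable_compose[OF env_seen_A \<psi>(1)])
  have v0: "0 \<le> v"
    unfolding v_def by (intro integral_nonneg_AE AE_I2 mean_step_square_nonneg) (simp add: space_Q)
  define V where "V n z = mart (\<lambda>\<omega> e. \<phi> \<omega> e * \<phi> \<omega> e) n z / real n" for n z
  define s where "s n = 1 / sqrt (real n)" for n
  have s2: "(s n)\<^sup>2 = 1 / real n" for n by (simp add: s_def power_divide)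
  let ?T = "\<lambda>n. mcleish \<phi> (s n) n"
  define E where "E n z = complex_of_real (\<psi> (env_seen 0 z)) * iexp (mart \<phi> n z / sqrt (real n))" for n z
  define D where "D n z = complex_of_real (exp (- v / 2)) * (of_real (\<psi> (env_seen 0 z)) * ?T n z)" for n z
  have mm: "mart \<phi> n \<in> borel_measurable A" for n by (rule past_measurable[OF mart_past[OF \<phi>m]])
  note [measurable] = mm
  have Em: "E n \<in> borel_measurable A" for n unfolding E_def[abs_def] by measurable
  have Ei: "integrable A (E n)" for n
  proof (rule A.integrable_const_bound[OF _ Em])
    show "AE z in A. norm (E n z) \<le> \<bar>C\<bar>"
      using \<psi>' by eventually_elim (simp add: E_def norm_mult)
  qed
  have Di: "integrable A (D n)" and DI: "(\<integral>z. D n z \<partial>A) = of_real (exp (- v / 2)) * of_real (\<integral>\<omega>. \<psi> \<omega> \<partial>Q)" for n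
    unfolding D_def[abs_def] using mcleish_mean[OF \<phi> \<psi>, of "s n" n] by simp_all
  have VL: "(\<lambda>z. V n z - v) \<in> L2 A" for n
    using L2_diff[OF L2_cmult[OF mart_L2[OF \<phi>2]] A.L2_const, of "1 / real n" n v] by (simp add: V_def)
  define B where "B = \<bar>C\<bar> * exp (c\<^sup>2 / 2)"
  have pt: "AE z in A. norm (E n z - D n z) \<le> \<bar>C\<bar> * c ^ 3 / sqrt (real n) + B * \<bar>V n z - v\<bar>"
    if n: "1 \<le> n" "c\<^sup>2 \<le> real n" for n
    using c' \<psi>'
  proof eventually_elim
    case (elim z)
    define x where "x k = s n * \<phi> (env_seen k z) (step k z)" for k
    have sn: "0 < s n" using n by (simp add: s_def)
    have xc: "\<bar>x k\<bar> \<le> s n * c" for k using elim(1) sn by (simp add: x_def abs_mult)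
    have "c \<le> sqrt (real n)" using n(2) by (intro real_le_rsqrt)
    then have "s n * c \<le> 1" using n by (simp add: s_def pos_divide_le_eq)
    then have x1: "\<bar>x k\<bar> \<le> 1" for k using xc[of k] by linarith
    have sumx: "mart \<phi> n z / sqrt (real n) = (\<Sum>k<n. x k)"
      by (simp add: mart_def x_def s_def sum_divide_distrib)
    have "(x k)\<^sup>2 = \<phi> (env_seen k z) (step k z) * \<phi> (env_seen k z) (step k z) / real n" for k
      by (simp only: x_def power_mult_distrib s2) (simp add: power2_eq_square)
    then have sumx2: "(\<Sum>k<n. (x k)\<^sup>2) = V n z"
      by (simp add: V_def mart_def sum_divide_distrib)
    have V0: "0 \<le> V n z" unfolding sumx2[symmetric] by (intro sum_nonneg) auto
    have Vc: "V n z \<le> c\<^sup>2"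
    proof -
      have "(\<Sum>k<n. (x k)\<^sup>2) \<le> (\<Sum>k<n. (s n * c)\<^sup>2)"
      proof (rule sum_mono)
        fix k show "(x k)\<^sup>2 \<le> (s n * c)\<^sup>2" using xc[of k] sn c(1) by (intro power2_le_iff_abs_le[THEN iffD2]) auto
      qed
      then show ?thesis using n by (simp add: sumx2 power_mult_distrib s2)
    qed
    have i: "iexp (\<Sum>k<n. x k) = (\<Prod>k<n. iexp (x k))" by (simp add: sum_distrib_left exp_sum)
    have t: "?T n z * of_real (exp (- V n z / 2)) = (\<Prod>k<n. (1 + \<i> * of_real (x k)) * of_real (exp (- (x k)\<^sup>2 / 2)))"
      by (simp add: mcleish_def x_def[symmetric] prod.distrib sumx2[symmetric] exp_sum[symmetric]
        sum_negf sum_divide_distrib flip: of_real_prod)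
    \<comment> \<open>All factors on both sides have modulus at most 1, so the products differ by at
      most the sum of the differences of the factors.\<close>
    have "cmod (iexp (\<Sum>k<n. x k) - ?T n z * of_real (exp (- V n z / 2))) \<le>
        (\<Sum>k<n. cmod (iexp (x k) - (1 + \<i> * of_real (x k)) * of_real (exp (- (x k)\<^sup>2 / 2))))"
      unfolding i t
    proof (rule norm_prod_diff)
      fix k
      show "norm ((1 + \<i> * of_real (x k)) * complex_of_real (exp (- (x k)\<^sup>2 / 2))) \<le> 1"
        using mult_right_mono[OF cmod_one_plus_i_le[of "x k"], of "exp (- (x k)\<^sup>2 / 2)"]
        by (simp add: norm_mult exp_add[symmetric])
    qed simp
    also have "\<dots> \<le> (\<Sum>k<n. (s n * c) ^ 3)"
      using xc x1 by (intro sum_mono order_trans[OF iexp_factor_approx] power_mono) auto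
    also have "\<dots> = c ^ 3 / sqrt (real n)"
    proof -
      have "real n * (s n) ^ 3 = s n"
        using n s2[of n] by (simp add: power3_eq_cube power2_eq_square[symmetric] mult.assoc[symmetric])
      moreover have "(\<Sum>k<n. (s n * c) ^ 3) = (real n * (s n) ^ 3) * c ^ 3" by (simp add: power_mult_distrib)
      ultimately have "(\<Sum>k<n. (s n * c) ^ 3) = s n * c ^ 3" by simp
      then show ?thesis by (simp add: s_def)
    qed
    finally have 1: "cmod (iexp (\<Sum>k<n. x k) - ?T n z * of_real (exp (- V n z / 2))) \<le> c ^ 3 / sqrt (real n)" .
    have T: "cmod (?T n z) \<le> exp (c\<^sup>2 / 2)"
    proof -
      have "cmod (?T n z) \<le> (\<Prod>k<n. exp ((x k)\<^sup>2 / 2))"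
        unfolding mcleish_def x_def[symmetric] prod_norm[symmetric]
        by (intro prod_mono conjI norm_ge_zero cmod_one_plus_i_le)
      also have "\<dots> = exp (V n z / 2)" by (simp add: exp_sum[symmetric] sumx2[symmetric] sum_divide_distrib)
      finally show ?thesis using Vc by (smt (verit) exp_le_cancel_iff divide_right_mono)
    qed
    have "\<bar>exp (- (V n z / 2)) - exp (- (v / 2))\<bar> \<le> \<bar>V n z / 2 - v / 2\<bar>"
      using V0 v0 by (intro exp_minus_Lipschitz) auto
    also have "\<dots> \<le> \<bar>V n z - v\<bar>" by linarith
    finally have "\<bar>exp (- V n z / 2) - exp (- v / 2)\<bar> \<le> \<bar>V n z - v\<bar>" by simp
    then have 2: "cmod (?T n z * of_real (exp (- V n z / 2)) - ?T n z * of_real (exp (- v / 2))) \<le> exp (c\<^sup>2 / 2) * \<bar>V n z - v\<bar>"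
      using T by (simp add: right_diff_distrib[symmetric] norm_mult mult_mono del: of_real_diff flip: of_real_diff)
    have "E n z - D n z = of_real (\<psi> (env_seen 0 z)) * (iexp (\<Sum>k<n. x k) - ?T n z * of_real (exp (- v / 2)))"
      by (simp only: E_def D_def sumx right_diff_distrib mult_ac)
    then have "norm (E n z - D n z) = \<bar>\<psi> (env_seen 0 z)\<bar> * cmod (iexp (\<Sum>k<n. x k) - ?T n z * of_real (exp (- v / 2)))"
      by (simp only: norm_mult norm_of_real)
    also have "\<dots> \<le> \<bar>C\<bar> * (c ^ 3 / sqrt (real n) + exp (c\<^sup>2 / 2) * \<bar>V n z - v\<bar>)"
      using elim(2) norm_triangle_ineq[of "iexp (\<Sum>k<n. x k) - ?T n z * of_real (exp (- V n z / 2))"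
        "?T n z * of_real (exp (- V n z / 2)) - ?T n z * of_real (exp (- v / 2))"] 1 2
      by (intro mult_mono) auto
    finally show ?case by (simp add: B_def algebra_simps)
  qed
  have bound: "norm ((\<integral>z. E n z \<partial>A) - of_real (\<integral>\<omega>. \<psi> \<omega> \<partial>Q) * of_real (exp (- v / 2))) \<le>
      \<bar>C\<bar> * c ^ 3 / sqrt (real n) + B * nrm A (\<lambda>z. V n z - v)" if n: "1 \<le> n" "c\<^sup>2 \<le> real n" for n
  proof -
    have "(\<integral>z. E n z \<partial>A) - of_real (\<integral>\<omega>. \<psi> \<omega> \<partial>Q) * of_real (exp (- v / 2)) = (\<integral>z. E n z - D n z \<partial>A)"
      using Ei Di by (simp add: DI mult.commute)
    also have "norm \<dots> \<le> (\<integral>z. \<bar>C\<bar> * c ^ 3 / sqrt (real n) + B * \<bar>V n z - v\<bar> \<partial>A)"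
      using pt[OF n] A.L2_integrable[OF VL, of n] Ei Di by (intro integral_norm_bound_AE) auto
    also have "\<dots> = \<bar>C\<bar> * c ^ 3 / sqrt (real n) + B * (\<integral>z. \<bar>V n z - v\<bar> \<partial>A)"
      using A.L2_integrable[OF VL, of n] by (simp add: A.prob_space)
    also have "\<dots> \<le> \<bar>C\<bar> * c ^ 3 / sqrt (real n) + B * nrm A (\<lambda>z. V n z - v)"
      using A.nrm_ge_integral_abs[OF VL, of n] by (intro add_left_mono mult_left_mono) (auto simp: B_def)
    finally show ?thesis .
  qed
  have lim: "(\<lambda>n. \<bar>C\<bar> * c ^ 3 / sqrt (real n) + B * nrm A (\<lambda>z. V n z - v)) \<longlonglongrightarrow> 0 + B * 0"
    unfolding V_def v_def by (intro tendsto_intros real_nat_sqrt_tendsto mart_lln \<phi>2)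
  obtain N :: nat where N: "c\<^sup>2 \<le> real N" using real_arch_simple by blast
  have "eventually (\<lambda>n. norm ((\<integral>z. E n z \<partial>A) - of_real (\<integral>\<omega>. \<psi> \<omega> \<partial>Q) * of_real (exp (- v / 2))) \<le>
      \<bar>C\<bar> * c ^ 3 / sqrt (real n) + B * nrm A (\<lambda>z. V n z - v)) sequentially"
    unfolding eventually_sequentially using N by (intro exI[of _ "max 1 N"] allI impI bound) auto
  from Lim_null_comparison[OF this] lim
  have "(\<lambda>n. (\<integral>z. E n z \<partial>A) - of_real (\<integral>\<omega>. \<psi> \<omega> \<partial>Q) * of_real (exp (- v / 2))) \<longlonglongrightarrow> 0" by simp
  then show ?thesis unfolding E_def by (rule LIM_zero_cancel)
qed

text \<open>The approximating martingale has norm exactly proportional to sqrt n, so the quotients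
  stay eventually within e/3 of a constant. Convergence is needed for linear combinations of f with
  the drift too, and \<open>hm1\<close>, unlike \<open>H_minus_1\<close> by its definition, visibly
  passes to these.\<close>

lemma nrm_ssum_convergent:
  assumes f: "hm1 K f"
  shows "convergent (\<lambda>n. nrm A (ssum f n) / sqrt (real n))"
proof -
  have fL: "f \<in> L2 Q" by (rule hm1_L2[OF f])
  have "Cauchy (\<lambda>n. nrm A (ssum f n) / sqrt (real n))"
  proof (rule metric_CauchyI)
    fix e :: real assume e: "0 < e"
    then obtain v N where v: "bdd_env v"
      and N: "\<And>n. N \<le> n \<Longrightarrow> nrm A (\<lambda>z. ssum f n z - mart (mdiff v) n z) \<le> e / 3 * sqrt (real n)"
      using martingale_approx[OF f, of "e / 3"] by auto
    define \<sigma> where "\<sigma> = sqrt (\<integral>\<omega>. mean_step (\<lambda>\<omega> e. mdiff v \<omega> e * mdiff v \<omega> e) \<omega> \<partial>Q)"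
    have "\<bar>nrm A (ssum f n) / sqrt (real n) - \<sigma>\<bar> \<le> e / 3" if n: "max 1 N \<le> n" for n
    proof -
      have "nrm A (mart (mdiff v) n) = sqrt (real n) * \<sigma>"
        unfolding \<sigma>_def by (rule nrm_mart[OF mdiff_bdd[OF v] mean_step_mdiff])
      then have "\<bar>nrm A (ssum f n) - sqrt (real n) * \<sigma>\<bar> \<le> e / 3 * sqrt (real n)"
        using nrm_triangle_rev[OF ssum_L2[OF fL, of n] mart_L2[OF mdiff_bdd[OF v], of n]] N[of n] n by simp
      then have "\<bar>nrm A (ssum f n) - sqrt (real n) * \<sigma>\<bar> / sqrt (real n) \<le> e / 3" using n by (simp add: pos_divide_le_eq)
      also have "\<bar>nrm A (ssum f n) - sqrt (real n) * \<sigma>\<bar> / sqrt (real n) = \<bar>(nrm A (ssum f n) - sqrt (real n) * \<sigma>) / sqrt (real n)\<bar>"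
        by (simp add: abs_divide)
      also have "(nrm A (ssum f n) - sqrt (real n) * \<sigma>) / sqrt (real n) = nrm A (ssum f n) / sqrt (real n) - \<sigma>"
        using n by (simp add: diff_divide_distrib)
      finally show ?thesis .
    qed
    note b = this
    have "dist (nrm A (ssum f m) / sqrt (real m)) (nrm A (ssum f n) / sqrt (real n)) < e"
      if "max 1 N \<le> m" "max 1 N \<le> n" for m n
      using b[OF that(1)] b[OF that(2)] e unfolding dist_real_def by linarith
    then show "\<exists>M. \<forall>m\<ge>M. \<forall>n\<ge>M. dist (nrm A (ssum f m) / sqrt (real m)) (nrm A (ssum f n) / sqrt (real n)) < e"
      by blast
  qed
  then show ?thesis by (simp add: Cauchy_convergent_iff)
qed

text \<open>The asymptotic standard deviation.\<close>

definition asd :: "('d env \<Rightarrow> real) \<Rightarrow> real" where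
  "asd f = lim (\<lambda>n. nrm A (ssum f n) / sqrt (real n))"

lemma asd_tendsto: "hm1 K f \<Longrightarrow> (\<lambda>n. nrm A (ssum f n) / sqrt (real n)) \<longlonglongrightarrow> asd f"
  using nrm_ssum_convergent[of K f] by (simp add: asd_def convergent_LIMSEQ_iff)

text \<open>An approximation error \<eta> sqrt n moves the weighted characteristic function by at
  most |C| \<eta> and the asymptotic standard deviation by at most \<eta>; the rest is the theorem
  for the approximating martingale.\<close>

lemma additive_functional_clt:
  assumes f: "hm1 K f" and \<psi>: "\<psi> \<in> borel_measurable env_space" "AE \<omega> in Q. \<bar>\<psi> \<omega>\<bar> \<le> C"
  shows "(\<lambda>n. \<integral>z. of_real (\<psi> (env_seen 0 z)) * iexp (ssum f n z / sqrt (real n)) \<partial>A) \<longlonglongrightarrow>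
    of_real (\<integral>\<omega>. \<psi> \<omega> \<partial>Q) * of_real (exp (- (asd f)\<^sup>2 / 2))"
proof (rule LIMSEQ_I)
  fix e :: real assume e: "0 < e"
  have fL: "f \<in> L2 Q" by (rule hm1_L2[OF f])
  define m where "m = (\<integral>\<omega>. \<psi> \<omega> \<partial>Q)"
  \<comment> \<open>D dominates the coefficients of \<eta> in both errors, comparison of the
    characteristic functions and comparison of the variances, so each of them becomes at most
    e/4.\<close>
  define D where "D = \<bar>C\<bar> + \<bar>m\<bar> * (\<bar>asd f\<bar> + 1) + 1"
  have D: "0 < D" "\<bar>C\<bar> \<le> D" "\<bar>m\<bar> * (\<bar>asd f\<bar> + 1) \<le> D" by (auto simp: D_def add_nonneg_pos)
  define \<eta> where "\<eta> = min 1 (e / (4 * D))"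
  have \<eta>: "0 < \<eta>" "\<eta> \<le> 1" "D * \<eta> \<le> e / 4"
    using e D by (auto simp: \<eta>_def min_def field_simps)
  obtain v N where v: "bdd_env v"
    and N: "\<And>n. N \<le> n \<Longrightarrow> nrm A (\<lambda>z. ssum f n z - mart (mdiff v) n z) \<le> \<eta> * sqrt (real n)"
    using martingale_approx[OF f \<eta>(1)] by auto
  note \<phi> = mdiff_bdd[OF v]
  define V where "V = (\<integral>\<omega>. mean_step (\<lambda>\<omega> e. mdiff v \<omega> e * mdiff v \<omega> e) \<omega> \<partial>Q)"
  define E where "E F n z = complex_of_real (\<psi> (env_seen 0 z)) * iexp (F n z / sqrt (real n))" for F :: "nat \<Rightarrow> 'd env \<times> 'd path \<Rightarrow> real" and n z
  have V0: "0 \<le> V"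
    unfolding V_def by (intro integral_nonneg_AE AE_I2 mean_step_square_nonneg) (simp add: space_Q)
  have \<psi>': "AE z in A. \<bar>\<psi> (env_seen 0 z)\<bar> \<le> C"
    by (rule AE_distrD[OF env_seen_A, of "\<lambda>\<omega>. \<bar>\<psi> \<omega>\<bar> \<le> C" 0]) (simp only: distr_env_seen \<psi>(2))
  have \<psi>m [measurable]: "(\<lambda>z. \<psi> (env_seen 0 z)) \<in> borel_measurable A"
    by (rule measurable_compose[OF env_seen_A \<psi>(1)])
  have Ei: "integrable A (E F n)" if "F n \<in> L2 A" for F n
  proof (rule A.integrable_const_bound)
    note [measurable] = L2_measurable[OF that]
    show "E F n \<in> borel_measurable A" unfolding E_def[abs_def] by measurable
    show "AE z in A. norm (E F n z) \<le> \<bar>C\<bar>" using \<psi>' by eventually_elim (simp add: E_def norm_mult)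
  qed
  have diff: "norm ((\<integral>z. E (ssum f) n z \<partial>A) - (\<integral>z. E (mart (mdiff v)) n z \<partial>A)) \<le> \<bar>C\<bar> * \<eta>" if n: "max 1 N \<le> n" for n
  proof -
    note L = ssum_L2[OF fL, of n] mart_L2[OF \<phi>, of n]
    have "norm ((\<integral>z. E (ssum f) n z \<partial>A) - (\<integral>z. E (mart (mdiff v)) n z \<partial>A)) =
        norm (\<integral>z. E (ssum f) n z - E (mart (mdiff v)) n z \<partial>A)"
      using Ei L by simp
    also have "\<dots> \<le> (\<integral>z. (\<bar>C\<bar> / sqrt (real n)) * \<bar>ssum f n z - mart (mdiff v) n z\<bar> \<partial>A)"
    proof (rule integral_norm_bound_AE)
      show "AE z in A. norm (E (ssum f) n z - E (mart (mdiff v)) n z) \<le> (\<bar>C\<bar> / sqrt (real n)) * \<bar>ssum f n z - mart (mdiff v) n z\<bar>"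
        using \<psi>'
      proof eventually_elim
        case (elim z)
        have "norm (E (ssum f) n z - E (mart (mdiff v)) n z) =
            \<bar>\<psi> (env_seen 0 z)\<bar> * cmod (iexp (ssum f n z / sqrt (real n)) - iexp (mart (mdiff v) n z / sqrt (real n)))"
          by (simp only: E_def right_diff_distrib[symmetric] norm_mult norm_of_real)
        also have "\<dots> \<le> \<bar>C\<bar> * \<bar>ssum f n z / sqrt (real n) - mart (mdiff v) n z / sqrt (real n)\<bar>"
          using elim by (intro mult_mono iexp_Lipschitz) auto
        also have "\<dots> = (\<bar>C\<bar> / sqrt (real n)) * \<bar>ssum f n z - mart (mdiff v) n z\<bar>"
          by (simp add: diff_divide_distrib[symmetric] abs_divide)
        finally show ?case .
      qed
    qed (use Ei L A.L2_integrable[OF L2_diff[OF L]] in auto)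
    also have "\<dots> \<le> (\<bar>C\<bar> / sqrt (real n)) * (\<eta> * sqrt (real n))"
      using A.nrm_ge_integral_abs[OF L2_diff[OF L]] N[of n] n
      by (simp only: integral_mult_right_zero, intro mult_left_mono) auto
    finally show ?thesis using n by simp
  qed
  have "\<bar>asd f - sqrt V\<bar> \<le> \<eta>"
  proof -
    have b: "\<bar>nrm A (ssum f n) / sqrt (real n) - sqrt V\<bar> \<le> \<eta>" if n: "max 1 N \<le> n" for n
    proof -
      have "nrm A (mart (mdiff v) n) = sqrt (real n) * sqrt V"
        unfolding V_def by (rule nrm_mart[OF \<phi> mean_step_mdiff])
      then have "\<bar>nrm A (ssum f n) - sqrt (real n) * sqrt V\<bar> \<le> \<eta> * sqrt (real n)"
        using nrm_triangle_rev[OF ssum_L2[OF fL, of n] mart_L2[OF \<phi>, of n]] N[of n] n by simp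
      then have "\<bar>(nrm A (ssum f n) - sqrt (real n) * sqrt V) / sqrt (real n)\<bar> \<le> \<eta>"
        using n by (simp add: abs_divide pos_divide_le_eq)
      also have "(nrm A (ssum f n) - sqrt (real n) * sqrt V) / sqrt (real n) = nrm A (ssum f n) / sqrt (real n) - sqrt V"
        using n by (simp add: diff_divide_distrib)
      finally show ?thesis .
    qed
    have "(\<lambda>n. \<bar>nrm A (ssum f n) / sqrt (real n) - sqrt V\<bar>) \<longlonglongrightarrow> \<bar>asd f - sqrt V\<bar>"
      by (intro tendsto_intros asd_tendsto[OF f])
    then show ?thesis by (rule LIMSEQ_le_const2) (use b in blast)
  qed
  then have "\<bar>(asd f)\<^sup>2 - V\<bar> \<le> \<eta> * (2 * \<bar>asd f\<bar> + \<eta>)"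
  proof -
    assume a: "\<bar>asd f - sqrt V\<bar> \<le> \<eta>"
    have "(asd f)\<^sup>2 - V = (asd f - sqrt V) * (asd f + sqrt V)"
      using V0 by (simp add: algebra_simps power2_eq_square)
    then have "\<bar>(asd f)\<^sup>2 - V\<bar> = \<bar>asd f - sqrt V\<bar> * \<bar>asd f + sqrt V\<bar>" by (simp add: abs_mult)
    also have "\<dots> \<le> \<eta> * (2 * \<bar>asd f\<bar> + \<eta>)"
      using a by (intro mult_mono) auto
    finally show ?thesis .
  qed
  moreover have "\<eta> * (2 * \<bar>asd f\<bar> + \<eta>) \<le> \<eta> * (2 * \<bar>asd f\<bar> + 2)"
    using \<eta> by (intro mult_left_mono) auto
  moreover have "\<eta> * (2 * \<bar>asd f\<bar> + 2) = 2 * (\<eta> * (\<bar>asd f\<bar> + 1))" by (simp add: algebra_simps)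
  ultimately have "\<bar>V / 2 - (asd f)\<^sup>2 / 2\<bar> \<le> \<eta> * (\<bar>asd f\<bar> + 1)" by linarith
  then have "\<bar>exp (- (V / 2)) - exp (- ((asd f)\<^sup>2 / 2))\<bar> \<le> \<eta> * (\<bar>asd f\<bar> + 1)"
    using exp_minus_Lipschitz[of "V / 2" "(asd f)\<^sup>2 / 2"] V0 by simp
  then have "\<bar>m\<bar> * \<bar>exp (- V / 2) - exp (- (asd f)\<^sup>2 / 2)\<bar> \<le> \<bar>m\<bar> * (\<eta> * (\<bar>asd f\<bar> + 1))"
    by (intro mult_left_mono) auto
  also have "\<dots> \<le> D * \<eta>" using mult_right_mono[OF D(3), of \<eta>] \<eta> by (simp add: mult_ac)
  finally have lim_diff: "norm (complex_of_real m * of_real (exp (- V / 2)) - of_real m * of_real (exp (- (asd f)\<^sup>2 / 2))) \<le> D * \<eta>"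
    by (simp only: right_diff_distrib[symmetric] of_real_diff[symmetric] norm_mult norm_of_real)
  have "(\<lambda>n. \<integral>z. E (mart (mdiff v)) n z \<partial>A) \<longlonglongrightarrow> of_real m * of_real (exp (- V / 2))"
    unfolding E_def m_def V_def by (rule bounded_martingale_clt[OF \<phi> mean_step_mdiff \<psi>])
  then obtain N' where N': "\<And>n. N' \<le> n \<Longrightarrow> norm ((\<integral>z. E (mart (mdiff v)) n z \<partial>A) - of_real m * of_real (exp (- V / 2))) < e / 4"
    using LIMSEQ_D[of _ _ "e / 4"] e by (metis divide_pos_pos zero_less_numeral)
  show "\<exists>no. \<forall>n\<ge>no. norm ((\<integral>z. of_real (\<psi> (env_seen 0 z)) * iexp (ssum f n z / sqrt (real n)) \<partial>A) -
      of_real (\<integral>\<omega>. \<psi> \<omega> \<partial>Q) * of_real (exp (- (asd f)\<^sup>2 / 2))) < e"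
    unfolding m_def[symmetric] E_def[symmetric]
  proof (intro exI[of _ "max N' (max 1 N)"] allI impI)
    fix n assume n: "max N' (max 1 N) \<le> n"
    have "\<bar>C\<bar> * \<eta> \<le> D * \<eta>" using D \<eta> by (intro mult_right_mono) auto
    then have 1: "norm ((\<integral>z. E (ssum f) n z \<partial>A) - (\<integral>z. E (mart (mdiff v)) n z \<partial>A)) \<le> e / 4"
      using diff[of n] n \<eta>(3) by simp
    have 2: "norm ((\<integral>z. E (mart (mdiff v)) n z \<partial>A) - of_real m * of_real (exp (- V / 2))) < e / 4"
      using N' n by simp
    let ?a = "\<integral>z. E (ssum f) n z \<partial>A" and ?b = "\<integral>z. E (mart (mdiff v)) n z \<partial>A"
      and ?c = "complex_of_real m * of_real (exp (- V / 2))" and ?d = "complex_of_real m * of_real (exp (- (asd f)\<^sup>2 / 2))"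
    have "norm (?a - ?d) \<le> norm (?a - ?b) + norm (?b - ?c) + norm (?c - ?d)"
      using norm_triangle_ineq[of "(?a - ?b) + (?b - ?c)" "?c - ?d"] norm_triangle_ineq[of "?a - ?b" "?b - ?c"] by simp
    also have "\<dots> < e" using 1 2 lim_diff \<eta>(3) e by linarith
    finally show "norm (?a - ?d) < e" .
  qed
qed

end

section \<open>Time reversal and the tilted walk\<close>

lemma abs_exp_remainder_le:
  fixes v :: real assumes "\<bar>v\<bar> \<le> 1" shows "\<bar>exp v - 1 - v\<bar> \<le> v\<^sup>2"
proof -
  have "exp v \<le> 1 + v + v\<^sup>2"
  proof (cases "0 \<le> v")
    case True then show ?thesis using exp_bound[of v] assms by simp
  next
    case False
    then have "exp v \<le> 1 + v + v\<^sup>2 / 2" using exp_minus_le_quadratic[of "- v"] by simp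
    then show ?thesis using zero_le_power2[of v] by linarith
  qed
  then show ?thesis using exp_ge_add_one_self[of v] zero_le_power2[of v] by (intro abs_leI; linarith)
qed

locale rcm_direction = rcm P for P :: "'d::finite env measure" +
  fixes l :: "real ^ 'd"
  assumes norm_l: "norm l = 1"
begin

definition ldrift :: "'d env \<Rightarrow> real" where
  "ldrift = mean_step (\<lambda>\<omega> e. rvec e \<bullet> l)"

definition zeta :: "'d env \<Rightarrow> int ^ 'd \<Rightarrow> real" where
  "zeta \<omega> e = rvec e \<bullet> l - ldrift \<omega>"

text \<open>The displacement along l as a sum over the steps, so that lemmas on \<open>mart\<close>
  apply although these steps are not centred.\<close>

definition disp :: "nat \<Rightarrow> 'd env \<times> 'd path \<Rightarrow> real" where
  "disp = mart (\<lambda>\<omega> e. rvec e \<bullet> l)"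

lemma abs_dir_le: "e \<in> units \<Longrightarrow> \<bar>rvec e \<bullet> l\<bar> \<le> 1"
  using Cauchy_Schwarz_ineq2[of "rvec e" l] by (simp add: units_def norm_l)

lemma bdd_step_dir: "bdd_step (\<lambda>\<omega> e. rvec e \<bullet> l)"
  by (rule bdd_step_step)

lemma ldrift_bdd: "bdd_env ldrift"
  unfolding ldrift_def by (rule bdd_step_mean[OF bdd_step_dir])

lemma abs_ldrift_le: "\<omega> \<in> space env_space \<Longrightarrow> \<bar>ldrift \<omega>\<bar> \<le> 1"
  unfolding ldrift_def by (rule mean_step_bound) (auto intro: abs_dir_le)

lemma zeta_bdd: "bdd_step zeta"
  unfolding zeta_def[abs_def] by (intro bdd_step_diff bdd_step_dir bdd_step_base ldrift_bdd)

lemma mean_step_zeta: "\<omega> \<in> space env_space \<Longrightarrow> mean_step zeta \<omega> = 0"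
  unfolding zeta_def[abs_def] by (simp add: mean_step_diff mean_step_const) (simp add: ldrift_def)

lemma abs_zeta_le: "\<omega> \<in> space env_space \<Longrightarrow> e \<in> units \<Longrightarrow> \<bar>zeta \<omega> e\<bar> \<le> 2"
  using abs_dir_le[of e] abs_ldrift_le[of \<omega>] by (simp add: zeta_def)

lemma disp_eq: "disp n z = ssum ldrift n z + mart zeta n z"
  by (simp add: disp_def mart_def ssum_def zeta_def sum_subtractf)

lemma drift_eq: "\<omega> \<in> space env_space \<Longrightarrow> drift \<omega> 0 \<bullet> l = ldrift \<omega>"
proof -
  assume \<omega>: "\<omega> \<in> space env_space"
  let ?F = "\<lambda>X. rvec (X (Suc 0)) - rvec (X 0) :: real ^ 'd"
  have m: "(\<lambda>X. rvec (X k) :: real ^ 'd) \<in> borel_measurable path_space" for k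
    by (rule measurable_compose[OF coord_measurable]) simp
  have "drift \<omega> 0 = (\<Sum>p\<in>paths (Suc 0). cyl_prob \<omega> 0 (Suc 0) p *\<^sub>R ?F p)"
    unfolding drift_def One_nat_def
    by (rule walk_law_integral[OF \<omega>]) (use m in auto)
  also have "\<dots> = (\<Sum>e\<in>units. trans_prob \<omega> 0 e *\<^sub>R rvec e)"
    unfolding sum_paths_Suc cyl_prob_extend by (simp add: cyl_prob_def rvec_0)
  finally show ?thesis by (simp add: ldrift_def mean_step_def inner_sum_left)
qed

lemma dir_reversal:
  assumes g: "g \<in> L2 Q"
  shows "(\<integral>z. (rvec (step 0 z) \<bullet> l) * g (env_seen (Suc 0) z) \<partial>A) = - ip ldrift g"
proof -
  let ?\<phi> = "\<lambda>\<omega> e. (rvec e \<bullet> l) * g \<omega>"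
  have \<phi>: "step_measurable ?\<phi>"
    by (intro step_measurable_arith(3) step_measurable_step step_measurable_base L2_Q_measurable[OF g])
  have i: "integrable A (\<lambda>z. ?\<phi> (env_seen 0 z) (step 0 z))"
    by (rule L2_integrable_mult[OF bdd_step_L2[OF bdd_step_dir] L2_env_seen[OF g]])
  have "ip ldrift g = (\<integral>z. ldrift (env_seen 0 z) * g (env_seen 0 z) \<partial>A)"
    by (rule integral_env_seen_mult[OF bdd_env_L2[OF ldrift_bdd] g, symmetric])
  also have "\<dots> = (\<integral>z. ?\<phi> (env_seen 0 z) (step 0 z) \<partial>A)"
    unfolding ldrift_def
    by (rule markov_L2[OF env_seen_past[OF le_refl L2_Q_measurable[OF g]] L2_env_seen[OF g]
        bdd_step_measurable[OF bdd_step_dir] bdd_step_L2[OF bdd_step_dir], symmetric])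
  also have "\<dots> = (\<integral>z. ?\<phi> (env_seen (Suc 0) z) (- step 0 z) \<partial>A)"
    by (rule reversal[OF \<phi> i])
  finally show ?thesis by (simp add: rvec_uminus)
qed

text \<open>The drift is a discrete divergence: by reversal - 2 ip ldrift g is the mean of the step
  along l times the increment of g. Steps along l are bounded by 1, and the Cauchy-Schwarz
  inequality leaves the Dirichlet form.\<close>

lemma hm1_ldrift: "hm1 1 ldrift"
  unfolding hm1_def
proof (intro conjI allI impI)
  show L: "ldrift \<in> L2 Q" by (rule bdd_env_L2[OF ldrift_bdd])
  fix g :: "'d env \<Rightarrow> real" assume "bdd_env g"
  then have g: "g \<in> L2 Q" by (rule bdd_env_L2)
  let ?d = "\<lambda>z. rvec (step 0 z) \<bullet> l"
  have dL: "?d \<in> L2 A" by (rule bdd_step_L2[OF bdd_step_dir])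
  have "(\<integral>z. ?d z * g (env_seen 0 z) \<partial>A) = (\<integral>z. ldrift (env_seen 0 z) * g (env_seen 0 z) \<partial>A)"
    unfolding ldrift_def
    by (rule markov_L2[OF env_seen_past[OF le_refl L2_Q_measurable[OF g]] L2_env_seen[OF g]
        bdd_step_measurable[OF bdd_step_dir] bdd_step_L2[OF bdd_step_dir]])
  also have "\<dots> = ip ldrift g" by (rule integral_env_seen_mult[OF L g])
  finally have 0: "(\<integral>z. ?d z * g (env_seen 0 z) \<partial>A) = ip ldrift g" .
  have "(\<integral>z. ?d z * incr g z \<partial>A) = (\<integral>z. ?d z * g (env_seen (Suc 0) z) - ?d z * g (env_seen 0 z) \<partial>A)"
    by (simp add: incr_def right_diff_distrib)
  also have "\<dots> = - 2 * ip ldrift g"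
    using 0 dir_reversal[OF g] L2_integrable_mult[OF dL L2_env_seen[OF g]] by simp
  finally have "(- 2 * ip ldrift g)\<^sup>2 \<le> (\<integral>z. (?d z)\<^sup>2 \<partial>A) * (\<integral>z. (incr g z)\<^sup>2 \<partial>A)"
    using integral_Cauchy_Schwarz[OF dL incr_L2[OF g]] by simp
  also have "\<dots> \<le> 1 * (\<integral>z. (incr g z)\<^sup>2 \<partial>A)"
  proof (rule mult_right_mono)
    have "AE z in A. \<bar>?d z\<bar> \<le> 1" using AE_step_units[of 0] by eventually_elim (rule abs_dir_le)
    then have "nrm A ?d \<le> 1" using A.L2_bounded(2)[OF L2_measurable[OF dL], of 1] by simp
    then show "(\<integral>z. (?d z)\<^sup>2 \<partial>A) \<le> 1" using power_le_one[of "nrm A ?d" 2] by (simp add: nrm_sq)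
  qed simp
  also have "\<dots> = 2 * energy g g" by (simp add: energy_def power2_eq_square)
  finally show "(ip ldrift g)\<^sup>2 \<le> 1 * energy g g" using energy_nonneg[of g] by (simp add: power_mult_distrib)
qed

lemma markov_lag:
  assumes F: "past n F" "F \<in> L2 A" and h: "h \<in> L2 Q"
  shows "(\<integral>z. h (env_seen (n + m) z) * F z \<partial>A) = (\<integral>z. (trans_op ^^ m) h (env_seen n z) * F z \<partial>A)"
  using h
proof (induction m arbitrary: h)
  case (Suc m)
  have "(\<integral>z. h (env_seen (Suc (n + m)) z) * F z \<partial>A) = (\<integral>z. trans_op h (env_seen (n + m) z) * F z \<partial>A)"
    by (rule markov_trans_op[OF past_mono[OF F(1)] F(2) Suc.prems]) simp
  then show ?case using Suc.IH[OF trans_op_L2[OF Suc.prems]] by (simp add: funpow_swap1)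
qed simp

lemma ip_funpow_symmetric: "g \<in> L2 Q \<Longrightarrow> h \<in> L2 Q \<Longrightarrow> ip ((trans_op ^^ m) g) h = ip g ((trans_op ^^ m) h)"
proof (induction m arbitrary: h)
  case (Suc m)
  then show ?case
    using ip_trans_op_symmetric[OF funpow_trans_op_L2[OF Suc.prems(1), of m] Suc.prems(2)]
      Suc.IH[OF Suc.prems(1) trans_op_L2[OF Suc.prems(2)]] by (simp add: funpow_swap1)
qed simp

text \<open>Against the past a step acts like the drift at its starting point; against the future it
  acts, by reversal, like minus the drift at its end point.\<close>

lemma dir_future:
  assumes f: "f \<in> L2 Q"
  shows "(\<integral>z. (rvec (step k z) \<bullet> l) * f (env_seen (Suc k + m) z) \<partial>A) = - ip f ((trans_op ^^ m) ldrift)"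
proof -
  let ?d = "\<lambda>k z. rvec (step k z) \<bullet> l" and ?h = "(trans_op ^^ m) f"
  have hL: "?h \<in> L2 Q" by (rule funpow_trans_op_L2[OF f])
  have dL: "?d k \<in> L2 A" for k by (rule bdd_step_L2[OF bdd_step_dir])
  let ?\<phi> = "\<lambda>\<omega> e. (rvec e \<bullet> l) * ?h (env_shift e \<omega>)"
  have \<phi>: "step_measurable ?\<phi>"
    by (intro step_measurable_arith(3) step_measurable_step step_measurable_shift L2_Q_measurable[OF hL])
  have i: "integrable A (\<lambda>z. ?\<phi> (env_seen k z) (step k z))" for k
    using L2_integrable_mult[OF dL L2_env_seen[OF hL], of k "Suc k"] by (simp add: env_seen_Suc)
  have "(\<integral>z. f (env_seen (Suc k + m) z) * ?d k z \<partial>A) = (\<integral>z. ?h (env_seen (Suc k) z) * ?d k z \<partial>A)"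
    by (rule markov_lag[OF step_past[OF _ bdd_step_measurable[OF bdd_step_dir]] dL f]) simp
  also have "\<dots> = (\<integral>z. ?\<phi> (env_seen k z) (step k z) \<partial>A)" by (simp add: env_seen_Suc mult.commute)
  also have "\<dots> = (\<integral>z. ?\<phi> (env_seen 0 z) (step 0 z) \<partial>A)"
    unfolding markov1[OF \<phi> i] integral_env_seen[OF mean_step_measurable[OF \<phi>]] ..
  also have "\<dots> = - ip ldrift ?h" using dir_reversal[OF hL] by (simp add: env_seen_Suc)
  also have "ip ldrift ?h = ip f ((trans_op ^^ m) ldrift)"
    using ip_funpow_symmetric[OF bdd_env_L2[OF ldrift_bdd] f, of m] by (simp add: ip_commute)
  finally show ?thesis by (simp add: mult.commute)
qed

text \<open>Time reversal fixes \<open>ssum f (Suc n)\<close> and changes the sign of \<open>disp n\<close>.\<close>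

lemma ssum_disp_orthogonal:
  assumes f: "f \<in> L2 Q"
  shows "(\<integral>z. ssum f (Suc n) z * disp n z \<partial>A) = 0"
proof (induction n)
  case 0 then show ?case by (simp add: disp_def mart_def)
next
  case (Suc n)
  let ?d = "\<lambda>k z. rvec (step k z) \<bullet> l"
  \<comment> \<open>The correlation at lag m. Passing to Suc n adds the new step against the old
    values of f and the new value of f against all steps; the two sums of the c (n - j)
    cancel.\<close>
  define c where "c m = ip f ((trans_op ^^ m) ldrift)" for m
  note fm = L2_Q_measurable[OF f] and lL = bdd_env_L2[OF ldrift_bdd]
  have dL: "?d k \<in> L2 A" for k by (rule bdd_step_L2[OF bdd_step_dir])
  have DL: "disp k \<in> L2 A" for k unfolding disp_def by (rule mart_L2[OF bdd_step_dir])
  have 1: "(\<integral>z. ?d n z * ssum f (Suc n) z \<partial>A) = (\<Sum>j<Suc n. c (n - j))"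
  proof -
    have "(\<integral>z. ?d n z * ssum f (Suc n) z \<partial>A) = (\<integral>z. ldrift (env_seen n z) * ssum f (Suc n) z \<partial>A)"
      unfolding ldrift_def
      by (rule markov_L2[OF ssum_past[OF fm] ssum_L2[OF f] bdd_step_measurable[OF bdd_step_dir] dL])
    also have "\<dots> = (\<Sum>j<Suc n. \<integral>z. f (env_seen j z) * ldrift (env_seen n z) \<partial>A)"
      unfolding ssum_def sum_distrib_left mult.commute[of "ldrift _"]
      by (rule Bochner_Integration.integral_sum) (rule L2_integrable_mult[OF L2_env_seen[OF f] L2_env_seen[OF lL]])
    also have "\<dots> = (\<Sum>j<Suc n. c (n - j))"
    proof (intro sum.cong refl)
      fix j assume "j \<in> {..<Suc n}"
      then show "(\<integral>z. f (env_seen j z) * ldrift (env_seen n z) \<partial>A) = c (n - j)"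
        using integral_env_seen_lag[OF f lL, of j "n - j"] by (simp add: c_def)
    qed
    finally show ?thesis .
  qed
  have 2: "(\<integral>z. f (env_seen (Suc n) z) * disp (Suc n) z \<partial>A) = - (\<Sum>j<Suc n. c (n - j))"
  proof -
    have "(\<integral>z. f (env_seen (Suc n) z) * disp (Suc n) z \<partial>A) = (\<Sum>k<Suc n. \<integral>z. ?d k z * f (env_seen (Suc n) z) \<partial>A)"
      unfolding disp_def mart_def sum_distrib_left mult.commute[of "f _"]
      by (rule Bochner_Integration.integral_sum) (rule L2_integrable_mult[OF dL L2_env_seen[OF f]])
    also have "\<dots> = (\<Sum>k<Suc n. - c (n - k))"
    proof (intro sum.cong refl)
      fix k assume "k \<in> {..<Suc n}"
      then have "Suc n = Suc k + (n - k)" by simp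
      then show "(\<integral>z. ?d k z * f (env_seen (Suc n) z) \<partial>A) = - c (n - k)"
        using dir_future[OF f, of k "n - k"] by (simp only: c_def)
    qed
    finally show ?thesis by (simp add: sum_negf)
  qed
  have "(\<integral>z. ssum f (Suc (Suc n)) z * disp (Suc n) z \<partial>A) =
      (\<integral>z. (ssum f (Suc n) z * disp n z + ?d n z * ssum f (Suc n) z) + f (env_seen (Suc n) z) * disp (Suc n) z \<partial>A)"
    by (intro Bochner_Integration.integral_cong refl)
      (simp add: ssum_Suc[of f "Suc n"] disp_def mart_Suc algebra_simps)
  also have "\<dots> = ((\<integral>z. ssum f (Suc n) z * disp n z \<partial>A) + (\<integral>z. ?d n z * ssum f (Suc n) z \<partial>A)) +
      (\<integral>z. f (env_seen (Suc n) z) * disp (Suc n) z \<partial>A)"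
    using L2_integrable_mult[OF ssum_L2[OF f, of "Suc n"] DL[of n]] L2_integrable_mult[OF dL[of n] ssum_L2[OF f, of "Suc n"]]
      L2_integrable_mult[OF L2_env_seen[OF f, of "Suc n"] DL[of "Suc n"]] by simp
  finally show ?case using Suc 1 2 by simp
qed

section \<open>The tilted walk as a change of measure\<close>

definition weight :: "real \<Rightarrow> 'd env \<Rightarrow> int ^ 'd \<Rightarrow> real" where
  "weight lam \<omega> e = exp (lam * (rvec e \<bullet> l)) / mean_step (\<lambda>\<omega> e. exp (lam * (rvec e \<bullet> l))) \<omega>"

definition girs :: "real \<Rightarrow> nat \<Rightarrow> 'd env \<times> 'd path \<Rightarrow> real" where
  "girs lam n z = (\<Prod>k<n. weight lam (env_seen k z) (step k z))"

lemma mean_exp_pos: "\<omega> \<in> space env_space \<Longrightarrow> 0 < mean_step (\<lambda>\<omega> e. exp (lam * (rvec e \<bullet> l))) \<omega>"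
  unfolding mean_step_def
  by (intro sum_pos finite_units units_nonempty mult_pos_pos trans_prob_pos) auto

text \<open>At x the tilt multiplies the conductance towards x + e by exp (2 lam (l . x)) exp (lam
  (l . e)). The first factor is common to all neighbours and cancels in the transition probability,
  so the ratio depends on the environment seen from x alone.\<close>

lemma trans_prob_tilt:
  assumes \<omega>: "\<omega> \<in> space env_space" and e: "e \<in> units"
  shows "trans_prob (tilt l lam \<omega>) x (x + e) = trans_prob \<omega> x (x + e) * weight lam (env_shift x \<omega>) e"
proof -
  define a where "a = exp (lam * (l \<bullet> rvec x + l \<bullet> rvec x))"
  define b where "b e = exp (lam * (rvec e \<bullet> l))" for e
  have a: "a > 0" by (simp add: a_def)
  have ab: "exp (lam * (l \<bullet> (rvec x + rvec (x + e)))) = a * b e" for e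
  proof -
    have "l \<bullet> (rvec x + rvec (x + e)) = (l \<bullet> rvec x + l \<bullet> rvec x) + rvec e \<bullet> l"
      by (simp only: rvec_add inner_add_right inner_commute[of l "rvec e"] add.assoc)
    then show ?thesis by (simp only: a_def b_def distrib_left exp_add)
  qed
  have tc: "total_cond (tilt l lam \<omega>) x = a * (\<Sum>e\<in>units. \<omega> {x, x + e} * b e)"
    unfolding total_cond_def by (simp add: tilt_bond ab sum_distrib_left mult_ac)
  have tpos: "0 < total_cond \<omega> x" by (rule total_cond_pos[OF \<omega>])
  have "mean_step (\<lambda>\<omega> e. exp (lam * (rvec e \<bullet> l))) (env_shift x \<omega>) = (\<Sum>e\<in>units. \<omega> {x, x + e} * b e) / total_cond \<omega> x"
    unfolding mean_step_def sum_divide_distrib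
    by (intro sum.cong refl) (simp add: trans_prob_env_shift, simp add: trans_prob_def b_def)
  then show ?thesis
    using e a tpos by (simp add: weight_def trans_prob_def tilt_bond ab tc b_def[symmetric])
qed

lemma cyl_prob_tilt:
  assumes \<omega>: "\<omega> \<in> space env_space" and p: "p \<in> paths n"
  shows "cyl_prob (tilt l lam \<omega>) 0 n p = cyl_prob \<omega> 0 n p * girs lam n (\<omega>, p)"
  using p
proof (induction n arbitrary: p)
  case 0 then show ?case by (simp add: cyl_prob_def girs_def)
next
  case (Suc n)
  then obtain p' e where p': "p' \<in> paths n" "e \<in> units" "p = extend_path n p' e" by auto
  have "girs lam n (\<omega>, p) = girs lam n (\<omega>, p')"
    unfolding girs_def p'(3) by (intro prod.cong refl) (simp add: env_seen_def step_def)
  then have "girs lam (Suc n) (\<omega>, p) = girs lam n (\<omega>, p') * weight lam (env_shift (p' n) \<omega>) e"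
    by (simp add: girs_def p'(3)) (simp add: env_seen_def step_def)
  then show ?case
    by (simp add: p'(3) cyl_prob_extend Suc.IH[OF p'(1)] trans_prob_tilt[OF \<omega> p'(2)])
qed

lemma weight_step_measurable: "step_measurable (weight lam)"
proof -
  have "mean_step (\<lambda>\<omega> e. exp (lam * (rvec e \<bullet> l))) \<in> borel_measurable env_space"
    by (rule mean_step_measurable[OF step_measurable_step])
  then show ?thesis unfolding weight_def[abs_def] step_measurable_def by simp
qed

lemma girs_past: "past n (girs lam n)"
  unfolding girs_def[abs_def] by (intro past_prod step_past weight_step_measurable) auto

text \<open>For functionals of n steps both expectations are finite sums over paths, and the
  cylinder probability of each path acquires the factor \<open>girs lam n\<close>.\<close>

lemma girsanov:
  assumes F: "past n F" and i: "integrable A (\<lambda>z. F z * girs lam n z)"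
  shows "(\<integral>z. F z \<partial>annealed Q (walk_tilted l lam)) = (\<integral>z. F z * girs lam n z \<partial>A)"
proof -
  interpret T: annealed_walk Q "tilt l lam"
    by unfold_locales (auto simp: sets_Q Q.prob_space_axioms tilt_measurable)
  have FG: "past n (\<lambda>z. F z * girs lam n z)" by (intro past_mult F girs_past)
  note Fm = past_borel[OF F] and FGm = past_borel[OF FG]
  have d: "depends_upto n F" "depends_upto n (\<lambda>z. F z * girs lam n z)"
    using F FG by (auto simp: past_def)
  have eq: "cyl_prob (tilt l lam \<omega>) 0 n p *\<^sub>R F (\<omega>, p) = cyl_prob \<omega> 0 n p *\<^sub>R (F (\<omega>, p) * girs lam n (\<omega>, p))"
    if "p \<in> paths n" "\<omega> \<in> space Q" for p \<omega>
    using that by (simp add: cyl_prob_tilt space_Q)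
  have ie: "integrable Q (\<lambda>\<omega>. cyl_prob (tilt l lam \<omega>) 0 n p *\<^sub>R F (\<omega>, p)) \<longleftrightarrow>
      integrable Q (\<lambda>\<omega>. cyl_prob \<omega> 0 n p *\<^sub>R (F (\<omega>, p) * girs lam n (\<omega>, p)))" if "p \<in> paths n" for p
    by (rule Bochner_Integration.integrable_cong[OF refl eq[OF that]])
  have iT: "integrable (annealed Q (walk_tilted l lam)) F"
    using i unfolding T.integrable_iff_paths[OF Fm d(1)] W.integrable_iff_paths[OF FGm d(2)] using ie by blast
  show ?thesis
    unfolding T.integral_paths[OF Fm d(1) iT] W.integral_paths[OF FGm d(2) i]
    by (intro sum.cong refl Bochner_Integration.integral_cong eq)
qed

text \<open>Numerator and denominator are expanded to first order with remainders x and y at most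
  lam^2; the linear terms combine to \<open>zeta\<close>, the step minus its conditional
  mean.\<close>

lemma weight_bounds:
  assumes lam: "0 < lam" "lam \<le> 1" and \<omega>: "\<omega> \<in> space env_space" and e: "e \<in> units"
  shows "\<bar>weight lam \<omega> e - 1 - lam * zeta \<omega> e\<bar> \<le> 18 * lam\<^sup>2" "\<bar>weight lam \<omega> e - 1\<bar> \<le> 20 * lam" "0 \<le> weight lam \<omega> e"
proof -
  define D where "D = mean_step (\<lambda>\<omega> e. exp (lam * (rvec e \<bullet> l))) \<omega>"
  define a where "a = rvec e \<bullet> l"
  define b where "b = ldrift \<omega>"
  have a1: "\<bar>a\<bar> \<le> 1" using abs_dir_le[OF e] by (simp add: a_def)
  have b1: "\<bar>b\<bar> \<le> 1" using abs_ldrift_le[OF \<omega>] by (simp add: b_def)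
  have ex: "\<bar>exp (lam * u) - 1 - lam * u\<bar> \<le> lam\<^sup>2" if u: "\<bar>u\<bar> \<le> 1" for u :: real
  proof -
    have lu: "\<bar>lam * u\<bar> \<le> lam" using lam u mult_left_mono[OF u, of lam] by (simp add: abs_mult)
    have "\<bar>exp (lam * u) - 1 - lam * u\<bar> \<le> (lam * u)\<^sup>2"
      using lu lam by (intro abs_exp_remainder_le) linarith
    also have "\<dots> \<le> lam\<^sup>2" using lu lam by (intro power2_le_iff_abs_le[THEN iffD2]) auto
    finally show ?thesis .
  qed
  define x where "x = exp (lam * a) - 1 - lam * a"
  define y where "y = D - 1 - lam * b"
  have x: "\<bar>x\<bar> \<le> lam\<^sup>2" unfolding x_def by (rule ex[OF a1])
  have y: "\<bar>y\<bar> \<le> lam\<^sup>2"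
  proof -
    have "y = mean_step (\<lambda>\<omega> e. exp (lam * (rvec e \<bullet> l)) - 1 - lam * (rvec e \<bullet> l)) \<omega>"
      unfolding y_def D_def b_def ldrift_def
      using mean_step_const[OF \<omega>, of "\<lambda>_. 1"] mean_step_mult[of "\<lambda>_. lam" "\<lambda>_ e. rvec e \<bullet> l" \<omega>]
      by (simp add: mean_step_diff)
    then show ?thesis using mean_step_bound[OF \<omega>, of "\<lambda>\<omega> e. exp (lam * (rvec e \<bullet> l)) - 1 - lam * (rvec e \<bullet> l)" "lam\<^sup>2"]
        ex[OF abs_dir_le] by simp
  qed
  have l2: "lam\<^sup>2 \<le> lam" using lam by (simp add: power2_eq_square mult_left_le_one_le)
  \<comment> \<open>The exponents are at least - 1, and exp (- 1) \<ge> 1/3.\<close>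
  have D3: "1 / 3 \<le> D"
  proof -
    have "mean_step (\<lambda>\<omega> e. 1 / 3) \<omega> \<le> D" unfolding D_def
    proof (rule mean_step_mono[OF \<omega>])
      fix e :: "int ^ 'd" assume "e \<in> units"
      have "- 1 \<le> - (lam * \<bar>rvec e \<bullet> l\<bar>)"
        using abs_dir_le[OF \<open>e \<in> units\<close>] lam by (simp add: mult_le_one)
      also have "\<dots> \<le> lam * (rvec e \<bullet> l)" using lam by (simp add: abs_if mult_le_0_iff)
      finally have "exp (- 1) \<le> exp (lam * (rvec e \<bullet> l))" by simp
      moreover have "1 / 3 \<le> exp (- 1 :: real)" using exp_le by (simp add: exp_minus field_simps)
      ultimately show "1 / 3 \<le> exp (lam * (rvec e \<bullet> l))" by linarith
    qed
    then show ?thesis using mean_step_const[OF \<omega>, of "\<lambda>_. 1 / 3"] by simp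
  qed
  have z: "zeta \<omega> e = a - b" by (simp add: zeta_def a_def b_def)
  have w: "weight lam \<omega> e = exp (lam * a) / D" by (simp add: weight_def D_def a_def)
  then show "0 \<le> weight lam \<omega> e" using D3 by simp
  have "weight lam \<omega> e - 1 - lam * zeta \<omega> e = (x - y - lam * (a - b) * (lam * b + y)) / D"
    using D3 unfolding w z x_def y_def by (simp add: field_simps)
  then have eq: "\<bar>weight lam \<omega> e - 1 - lam * zeta \<omega> e\<bar> = \<bar>x - y - lam * (a - b) * (lam * b + y)\<bar> / D"
    using D3 by (simp add: abs_divide)
  have "\<bar>lam * (a - b) * (lam * b + y)\<bar> \<le> (lam * 2) * (2 * lam)"
  proof -
    have "\<bar>a - b\<bar> \<le> 2" using a1 b1 by linarith
    then have 1: "\<bar>lam * (a - b)\<bar> \<le> lam * 2" using lam by (simp add: abs_mult)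
    have "\<bar>lam * b\<bar> \<le> lam" using mult_left_mono[OF b1, of lam] lam by (simp add: abs_mult)
    then have 2: "\<bar>lam * b + y\<bar> \<le> 2 * lam" using y l2 by linarith
    show ?thesis unfolding abs_mult[of "lam * (a - b)"] using 1 2 lam by (intro mult_mono) auto
  qed
  \<comment> \<open>1 + 1 + 4 = 6; division by D \<ge> 1/3 gives 18, and |\<open>zeta\<close>| \<le>
    2 raises this to 20 in the second bound.\<close>
  then have "\<bar>x - y - lam * (a - b) * (lam * b + y)\<bar> \<le> 6 * lam\<^sup>2"
    using x y by (simp add: power2_eq_square)
  moreover have "\<bar>x - y - lam * (a - b) * (lam * b + y)\<bar> / D \<le> \<bar>x - y - lam * (a - b) * (lam * b + y)\<bar> / (1 / 3)"
    using D3 by (intro divide_left_mono) auto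
  ultimately show 1: "\<bar>weight lam \<omega> e - 1 - lam * zeta \<omega> e\<bar> \<le> 18 * lam\<^sup>2" unfolding eq by simp
  have "\<bar>lam * zeta \<omega> e\<bar> \<le> 2 * lam"
    using mult_left_mono[OF abs_zeta_le[OF \<omega> e], of lam] lam by (simp add: abs_mult)
  then show "\<bar>weight lam \<omega> e - 1\<bar> \<le> 20 * lam" using 1 l2 by linarith
qed

lemma mean_step_weight: "\<omega> \<in> space env_space \<Longrightarrow> mean_step (weight lam) \<omega> = 1"
  using mean_exp_pos[of \<omega> lam]
  unfolding mean_step_def weight_def times_divide_eq_right sum_divide_distrib[symmetric] by simp

lemma weight_bdd: "0 < lam \<Longrightarrow> lam \<le> 1 \<Longrightarrow> bdd_step (weight lam)"
  unfolding bdd_step_def using weight_step_measurable weight_bounds(2)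
  by (intro conjI exI[of _ 21] ballI) (smt (verit))+

end

section \<open>Moments of the Girsanov density\<close>

lemma L2_mult_bounded:
  assumes f: "f \<in> L2 M" and g: "g \<in> borel_measurable M" "AE x in M. \<bar>g x\<bar> \<le> c"
  shows "(\<lambda>x. f x * g x) \<in> L2 M"
proof -
  have fm [measurable]: "f \<in> borel_measurable M" by (rule L2_measurable[OF f])
  note [measurable] = g(1)
  have "integrable M (\<lambda>x. (f x * g x)\<^sup>2)"
  proof (rule Bochner_Integration.integrable_bound)
    show "integrable M (\<lambda>x. c\<^sup>2 * (f x)\<^sup>2)" using L2_integrable_sq[OF f] by simp
    show "AE x in M. norm ((f x * g x)\<^sup>2) \<le> norm (c\<^sup>2 * (f x)\<^sup>2)"
      using g(2)
    proof eventually_elim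
      case (elim x)
      then have "(g x)\<^sup>2 \<le> c\<^sup>2" by (simp add: abs_le_square_iff[symmetric])
      then show ?case using mult_left_mono[of "(g x)\<^sup>2" "c\<^sup>2" "(f x)\<^sup>2"]
        by (simp add: power_mult_distrib mult.commute)
    qed
  qed measurable
  then show ?thesis by (simp add: L2_def)
qed

section \<open>Asymptotic covariances, the class \<open>H_minus_1\<close> and the change of initial
  law\<close>

context rcm
begin

text \<open>The asymptotic covariance, by polarization from \<open>asd\<close>, so that its
  existence as a limit (\<open>acov_tendsto\<close>) is inherited from the variances.\<close>

definition acov :: "('d env \<Rightarrow> real) \<Rightarrow> ('d env \<Rightarrow> real) \<Rightarrow> real" where
  "acov f g = ((asd (\<lambda>\<omega>. f \<omega> + g \<omega>))\<^sup>2 - (asd f)\<^sup>2 - (asd g)\<^sup>2) / 2"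

lemma asd_sq_tendsto:
  assumes "hm1 K f" shows "(\<lambda>n. (nrm A (ssum f n))\<^sup>2 / real n) \<longlonglongrightarrow> (asd f)\<^sup>2"
  using tendsto_power[OF asd_tendsto[OF assms], of 2] by (simp add: power_divide)

lemma nrm_ssum_combination:
  assumes f: "f \<in> L2 Q" and g: "g \<in> L2 Q"
  shows "(nrm A (ssum (\<lambda>\<omega>. a * f \<omega> + b * g \<omega>) n))\<^sup>2 =
    a\<^sup>2 * (nrm A (ssum f n))\<^sup>2 + 2 * a * b * (\<integral>z. ssum f n z * ssum g n z \<partial>A) + b\<^sup>2 * (nrm A (ssum g n))\<^sup>2"
proof -
  have "ssum (\<lambda>\<omega>. a * f \<omega> + b * g \<omega>) n = (\<lambda>z. a * ssum f n z + b * ssum g n z)"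
    by (simp add: fun_eq_iff ssum_add ssum_cmult)
  then have "(nrm A (ssum (\<lambda>\<omega>. a * f \<omega> + b * g \<omega>) n))\<^sup>2 = (\<integral>z. (a * ssum f n z + b * ssum g n z)\<^sup>2 \<partial>A)"
    by (simp add: nrm_sq)
  also have "\<dots> = (\<integral>z. (ssum g n z)\<^sup>2 \<partial>A) * b\<^sup>2 + 2 * (\<integral>z. (a * ssum f n z) * ssum g n z \<partial>A) * b + (\<integral>z. (a * ssum f n z)\<^sup>2 \<partial>A)"
    by (rule L2_integral_add_scaled_sq[OF L2_cmult[OF ssum_L2[OF f]] ssum_L2[OF g]])
  finally show ?thesis by (simp add: nrm_sq power_mult_distrib mult.assoc algebra_simps)
qed

lemma acov_tendsto:
  assumes f: "hm1 K f" and g: "hm1 L g"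
  shows "(\<lambda>n. (\<integral>z. ssum f n z * ssum g n z \<partial>A) / real n) \<longlonglongrightarrow> acov f g"
proof -
  have "(\<lambda>n. ((nrm A (ssum (\<lambda>\<omega>. f \<omega> + g \<omega>) n))\<^sup>2 / real n - (nrm A (ssum f n))\<^sup>2 / real n - (nrm A (ssum g n))\<^sup>2 / real n) / 2)
      \<longlonglongrightarrow> acov f g"
    unfolding acov_def by (intro tendsto_intros asd_sq_tendsto[OF f] asd_sq_tendsto[OF g] asd_sq_tendsto[OF hm1_add[OF f g]]) simp
  moreover have "((nrm A (ssum (\<lambda>\<omega>. f \<omega> + g \<omega>) n))\<^sup>2 / real n - (nrm A (ssum f n))\<^sup>2 / real n - (nrm A (ssum g n))\<^sup>2 / real n) / 2 =
      (\<integral>z. ssum f n z * ssum g n z \<partial>A) / real n" for n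
    using nrm_ssum_combination[OF hm1_L2[OF f] hm1_L2[OF g], of 1 1 n] by (simp add: add_divide_distrib)
  ultimately show ?thesis by simp
qed

lemma hm1_combination: "hm1 K f \<Longrightarrow> hm1 L g \<Longrightarrow> hm1 (2 * (a\<^sup>2 * K + b\<^sup>2 * L)) (\<lambda>\<omega>. a * f \<omega> + b * g \<omega>)"
  by (intro hm1_add hm1_cmult)

lemma asd_combination:
  assumes f: "hm1 K f" and g: "hm1 L g"
  shows "(asd (\<lambda>\<omega>. a * f \<omega> + b * g \<omega>))\<^sup>2 = (asd f)\<^sup>2 * a\<^sup>2 + 2 * acov f g * a * b + (asd g)\<^sup>2 * b\<^sup>2"
proof (rule LIMSEQ_unique)
  show "(\<lambda>n. (nrm A (ssum (\<lambda>\<omega>. a * f \<omega> + b * g \<omega>) n))\<^sup>2 / real n) \<longlonglongrightarrow> (asd (\<lambda>\<omega>. a * f \<omega> + b * g \<omega>))\<^sup>2"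
    by (rule asd_sq_tendsto[OF hm1_combination[OF f g]])
  have "(\<lambda>n. (nrm A (ssum f n))\<^sup>2 / real n * a\<^sup>2 + 2 * ((\<integral>z. ssum f n z * ssum g n z \<partial>A) / real n) * a * b +
      (nrm A (ssum g n))\<^sup>2 / real n * b\<^sup>2) \<longlonglongrightarrow> (asd f)\<^sup>2 * a\<^sup>2 + 2 * acov f g * a * b + (asd g)\<^sup>2 * b\<^sup>2"
    by (intro tendsto_intros asd_sq_tendsto[OF f] asd_sq_tendsto[OF g] acov_tendsto[OF f g])
  then show "(\<lambda>n. (nrm A (ssum (\<lambda>\<omega>. a * f \<omega> + b * g \<omega>) n))\<^sup>2 / real n) \<longlonglongrightarrow>
      (asd f)\<^sup>2 * a\<^sup>2 + 2 * acov f g * a * b + (asd g)\<^sup>2 * b\<^sup>2"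
    by (simp add: nrm_ssum_combination[OF hm1_L2[OF f] hm1_L2[OF g]] add_divide_distrib mult_ac)
qed

lemma acov_Cauchy_Schwarz:
  assumes f: "hm1 K f" and g: "hm1 L g"
  shows "(acov f g)\<^sup>2 \<le> (asd f)\<^sup>2 * (asd g)\<^sup>2"
proof (rule LIMSEQ_le)
  show "(\<lambda>n. ((\<integral>z. ssum f n z * ssum g n z \<partial>A) / real n)\<^sup>2) \<longlonglongrightarrow> (acov f g)\<^sup>2"
    by (intro tendsto_intros acov_tendsto[OF f g])
  show "(\<lambda>n. ((nrm A (ssum f n))\<^sup>2 / real n) * ((nrm A (ssum g n))\<^sup>2 / real n)) \<longlonglongrightarrow> (asd f)\<^sup>2 * (asd g)\<^sup>2"
    by (intro tendsto_intros asd_sq_tendsto[OF f] asd_sq_tendsto[OF g])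
  have "((\<integral>z. ssum f n z * ssum g n z \<partial>A) / real n)\<^sup>2 \<le> ((nrm A (ssum f n))\<^sup>2 / real n) * ((nrm A (ssum g n))\<^sup>2 / real n)" for n
    using divide_right_mono[OF integral_Cauchy_Schwarz[OF ssum_L2[OF hm1_L2[OF f]] ssum_L2[OF hm1_L2[OF g]], of n n], of "(real n)\<^sup>2"]
    by (simp add: power_divide nrm_sq) (simp add: power2_eq_square)
  then show "\<exists>N. \<forall>n\<ge>N. ((\<integral>z. ssum f n z * ssum g n z \<partial>A) / real n)\<^sup>2 \<le>
      ((nrm A (ssum f n))\<^sup>2 / real n) * ((nrm A (ssum g n))\<^sup>2 / real n)" by blast
qed

text \<open>A convergent sequence of normalized variances is bounded, and
  \<open>hm1_of_variance_bound\<close> converts the bound into the dual estimate.\<close>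

lemma H_minus_1_imp_hm1:
  assumes f: "f \<in> H_minus_1 P"
  shows "\<exists>K. hm1 K f"
proof -
  have fL: "f \<in> L2 Q" using f by (simp add: H_minus_1_def L2_def)
  have eq: "(\<Sum>k=0..n. f (env_seen k z)) = ssum f (Suc n) z" for n z
    by (simp add: ssum_def atLeast0AtMost lessThan_Suc_atMost)
  have "convergent (\<lambda>n. (\<integral>z. (\<Sum>k=0..n. f (env_seen k z))\<^sup>2 \<partial>A) / real n)"
    using f by (simp add: H_minus_1_def)
  then have "Bseq (\<lambda>n. (nrm A (ssum f (Suc n)))\<^sup>2 / real n)"
    unfolding eq nrm_sq by (rule convergent_imp_Bseq)
  then obtain C where C: "0 < C" "\<And>n. \<bar>(nrm A (ssum f (Suc n)))\<^sup>2 / real n\<bar> \<le> C"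
    by (auto simp: Bseq_def)
  define K where "K = sqrt (C + (nrm Q f)\<^sup>2)"
  have "nrm A (ssum f n) \<le> K * sqrt (real n)" for n
  proof -
    \<comment> \<open>The given quotient has n + 1 summands over n. Its value at index 0 is 0 by
      convention and says nothing about a single summand, so n = 1 is bounded directly by the norm
      of f.\<close>
    consider "n = 0" | "n = 1" | m where "n = Suc m" "m \<noteq> 0" by (cases n) auto
    then have "(nrm A (ssum f n))\<^sup>2 \<le> (C + (nrm Q f)\<^sup>2) * real n"
    proof cases
      case 1 then show ?thesis by (simp add: ssum_def nrm_def)
    next
      case 2
      then have "ssum f n = (\<lambda>z. f (env_seen 0 z))" by (simp add: ssum_def fun_eq_iff)
      then show ?thesis using 2 C(1) nrm_env_seen[OF fL, of 0] by simp
    next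
      case 3
      then have "(nrm A (ssum f n))\<^sup>2 \<le> C * real m" using C(2)[of m] by (simp add: pos_divide_le_eq)
      also have "\<dots> \<le> (C + (nrm Q f)\<^sup>2) * real n" using 3 C(1) by (intro mult_mono) auto
      finally show ?thesis .
    qed
    then have "nrm A (ssum f n) \<le> sqrt ((C + (nrm Q f)\<^sup>2) * real n)" by (rule real_le_rsqrt)
    then show ?thesis by (simp add: K_def real_sqrt_mult)
  qed
  from hm1_of_variance_bound[OF fL _ this] show ?thesis using C(1) by (auto simp: K_def)
qed

text \<open>Changing the initial law costs a bounded weight at \<open>env_seen 0\<close>, exactly
  the kind of factor \<psi> that the central limit theorems carry.\<close>

lemma integral_annealed_P:
  fixes F :: "'d env \<times> 'd path \<Rightarrow> complex"
  assumes F: "past n F" and b: "\<And>z. norm (F z) \<le> 1"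
  shows "(\<integral>z. F z \<partial>annealed P walk0) = (\<integral>z. of_real (P_density (env_seen 0 z)) * F z \<partial>A)"
proof -
  interpret WP: annealed_walk P "\<lambda>\<omega>. \<omega>"
    by unfold_locales (auto simp: sets_P P.prob_space_axioms)
  interpret AP: prob_space "annealed P walk0" by (rule WP.prob_space_A)
  let ?G = "\<lambda>z. of_real (P_density (env_seen 0 z)) * F z"
  have G: "past n ?G"
    by (intro past_mult F past_of_real env_seen_past P_density_measurable) simp
  have d: "depends_upto n F" "depends_upto n ?G" using F G by (auto simp: past_def)
  have iP: "integrable (annealed P walk0) F"
    by (rule AP.integrable_const_bound[where B = 1])
      (use b past_borel[OF F] in \<open>auto simp: measurable_cong_sets[OF WP.sets_A refl]\<close>)
  have iA: "integrable A ?G"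
  proof (rule A.integrable_const_bound[OF _ past_measurable[OF G]])
    have "AE z in A. \<bar>P_density (env_seen 0 z)\<bar> \<le> Z * ellipticity"
      by (rule AE_distrD[OF env_seen_A, of "\<lambda>\<omega>. \<bar>P_density \<omega>\<bar> \<le> Z * ellipticity" 0])
        (simp only: distr_env_seen AE_P_density_bound)
    then show "AE z in A. norm (?G z) \<le> Z * ellipticity"
    proof eventually_elim
      case (elim z)
      have "norm (?G z) \<le> \<bar>P_density (env_seen 0 z)\<bar> * 1"
        unfolding norm_mult norm_of_real by (intro mult_left_mono b) auto
      then show ?case using elim by simp
    qed
  qed
  have "(\<integral>\<omega>. cyl_prob \<omega> 0 n p *\<^sub>R F (\<omega>, p) \<partial>P) = (\<integral>\<omega>. cyl_prob \<omega> 0 n p *\<^sub>R ?G (\<omega>, p) \<partial>Q)" if p: "p \<in> paths n" for p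
  proof -
    have "(\<lambda>\<omega>. F (\<omega>, p)) \<in> borel_measurable env_space"
      by (rule measurable_compose[OF _ past_borel[OF F]]) (simp add: measurable_Pair2')
    then have "(\<integral>\<omega>. cyl_prob \<omega> 0 n p *\<^sub>R F (\<omega>, p) \<partial>P) = (\<integral>\<omega>. P_density \<omega> *\<^sub>R (cyl_prob \<omega> 0 n p *\<^sub>R F (\<omega>, p)) \<partial>Q)"
      by (intro integral_P) auto
    also have "\<dots> = (\<integral>\<omega>. cyl_prob \<omega> 0 n p *\<^sub>R ?G (\<omega>, p) \<partial>Q)"
      by (intro Bochner_Integration.integral_cong refl)
        (simp add: env_seen_def paths_start[OF p] env_shift_zero space_Q scaleR_conv_of_real mult_ac)
    finally show ?thesis .
  qed
  then show ?thesis
    unfolding WP.integral_paths[OF past_borel[OF F] d(1) iP] W.integral_paths[OF past_borel[OF G] d(2) iA]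
    by (intro sum.cong refl)
qed

lemma integral_P_density: "(\<integral>\<omega>. P_density \<omega> \<partial>Q) = 1"
  using integral_P[of "\<lambda>_. 1 :: real"] by (simp add: P.prob_space)

end

section \<open>Estimates for the density and for martingales under the tilt\<close>

context rcm_direction
begin

lemma AE_weight:
  assumes lam: "0 < lam" "lam \<le> 1"
  shows "AE z in A. \<forall>k. 0 \<le> weight lam (env_seen k z) (step k z) \<and> weight lam (env_seen k z) (step k z) \<le> 21"
  unfolding AE_all_countable
proof
  fix k
  show "AE z in A. 0 \<le> weight lam (env_seen k z) (step k z) \<and> weight lam (env_seen k z) (step k z) \<le> 21"
    using AE_step_units[of k] AE_space
  proof eventually_elim
    case (elim z)
    show ?case using weight_bounds(2,3)[OF lam env_seen_space_A[OF elim(2)] elim(1), of k] lam by linarith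
  qed
qed

lemma AE_girs:
  assumes lam: "0 < lam" "lam \<le> 1"
  shows "AE z in A. 0 \<le> girs lam n z" "AE z in A. \<bar>girs lam n z\<bar> \<le> 21 ^ n"
proof -
  show 1: "AE z in A. 0 \<le> girs lam n z"
    using AE_weight[OF lam] by eventually_elim (auto simp: girs_def intro: prod_nonneg)
  show "AE z in A. \<bar>girs lam n z\<bar> \<le> 21 ^ n"
    using AE_weight[OF lam] 1
  proof eventually_elim
    case (elim z)
    have "girs lam n z \<le> (\<Prod>k<n. 21)" unfolding girs_def using elim(1) by (intro prod_mono) auto
    then show ?case using elim(2) by simp
  qed
qed

lemma girs_measurable: "girs lam n \<in> borel_measurable A"
  by (rule past_measurable[OF girs_past])

lemma girs_L2: "0 < lam \<Longrightarrow> lam \<le> 1 \<Longrightarrow> girs lam n \<in> L2 A"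
  by (rule A.L2_bounded(1)[OF girs_measurable AE_girs(2)])

lemma girs_Suc: "girs lam (Suc n) z = girs lam n z * weight lam (env_seen n z) (step n z)"
  by (simp add: girs_def)

lemma L2_mult_girs: "0 < lam \<Longrightarrow> lam \<le> 1 \<Longrightarrow> F \<in> L2 A \<Longrightarrow> (\<lambda>z. F z * girs lam n z) \<in> L2 A"
  by (rule L2_mult_bounded[OF _ girs_measurable AE_girs(2)])

lemma girs_martingale:
  assumes lam: "0 < lam" "lam \<le> 1" and F: "past n F" "F \<in> L2 A"
  shows "(\<integral>z. F z * girs lam (Suc n) z \<partial>A) = (\<integral>z. F z * girs lam n z \<partial>A)"
proof -
  have "(\<integral>z. F z * girs lam (Suc n) z \<partial>A) = (\<integral>z. weight lam (env_seen n z) (step n z) * (F z * girs lam n z) \<partial>A)"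
    by (simp add: girs_Suc mult_ac)
  also have "\<dots> = (\<integral>z. mean_step (weight lam) (env_seen n z) * (F z * girs lam n z) \<partial>A)"
    by (rule markov_L2[OF past_mult[OF F(1) girs_past] L2_mult_girs[OF lam F(2)] weight_step_measurable
        bdd_step_L2[OF weight_bdd[OF lam]]])
  also have "\<dots> = (\<integral>z. F z * girs lam n z \<partial>A)"
    by (intro Bochner_Integration.integral_cong) (auto simp: mean_step_weight env_seen_space_A)
  finally show ?thesis .
qed

lemma girs_mean: "0 < lam \<Longrightarrow> lam \<le> 1 \<Longrightarrow> (\<integral>z. girs lam n z \<partial>A) = 1"
proof (induction n)
  case 0 then show ?case by (simp add: girs_def A.prob_space)
next
  case (Suc n)
  then show ?case using girs_martingale[OF Suc.prems past_const[of n "1::real"] A.L2_const] by simp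
qed

text \<open>The weight has conditional mean 1, so its second moment exceeds 1 by its variance, which
  is at most (20 lam)^2: no term linear in lam survives.\<close>

lemma mean_step_weight_sq:
  assumes lam: "0 < lam" "lam \<le> 1" and \<omega>: "\<omega> \<in> space env_space"
  shows "mean_step (\<lambda>\<omega> e. weight lam \<omega> e * weight lam \<omega> e) \<omega> \<le> 1 + 400 * lam\<^sup>2"
proof -
  have "mean_step (\<lambda>\<omega> e. weight lam \<omega> e * weight lam \<omega> e) \<omega> \<le> mean_step (\<lambda>\<omega> e. 2 * weight lam \<omega> e + (400 * lam\<^sup>2 - 1)) \<omega>"
  proof (rule mean_step_mono[OF \<omega>])
    fix e :: "int ^ 'd" assume e: "e \<in> units"
    have "\<bar>weight lam \<omega> e - 1\<bar>\<^sup>2 \<le> (20 * lam)\<^sup>2" by (intro power_mono weight_bounds(2)[OF lam \<omega> e]) auto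
    then show "weight lam \<omega> e * weight lam \<omega> e \<le> 2 * weight lam \<omega> e + (400 * lam\<^sup>2 - 1)"
      by (simp add: power2_eq_square algebra_simps)
  qed
  also have "\<dots> = 1 + 400 * lam\<^sup>2"
    using mean_step_mult[of "\<lambda>_. 2" "weight lam" \<omega>] mean_step_const[OF \<omega>, of "\<lambda>_. 400 * lam\<^sup>2 - 1"]
    by (simp add: mean_step_add mean_step_weight[OF \<omega>])
  finally show ?thesis .
qed

text \<open>The conditional second moments multiply to at most exp (400 lam^2 n), which stays
  bounded as long as n is of order 1/lam^2.\<close>

lemma nrm_girs_le:
  assumes lam: "0 < lam" "lam \<le> 1"
  shows "nrm A (girs lam n) \<le> exp (200 * lam\<^sup>2 * real n)"
proof -
  let ?w2 = "\<lambda>\<omega> e. weight lam \<omega> e * weight lam \<omega> e"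
  note w2 = bdd_step_mult[OF weight_bdd[OF lam] weight_bdd[OF lam]]
  have "(nrm A (girs lam n))\<^sup>2 \<le> (1 + 400 * lam\<^sup>2) ^ n"
  proof (induction n)
    case 0 then show ?case by (simp add: nrm_sq girs_def A.prob_space)
  next
    case (Suc n)
    have gL: "(\<lambda>z. girs lam n z * girs lam n z) \<in> L2 A" by (rule L2_mult_girs[OF lam girs_L2[OF lam]])
    have "(nrm A (girs lam (Suc n)))\<^sup>2 = (\<integral>z. ?w2 (env_seen n z) (step n z) * (girs lam n z * girs lam n z) \<partial>A)"
      by (simp add: nrm_sq girs_Suc) (simp add: power2_eq_square mult_ac)
    also have "\<dots> = (\<integral>z. mean_step ?w2 (env_seen n z) * (girs lam n z * girs lam n z) \<partial>A)"
      by (rule markov_L2[OF past_mult[OF girs_past girs_past] gL bdd_step_measurable[OF w2] bdd_step_L2[OF w2]])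
    also have "\<dots> \<le> (\<integral>z. (1 + 400 * lam\<^sup>2) * (girs lam n z * girs lam n z) \<partial>A)"
    proof (rule integral_mono)
      show "integrable A (\<lambda>z. mean_step ?w2 (env_seen n z) * (girs lam n z * girs lam n z))"
        by (rule L2_integrable_mult[OF L2_env_seen[OF bdd_env_L2[OF bdd_step_mean[OF w2]]] gL])
      show "integrable A (\<lambda>z. (1 + 400 * lam\<^sup>2) * (girs lam n z * girs lam n z))"
        using A.L2_integrable[OF gL] by simp
      show "mean_step ?w2 (env_seen n z) * (girs lam n z * girs lam n z) \<le> (1 + 400 * lam\<^sup>2) * (girs lam n z * girs lam n z)"
        if "z \<in> space A" for z
        by (intro mult_right_mono mean_step_weight_sq[OF lam] env_seen_space_A that) auto
    qed
    also have "\<dots> = (1 + 400 * lam\<^sup>2) * (nrm A (girs lam n))\<^sup>2" by (simp only: nrm_sq integral_mult_right_zero) (simp add: power2_eq_square)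
    also have "\<dots> \<le> (1 + 400 * lam\<^sup>2) * (1 + 400 * lam\<^sup>2) ^ n" by (intro mult_left_mono Suc) auto
    finally show ?case by simp
  qed
  also have "\<dots> \<le> exp (400 * lam\<^sup>2) ^ n" by (intro power_mono exp_ge_add_one_self) auto
  also have "\<dots> = (exp (200 * lam\<^sup>2 * real n))\<^sup>2" by (simp add: exp_of_nat_mult[symmetric] exp_double[symmetric] mult_ac)
  finally show ?thesis by (rule power2_le_imp_le) simp
qed

text \<open>Under the tilt a martingale gains the drift lam h per step, h being its predictable
  covariation with the martingale of \<open>zeta\<close>. The second-order remainder costs at most
  18 c lam^2 per step because the density is nonnegative with mean 1.\<close>

lemma mart_girs:
  assumes lam: "0 < lam" "lam \<le> 1" and \<phi>: "bdd_step \<phi>" "\<And>\<omega>. \<omega> \<in> space env_space \<Longrightarrow> mean_step \<phi> \<omega> = 0"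
    and c: "\<And>\<omega> e. \<omega> \<in> space env_space \<Longrightarrow> e \<in> units \<Longrightarrow> \<bar>\<phi> \<omega> e\<bar> \<le> c" and c0: "0 \<le> c"
  defines "h \<equiv> mean_step (\<lambda>\<omega> e. \<phi> \<omega> e * zeta \<omega> e)"
  shows "\<bar>(\<integral>z. mart \<phi> n z * girs lam n z \<partial>A) - lam * (\<integral>z. ssum h n z * girs lam n z \<partial>A)\<bar> \<le> 18 * c * lam\<^sup>2 * real n"
proof (induction n)
  case 0 then show ?case by (simp add: mart_def ssum_def)
next
  case (Suc n)
  let ?w = "\<lambda>z. weight lam (env_seen n z) (step n z)"
  let ?\<phi>w = "\<lambda>\<omega> e. \<phi> \<omega> e * weight lam \<omega> e"
  note wb = weight_bdd[OF lam]
  note \<phi>w = bdd_step_mult[OF \<phi>(1) wb]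
  have h: "bdd_env h" unfolding h_def by (rule bdd_step_mean[OF bdd_step_mult[OF \<phi>(1) zeta_bdd]])
  note hL = bdd_env_L2[OF h] and mL = mart_L2[OF \<phi>(1), of n] and gL = girs_L2[OF lam, of n]
  note mp = mart_past[OF bdd_step_measurable[OF \<phi>(1)], of n]
  have "(\<integral>z. mart \<phi> (Suc n) z * girs lam (Suc n) z \<partial>A) =
      (\<integral>z. mart \<phi> n z * girs lam (Suc n) z + ?\<phi>w (env_seen n z) (step n z) * girs lam n z \<partial>A)"
    by (intro Bochner_Integration.integral_cong refl) (simp add: mart_Suc girs_Suc algebra_simps)
  also have "\<dots> = (\<integral>z. mart \<phi> n z * girs lam n z \<partial>A) + (\<integral>z. mean_step ?\<phi>w (env_seen n z) * girs lam n z \<partial>A)"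
    using girs_martingale[OF lam mp mL] markov_L2[OF girs_past gL bdd_step_measurable[OF \<phi>w] bdd_step_L2[OF \<phi>w]]
      L2_integrable_mult[OF mL girs_L2[OF lam, of "Suc n"]] L2_integrable_mult[OF bdd_step_L2[OF \<phi>w, of n] gL] by simp
  finally have 1: "(\<integral>z. mart \<phi> (Suc n) z * girs lam (Suc n) z \<partial>A) =
      (\<integral>z. mart \<phi> n z * girs lam n z \<partial>A) + (\<integral>z. mean_step ?\<phi>w (env_seen n z) * girs lam n z \<partial>A)" .
  \<comment> \<open>\<open>ssum h (Suc n)\<close> is known at time n, so the density at time Suc n
    may be replaced by the one at time n.\<close>
  have "(\<integral>z. ssum h (Suc n) z * girs lam (Suc n) z \<partial>A) = (\<integral>z. ssum h (Suc n) z * girs lam n z \<partial>A)"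
    by (rule girs_martingale[OF lam ssum_past[OF bdd_envD[OF h]] ssum_L2[OF hL]])
  also have "\<dots> = (\<integral>z. ssum h n z * girs lam n z \<partial>A) + (\<integral>z. h (env_seen n z) * girs lam n z \<partial>A)"
    using L2_integrable_mult[OF ssum_L2[OF hL, of n] gL] L2_integrable_mult[OF L2_env_seen[OF hL, of n] gL]
    by (simp add: ssum_Suc distrib_right)
  finally have 2: "(\<integral>z. ssum h (Suc n) z * girs lam (Suc n) z \<partial>A) =
      (\<integral>z. ssum h n z * girs lam n z \<partial>A) + (\<integral>z. h (env_seen n z) * girs lam n z \<partial>A)" .
  have m\<phi>w: "bdd_env (mean_step ?\<phi>w)" by (rule bdd_step_mean[OF \<phi>w])
  have pt: "\<bar>mean_step ?\<phi>w \<omega> - lam * h \<omega>\<bar> \<le> 18 * c * lam\<^sup>2" if \<omega>: "\<omega> \<in> space env_space" for \<omega>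
  proof -
    have "mean_step (\<lambda>\<omega> e. ?\<phi>w \<omega> e - \<phi> \<omega> e - lam * (\<phi> \<omega> e * zeta \<omega> e)) \<omega> = mean_step ?\<phi>w \<omega> - lam * h \<omega>"
      using mean_step_mult[of "\<lambda>_. lam" "\<lambda>\<omega> e. \<phi> \<omega> e * zeta \<omega> e" \<omega>] by (simp add: mean_step_diff \<phi>(2)[OF \<omega>] h_def)
    moreover have "\<bar>mean_step (\<lambda>\<omega> e. ?\<phi>w \<omega> e - \<phi> \<omega> e - lam * (\<phi> \<omega> e * zeta \<omega> e)) \<omega>\<bar> \<le> 18 * c * lam\<^sup>2"
    proof (rule mean_step_bound[OF \<omega>])
      fix e :: "int ^ 'd" assume e: "e \<in> units"
      have "?\<phi>w \<omega> e - \<phi> \<omega> e - lam * (\<phi> \<omega> e * zeta \<omega> e) = \<phi> \<omega> e * (weight lam \<omega> e - 1 - lam * zeta \<omega> e)"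
        by (simp add: algebra_simps)
      then have "\<bar>?\<phi>w \<omega> e - \<phi> \<omega> e - lam * (\<phi> \<omega> e * zeta \<omega> e)\<bar> = \<bar>\<phi> \<omega> e\<bar> * \<bar>weight lam \<omega> e - 1 - lam * zeta \<omega> e\<bar>"
        by (simp only: abs_mult)
      also have "\<dots> \<le> c * (18 * lam\<^sup>2)" using c0 by (intro mult_mono c[OF \<omega> e] weight_bounds(1)[OF lam \<omega> e]) auto
      finally show "\<bar>?\<phi>w \<omega> e - \<phi> \<omega> e - lam * (\<phi> \<omega> e * zeta \<omega> e)\<bar> \<le> 18 * c * lam\<^sup>2" by simp
    qed
    ultimately show ?thesis by simp
  qed
  have i: "integrable A (\<lambda>z. mean_step ?\<phi>w (env_seen n z) * girs lam n z)" "integrable A (\<lambda>z. h (env_seen n z) * girs lam n z)"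
    by (intro L2_integrable_mult L2_env_seen bdd_env_L2 m\<phi>w h gL)+
  have "(\<integral>z. mean_step ?\<phi>w (env_seen n z) * girs lam n z \<partial>A) - lam * (\<integral>z. h (env_seen n z) * girs lam n z \<partial>A) =
      (\<integral>z. mean_step ?\<phi>w (env_seen n z) * girs lam n z - lam * (h (env_seen n z) * girs lam n z) \<partial>A)"
    using i by simp
  also have "\<bar>\<dots>\<bar> \<le> (\<integral>z. (18 * c * lam\<^sup>2) * girs lam n z \<partial>A)"
    unfolding real_norm_def[symmetric]
  proof (rule integral_norm_bound_AE)
    show "AE z in A. norm (mean_step ?\<phi>w (env_seen n z) * girs lam n z - lam * (h (env_seen n z) * girs lam n z)) \<le> (18 * c * lam\<^sup>2) * girs lam n z"
      using AE_girs(1)[OF lam, of n] AE_space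
    proof eventually_elim
      case (elim z)
      have "norm (mean_step ?\<phi>w (env_seen n z) * girs lam n z - lam * (h (env_seen n z) * girs lam n z)) =
          \<bar>mean_step ?\<phi>w (env_seen n z) - lam * h (env_seen n z)\<bar> * girs lam n z"
        using elim(1) by (simp add: abs_mult left_diff_distrib[symmetric] mult.assoc[symmetric])
      also have "\<dots> \<le> (18 * c * lam\<^sup>2) * girs lam n z"
        by (intro mult_right_mono pt env_seen_space_A elim)
      finally show ?case .
    qed
  qed (use i A.L2_integrable[OF gL] in auto)
  also have "\<dots> = 18 * c * lam\<^sup>2" by (simp add: girs_mean[OF lam])
  finally have 3: "\<bar>(\<integral>z. mean_step ?\<phi>w (env_seen n z) * girs lam n z \<partial>A) - lam * (\<integral>z. h (env_seen n z) * girs lam n z \<partial>A)\<bar> \<le> 18 * c * lam\<^sup>2" .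
  have "18 * c * lam\<^sup>2 * real (Suc n) = 18 * c * lam\<^sup>2 * real n + 18 * c * lam\<^sup>2" by (simp add: algebra_simps)
  then show ?case using Suc 3 unfolding 1 2 distrib_left by linarith
qed

text \<open>Pairing with the displacement vanishes by time reversal, so the pairing with its
  martingale part is minus the pairing with its drift part, up to a negligible term.\<close>

lemma zeta_tendsto:
  assumes f: "hm1 K f"
  shows "(\<lambda>n. (\<integral>z. ssum f n z * mart zeta n z \<partial>A) / real n) \<longlonglongrightarrow> - acov f ldrift"
proof -
  note fL = hm1_L2[OF f] and lL = bdd_env_L2[OF ldrift_bdd]
  have DL: "disp n \<in> L2 A" for n unfolding disp_def by (rule mart_L2[OF bdd_step_dir])
  define \<sigma> where "\<sigma> = sqrt (\<integral>\<omega>. mean_step (\<lambda>\<omega> e. zeta \<omega> e * zeta \<omega> e) \<omega> \<partial>Q)"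
  have nd: "nrm A (disp n) \<le> (11 + \<sigma>) * sqrt (real n)" if "1 \<le> n" for n
  proof -
    have "disp n = (\<lambda>z. ssum ldrift n z + mart zeta n z)" by (rule ext) (rule disp_eq)
    then have "nrm A (disp n) \<le> nrm A (ssum ldrift n) + nrm A (mart zeta n)"
      using nrm_triangle[OF ssum_L2[OF lL] mart_L2[OF zeta_bdd]] by simp
    also have "nrm A (mart zeta n) = sqrt (real n) * \<sigma>"
      unfolding \<sigma>_def by (rule nrm_mart[OF zeta_bdd mean_step_zeta])
    also have "nrm A (ssum ldrift n) \<le> 11 * sqrt (real n)" using nrm_ssum_hm1[OF hm1_ldrift _ that] by simp
    finally show ?thesis by (simp add: algebra_simps)
  qed
  \<comment> \<open>Orthogonality holds for \<open>ssum f (Suc n)\<close>; the surplus term at time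
    n, paired with the displacement of order sqrt n, disappears after division by n.\<close>
  have eq: "(\<integral>z. ssum f n z * mart zeta n z \<partial>A) / real n =
      - ((\<integral>z. f (env_seen n z) * disp n z \<partial>A) / real n) - (\<integral>z. ssum f n z * ssum ldrift n z \<partial>A) / real n" for n
  proof -
    have "(\<integral>z. ssum f n z * mart zeta n z \<partial>A) =
        (\<integral>z. (ssum f (Suc n) z * disp n z - f (env_seen n z) * disp n z) - ssum f n z * ssum ldrift n z \<partial>A)"
      by (intro Bochner_Integration.integral_cong refl) (simp add: ssum_Suc disp_eq algebra_simps)
    also have "\<dots> = ((\<integral>z. ssum f (Suc n) z * disp n z \<partial>A) - (\<integral>z. f (env_seen n z) * disp n z \<partial>A)) -
        (\<integral>z. ssum f n z * ssum ldrift n z \<partial>A)"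
      using L2_integrable_mult[OF ssum_L2[OF fL, of "Suc n"] DL[of n]] L2_integrable_mult[OF L2_env_seen[OF fL, of n] DL[of n]]
        L2_integrable_mult[OF ssum_L2[OF fL, of n] ssum_L2[OF lL, of n]] by simp
    finally show ?thesis by (simp add: ssum_disp_orthogonal[OF fL] diff_divide_distrib)
  qed
  have "(\<lambda>n. (\<integral>z. f (env_seen n z) * disp n z \<partial>A) / real n) \<longlonglongrightarrow> 0"
  proof (rule Lim_null_comparison[OF _ real_nat_sqrt_tendsto])
    show "eventually (\<lambda>n. norm ((\<integral>z. f (env_seen n z) * disp n z \<partial>A) / real n) \<le> (nrm Q f * (11 + \<sigma>)) / sqrt (real n)) sequentially"
      unfolding eventually_sequentially
    proof (intro exI[of _ 1] allI impI)
      fix n :: nat assume n: "1 \<le> n"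
      have "\<bar>\<integral>z. f (env_seen n z) * disp n z \<partial>A\<bar> \<le> nrm Q f * ((11 + \<sigma>) * sqrt (real n))"
        using nrm_Cauchy_Schwarz[OF L2_env_seen[OF fL, of n] DL[of n]] mult_left_mono[OF nd[OF n], of "nrm Q f"]
        by (simp add: nrm_env_seen[OF fL])
      then have "\<bar>\<integral>z. f (env_seen n z) * disp n z \<partial>A\<bar> / real n \<le> (nrm Q f * (11 + \<sigma>)) * (sqrt (real n) / real n)"
        using divide_right_mono[of _ _ "real n"] by fastforce
      also have "sqrt (real n) / real n = 1 / sqrt (real n)" by (simp only: sqrt_divide_self_eq[OF of_nat_0_le_iff] inverse_eq_divide)
      finally show "norm ((\<integral>z. f (env_seen n z) * disp n z \<partial>A) / real n) \<le> (nrm Q f * (11 + \<sigma>)) / sqrt (real n)" by simp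
    qed
  qed
  then have "(\<lambda>n. - ((\<integral>z. f (env_seen n z) * disp n z \<partial>A) / real n) - (\<integral>z. ssum f n z * ssum ldrift n z \<partial>A) / real n)
      \<longlonglongrightarrow> - 0 - acov f ldrift"
    by (intro tendsto_intros acov_tendsto[OF f hm1_ldrift])
  then show ?thesis by (simp add: eq)
qed

end

section \<open>The limits\<close>

context rcm_direction
begin

text \<open>The choices are nested: \<epsilon> fixes \<eta>, which fixes v and with it c, h and m;
  only then is the threshold d for lam chosen.\<close>

lemma tilted_limit:
  assumes f: "hm1 K f" and t: "1 \<le> t"
  defines "n \<equiv> \<lambda>lam. Suc (nat \<lfloor>t / lam\<^sup>2\<rfloor>)"
  shows "((\<lambda>lam. lam / t * (\<integral>z. ssum f (n lam) z * girs lam (n lam) z \<partial>A)) \<longlongrightarrow> - acov f ldrift) (at_right 0)"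
proof (rule tendstoI)
  fix \<epsilon> :: real assume \<epsilon>: "0 < \<epsilon>"
  note fL = hm1_L2[OF f]
  \<comment> \<open>Bounds the norm of the density up to the relevant time, since
    \<open>lam\<^sup>2 * real k\<close> is at most t + 1.\<close>
  define E where "E = exp (200 * (t + 1))"
  have E: "1 \<le> E" using t by (simp add: E_def)
  define \<sigma> where "\<sigma> = sqrt (\<integral>\<omega>. mean_step (\<lambda>\<omega> e. zeta \<omega> e * zeta \<omega> e) \<omega> \<partial>Q)"
  have \<sigma>: "0 \<le> \<sigma>"
    unfolding \<sigma>_def by (intro real_sqrt_ge_zero integral_nonneg_AE AE_I2 mean_step_square_nonneg) (simp add: space_Q)
  \<comment> \<open>The five errors below add up to (4 E + \<sigma> + 2) \<eta>; one more \<eta>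
    makes the final inequality strict.\<close>
  define \<eta> where "\<eta> = \<epsilon> / (4 * E + \<sigma> + 3)"
  have \<eta>: "0 < \<eta>" using \<epsilon> E \<sigma> by (simp add: \<eta>_def)
  obtain v N0 where v: "bdd_env v"
    and N0: "\<And>n. N0 \<le> n \<Longrightarrow> nrm A (\<lambda>z. ssum f n z - mart (mdiff v) n z) \<le> \<eta> * sqrt (real n)"
    using martingale_approx[OF f \<eta>] by blast
  note \<phi> = mdiff_bdd[OF v]
  obtain c where c: "\<And>\<omega> e. \<omega> \<in> space env_space \<Longrightarrow> e \<in> units \<Longrightarrow> \<bar>mdiff v \<omega> e\<bar> \<le> c" "0 \<le> c"
  proof -
    obtain c where "\<And>\<omega> e. \<omega> \<in> space env_space \<Longrightarrow> e \<in> units \<Longrightarrow> \<bar>mdiff v \<omega> e\<bar> \<le> c"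
      using \<phi> by (auto simp: bdd_step_def)
    then have "\<bar>mdiff v \<omega> e\<bar> \<le> \<bar>c\<bar>" if "\<omega> \<in> space env_space" "e \<in> units" for \<omega> e
      using that by (meson abs_ge_self order_trans)
    then show thesis using that[of "\<bar>c\<bar>"] by simp
  qed
  define h where "h = mean_step (\<lambda>\<omega> e. mdiff v \<omega> e * zeta \<omega> e)"
  have h: "bdd_env h" unfolding h_def by (rule bdd_step_mean[OF bdd_step_mult[OF \<phi> zeta_bdd]])
  define m where "m = (\<integral>\<omega>. h \<omega> \<partial>Q)"
  have "eventually (\<lambda>n. nrm A (\<lambda>z. ssum h n z / real n - m) < \<eta>) sequentially"
    using ssum_lln[OF h] \<eta> unfolding m_def by (intro order_tendstoD)
  then obtain N1 where N1: "\<And>n. N1 \<le> n \<Longrightarrow> nrm A (\<lambda>z. ssum h n z / real n - m) < \<eta>"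
    by (auto simp: eventually_sequentially)
  \<comment> \<open>m is the covariance per step of the approximating martingale with the one of
    \<open>zeta\<close>. It is compared with the limit for f at lam = 0, by letting n grow with v
    fixed.\<close>
  have mb: "\<bar>m + acov f ldrift\<bar> \<le> \<eta> * \<sigma>"
  proof -
    have b: "\<bar>m - (\<integral>z. ssum f n z * mart zeta n z \<partial>A) / real n\<bar> \<le> \<eta> * \<sigma>" if n: "max 1 N0 \<le> n" for n
    proof -
      note L = ssum_L2[OF fL, of n] mart_L2[OF \<phi>, of n] mart_L2[OF zeta_bdd, of n]
      have "(\<integral>z. (ssum f n z - mart (mdiff v) n z) * mart zeta n z \<partial>A) =
          (\<integral>z. ssum f n z * mart zeta n z \<partial>A) - (\<integral>z. mart (mdiff v) n z * mart zeta n z \<partial>A)"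
        using L by (simp add: left_diff_distrib L2_integrable_mult)
      also have "(\<integral>z. mart (mdiff v) n z * mart zeta n z \<partial>A) = real n * m"
        unfolding m_def h_def by (rule mart_covariance[OF \<phi> mean_step_mdiff zeta_bdd mean_step_zeta])
      finally have "\<bar>(\<integral>z. ssum f n z * mart zeta n z \<partial>A) - real n * m\<bar> \<le>
          nrm A (\<lambda>z. ssum f n z - mart (mdiff v) n z) * nrm A (mart zeta n)"
        using nrm_Cauchy_Schwarz[OF L2_diff[OF L(1,2)] L(3)] by simp
      also have "nrm A (mart zeta n) = sqrt (real n) * \<sigma>"
        unfolding \<sigma>_def by (rule nrm_mart[OF zeta_bdd mean_step_zeta])
      also have "nrm A (\<lambda>z. ssum f n z - mart (mdiff v) n z) * (sqrt (real n) * \<sigma>) \<le>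
          (\<eta> * sqrt (real n)) * (sqrt (real n) * \<sigma>)"
        using N0[of n] n \<sigma> by (intro mult_right_mono) auto
      also have "\<dots> = \<eta> * \<sigma> * (sqrt (real n) * sqrt (real n))" by (simp only: mult_ac)
      also have "\<dots> = \<eta> * \<sigma> * real n" by simp
      finally have "\<bar>real n * m - (\<integral>z. ssum f n z * mart zeta n z \<partial>A)\<bar> / real n \<le> \<eta> * \<sigma>"
        using n by (simp add: pos_divide_le_eq abs_minus_commute)
      also have "\<bar>real n * m - (\<integral>z. ssum f n z * mart zeta n z \<partial>A)\<bar> / real n =
          \<bar>(real n * m - (\<integral>z. ssum f n z * mart zeta n z \<partial>A)) / real n\<bar>" by (simp add: abs_divide)
      also have "(real n * m - (\<integral>z. ssum f n z * mart zeta n z \<partial>A)) / real n = m - (\<integral>z. ssum f n z * mart zeta n z \<partial>A) / real n"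
        using n by (simp add: diff_divide_distrib)
      finally show ?thesis .
    qed
    have "(\<lambda>n. \<bar>m - (\<integral>z. ssum f n z * mart zeta n z \<partial>A) / real n\<bar>) \<longlonglongrightarrow> \<bar>m - (- acov f ldrift)\<bar>"
      by (intro tendsto_intros zeta_tendsto[OF f])
    then have "\<bar>m - (- acov f ldrift)\<bar> \<le> \<eta> * \<sigma>" by (rule LIMSEQ_le_const2) (use b in blast)
    then show ?thesis by simp
  qed
  define N where "N = max 1 (max N0 N1)"
  \<comment> \<open>The bounds in turn: the expansion needs lam \<le> 1, t/(N + 1) makes the time
    exceed N, \<eta>/(36 c + 1) absorbs the second-order remainder, and \<eta>/(|m| + 1) the
    rounding of the time to an integer.\<close>
  define d where "d = min 1 (min (t / real (Suc N)) (min (\<eta> / (36 * c + 1)) (\<eta> / (\<bar>m\<bar> + 1))))"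
  have d: "0 < d" using t \<eta> c(2) by (auto simp: d_def intro!: divide_pos_pos add_nonneg_pos)
  have "dist (lam / t * (\<integral>z. ssum f (n lam) z * girs lam (n lam) z \<partial>A)) (- acov f ldrift) < \<epsilon>"
    if lam: "0 < lam" "lam < d" for lam
  proof -
    have lam1: "lam \<le> 1" and dN: "lam \<le> t / real (Suc N)" and dc: "lam \<le> \<eta> / (36 * c + 1)" and dm: "lam \<le> \<eta> / (\<bar>m\<bar> + 1)"
      using lam by (auto simp: d_def)
    \<comment> \<open>One more than the floor, because the sum in the theorem includes its upper
      index; hence \<open>lam\<^sup>2 * real k\<close> lies between t and t +
      \<open>lam\<^sup>2\<close>.\<close>
    define k where "k = n lam"
    have l2: "lam\<^sup>2 \<le> lam" "0 < lam\<^sup>2" using lam lam1 by (auto simp: power2_eq_square mult_left_le_one_le)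
    have fl: "real_of_int \<lfloor>t / lam\<^sup>2\<rfloor> \<le> t / lam\<^sup>2" "t / lam\<^sup>2 < real_of_int \<lfloor>t / lam\<^sup>2\<rfloor> + 1" by linarith+
    have "0 \<le> \<lfloor>t / lam\<^sup>2\<rfloor>" using t l2 by simp
    then have "real k = real_of_int \<lfloor>t / lam\<^sup>2\<rfloor> + 1" by (simp add: k_def n_def)
    then have k: "t / lam\<^sup>2 < real k" "real k \<le> t / lam\<^sup>2 + 1" using fl by linarith+
    then have k1: "t \<le> lam\<^sup>2 * real k" "lam\<^sup>2 * real k \<le> t + lam\<^sup>2"
      using l2 by (simp_all add: field_simps)
    have "lam\<^sup>2 * real (Suc N) \<le> lam * real (Suc N)" using l2 by (intro mult_right_mono) auto
    also have "\<dots> \<le> t" using dN by (simp add: pos_le_divide_eq)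
    finally have "lam\<^sup>2 * real (Suc N) \<le> lam\<^sup>2 * real k" using k1 by linarith
    then have "N \<le> k" using l2 by simp
    then have kN: "1 \<le> k" "N0 \<le> k" "N1 \<le> k" by (auto simp: N_def)
    have kt: "lam\<^sup>2 * real k \<le> t + 1" using k1 l2 lam1 by linarith
    have gE: "nrm A (girs lam k) \<le> E"
    proof -
      have "nrm A (girs lam k) \<le> exp (200 * lam\<^sup>2 * real k)" by (rule nrm_girs_le[OF lam(1) lam1])
      also have "\<dots> \<le> E" unfolding E_def using kt by simp
      finally show ?thesis .
    qed
    note gL = girs_L2[OF lam(1) lam1, of k] and hL = bdd_env_L2[OF h]
    let ?I = "\<lambda>F. \<integral>z. F z * girs lam k z \<partial>A"
    have t2: "(t + 1) / t \<le> 2" using t by (simp add: pos_divide_le_eq)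
    \<comment> \<open>From f to the martingale: an error \<eta> sqrt k against a density of norm at
      most E, where lam sqrt k \<le> t + 1 and (t + 1)/t \<le> 2.\<close>
    have T1: "\<bar>lam / t * ?I (ssum f k) - lam / t * ?I (mart (mdiff v) k)\<bar> \<le> 2 * E * \<eta>"
    proof -
      have "?I (ssum f k) - ?I (mart (mdiff v) k) = ?I (\<lambda>z. ssum f k z - mart (mdiff v) k z)"
        using gL ssum_L2[OF fL] mart_L2[OF \<phi>] by (simp add: left_diff_distrib L2_integrable_mult)
      then have "\<bar>?I (ssum f k) - ?I (mart (mdiff v) k)\<bar> \<le> nrm A (\<lambda>z. ssum f k z - mart (mdiff v) k z) * nrm A (girs lam k)"
        using nrm_Cauchy_Schwarz[OF L2_diff[OF ssum_L2[OF fL] mart_L2[OF \<phi>]] gL, of k k] by simp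
      also have "\<dots> \<le> (\<eta> * sqrt (real k)) * E" using N0[OF kN(2)] gE \<eta> by (intro mult_mono) auto
      finally have "lam / t * \<bar>?I (ssum f k) - ?I (mart (mdiff v) k)\<bar> \<le> lam / t * ((\<eta> * sqrt (real k)) * E)"
        using lam t by (intro mult_left_mono) auto
      also have "\<dots> = (\<eta> * E) * ((lam * sqrt (real k)) / t)" by simp
      also have "\<dots> \<le> (\<eta> * E) * ((t + 1) / t)"
      proof (intro mult_left_mono divide_right_mono)
        have "lam * sqrt (real k) = sqrt (lam\<^sup>2 * real k)" using lam by (simp add: real_sqrt_mult)
        also have "\<dots> \<le> sqrt (t + 1)" using kt by simp
        also have "\<dots> \<le> t + 1" using t by (intro real_le_lsqrt) (auto simp: power2_eq_square)
        finally show "lam * sqrt (real k) \<le> t + 1" .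
      qed (use t \<eta> E in auto)
      also have "\<dots> \<le> (\<eta> * E) * 2" using t2 \<eta> E by (intro mult_left_mono) auto
      finally have "lam / t * \<bar>?I (ssum f k) - ?I (mart (mdiff v) k)\<bar> \<le> 2 * E * \<eta>" by (simp add: mult_ac)
      then show ?thesis using lam t by (simp add: right_diff_distrib[symmetric] abs_mult del: times_divide_eq_left)
    qed
    \<comment> \<open>From the martingale to its drift under the tilt: the remainder of order 1 is
      multiplied by lam.\<close>
    have T2: "\<bar>lam / t * ?I (mart (mdiff v) k) - lam / t * (lam * ?I (ssum h k))\<bar> \<le> \<eta>"
    proof -
      have "\<bar>?I (mart (mdiff v) k) - lam * ?I (ssum h k)\<bar> \<le> 18 * c * lam\<^sup>2 * real k"
        unfolding h_def by (rule mart_girs[OF lam(1) lam1 \<phi> mean_step_mdiff c])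
      also have "\<dots> = 18 * c * (lam\<^sup>2 * real k)" by simp
      also have "\<dots> \<le> 18 * c * (t + 1)" using kt c(2) by (intro mult_left_mono) auto
      finally have "lam / t * \<bar>?I (mart (mdiff v) k) - lam * ?I (ssum h k)\<bar> \<le> lam / t * (18 * c * (t + 1))"
        using lam t by (intro mult_left_mono) auto
      also have "\<dots> = (lam * (18 * c)) * ((t + 1) / t)" by simp
      also have "\<dots> \<le> (lam * (18 * c)) * 2" using t2 lam c(2) by (intro mult_left_mono) auto
      also have "\<dots> = lam * (36 * c)" by simp
      also have "\<dots> \<le> \<eta> / (36 * c + 1) * (36 * c)" using dc c(2) by (intro mult_right_mono) auto
      also have "\<dots> \<le> \<eta>" using \<eta> c(2) by (simp add: field_simps)
      finally show ?thesis using lam t by (simp add: right_diff_distrib[symmetric] abs_mult del: times_divide_eq_left)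
    qed
    \<comment> \<open>From the drift to its mean: the law of large numbers in the mean square of the
      untilted walk survives the tilt because the density is bounded in that norm and has mean
      1.\<close>
    have T3: "\<bar>lam / t * (lam * ?I (ssum h k)) - (lam\<^sup>2 * real k / t) * m\<bar> \<le> 2 * E * \<eta>"
    proof -
      have L: "(\<lambda>z. ssum h k z / real k - m) \<in> L2 A"
        using L2_diff[OF L2_cmult[OF ssum_L2[OF hL]] A.L2_const, of "1 / real k" k m] by simp
      have "?I (\<lambda>z. ssum h k z / real k - m) = ?I (ssum h k) / real k - m"
        using L2_integrable_mult[OF ssum_L2[OF hL, of k] gL] A.L2_integrable[OF gL]
        by (simp add: left_diff_distrib girs_mean[OF lam(1) lam1])
      then have "\<bar>?I (ssum h k) / real k - m\<bar> \<le> nrm A (\<lambda>z. ssum h k z / real k - m) * nrm A (girs lam k)"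
        using nrm_Cauchy_Schwarz[OF L gL] by simp
      also have "\<dots> \<le> \<eta> * E" using N1[OF kN(3)] gE \<eta> by (intro mult_mono) auto
      finally have a: "\<bar>?I (ssum h k) / real k - m\<bar> \<le> \<eta> * E" .
      have "lam / t * (lam * ?I (ssum h k)) - (lam\<^sup>2 * real k / t) * m = (lam\<^sup>2 * real k / t) * (?I (ssum h k) / real k - m)"
        using kN(1) by (simp add: right_diff_distrib power2_eq_square)
      then have "\<bar>lam / t * (lam * ?I (ssum h k)) - (lam\<^sup>2 * real k / t) * m\<bar> = (lam\<^sup>2 * real k / t) * \<bar>?I (ssum h k) / real k - m\<bar>"
        using t by (simp only: abs_mult) simp
      also have "\<dots> \<le> ((t + 1) / t) * (\<eta> * E)"
        using a kt t by (intro mult_mono divide_right_mono) auto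
      also have "\<dots> \<le> 2 * (\<eta> * E)" using t2 \<eta> E by (intro mult_right_mono) auto
      finally show ?thesis by (simp add: mult_ac)
    qed
    \<comment> \<open>\<open>lam\<^sup>2 * real k\<close> exceeds t by at most
      \<open>lam\<^sup>2\<close>.\<close>
    have T4: "\<bar>(lam\<^sup>2 * real k / t) * m - m\<bar> \<le> \<eta>"
    proof -
      have "(lam\<^sup>2 * real k / t) * m - m = ((lam\<^sup>2 * real k - t) / t) * m" using t by (simp add: field_simps)
      then have "\<bar>(lam\<^sup>2 * real k / t) * m - m\<bar> = (lam\<^sup>2 * real k - t) / t * \<bar>m\<bar>"
        using k1(1) t by (simp add: abs_mult)
      also have "\<dots> \<le> lam * \<bar>m\<bar>"
      proof (rule mult_right_mono)
        have "(lam\<^sup>2 * real k - t) / t \<le> lam / 1" using k1 l2 t lam by (intro frac_le) auto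
        then show "(lam\<^sup>2 * real k - t) / t \<le> lam" by simp
      qed simp
      also have "\<dots> \<le> \<eta> / (\<bar>m\<bar> + 1) * \<bar>m\<bar>" using dm by (intro mult_right_mono) auto
      also have "\<dots> \<le> \<eta>" using \<eta> by (simp add: field_simps)
      finally show ?thesis .
    qed
    have "\<bar>lam / t * ?I (ssum f k) - (- acov f ldrift)\<bar> \<le> 2 * E * \<eta> + \<eta> + 2 * E * \<eta> + \<eta> + \<eta> * \<sigma>"
    proof -
      have "\<bar>a0 - (- b)\<bar> \<le> c1 + c2 + c3 + c4 + c5"
        if "\<bar>a0 - a1\<bar> \<le> c1" "\<bar>a1 - a2\<bar> \<le> c2" "\<bar>a2 - a3\<bar> \<le> c3" "\<bar>a3 - a4\<bar> \<le> c4" "\<bar>a4 + b\<bar> \<le> c5"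
        for a0 a1 a2 a3 a4 b c1 c2 c3 c4 c5 :: real
        using that by linarith
      from this[OF T1 T2 T3 T4 mb] show ?thesis .
    qed
    also have "\<dots> = (4 * E + \<sigma> + 2) * \<eta>" by (simp add: algebra_simps)
    also have "\<dots> < (4 * E + \<sigma> + 3) * \<eta>" using \<eta> by (intro mult_strict_right_mono) auto
    also have "\<dots> = \<epsilon>" using E \<sigma> by (simp add: \<eta>_def)
    finally show ?thesis by (simp add: dist_real_def k_def)
  qed
  then show "eventually (\<lambda>lam. dist (lam / t * (\<integral>z. ssum f (n lam) z * girs lam (n lam) z \<partial>A)) (- acov f ldrift) < \<epsilon>) (at_right 0)"
    using d unfolding eventually_at_right_field by blast
qed

section \<open>The limit law of the definition of \<open>Lambda\<close>, and the conclusion\<close>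

lemma clt_vector_eq:
  assumes f: "hm1 K f" and z: "z \<in> space env_space \<times> UNIV"
  defines "F \<equiv> \<lambda>u \<omega>. fst u * f \<omega> + snd u * ldrift \<omega>"
  shows "u \<bullet> clt_vector P l f n z = (ssum (F u) n z + (F u (env_seen n z) - F u (env_seen 0 z))) / sqrt (real n)"
proof -
  have "u \<bullet> clt_vector P l f n z = (\<Sum>k=1..n. F u (env_seen k z)) / sqrt (real n)"
    using env_seen_space[OF z]
    by (simp add: clt_vector_def inner_prod_def hm1_mean_zero[OF f] drift_eq F_def sum.distrib
      sum_distrib_left add_divide_distrib sum_divide_distrib)
  \<comment> \<open>The vector sums over 1 to n, \<open>ssum\<close> over 0 to n - 1; the difference
    is one boundary term at either end.\<close>
  also have "(\<Sum>k=1..n. F u (env_seen k z)) = ssum (F u) n z + (F u (env_seen n z) - F u (env_seen 0 z))"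
    by (induction n) (simp_all add: ssum_def)
  finally show ?thesis .
qed

lemma clt_vector_measurable:
  assumes f: "hm1 K f"
  shows "clt_vector P l f n \<in> borel_measurable (env_space \<Otimes>\<^sub>M path_space)"
proof -
  have fm: "f \<in> borel_measurable env_space" by (rule L2_Q_measurable[OF hm1_L2[OF f]])
  have 1: "(\<lambda>z. f (env_seen k z)) \<in> borel_measurable (env_space \<Otimes>\<^sub>M path_space)" for k
    by (rule measurable_compose[OF env_seen_measurable fm])
  have "(\<lambda>z. ldrift (env_seen k z)) \<in> borel_measurable (env_space \<Otimes>\<^sub>M path_space)" for k
    by (rule measurable_compose[OF env_seen_measurable bdd_envD[OF ldrift_bdd]])
  then have 2: "(\<lambda>z. drift (env_seen k z) 0 \<bullet> l) \<in> borel_measurable (env_space \<Otimes>\<^sub>M path_space)" for k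
    by (rule measurable_cong[THEN iffD1, rotated])
      (simp add: drift_eq env_seen_space space_pair_measure)
  show ?thesis
    unfolding clt_vector_def[abs_def] borel_prod[symmetric]
    using 1 2 by (simp add: borel_measurable_scaleR borel_prod)
qed

lemma clt_vector_past:
  assumes f: "hm1 K f"
  shows "past n (clt_vector P l f n)"
  by (rule pastI[OF clt_vector_measurable[OF f]]) (simp add: clt_vector_def env_seen_def)

text \<open>Cramer-Wold device: the component along u is, up to boundary terms, the additive
  functional of fst u * f + snd u * ldrift. The scalar theorem with weight \<open>P_density\<close>,
  of integral 1, gives its characteristic function, and \<open>asd_combination\<close> exhibits the
  exponent as a quadratic form with mixed coefficient \<open>acov f ldrift\<close>.\<close>

lemma covariance_clt_limit:
  assumes f: "hm1 K f"
  shows "covariance (clt_limit P l f) = acov f ldrift"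
  unfolding clt_limit_def
proof (rule covariance_of_clt)
  interpret WP: annealed_walk P "\<lambda>\<omega>. \<omega>"
    by unfold_locales (auto simp: sets_P P.prob_space_axioms)
  have vm: "clt_vector P l f n \<in> borel_measurable (annealed P walk0)" for n
    using clt_vector_measurable[OF f, of n] by (simp add: measurable_cong_sets[OF WP.sets_A refl])
  show "prob_space (distr (annealed P walk0) borel (clt_vector P l f n))" for n
    by (rule prob_space.prob_space_distr[OF WP.prob_space_A vm])
  show "sets (distr (annealed P walk0) borel (clt_vector P l f n)) = sets borel" for n by simp
  show "0 \<le> (asd f)\<^sup>2" "0 \<le> (asd ldrift)\<^sup>2" by simp_all
  show "(acov f ldrift)\<^sup>2 \<le> (asd f)\<^sup>2 * (asd ldrift)\<^sup>2" by (rule acov_Cauchy_Schwarz[OF f hm1_ldrift])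
  fix u :: "real \<times> real"
  define F where "F \<omega> = fst u * f \<omega> + snd u * ldrift \<omega>" for \<omega>
  have F: "hm1 (2 * ((fst u)\<^sup>2 * K + (snd u)\<^sup>2 * 1)) F"
    unfolding F_def[abs_def] by (rule hm1_combination[OF f hm1_ldrift])
  note FL = hm1_L2[OF F]
  define C where "C = Z * ellipticity"
  let ?\<psi> = "\<lambda>z. complex_of_real (P_density (env_seen 0 z))"
  have \<psi>b: "AE z in A. \<bar>P_density (env_seen 0 z)\<bar> \<le> C"
    unfolding C_def by (rule AE_distrD[OF env_seen_A, of "\<lambda>\<omega>. \<bar>P_density \<omega>\<bar> \<le> Z * ellipticity" 0])
      (simp only: distr_env_seen AE_P_density_bound)
  have \<psi>m [measurable]: "(\<lambda>z. P_density (env_seen 0 z)) \<in> borel_measurable A"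
    by (rule measurable_compose[OF env_seen_A P_density_measurable])
  define a where "a n z = ssum F n z / sqrt (real n)" for n z
  have am [measurable]: "a n \<in> borel_measurable A" for n
    unfolding a_def[abs_def] using L2_measurable[OF ssum_L2[OF FL, of n]] by simp
  have bm [measurable]: "(\<lambda>z. u \<bullet> clt_vector P l f n z) \<in> borel_measurable A" for n
    using past_measurable[OF clt_vector_past[OF f, of n]] by measurable
  have int: "integrable A (\<lambda>z. ?\<psi> z * iexp (b z))" if [measurable]: "b \<in> borel_measurable A" for b
  proof (rule A.integrable_const_bound)
    show "AE z in A. norm (?\<psi> z * iexp (b z)) \<le> C" using \<psi>b by eventually_elim (simp add: norm_mult)
  qed measurable
  have cf_eq: "cf (distr (annealed P walk0) borel (clt_vector P l f n)) u = (\<integral>z. ?\<psi> z * iexp (u \<bullet> clt_vector P l f n z) \<partial>A)" for n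
  proof -
    have "cf (distr (annealed P walk0) borel (clt_vector P l f n)) u = (\<integral>z. iexp (u \<bullet> clt_vector P l f n z) \<partial>annealed P walk0)"
      unfolding cf_def by (rule integral_distr[OF vm]) measurable
    also have "\<dots> = (\<integral>z. ?\<psi> z * iexp (u \<bullet> clt_vector P l f n z) \<partial>A)"
    proof (rule integral_annealed_P)
      have m: "(\<lambda>z. iexp (u \<bullet> clt_vector P l f n z)) \<in> borel_measurable (env_space \<Otimes>\<^sub>M path_space)"
        using clt_vector_measurable[OF f, of n] by measurable
      show "past n (\<lambda>z. iexp (u \<bullet> clt_vector P l f n z))"
        by (rule pastI[OF m], rule arg_cong[OF pastD[OF clt_vector_past[OF f]], where f = "\<lambda>x. iexp (u \<bullet> x)"])
    qed simp
    finally show ?thesis .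
  qed
  \<comment> \<open>The boundary terms have norm at most 2 nrm Q F by stationarity and are divided
    by sqrt n, while \<open>iexp\<close> is Lipschitz and the weight bounded.\<close>
  have "(\<lambda>n. (\<integral>z. ?\<psi> z * iexp (u \<bullet> clt_vector P l f n z) \<partial>A) - (\<integral>z. ?\<psi> z * iexp (a n z) \<partial>A)) \<longlonglongrightarrow> 0"
  proof (rule Lim_null_comparison[OF _ real_nat_sqrt_tendsto])
    show "eventually (\<lambda>n. norm ((\<integral>z. ?\<psi> z * iexp (u \<bullet> clt_vector P l f n z) \<partial>A) - (\<integral>z. ?\<psi> z * iexp (a n z) \<partial>A)) \<le>
        (C * (2 * nrm Q F)) / sqrt (real n)) sequentially"
    proof (intro always_eventually allI)
      fix n
      have C0: "0 \<le> C" unfolding C_def using Z_pos ellipticity(1) by simp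
      let ?b = "\<lambda>z. F (env_seen n z) - F (env_seen 0 z)"
      have bL: "?b \<in> L2 A" by (intro L2_diff L2_env_seen FL)
      have "(\<integral>z. ?\<psi> z * iexp (u \<bullet> clt_vector P l f n z) \<partial>A) - (\<integral>z. ?\<psi> z * iexp (a n z) \<partial>A) =
          (\<integral>z. ?\<psi> z * iexp (u \<bullet> clt_vector P l f n z) - ?\<psi> z * iexp (a n z) \<partial>A)"
        by (rule Bochner_Integration.integral_diff[symmetric]) (intro int am bm)+
      also have "norm \<dots> \<le> (\<integral>z. (C / sqrt (real n)) * \<bar>?b z\<bar> \<partial>A)"
      proof (rule integral_norm_bound_AE)
        show "integrable A (\<lambda>z. ?\<psi> z * iexp (u \<bullet> clt_vector P l f n z) - ?\<psi> z * iexp (a n z))"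
          by (intro Bochner_Integration.integrable_diff int am bm)
        show "integrable A (\<lambda>z. (C / sqrt (real n)) * \<bar>?b z\<bar>)" using A.L2_integrable[OF bL] by simp
        show "AE z in A. norm (?\<psi> z * iexp (u \<bullet> clt_vector P l f n z) - ?\<psi> z * iexp (a n z)) \<le> (C / sqrt (real n)) * \<bar>?b z\<bar>"
          using \<psi>b AE_space
        proof eventually_elim
          case (elim z)
          have "z \<in> space env_space \<times> UNIV" using elim(2) by (simp only: W.space_A)
          from clt_vector_eq[OF f this, of u n]
          have "u \<bullet> clt_vector P l f n z - a n z = ?b z / sqrt (real n)"
            by (simp add: a_def F_def[abs_def] add_divide_distrib)
          then have "cmod (iexp (u \<bullet> clt_vector P l f n z) - iexp (a n z)) \<le> \<bar>?b z\<bar> / sqrt (real n)"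
            using iexp_Lipschitz[of "u \<bullet> clt_vector P l f n z" "a n z"] by (simp add: abs_divide)
          moreover have "norm (?\<psi> z * iexp (u \<bullet> clt_vector P l f n z) - ?\<psi> z * iexp (a n z)) =
              \<bar>P_density (env_seen 0 z)\<bar> * cmod (iexp (u \<bullet> clt_vector P l f n z) - iexp (a n z))"
            by (simp only: right_diff_distrib[symmetric] norm_mult norm_of_real)
          ultimately have "norm (?\<psi> z * iexp (u \<bullet> clt_vector P l f n z) - ?\<psi> z * iexp (a n z)) \<le> C * (\<bar>?b z\<bar> / sqrt (real n))"
            using elim(1) C0 by (simp only:) (intro mult_mono, auto)
          then show ?case by simp
        qed
      qed
      also have "\<dots> = (C / sqrt (real n)) * (\<integral>z. \<bar>?b z\<bar> \<partial>A)" by simp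
      also have "\<dots> \<le> (C / sqrt (real n)) * (2 * nrm Q F)"
      proof (rule mult_left_mono)
        have "(\<integral>z. \<bar>?b z\<bar> \<partial>A) \<le> nrm A ?b" by (rule A.nrm_ge_integral_abs[OF bL])
        also have "\<dots> \<le> 2 * nrm Q F"
          using nrm_triangle_diff[OF L2_env_seen[OF FL, of n] L2_env_seen[OF FL, of 0]] by (simp add: nrm_env_seen[OF FL])
        finally show "(\<integral>z. \<bar>?b z\<bar> \<partial>A) \<le> 2 * nrm Q F" .
      qed (use C0 in simp)
      finally show "norm ((\<integral>z. ?\<psi> z * iexp (u \<bullet> clt_vector P l f n z) \<partial>A) - (\<integral>z. ?\<psi> z * iexp (a n z) \<partial>A)) \<le>
          (C * (2 * nrm Q F)) / sqrt (real n)" by simp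
    qed
  qed
  moreover have "(\<lambda>n. \<integral>z. ?\<psi> z * iexp (a n z) \<partial>A) \<longlonglongrightarrow> of_real 1 * of_real (exp (- (asd F)\<^sup>2 / 2))"
    using additive_functional_clt[OF F P_density_measurable AE_P_density_bound]
    unfolding a_def integral_P_density .
  ultimately have "(\<lambda>n. ((\<integral>z. ?\<psi> z * iexp (u \<bullet> clt_vector P l f n z) \<partial>A) - (\<integral>z. ?\<psi> z * iexp (a n z) \<partial>A)) +
      (\<integral>z. ?\<psi> z * iexp (a n z) \<partial>A)) \<longlonglongrightarrow> 0 + of_real 1 * of_real (exp (- (asd F)\<^sup>2 / 2))"
    by (rule tendsto_add)
  moreover have "(asd F)\<^sup>2 = (asd f)\<^sup>2 * (fst u)\<^sup>2 + 2 * acov f ldrift * fst u * snd u + (asd ldrift)\<^sup>2 * (snd u)\<^sup>2"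
    unfolding F_def[abs_def] by (rule asd_combination[OF f hm1_ldrift])
  ultimately show "(\<lambda>n. cf (distr (annealed P walk0) borel (clt_vector P l f n)) u) \<longlonglongrightarrow>
      complex_of_real (exp (- ((asd f)\<^sup>2 * (fst u)\<^sup>2 + 2 * acov f ldrift * fst u * snd u + (asd ldrift)\<^sup>2 * (snd u)\<^sup>2) / 2))"
    by (simp add: cf_eq)
qed

end

theorem theorem3:
  fixes P :: "'d::finite env measure" and l :: "real ^ 'd" and t :: real and f :: "'d env \<Rightarrow> real"
  assumes "CARD('d) \<ge> 2"
    and "iid_elliptic P"
    and "norm l = 1"
    and "t \<ge> 1"
    and "f \<in> H_minus_1 P"
  shows "((\<lambda>lam. ((lam\<^sup>2 / t) *
              (\<integral>z. (\<Sum>k=0..nat \<lfloor>t / lam\<^sup>2\<rfloor>. f (env_seen k z)) \<partial>annealed (Q0 P) (walk_tilted l lam))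
            - (\<integral>\<omega>. f \<omega> \<partial>Q0 P)) / lam)
          \<longlongrightarrow> Lambda P l f) (at_right 0)"
proof -
  interpret rcm_direction P l by unfold_locales (use assms in auto)
  obtain K where f: "hm1 K f" using H_minus_1_imp_hm1[OF assms(5)] by blast
  note fL = hm1_L2[OF f]
  have L: "Lambda P l f = - acov f ldrift" by (simp add: Lambda_def covariance_clt_limit[OF f])
  \<comment> \<open>The mean of f vanishes, one factor lam cancels, and \<open>girsanov\<close>
    expresses the tilted mean through the density. The sum is known one step before the time Suc ?N
    at which the density is taken.\<close>
  have eq: "lam / t * (\<integral>z. ssum f (Suc (nat \<lfloor>t / lam\<^sup>2\<rfloor>)) z * girs lam (Suc (nat \<lfloor>t / lam\<^sup>2\<rfloor>)) z \<partial>A) =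
      ((lam\<^sup>2 / t) * (\<integral>z. (\<Sum>k=0..nat \<lfloor>t / lam\<^sup>2\<rfloor>. f (env_seen k z)) \<partial>annealed Q (walk_tilted l lam))
        - (\<integral>\<omega>. f \<omega> \<partial>Q)) / lam" if lam: "0 < lam" "lam < 1" for lam
  proof -
    let ?N = "nat \<lfloor>t / lam\<^sup>2\<rfloor>"
    have s: "(\<lambda>z. \<Sum>k=0..?N. f (env_seen k z)) = ssum f (Suc ?N)"
      by (simp add: ssum_def fun_eq_iff atLeast0AtMost lessThan_Suc_atMost)
    have "(\<integral>z. ssum f (Suc ?N) z \<partial>annealed Q (walk_tilted l lam)) = (\<integral>z. ssum f (Suc ?N) z * girs lam (Suc ?N) z \<partial>A)"
    proof (rule girsanov)
      show "past (Suc ?N) (ssum f (Suc ?N))"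
        by (rule past_mono[OF ssum_past[OF L2_Q_measurable[OF fL]]]) simp
      show "integrable A (\<lambda>z. ssum f (Suc ?N) z * girs lam (Suc ?N) z)"
        using lam by (intro L2_integrable_mult ssum_L2[OF fL] girs_L2) auto
    qed
    then show ?thesis using lam by (simp only: s) (simp add: hm1_mean_zero[OF f] power2_eq_square)
  qed
  have ev: "eventually (\<lambda>lam::real. 0 < lam \<and> lam < 1) (at_right 0)"
    unfolding eventually_at_right_field by (intro exI[of _ 1]) auto
  show ?thesis
    unfolding L
    by (rule Lim_transform_eventually[OF tilted_limit[OF f assms(4)] eventually_mono[OF ev eq]]) auto
qed

end
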